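(* Let $m\ge 3$ and $1\le \ell\le\lfloor\frac{m-1}{2}\rfloor$ be integers, let $\kappa\in\mathbb{R}$ with $-\frac{\ell}{m}<\kappa<\frac{\ell}{m}$, and put $\delta:=\frac12-\frac{\ell}{m}$. Define a real symmetric $2\times2$ matrix function $K$, positively homogeneous of degree $0$, as follows. On the fundamental chamber $\mathcal{C}=\{z=re^{\mathrm{i}\theta}: r>0,\ 0<\theta<\frac{\pi}{m}\}$ let $$K(re^{\mathrm{i}\theta})=\frac{\cos\pi\kappa}{2\pi\cos\pi\delta}\,L(\theta)^{T}\begin{bmatrix}H(-\kappa,\delta)&0\\0&H(\kappa,\delta)\end{bmatrix}L(\theta),$$ where, with $v:=\sin^{2}\frac{m\theta}{2}$, $$L(\theta)=\begin{bmatrix}f_{1}(\kappa,\delta;v)&f_{2}(\kappa,\delta;v)\\-f_{2}(-\kappa,\delta;v)&f_{1}(-\kappa,\delta;v)\end{bmatrix}\begin{bmatrix}\cos\delta m\theta&-\sin\delta m\theta\\\sin\delta m\theta&\cos\delta m\theta\end{bmatrix},$$ and on the other chambers $\{re^{\mathrm{i}\theta}:r>0,\ (j-1)\frac{\pi}{m}<\theta<j\frac{\pi}{m}\}$, $2\le j\le 2m$, define $K$ by $K(zw)=\tau_\ell(w)^{-1}K(z)\tau_\ell(w)$ for $z\in\mathcal{C}$, $w\in I_2(m)$. Then $K$ is positive definite on each chamber, $K(z)e^{-|z|^2/2}$ is integrable over $\mathbb{C}$, and for all $f,g\in\mathcal{P}_{m,\ell}$, written in real coordinates as $f=F_1s_1+F_2s_2$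 and $g=G_1s_1+G_2s_2$, $$\langle f,g\rangle_G=\int_{\mathbb{C}}\,(G_1(z),G_2(z))\,K(z)\,(F_1(z),F_2(z))^{*}\,e^{-|z|^{2}/2}\,dm_2(z),$$ where $*$ denotes conjugate transpose and $dm_2(z)=dx_1dx_2$ is Lebesgue measure for $z=x_1+\mathrm{i}x_2$.
   Context: Set $\omega=e^{2\pi\mathrm{i}/m}$. The dihedral group $I_2(m)$ acts on $\mathbb{C}=\mathbb{R}^2$ on the right; its elements are the reflections $z\sigma_j=\overline z\omega^j$ $(0\le j<m)$ and the rotations $z\varrho_j=z\omega^j$ $(0\le j<m$, $\varrho_0$ the identity$)$. $\mathcal{P}_{m,\ell}$ is the complex vector space of polynomials $f(z,\overline z,t,\overline t)=f_1(z,\overline z)t+f_2(z,\overline z)\overline t$ with $f_1,f_2\in\mathbb{C}[z,\overline z]$. Real coordinates: $t=s_1+\mathrm{i}s_2$, $\overline t=s_1-\mathrm{i}s_2$, so $f_1t+f_2\overline t=(f_1+f_2)s_1+\mathrm{i}(f_1-f_2)s_2$, i.e. $F_1=f_1+f_2$, $F_2=\mathrm{i}(f_1-f_2)$. The representation $\tau_\ell$ in real coordinates (matrices acting on row vectors from the right): with $c=\cos\frac{2\pi\ell j}{m}$, $s=\sin\frac{2\pi\ell j}{m}$, $$\tau_\ell(\sigma_j)=\begin{bmatrix} c & s \\ s & -c \end{bmatrix},\qquad \tau_\ell(\varrho_j)=\begin{bmatrix} c & s \\ -s & c \end{bmatrix}.$$ Dunkl operators on $\mathcal{P}_{m,\ell}$: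 $$\mathcal{D}f=\frac{\partial f}{\partial z}+\kappa\sum_{j=0}^{m-1}\frac{f(z,\overline z,\omega^{\ell j}\overline t,\omega^{-\ell j}t)-f(\overline z\omega^j,z\omega^{-j},\omega^{\ell j}\overline t,\omega^{-\ell j}t)}{z-\overline z\omega^j},$$ $$\overline{\mathcal{D}}f=\frac{\partial f}{\partial\overline z}-\kappa\sum_{j=0}^{m-1}\frac{f(z,\overline z,\omega^{\ell j}\overline t,\omega^{-\ell j}t)-f(\overline z\omega^j,z\omega^{-j},\omega^{\ell j}\overline t,\omega^{-\ell j}t)}{z-\overline z\omega^j}\,\omega^j.$$ They commute. Put $\Delta_\kappa=4\mathcal{D}\overline{\mathcal{D}}$. For $p=\sum a_{jk}z^j\overline z^k$ let $p^*(2\overline{\mathcal D},2\mathcal D)=\sum\overline{a_{jk}}\,2^{j+k}\mathcal{D}^j\overline{\mathcal{D}}^k$. The form $\langle\cdot,\cdot\rangle$ on $\mathcal{P}_{m,\ell}$ is conjugate-linear in the first and linear in the second variable, with $\langle t,t\rangle=\langle\overline t,\overline t\rangle=2$, $\langle t,\overline t\rangle=\langle\overline t,t\rangle=0$, and $$\langle p_1t+p_2\overline t,q\rangle=\langle t,p_1^*(2\overline{\mathcal D},2\mathcal D)q\rangle|_{z=0}+\langle\overline t,p_2^*(2\overline{\mathcal D},2\mathcal D)q\rangle|_{z=0}.$$ The Gaussian form is $\langle f,g\rangle_G=\langle e^{\Delta_\kappa/2}f,e^{\Delta_\kappa/2}g\rangle$. Auxiliary functions (${}_2F_1$ the Gauss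 hypergeometric series, $0<v<1$): $$f_1(\kappa,\delta;v)=v^{\kappa/2}(1-v)^{-\kappa/2}\,{}_2F_1\left(\delta,-\delta;\tfrac12+\kappa;v\right),$$ $$f_2(\kappa,\delta;v)=\frac{\delta}{\frac12+\kappa}v^{(\kappa+1)/2}(1-v)^{(1-\kappa)/2}\,{}_2F_1\left(1+\delta,1-\delta;\tfrac32+\kappa;v\right),$$ $$H(\kappa,\delta)=\frac{\Gamma(\frac12+\kappa)^2}{\Gamma(\frac12+\kappa+\delta)\Gamma(\frac12+\kappa-\delta)}.$$ *)

theory Defs
  imports "HOL-Analysis.Analysis" "HOL-Library.Groups_Big_Fun"
begin

abbreviation mat2 :: "real \<Rightarrow> real \<Rightarrow> real \<Rightarrow> real \<Rightarrow> real^2^2" where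
  "mat2 a b c d \<equiv> vector [vector [a, b], vector [c, d]]"


section \<open>The dihedral group and its representation\<close>

definition omega :: "nat \<Rightarrow> complex" where
  "omega m = exp (2 * of_real pi * \<i> / of_nat m)"

text \<open>\<open>Refl j\<close> and \<open>Rotn j\<close> stand for \<open>\<sigma>\<^sub>j\<close> and \<open>\<rho>\<^sub>j\<close>.\<close>

datatype dihedral = Refl nat | Rotn nat

definition I2 :: "nat \<Rightarrow> dihedral set" where
  "I2 m = Refl ` {..<m} \<union> Rotn ` {..<m}"

fun act :: "nat \<Rightarrow> complex \<Rightarrow> dihedral \<Rightarrow> complex" where
  "act m z (Refl j) = cnj z * omega m ^ j"
| "act m z (Rotn j) = z * omega m ^ j"

fun tau :: "nat \<Rightarrow> nat \<Rightarrow> dihedral \<Rightarrow> real^2^2" where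
  "tau m l (Refl j) =
     (let c = cos (2 * pi * real l * real j / real m); s = sin (2 * pi * real l * real j / real m)
      in mat2 c s s (- c))"
| "tau m l (Rotn j) =
     (let c = cos (2 * pi * real l * real j / real m); s = sin (2 * pi * real l * real j / real m)
      in mat2 c s (- s) c)"

text \<open>The chamber \<open>(j - 1) \<pi> / m < arg z < j \<pi> / m\<close>, for \<open>1 \<le> j \<le> 2 m\<close>; the fundamental one
  is \<open>chamber m 1\<close>.\<close>

definition chamber :: "nat \<Rightarrow> nat \<Rightarrow> complex set" where
  "chamber m j = {of_real r * exp (\<i> * of_real \<theta>) | r \<theta>.
     0 < r \<and> (real j - 1) * pi / real m < \<theta> \<and> \<theta> < real j * pi / real m}"


section \<open>Polynomials\<close>

text \<open>A polynomial \<open>\<Sum> a\<^bsub>jk\<^esub> z\<^sup>j zbar\<^sup>k\<close> in the independent variables \<open>z\<close> (outer) and \<open>zbar\<close> (inner);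
  \<open>a\<^bsub>jk\<^esub>\<close> is \<^term>\<open>coeff (coeff p j) k\<close>.\<close>

type_synonym bipoly = "complex poly poly"

text \<open>The pair \<open>(f\<^sub>1, f\<^sub>2)\<close> stands for \<open>f\<^sub>1 t + f\<^sub>2 tbar\<close>. The underlying space does not depend on
  \<open>m\<close> and \<open>\<ell>\<close>; these parameters enter through the operators.\<close>

type_synonym vpoly = "bipoly \<times> bipoly"

abbreviation cst :: "complex \<Rightarrow> bipoly" where "cst c \<equiv> [:[:c:]:]"
abbreviation Z :: bipoly where "Z \<equiv> [:0, 1:]"
abbreviation Zb :: bipoly where "Zb \<equiv> [:[:0, 1:]:]"

definition scale :: "complex \<Rightarrow> vpoly \<Rightarrow> vpoly" where
  "scale c f = (cst c * fst f, cst c * snd f)"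

text \<open>\<open>p(A, B)\<close> for \<open>p = p(z, zbar)\<close>.\<close>

definition subst2 :: "bipoly \<Rightarrow> bipoly \<Rightarrow> bipoly \<Rightarrow> bipoly" where
  "subst2 p A B =
     (\<Sum>j\<le>degree p. \<Sum>k\<le>degree (coeff p j). cst (coeff (coeff p j) k) * A ^ j * B ^ k)"

text \<open>\<open>f(A, B, a tbar, b t)\<close> for \<open>f = f(z, zbar, t, tbar)\<close>.\<close>

definition subst_swap :: "vpoly \<Rightarrow> bipoly \<Rightarrow> bipoly \<Rightarrow> complex \<Rightarrow> complex \<Rightarrow> vpoly" where
  "subst_swap f A B a b = (cst b * subst2 (snd f) A B, cst a * subst2 (fst f) A B)"

text \<open>The value of \<open>p(z, zbar)\<close> at a point of the complex plane, and the pair \<open>(F\<^sub>1, F\<^sub>2)\<close> of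
  real coordinates there.\<close>

definition eval_bipoly :: "bipoly \<Rightarrow> complex \<Rightarrow> complex" where
  "eval_bipoly p z = poly (poly p [:z:]) (cnj z)"

definition real_coords :: "vpoly \<Rightarrow> complex \<Rightarrow> complex^2" where
  "real_coords f z = vector [eval_bipoly (fst f) z + eval_bipoly (snd f) z,
                             \<i> * (eval_bipoly (fst f) z - eval_bipoly (snd f) z)]"


section \<open>Dunkl operators\<close>

text \<open>The \<open>j\<close>-th difference quotient. Both numerators are multiples of \<open>z - zbar \<omega>\<^sup>j\<close>, so that
  \<open>div\<close> is the exact quotient of polynomials.\<close>

definition diff_quot :: "nat \<Rightarrow> nat \<Rightarrow> nat \<Rightarrow> vpoly \<Rightarrow> vpoly" where
  "diff_quot m l j f =
     (let w = omega m; a = w ^ (l * j); b = w powi (- int (l * j));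
          N = subst_swap f Z Zb a b
              - subst_swap f (cst (w ^ j) * Zb) (cst (w powi (- int j)) * Z) a b;
          q = Z - cst (w ^ j) * Zb
      in (fst N div q, snd N div q))"

definition dunkl :: "nat \<Rightarrow> nat \<Rightarrow> real \<Rightarrow> vpoly \<Rightarrow> vpoly" where
  "dunkl m l \<kappa> f =
     (pderiv (fst f), pderiv (snd f))
     + scale (of_real \<kappa>) (\<Sum>j<m. diff_quot m l j f)"

definition dunkl_bar :: "nat \<Rightarrow> nat \<Rightarrow> real \<Rightarrow> vpoly \<Rightarrow> vpoly" where
  "dunkl_bar m l \<kappa> f =
     (map_poly pderiv (fst f), map_poly pderiv (snd f))
     - scale (of_real \<kappa>) (\<Sum>j<m. scale (omega m ^ j) (diff_quot m l j f))"

definition laplacian :: "nat \<Rightarrow> nat \<Rightarrow> real \<Rightarrow> vpoly \<Rightarrow> vpoly" where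
  "laplacian m l \<kappa> f = scale 4 (dunkl m l \<kappa> (dunkl_bar m l \<kappa> f))"

text \<open>\<open>exp (\<Delta>\<^sub>\<kappa> / 2)\<close>. The series is finite because \<open>\<Delta>\<^sub>\<kappa>\<close> lowers the total degree in
  \<open>z, zbar\<close> by two.\<close>

definition exp_half_laplacian :: "nat \<Rightarrow> nat \<Rightarrow> real \<Rightarrow> vpoly \<Rightarrow> vpoly" where
  "exp_half_laplacian m l \<kappa> f =
     Sum_any (\<lambda>n. scale (1 / (2 ^ n * fact n)) ((laplacian m l \<kappa> ^^ n) f))"


section \<open>The sesquilinear forms\<close>

text \<open>\<open>p\<^sup>*(2 Dbar, 2 D) q\<close>.\<close>

definition star_op :: "nat \<Rightarrow> nat \<Rightarrow> real \<Rightarrow> bipoly \<Rightarrow> vpoly \<Rightarrow> vpoly" where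
  "star_op m l \<kappa> p q =
     (\<Sum>j\<le>degree p. \<Sum>k\<le>degree (coeff p j).
        scale (cnj (coeff (coeff p j) k) * 2 ^ (j + k))
          ((dunkl m l \<kappa> ^^ j) ((dunkl_bar m l \<kappa> ^^ k) q)))"

text \<open>The form on the span of \<open>t\<close> and \<open>tbar\<close>, in coordinates with respect to \<open>t, tbar\<close>.\<close>

definition form0 :: "complex \<times> complex \<Rightarrow> complex \<times> complex \<Rightarrow> complex" where
  "form0 a b = 2 * (cnj (fst a) * fst b + cnj (snd a) * snd b)"

definition at_zero :: "vpoly \<Rightarrow> complex \<times> complex" where
  "at_zero q = (eval_bipoly (fst q) 0, eval_bipoly (snd q) 0)"

definition form :: "nat \<Rightarrow> nat \<Rightarrow> real \<Rightarrow> vpoly \<Rightarrow> vpoly \<Rightarrow> complex" where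
  "form m l \<kappa> p q =
     form0 (1, 0) (at_zero (star_op m l \<kappa> (fst p) q))
     + form0 (0, 1) (at_zero (star_op m l \<kappa> (snd p) q))"

definition gauss_form :: "nat \<Rightarrow> nat \<Rightarrow> real \<Rightarrow> vpoly \<Rightarrow> vpoly \<Rightarrow> complex" where
  "gauss_form m l \<kappa> f g =
     form m l \<kappa> (exp_half_laplacian m l \<kappa> f) (exp_half_laplacian m l \<kappa> g)"


section \<open>The weight on the fundamental chamber\<close>

definition hyp2F1 :: "real \<Rightarrow> real \<Rightarrow> real \<Rightarrow> real \<Rightarrow> real" where
  "hyp2F1 a b c v = eval_fps (fps_hypergeo [a, b] [c] 1) v"

definition wt_f1 :: "real \<Rightarrow> real \<Rightarrow> real \<Rightarrow> real" where
  "wt_f1 \<kappa> \<delta> v =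
     v powr (\<kappa> / 2) * (1 - v) powr (- \<kappa> / 2) * hyp2F1 \<delta> (- \<delta>) (1 / 2 + \<kappa>) v"

definition wt_f2 :: "real \<Rightarrow> real \<Rightarrow> real \<Rightarrow> real" where
  "wt_f2 \<kappa> \<delta> v =
     \<delta> / (1 / 2 + \<kappa>) * v powr ((\<kappa> + 1) / 2) * (1 - v) powr ((1 - \<kappa>) / 2)
     * hyp2F1 (1 + \<delta>) (1 - \<delta>) (3 / 2 + \<kappa>) v"

definition wt_H :: "real \<Rightarrow> real \<Rightarrow> real" where
  "wt_H \<kappa> \<delta> = Gamma (1 / 2 + \<kappa>) ^ 2 / (Gamma (1 / 2 + \<kappa> + \<delta>) * Gamma (1 / 2 + \<kappa> - \<delta>))"

definition wt_L :: "nat \<Rightarrow> real \<Rightarrow> real \<Rightarrow> real \<Rightarrow> real^2^2" where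
  "wt_L m \<kappa> \<delta> \<theta> =
     (let v = (sin (real m * \<theta> / 2)) ^ 2
      in mat2 (wt_f1 \<kappa> \<delta> v) (wt_f2 \<kappa> \<delta> v) (- wt_f2 (- \<kappa>) \<delta> v) (wt_f1 (- \<kappa>) \<delta> v)
         ** mat2 (cos (\<delta> * real m * \<theta>)) (- sin (\<delta> * real m * \<theta>))
                 (sin (\<delta> * real m * \<theta>)) (cos (\<delta> * real m * \<theta>)))"

definition wt_K :: "nat \<Rightarrow> real \<Rightarrow> real \<Rightarrow> real \<Rightarrow> real^2^2" where
  "wt_K m \<kappa> \<delta> \<theta> =
     (cos (pi * \<kappa>) / (2 * pi * cos (pi * \<delta>))) *\<^sub>R
       (transpose (wt_L m \<kappa> \<delta> \<theta>)
        ** mat2 (wt_H (- \<kappa>) \<delta>) 0 0 (wt_H \<kappa> \<delta>)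
        ** wt_L m \<kappa> \<delta> \<theta>)"

definition pos_def :: "real^'n^'n \<Rightarrow> bool" where
  "pos_def A \<longleftrightarrow> transpose A = A \<and> (\<forall>x. x \<noteq> 0 \<longrightarrow> 0 < x \<bullet> (A *v x))"

end

theory Submission
  imports Defs "HOL-Probability.Probability"
begin

text \<open>The integral on the right-hand side defines a Hermitian form \<open>B\<close> for which multiplication by \<open>z\<close> is
  adjoint to multiplication by \<open>zbar\<close>. A form with this property is the Gaussian form as soon as
  \<open>2 (B(D f, g) + B(f, Dbar g)) = B(f, z g)\<close>, because \<open>exp (\<Delta> / 2)\<close> intertwines \<open>z\<close> with
  \<open>z + 2 Dbar\<close>. By induction on \<open>f\<close> this reduces to constant \<open>f\<close>, where it is a recurrence for the
  moments of \<open>K\<close>. In polar coordinates these are a Gaussian radial factor times Fourier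
  coefficients, over \<open>0 < x < \<pi>\<close> with \<open>x = m \<theta>\<close>, of the trace of \<open>K\<close> and of
  \<open>k\<^sub>1\<^sub>1 - k\<^sub>2\<^sub>2 + 2 \<i> k\<^sub>1\<^sub>2\<close>. With \<open>\<delta> m \<theta>\<close> rotated away they are functions \<open>T\<close> and \<open>V + \<i> W\<close> with
  \<open>T' = 2 \<kappa> V / sin x\<close>, \<open>V' = 2 \<kappa> T / sin x - 2 \<delta> W\<close>, \<open>W' = 2 \<delta> V\<close>, and the recurrence is this
  system integrated by parts; the constants \<open>H(\<plusminus>\<kappa>, \<delta>)\<close> are those for which the boundary value of
  \<open>W\<close> at \<open>\<pi>\<close> vanishes. The normalisation \<open>\<integral> T = 1\<close> is the limit \<open>d \<rightarrow> \<delta>\<close> of a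
  Lagrange identity between the systems for \<open>\<delta>\<close> and \<open>d\<close>.\<close>

section \<open>Polynomials in two variables\<close>

text \<open>The reduction to constant \<open>f\<close> works because the commutators of
  \<open>D\<close> and \<open>Dbar\<close> with z and zbar are the identity or zero up to multiples
  of sums over reflections, and \<open>B\<close> moves these sums from one argument to the other.
  For constant \<open>f\<close> the Dunkl operators leave monomials whose exponent differences form
  an arithmetic progression of step 2 m. The same progression arises on the analytic side from sin
  (n x) / sin x, a finite sum of cosines, which also absorbs the singular coefficient 1 / sin x of
  the system. The normalisation is the delicate point, since \<open>T\<close> is quadratic in
  hypergeometric functions. The Lagrange identity expresses its integral by boundary values at \<pi>
  and their derivatives in \<delta>. These values are H(\<plusminus>\<kappa>, \<delta>), by Gauss's
  summation, and S = sin (\<pi> \<delta>) / cos (\<pi> \<kappa>), by a Wronskian that couples x with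
  \<pi> - x. Since H(\<kappa>, \<delta>) H(-\<kappa>, \<delta>) + S^2 = 1, the derivatives of the
  Gamma factors enter only through that of S^2, and no digamma value is needed.\<close>

definition coeff_sum :: "(nat \<Rightarrow> nat \<Rightarrow> complex \<Rightarrow> 'a::comm_monoid_add) \<Rightarrow> bipoly \<Rightarrow> 'a" where
  "coeff_sum h p = (\<Sum>j\<le>degree p. \<Sum>k\<le>degree (coeff p j). h j k (coeff (coeff p j) k))"

text \<open>Uniform bounds replace the degree of each inner polynomial, so that sums for different
  polynomials can be compared term by term. Substitution and the operator form of a polynomial are
  both instances of \<open>coeff_sum\<close>; their rules for sums, z and zbar are derived from the
  same lemmas.\<close>

lemma coeff_sum_eq:
  assumes h0: "\<And>j k. h j k 0 = 0" and J: "degree p \<le> J" and K: "\<And>j. degree (coeff p j) \<le> K"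
  shows "coeff_sum h p = (\<Sum>j\<le>J. \<Sum>k\<le>K. h j k (coeff (coeff p j) k))"
proof -
  have "coeff_sum h p = (\<Sum>j\<le>degree p. \<Sum>k\<le>K. h j k (coeff (coeff p j) k))"
    unfolding coeff_sum_def
    by (intro sum.cong refl sum.mono_neutral_left) (use K in \<open>auto simp: coeff_eq_0 h0 not_le\<close>)
  also have "\<dots> = (\<Sum>j\<le>J. \<Sum>k\<le>K. h j k (coeff (coeff p j) k))"
    by (intro sum.mono_neutral_left) (use J in \<open>auto simp: coeff_eq_0 h0 not_le\<close>)
  finally show ?thesis .
qed

lemma degree_coeff_bounded: "\<exists>K. \<forall>j. degree (coeff (p :: bipoly) j) \<le> K"
proof (intro exI allI)
  fix j
  show "degree (coeff p j) \<le> Max ((\<lambda>j. degree (coeff p j)) ` {..Suc (degree p)})"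
  proof (cases "j \<le> degree p")
    case False
    then have "coeff p j = coeff p (Suc (degree p))" by (simp add: coeff_eq_0)
    then show ?thesis by (auto intro!: Max_ge)
  qed (auto intro!: Max_ge)
qed

lemma coeff_sum_add:
  assumes h0: "\<And>j k. h j k 0 = 0" and ha: "\<And>j k a b. h j k (a + b) = h j k a + h j k b"
  shows "coeff_sum h (p + q) = coeff_sum h p + coeff_sum h q"
proof -
  obtain A B where AB: "\<And>j. degree (coeff p j) \<le> A" "\<And>j. degree (coeff q j) \<le> B"
    using degree_coeff_bounded by metis
  let ?K = "max A B" and ?J = "max (degree p) (degree q)"
  have "degree (coeff (p + q) j) \<le> ?K" for j
    unfolding coeff_add using AB[of j] by (intro degree_add_le) auto
  moreover have "degree (p + q) \<le> ?J" by (simp add: degree_add_le_max)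
  ultimately have "coeff_sum h (p + q) = (\<Sum>j\<le>?J. \<Sum>k\<le>?K. h j k (coeff (coeff (p + q) j) k))"
    by (intro coeff_sum_eq h0) auto
  moreover have "coeff_sum h p = (\<Sum>j\<le>?J. \<Sum>k\<le>?K. h j k (coeff (coeff p j) k))"
    by (intro coeff_sum_eq h0) (use AB in \<open>auto simp: le_max_iff_disj\<close>)
  moreover have "coeff_sum h q = (\<Sum>j\<le>?J. \<Sum>k\<le>?K. h j k (coeff (coeff q j) k))"
    by (intro coeff_sum_eq h0) (use AB in \<open>auto simp: le_max_iff_disj\<close>)
  ultimately show ?thesis by (simp add: ha sum.distrib)
qed

lemma Z_times: "Z * p = pCons 0 (p :: bipoly)"
  by simp

lemma Zb_times: "Zb * p = map_poly (pCons 0) (p :: bipoly)"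
  by (rule poly_eqI) (simp add: coeff_map_poly)

lemma coeff_sum_Z:
  assumes h0: "\<And>j k. h j k 0 = 0"
  shows "coeff_sum h (Z * p) = coeff_sum (\<lambda>j. h (Suc j)) p"
proof -
  obtain A where A: "\<And>j. degree (coeff p j) \<le> A"
    using degree_coeff_bounded by metis
  have "coeff_sum h (Z * p)
      = (\<Sum>j\<le>Suc (degree p). \<Sum>k\<le>A. h j k (coeff (coeff (Z * p) j) k))"
    by (intro coeff_sum_eq h0)
       (use A in \<open>auto simp: Z_times coeff_pCons degree_pCons_le split: nat.splits\<close>)
  also have "\<dots> = (\<Sum>j\<le>degree p. \<Sum>k\<le>A. h (Suc j) k (coeff (coeff p j) k))"
    by (subst sum.atMost_Suc_shift) (simp add: h0)
  also have "\<dots> = coeff_sum (\<lambda>j. h (Suc j)) p"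
    by (rule sym, intro coeff_sum_eq h0) (use A in auto)
  finally show ?thesis .
qed

lemma coeff_sum_Zb:
  assumes h0: "\<And>j k. h j k 0 = 0"
  shows "coeff_sum h (Zb * p) = coeff_sum (\<lambda>j k. h j (Suc k)) p"
proof -
  obtain A where A: "\<And>j. degree (coeff p j) \<le> A"
    using degree_coeff_bounded by metis
  have c: "coeff (Zb * p) j = pCons 0 (coeff p j)" for j
    by (simp add: Zb_times coeff_map_poly)
  have "coeff_sum h (Zb * p)
      = (\<Sum>j\<le>degree p. \<Sum>k\<le>Suc A. h j k (coeff (coeff (Zb * p) j) k))"
  proof (intro coeff_sum_eq h0)
    show "degree (Zb * p) \<le> degree p" by (rule degree_le) (simp add: c coeff_eq_0)
    show "degree (coeff (Zb * p) j) \<le> Suc A" for j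
      unfolding c using A[of j] degree_pCons_le[of 0 "coeff p j"] by linarith
  qed
  also have "\<dots> = (\<Sum>j\<le>degree p. \<Sum>k\<le>A. h j (Suc k) (coeff (coeff p j) k))"
    unfolding c by (subst sum.atMost_Suc_shift) (simp add: h0)
  also have "\<dots> = coeff_sum (\<lambda>j k. h j (Suc k)) p"
    by (rule sym, intro coeff_sum_eq h0) (use A in auto)
  finally show ?thesis .
qed

lemma coeff_sum_cst: "coeff_sum h (cst c) = h 0 0 c"
  by (simp add: coeff_sum_def)

lemma cst_mult: "cst (c * d) = cst c * cst d"
  by simp

lemma cst_add: "cst (c + d) = cst c + cst d"
  by simp

lemma cst_1: "cst 1 = 1"
  by (simp add: one_pCons)

text \<open>Constants, sums and the two multiplications generate the polynomial ring. The operators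
  below are determined by their values on constants and their commutation rules with z and zbar, so
  identities between them reduce to these four cases.\<close>

lemma bipoly_induct [case_names cst Z Zb add]:
  assumes c: "\<And>c. P (cst c)" and Z: "\<And>p. P p \<Longrightarrow> P (Z * p)" and Zb: "\<And>p. P p \<Longrightarrow> P (Zb * p)"
    and a: "\<And>p q. P p \<Longrightarrow> P q \<Longrightarrow> P (p + q)"
  shows "P (p :: bipoly)"
proof -
  have 1: "P [:c:]" for c
  proof (induction c)
    case 0
    then show ?case using c[of 0] by simp
  next
    case (pCons x c)
    have "[:pCons x c:] = cst x + Zb * [:c:]" by simp
    then show ?case using a c Zb pCons by metis
  qed
  show ?thesis
  proof (induction p)
    case 0
    then show ?case using c[of 0] by simp
  next
    case (pCons x p)
    have "pCons x p = [:x:] + Z * p" by simp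
    then show ?case using a 1 Z pCons by metis
  qed
qed

section \<open>Reflections of polynomials and their divided differences\<close>

definition refl_poly :: "complex \<Rightarrow> bipoly \<Rightarrow> bipoly" where
  "refl_poly u p = subst2 p (cst u * Zb) (cst (inverse u) * Z)"

lemma subst2_coeff_sum: "subst2 p A B = coeff_sum (\<lambda>j k c. cst c * A ^ j * B ^ k) p"
  by (simp add: subst2_def coeff_sum_def)

lemma coeff_sum_mult_left:
  "coeff_sum (\<lambda>j k c. (a::'a::comm_semiring_0) * h j k c) p = a * coeff_sum h p"
  by (simp add: coeff_sum_def sum_distrib_left)

lemma bipoly_ring_mult1: "c * a ^ Suc j * b ^ k = a * (c * a ^ j * (b :: 'a :: comm_ring_1) ^ k)"
  by (simp add: mult_ac)

lemma bipoly_ring_mult2: "c * a ^ j * b ^ Suc k = b * (c * a ^ j * (b :: 'a :: comm_ring_1) ^ k)"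
  by (simp add: mult_ac)

lemma subst2_add: "subst2 (p + q) A B = subst2 p A B + subst2 q A B"
  unfolding subst2_coeff_sum by (rule coeff_sum_add) (simp, simp only: cst_add distrib_right)

lemma subst2_Z: "subst2 (Z * p) A B = A * subst2 p A B"
proof -
  have "cst c * A ^ Suc j * B ^ k = A * (cst c * A ^ j * B ^ k)" for c j k
    using bipoly_ring_mult1 .
  then show ?thesis
    unfolding subst2_coeff_sum coeff_sum_mult_left[symmetric]
    by (subst coeff_sum_Z) (simp, simp only:)
qed

lemma subst2_Zb: "subst2 (Zb * p) A B = B * subst2 p A B"
proof -
  have "cst c * A ^ j * B ^ Suc k = B * (cst c * A ^ j * B ^ k)" for c j k
    using bipoly_ring_mult2 .
  then show ?thesis
    unfolding subst2_coeff_sum coeff_sum_mult_left[symmetric]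
    by (subst coeff_sum_Zb) (simp, simp only:)
qed

lemma subst2_cst: "subst2 (cst c) A B = cst c"
  unfolding subst2_coeff_sum by (simp add: coeff_sum_cst)

lemma subst2_cst_mult: "subst2 (cst c * p) A B = cst c * subst2 p A B"
proof (induction p rule: bipoly_induct)
  case (cst d)
  have "cst c * cst d = cst (c * d)" by simp
  then show ?case by (simp only: subst2_cst)
next
  case (Z p)
  have "subst2 (cst c * (Z * p)) A B = subst2 (Z * (cst c * p)) A B"
    by (rule arg_cong[where f = "\<lambda>p. subst2 p A B"], rule mult.left_commute)
  also have "\<dots> = A * (cst c * subst2 p A B)" by (simp only: subst2_Z Z)
  also have "\<dots> = cst c * (A * subst2 p A B)" by (rule mult.left_commute)
  finally show ?case by (simp only: subst2_Z)
next
  case (Zb p)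
  have "subst2 (cst c * (Zb * p)) A B = subst2 (Zb * (cst c * p)) A B"
    by (rule arg_cong[where f = "\<lambda>p. subst2 p A B"], rule mult.left_commute)
  also have "\<dots> = B * (cst c * subst2 p A B)" by (simp only: subst2_Zb Zb)
  also have "\<dots> = cst c * (B * subst2 p A B)" by (rule mult.left_commute)
  finally show ?case by (simp only: subst2_Zb)
next
  case (add p q)
  then show ?case by (simp only: distrib_left subst2_add)
qed

lemma subst2_id: "subst2 p Z Zb = p"
proof (induction p rule: bipoly_induct)
  case (cst c)
  show ?case by (rule subst2_cst)
next
  case (Z p)
  then show ?case by (simp only: subst2_Z)
next
  case (Zb p)
  then show ?case by (simp only: subst2_Zb)
next
  case (add p q)
  then show ?case by (simp only: subst2_add)
qed

lemma refl_poly_add: "refl_poly u (p + q) = refl_poly u p + refl_poly u q"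
  unfolding refl_poly_def by (rule subst2_add)

lemma refl_poly_Z: "refl_poly u (Z * p) = cst u * Zb * refl_poly u p"
  unfolding refl_poly_def by (rule subst2_Z)

lemma refl_poly_Zb: "refl_poly u (Zb * p) = cst (inverse u) * Z * refl_poly u p"
  unfolding refl_poly_def by (rule subst2_Zb)

lemma refl_poly_cst: "refl_poly u (cst c) = cst c"
  unfolding refl_poly_def by (rule subst2_cst)

lemma refl_poly_cst_mult: "refl_poly u (cst c * p) = cst c * refl_poly u p"
  unfolding refl_poly_def by (rule subst2_cst_mult)

lemma refl_poly_refl_poly_Z:
  "refl_poly u (refl_poly v (Z * p)) = cst (v * inverse u) * (Z * refl_poly u (refl_poly v p))"
  by (simp only: refl_poly_Z refl_poly_Zb refl_poly_cst_mult mult.assoc cst_mult)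

lemma refl_poly_refl_poly_Zb:
  "refl_poly u (refl_poly v (Zb * p)) = cst (inverse v * u) * (Zb * refl_poly u (refl_poly v p))"
  by (simp only: refl_poly_Z refl_poly_Zb refl_poly_cst_mult mult.assoc cst_mult)

text \<open>The product of two reflections is a rotation, and only the quotient of the two
  parameters enters it.\<close>

lemma refl_poly_refl_poly:
  assumes 1: "v * inverse u = v' * inverse u'" and "u \<noteq> 0" "v \<noteq> 0" "u' \<noteq> 0" "v' \<noteq> 0"
  shows "refl_poly u (refl_poly v p) = refl_poly u' (refl_poly v' p)"
proof (induction p rule: bipoly_induct)
  case (cst c)
  show ?case by (simp only: refl_poly_cst)
next
  case (Z p)
  show ?case unfolding refl_poly_refl_poly_Z Z 1 ..
next
  case (Zb p)
  have "inverse v * u = inverse v' * u'" using assms by (simp add: field_simps)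
  then show ?case unfolding refl_poly_refl_poly_Zb Zb by (rule arg_cong)
next
  case (add p q)
  show ?case unfolding refl_poly_add add ..
qed

lemma refl_poly_invol:
  assumes "u \<noteq> 0" shows "refl_poly u (refl_poly u p) = p"
proof (induction p rule: bipoly_induct)
  case (cst c)
  show ?case unfolding refl_poly_cst ..
next
  case (Z p)
  show ?case unfolding refl_poly_refl_poly_Z Z right_inverse[OF assms] cst_1 mult_1_left ..
next
  case (Zb p)
  show ?case unfolding refl_poly_refl_poly_Zb Zb left_inverse[OF assms] cst_1 mult_1_left ..
next
  case (add p q)
  show ?case unfolding refl_poly_add add ..
qed

definition refl_quot :: "complex \<Rightarrow> bipoly \<Rightarrow> bipoly" where
  "refl_quot u p = (p - refl_poly u p) div (Z - cst u * Zb)"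

lemma refl_den_nonzero: "Z - cst u * Zb \<noteq> 0"
proof
  assume "Z - cst u * Zb = 0"
  then have "coeff (Z - cst u * Zb) 1 = 0" by simp
  then show False by simp
qed

lemma refl_quot_eqI:
  assumes "p - refl_poly u p = (Z - cst u * Zb) * X" shows "refl_quot u p = X"
  unfolding refl_quot_def assms by (rule nonzero_mult_div_cancel_left) (rule refl_den_nonzero)

lemma bipoly_ring_Z:
  "z * p - u * zb * r = z * (p - r) + (z - u * zb) * (r :: 'a :: comm_ring_1)"
  by (simp add: algebra_simps)

lemma bipoly_ring_Zb:
  assumes "v * u = 1"
  shows "zb * p - v * z * r = zb * (p - r) - v * (z - u * zb) * (r :: 'a :: comm_ring_1)"
proof -
  have "v * (z - u * zb) * r = v * z * r - (v * u) * (zb * r)" by (simp add: algebra_simps)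
  then have "v * (z - u * zb) * r = v * z * r - zb * r" by (simp only: assms mult_1_left)
  then show ?thesis by (simp only:) (simp add: algebra_simps)
qed

lemma bipoly_ring_sum:
  "q * (z * x + r) = z * (q * x) + q * (r :: 'a :: comm_ring_1)"
  "q * (z * x - v * r) = z * (q * x) - v * q * r"
  by (simp_all add: algebra_simps)

lemma cst_inverse:
  assumes "u \<noteq> 0" shows "cst (inverse u) * cst u = 1"
proof -
  have "cst (inverse u) * cst u = cst (inverse u * u)" by (rule cst_mult[symmetric])
  also have "inverse u * u = 1" using assms by (rule left_inverse)
  finally show ?thesis by (rule trans[OF _ cst_1])
qed

text \<open>The twisted Leibniz rule: z p - r(z) r(p) = z (p - r(p)) + (z - r(z)) r(p) for the
  reflection r, and z - r(z) is the divisor itself.\<close>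

lemma refl_quot_step_Z:
  assumes "p - refl_poly u p = (Z - cst u * Zb) * X"
  shows "Z * p - refl_poly u (Z * p) = (Z - cst u * Zb) * (Z * X + refl_poly u p)"
  unfolding refl_poly_Z
  by (subst bipoly_ring_Z, subst assms) (rule bipoly_ring_sum(1)[symmetric])

text \<open>Here zbar - r(zbar) = - (z - u zbar) / u, which explains the sign and the factor
  \<open>inverse u\<close>.\<close>

lemma refl_quot_step_Zb:
  assumes "p - refl_poly u p = (Z - cst u * Zb) * X" "u \<noteq> 0"
  shows "Zb * p - refl_poly u (Zb * p) = (Z - cst u * Zb) * (Zb * X - cst (inverse u) * refl_poly u p)"
proof -
  have 1: "cst (inverse u) * cst u = 1"
    by (rule cst_inverse) (rule assms)
  show ?thesis
    unfolding refl_poly_Zb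
    by (subst bipoly_ring_Zb[OF 1], subst assms(1)) (rule bipoly_ring_sum(2)[symmetric])
qed

text \<open>Divisibility holds on constants and is propagated by the twisted Leibniz rules, which
  also exhibit the quotient; from here on \<open>div\<close> is exact.\<close>

lemma refl_quot_ex:
  assumes "u \<noteq> 0"
  shows "\<exists>X. p - refl_poly u p = (Z - cst u * Zb) * X"
proof (induction p rule: bipoly_induct)
  case (cst c)
  show ?case by (rule exI[of _ 0]) (simp only: refl_poly_cst diff_self mult_zero_right)
next
  case (Z p)
  then show ?case by (elim exE) (rule exI, rule refl_quot_step_Z)
next
  case (Zb p)
  then show ?case by (elim exE) (rule exI, rule refl_quot_step_Zb[OF _ assms])
next
  case (add p q)
  then show ?case
  proof (elim exE)
    fix X Y
    assume XY: "p - refl_poly u p = (Z - cst u * Zb) * X" "q - refl_poly u q = (Z - cst u * Zb) * Y"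
    have "p + q - refl_poly u (p + q) = (p - refl_poly u p) + (q - refl_poly u q)"
      unfolding refl_poly_add by (rule add_diff_add)
    also have "\<dots> = (Z - cst u * Zb) * (X + Y)"
      unfolding XY by (rule distrib_left[symmetric])
    finally show "\<exists>X. p + q - refl_poly u (p + q) = (Z - cst u * Zb) * X" by (rule exI)
  qed
qed

lemma refl_quot:
  assumes "u \<noteq> 0" shows "p - refl_poly u p = (Z - cst u * Zb) * refl_quot u p"
proof -
  obtain X where X: "p - refl_poly u p = (Z - cst u * Zb) * X"
    using refl_quot_ex[OF assms] by (rule exE)
  show ?thesis unfolding refl_quot_eqI[OF X] by (rule X)
qed

lemma refl_quot_cst: "refl_quot u (cst c) = 0"
  unfolding refl_quot_def refl_poly_cst by (simp only: diff_self div_0)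

lemma refl_quot_Z:
  "u \<noteq> 0 \<Longrightarrow> refl_quot u (Z * p) = Z * refl_quot u p + refl_poly u p"
  by (rule refl_quot_eqI, rule refl_quot_step_Z, rule refl_quot)

lemma refl_quot_Zb:
  "u \<noteq> 0 \<Longrightarrow> refl_quot u (Zb * p) = Zb * refl_quot u p - cst (inverse u) * refl_poly u p"
  by (rule refl_quot_eqI, rule refl_quot_step_Zb, rule refl_quot)

lemma refl_quot_add:
  assumes "u \<noteq> 0" shows "refl_quot u (p + q) = refl_quot u p + refl_quot u q"
proof (rule refl_quot_eqI)
  have "p + q - refl_poly u (p + q) = (p - refl_poly u p) + (q - refl_poly u q)"
    unfolding refl_poly_add by (rule add_diff_add)
  also have "\<dots> = (Z - cst u * Zb) * (refl_quot u p + refl_quot u q)"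
    unfolding refl_quot[OF assms] by (rule distrib_left[symmetric])
  finally show "p + q - refl_poly u (p + q) = (Z - cst u * Zb) * (refl_quot u p + refl_quot u q)" .
qed

lemma refl_quot_cst_mult:
  assumes "u \<noteq> 0" shows "refl_quot u (cst c * p) = cst c * refl_quot u p"
proof (rule refl_quot_eqI)
  have "cst c * p - refl_poly u (cst c * p) = cst c * (p - refl_poly u p)"
    unfolding refl_poly_cst_mult by (rule right_diff_distrib[symmetric])
  also have "\<dots> = (Z - cst u * Zb) * (cst c * refl_quot u p)"
    unfolding refl_quot[OF assms] by (rule mult.left_commute)
  finally show "cst c * p - refl_poly u (cst c * p) = (Z - cst u * Zb) * (cst c * refl_quot u p)" .
qed

section \<open>Vector-valued polynomials\<close>

lemma cst_zero: "cst 0 = 0"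
  by simp

lemma scale_scale: "scale a (scale b f) = scale (a * b) f"
  by (simp only: scale_def cst_mult fst_conv snd_conv mult.assoc)

lemma scale_one: "scale 1 f = f"
  by (simp only: scale_def cst_1 mult_1_left prod.collapse)

lemma scale_add_right: "scale a (f + g) = scale a f + scale a g"
  by (simp only: scale_def fst_add snd_add distrib_left plus_prod_def fst_conv snd_conv)

lemma scale_add_left: "scale (a + b) f = scale a f + scale b f"
  by (simp only: scale_def fst_add snd_add cst_add distrib_right plus_prod_def fst_conv snd_conv)

interpretation vp: vector_space scale
  by unfold_locales (simp_all only: scale_scale scale_one scale_add_right scale_add_left)

declare split_paired_All [simp del]

section \<open>Linear operators on vector-valued polynomials\<close>

definition lin :: "(vpoly \<Rightarrow> vpoly) \<Rightarrow> bool" where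
  "lin A \<longleftrightarrow> (\<forall>f g. A (f + g) = A f + A g) \<and> (\<forall>c f. A (scale c f) = scale c (A f))"

lemma linI: "(\<And>f g. A (f + g) = A f + A g) \<Longrightarrow> (\<And>c f. A (scale c f) = scale c (A f)) \<Longrightarrow> lin A"
  by (simp add: lin_def)

lemma
  assumes "lin A"
  shows lin_add: "A (f + g) = A f + A g" and lin_scale: "A (scale c f) = scale c (A f)"
  using assms unfolding lin_def by blast+

lemma lin_zero: "lin A \<Longrightarrow> A 0 = 0"
  using lin_add[of A 0 0] by simp

lemma lin_minus: "lin A \<Longrightarrow> A (- f) = - A f"
  using lin_add[of A f "- f"] lin_zero[of A] by (simp add: eq_neg_iff_add_eq_0 add.commute)

lemma lin_diff: "lin A \<Longrightarrow> A (f - g) = A f - A g"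
  using lin_add[of A f "- g"] lin_minus[of A g] by simp

lemma lin_sum: "lin A \<Longrightarrow> A (sum h S) = (\<Sum>i\<in>S. A (h i))"
  by (induction S rule: infinite_finite_induct) (simp_all add: lin_zero lin_add)

lemma lin_comp: "lin A \<Longrightarrow> lin B \<Longrightarrow> lin (\<lambda>f. A (B f))"
  by (simp add: lin_def)

lemma lin_funpow: "lin A \<Longrightarrow> lin (A ^^ n)"
  by (induction n) (simp_all add: lin_def)

lemma lin_plus: "lin A \<Longrightarrow> lin B \<Longrightarrow> lin (\<lambda>f. A f + B f)"
  by (simp add: lin_def algebra_simps vp.scale_right_distrib)

lemma lin_minus_fun: "lin A \<Longrightarrow> lin B \<Longrightarrow> lin (\<lambda>f. A f - B f)"
  by (simp add: lin_def algebra_simps vp.scale_right_diff_distrib)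

lemma lin_scale_fun: "lin A \<Longrightarrow> lin (\<lambda>f. scale c (A f))"
  by (simp add: lin_def scale_add_right scale_scale mult.commute)

lemma lin_sum_fun: "(\<And>i. i \<in> S \<Longrightarrow> lin (A i)) \<Longrightarrow> lin (\<lambda>f. \<Sum>i\<in>S. A i f)"
  by (auto simp: lin_def sum.distrib vp.scale_sum_right intro!: sum.cong)

definition mz :: "vpoly \<Rightarrow> vpoly" where "mz f = (Z * fst f, Z * snd f)"
definition mzb :: "vpoly \<Rightarrow> vpoly" where "mzb f = (Zb * fst f, Zb * snd f)"
definition vconst :: "complex \<Rightarrow> complex \<Rightarrow> vpoly" where "vconst a b = (cst a, cst b)"

lemma lin_mz: "lin mz"
  by (rule linI) (simp_all only: mz_def fst_add snd_add distrib_left plus_prod_def fst_conv snd_conv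
    scale_def mult.left_commute[of Z])

lemma lin_mzb: "lin mzb"
  by (rule linI) (simp_all only: mzb_def fst_add snd_add distrib_left plus_prod_def fst_conv snd_conv
    scale_def mult.left_commute[of Zb])

lemma mz_mzb: "mz (mzb f) = mzb (mz f)"
  by (simp only: mz_def mzb_def fst_conv snd_conv mult.left_commute)

lemma scale_vconst: "scale c (vconst a b) = vconst (c * a) (c * b)"
  by (simp only: scale_def vconst_def fst_conv snd_conv cst_mult)

lemma vconst_add: "vconst a b + vconst c d = vconst (a + c) (b + d)"
  by (simp only: vconst_def plus_prod_def fst_conv snd_conv cst_add)

lemma vpoly_induct [case_names const mz mzb add]:
  assumes c: "\<And>a b. P (vconst a b)" and z: "\<And>f. P f \<Longrightarrow> P (mz f)" and zb: "\<And>f. P f \<Longrightarrow> P (mzb f)"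
    and a: "\<And>f g. P f \<Longrightarrow> P g \<Longrightarrow> P (f + g)"
  shows "P f"
proof -
  have 1: "P (p, 0)" for p
  proof (induction p rule: bipoly_induct)
    case (cst x)
    show ?case using c[of x 0] by (simp only: vconst_def cst_zero)
  next
    case (Z p)
    then show ?case using z[of "(p, 0)"] by (simp only: mz_def fst_conv snd_conv mult_zero_right)
  next
    case (Zb p)
    then show ?case using zb[of "(p, 0)"] by (simp only: mzb_def fst_conv snd_conv mult_zero_right)
  next
    case (add p q)
    then show ?case using a[of "(p, 0)" "(q, 0)"] by simp
  qed
  have 2: "P (0, p)" for p
  proof (induction p rule: bipoly_induct)
    case (cst x)
    show ?case using c[of 0 x] by (simp only: vconst_def cst_zero)
  next
    case (Z p)
    then show ?case using z[of "(0, p)"] by (simp only: mz_def fst_conv snd_conv mult_zero_right)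
  next
    case (Zb p)
    then show ?case using zb[of "(0, p)"] by (simp only: mzb_def fst_conv snd_conv mult_zero_right)
  next
    case (add p q)
    then show ?case using a[of "(0, p)" "(0, q)"] by simp
  qed
  show ?thesis using a[OF 1[of "fst f"] 2[of "snd f"]] by simp
qed

text \<open>\<open>vrefl\<close> is \<open>f \<mapsto> f(u zbar, z / u, u\<^sup>l tbar, u\<^sup>-\<^sup>l t)\<close>, and \<open>vquot\<close> the quotient by \<open>z - u zbar\<close> of
  \<open>f(z, zbar, u\<^sup>l tbar, u\<^sup>-\<^sup>l t)\<close> minus that.\<close>

definition vrefl :: "nat \<Rightarrow> complex \<Rightarrow> vpoly \<Rightarrow> vpoly" where
  "vrefl l u f = (cst (inverse u ^ l) * refl_poly u (snd f), cst (u ^ l) * refl_poly u (fst f))"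

definition vquot :: "nat \<Rightarrow> complex \<Rightarrow> vpoly \<Rightarrow> vpoly" where
  "vquot l u f = (cst (inverse u ^ l) * refl_quot u (snd f), cst (u ^ l) * refl_quot u (fst f))"

lemma lin_vrefl: "lin (vrefl l u)"
  by (rule linI) (simp_all only: vrefl_def fst_add snd_add refl_poly_add distrib_left plus_prod_def
    fst_conv snd_conv scale_def refl_poly_cst_mult, simp_all only: mult.left_commute)

lemma lin_vquot: "u \<noteq> 0 \<Longrightarrow> lin (vquot l u)"
  by (rule linI) (simp_all only: vquot_def fst_add snd_add refl_quot_add distrib_left plus_prod_def
    fst_conv snd_conv scale_def refl_quot_cst_mult not_False_eq_True, simp_all only: mult.left_commute)

lemma vrefl_mz: "vrefl l u (mz f) = scale u (mzb (vrefl l u f))"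
  by (simp only: vrefl_def mz_def mzb_def scale_def fst_conv snd_conv refl_poly_Z mult.assoc,
      simp only: mult.left_commute)

lemma vrefl_mzb: "vrefl l u (mzb f) = scale (inverse u) (mz (vrefl l u f))"
  by (simp only: vrefl_def mz_def mzb_def scale_def fst_conv snd_conv refl_poly_Zb mult.assoc,
      simp only: mult.left_commute)

lemma vrefl_vconst: "vrefl l u (vconst a b) = vconst (inverse u ^ l * b) (u ^ l * a)"
  by (simp only: vrefl_def vconst_def fst_conv snd_conv refl_poly_cst cst_mult)

lemma vquot_vconst: "vquot l u (vconst a b) = 0"
  by (simp only: vquot_def vconst_def fst_conv snd_conv refl_quot_cst mult_zero_right zero_prod_def)

lemma vquot_mz: "u \<noteq> 0 \<Longrightarrow> vquot l u (mz f) = mz (vquot l u f) + vrefl l u f"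
  by (simp only: vrefl_def vquot_def mz_def fst_conv snd_conv refl_quot_Z plus_prod_def
      not_False_eq_True distrib_left, simp only: mult.left_commute)

lemma vquot_mzb: "u \<noteq> 0 \<Longrightarrow> vquot l u (mzb f) = mzb (vquot l u f) - scale (inverse u) (vrefl l u f)"
  by (simp only: vrefl_def vquot_def mzb_def fst_conv snd_conv refl_quot_Zb minus_prod_def scale_def
      not_False_eq_True right_diff_distrib, simp only: mult.left_commute)

lemma vrefl_vrefl:
  assumes "v * inverse u = v' * inverse u'" "u \<noteq> 0" "v \<noteq> 0" "u' \<noteq> 0" "v' \<noteq> 0"
  shows "vrefl l u (vrefl l v f) = vrefl l u' (vrefl l v' f)"
proof -
  have 1: "inverse u ^ l * v ^ l = inverse u' ^ l * v' ^ l"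
    using assms(1) by (simp only: power_mult_distrib[symmetric] mult.commute)
  have "u * inverse v = u' * inverse v'" using assms by (simp add: field_simps)
  then have 2: "u ^ l * inverse v ^ l = u' ^ l * inverse v' ^ l"
    by (simp only: power_mult_distrib[symmetric])
  have *: "vrefl l u (vrefl l v f) = (cst (inverse u ^ l * v ^ l) * refl_poly u (refl_poly v (fst f)),
     cst (u ^ l * inverse v ^ l) * refl_poly u (refl_poly v (snd f)))" for u v
    by (simp only: vrefl_def fst_conv snd_conv refl_poly_cst_mult cst_mult mult.assoc)
  show ?thesis unfolding * 1 2 refl_poly_refl_poly[OF assms] ..
qed

lemma vrefl_invol: "u \<noteq> 0 \<Longrightarrow> vrefl l u (vrefl l u f) = f"
  by (simp only: vrefl_def fst_conv snd_conv refl_poly_cst_mult refl_poly_invol mult.assoc[symmetric]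
    cst_mult[symmetric] power_mult_distrib[symmetric] left_inverse right_inverse power_one cst_1 mult_1_left
    prod.collapse not_False_eq_True)

section \<open>Dunkl operators\<close>

definition dz :: "vpoly \<Rightarrow> vpoly" where "dz f = (pderiv (fst f), pderiv (snd f))"
definition dzb :: "vpoly \<Rightarrow> vpoly" where "dzb f = (map_poly pderiv (fst f), map_poly pderiv (snd f))"

lemma dz_rules:
  "lin dz" "dz (vconst a b) = 0" "dz (mz f) = mz (dz f) + f" "dz (mzb f) = mzb (dz f)"
proof -
  have 1: "pderiv (cst c * p) = cst c * pderiv p" for c and p :: bipoly
    by (simp add: pderiv_smult)
  show "lin dz"
    by (rule linI) (simp_all only: dz_def fst_add snd_add pderiv_add plus_prod_def fst_conv snd_conv scale_def 1)
  show "dz (vconst a b) = 0" by (simp add: dz_def vconst_def zero_prod_def)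
  show "dz (mz f) = mz (dz f) + f" by (simp add: dz_def mz_def pderiv_pCons plus_prod_def add.commute)
  show "dz (mzb f) = mzb (dz f)" by (simp add: dz_def mzb_def pderiv_smult)
qed

lemma map_poly_pderiv_rules:
  "map_poly pderiv (p + q) = map_poly pderiv p + map_poly pderiv q"
  "map_poly pderiv (cst c * p) = cst c * map_poly pderiv p"
  "map_poly pderiv (cst c) = 0"
  "map_poly pderiv (Z * p) = Z * map_poly pderiv p"
  "map_poly pderiv (Zb * p) = Zb * map_poly pderiv p + (p :: bipoly)"
proof -
  show "map_poly pderiv (p + q) = map_poly pderiv p + map_poly pderiv q"
    by (rule poly_eqI) (simp add: coeff_map_poly pderiv_add)
  show "map_poly pderiv (cst c * p) = cst c * map_poly pderiv p"
    by (rule poly_eqI) (simp add: coeff_map_poly pderiv_smult)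
  show "map_poly pderiv (cst c) = 0"
    by (rule poly_eqI) (simp add: coeff_map_poly coeff_pCons pderiv_pCons split: nat.splits)
  show "map_poly pderiv (Z * p) = Z * map_poly pderiv p"
    unfolding Z_times by (rule poly_eqI) (simp add: coeff_map_poly coeff_pCons split: nat.splits)
  show "map_poly pderiv (Zb * p) = Zb * map_poly pderiv p + p"
    unfolding Zb_times by (rule poly_eqI) (simp add: coeff_map_poly pderiv_pCons add.commute)
qed

lemma dzb_rules:
  "lin dzb" "dzb (vconst a b) = 0" "dzb (mz f) = mz (dzb f)" "dzb (mzb f) = mzb (dzb f) + f"
proof -
  show "lin dzb"
    by (rule linI) (simp_all only: dzb_def fst_add snd_add map_poly_pderiv_rules(1,2) plus_prod_def
      fst_conv snd_conv scale_def)
  show "dzb (vconst a b) = 0" unfolding dzb_def vconst_def fst_conv snd_conv map_poly_pderiv_rules(3)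
    by (simp only: zero_prod_def)
  show "dzb (mz f) = mz (dzb f)"
    unfolding dzb_def mz_def fst_conv snd_conv map_poly_pderiv_rules(4) ..
  show "dzb (mzb f) = mzb (dzb f) + f"
    unfolding dzb_def mzb_def fst_conv snd_conv map_poly_pderiv_rules(5) by (simp only: plus_prod_def fst_conv snd_conv)
qed

lemma omega_powi: "omega m powi (- int j) = inverse (omega m ^ j)"
  by (simp add: power_int_minus)

lemma omega_nonzero: "omega m \<noteq> 0"
  by (simp add: omega_def)

lemma omega_power: "omega m ^ j = cis (2 * pi * real j / real m)"
  by (simp add: omega_def cis_conv_exp exp_of_nat_mult [symmetric] mult_ac)

text \<open>Both terms of the numerator carry the same scalar factors, so these can be pulled in
  front of an exact quotient of scalar polynomials.\<close>

lemma diff_quot_eq: "diff_quot m l j f = vquot l (omega m ^ j) f"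
proof -
  define u where "u = omega m ^ j"
  have u: "u \<noteq> 0" by (simp add: u_def omega_nonzero)
  have a: "omega m ^ (l * j) = u ^ l" by (simp add: u_def power_mult [symmetric] mult.commute)
  have b: "omega m powi (- int (l * j)) = inverse u ^ l"
    by (simp only: omega_powi a power_inverse)
  have w: "omega m powi (- int j) = inverse u" by (simp only: omega_powi u_def)
  have *: "(cst c * subst2 p Z Zb - cst c * refl_poly u p) div (Z - cst u * Zb) = cst c * refl_quot u p" for c p
  proof -
    have "cst c * subst2 p Z Zb - cst c * refl_poly u p = cst c * (p - refl_poly u p)"
      unfolding subst2_id by (rule right_diff_distrib[symmetric])
    also have "\<dots> = (Z - cst u * Zb) * (cst c * refl_quot u p)"
      unfolding refl_quot[OF u] by (rule mult.left_commute)
    finally show ?thesis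
      by (simp only:) (rule nonzero_mult_div_cancel_left, rule refl_den_nonzero)
  qed
  show ?thesis
    unfolding diff_quot_def Let_def a b w u_def[symmetric] subst_swap_def refl_poly_def[symmetric]
      fst_diff snd_diff fst_conv snd_conv * vquot_def ..
qed

section \<open>Sums over reflections and the commutators of the Dunkl operators\<close>

definition unity_roots :: "nat \<Rightarrow> complex set" where "unity_roots m = {u. u ^ m = 1}"

text \<open>Reflections summed against the character \<open>u powi k\<close>. Such sums are what the
  commutators of the Dunkl operators with z and zbar leave over, with k = 0 or k =
  \<plusminus>1.\<close>

definition refl_sum :: "nat \<Rightarrow> nat \<Rightarrow> int \<Rightarrow> vpoly \<Rightarrow> vpoly" where
  "refl_sum m l k f = (\<Sum>u\<in>unity_roots m. scale (u powi k) (vrefl l u f))"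

locale dihedral_params =
  fixes m l :: nat and \<kappa> :: real
  assumes m_pos: "0 < m"
begin

abbreviation "D \<equiv> dunkl m l \<kappa>"
abbreviation "Db \<equiv> dunkl_bar m l \<kappa>"
abbreviation "U \<equiv> unity_roots m"
abbreviation "S \<equiv> refl_sum m l"
abbreviation "k' \<equiv> complex_of_real \<kappa>"

lemma root_nonzero: "u \<in> U \<Longrightarrow> u \<noteq> 0"
  using m_pos by (auto simp: unity_roots_def power_0_left)

lemma bij_omega: "bij_betw (\<lambda>j. omega m ^ j) {..<m} U"
  using Complex.bij_betw_roots_unity[OF m_pos] by (simp add: omega_power unity_roots_def)

lemma root_sum: "(\<Sum>j<m. h (omega m ^ j)) = (\<Sum>u\<in>U. h u)"
  using sum.reindex_bij_betw[OF bij_omega] .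

lemma D_eq: "D f = dz f + scale k' (\<Sum>u\<in>U. vquot l u f)"
  unfolding dunkl_def diff_quot_eq root_sum[symmetric] dz_def ..

lemma Db_eq: "Db f = dzb f - scale k' (\<Sum>u\<in>U. scale u (vquot l u f))"
  unfolding dunkl_bar_def diff_quot_eq root_sum[symmetric] dzb_def ..

lemma lin_D: "lin D"
  unfolding D_eq[abs_def]
  by (intro lin_plus lin_scale_fun lin_sum_fun lin_vquot dz_rules root_nonzero)

lemma lin_Db: "lin Db"
  unfolding Db_eq[abs_def]
  by (intro lin_minus_fun lin_scale_fun lin_sum_fun lin_vquot dzb_rules root_nonzero)

lemma D_const: "D (vconst a b) = 0"
  by (simp add: D_eq dz_rules vquot_vconst vp.scale_zero_right)

lemma Db_const: "Db (vconst a b) = 0"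
  by (simp add: Db_eq dzb_rules vquot_vconst vp.scale_zero_right)

lemma D_mz: "D (mz f) = mz (D f) + f + scale k' (S 0 f)"
proof -
  have "(\<Sum>u\<in>U. vquot l u (mz f)) = mz (\<Sum>u\<in>U. vquot l u f) + S 0 f"
    by (simp add: vquot_mz root_nonzero sum.distrib lin_sum[OF lin_mz] refl_sum_def scale_one)
  then show ?thesis
    by (simp add: D_eq dz_rules lin_add[OF lin_mz] lin_scale[OF lin_mz] scale_add_right)
qed

lemma D_mzb: "D (mzb f) = mzb (D f) - scale k' (S (-1) f)"
proof -
  have "(\<Sum>u\<in>U. vquot l u (mzb f)) = mzb (\<Sum>u\<in>U. vquot l u f) - S (-1) f"
    by (simp add: vquot_mzb root_nonzero sum_subtractf lin_sum[OF lin_mzb] refl_sum_def power_int_minus)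
  then show ?thesis
    by (simp add: D_eq dz_rules lin_add[OF lin_mzb] lin_scale[OF lin_mzb] vp.scale_right_diff_distrib)
qed

lemma Db_mz: "Db (mz f) = mz (Db f) - scale k' (S 1 f)"
proof -
  have "(\<Sum>u\<in>U. scale u (vquot l u (mz f))) = mz (\<Sum>u\<in>U. scale u (vquot l u f)) + S 1 f"
    by (simp add: vquot_mz root_nonzero sum.distrib lin_sum[OF lin_mz] lin_scale[OF lin_mz] refl_sum_def
        scale_add_right)
  then show ?thesis
    by (simp add: Db_eq dzb_rules lin_diff[OF lin_mz] lin_scale[OF lin_mz] scale_add_right)
qed

lemma Db_mzb: "Db (mzb f) = mzb (Db f) + f + scale k' (S 0 f)"
proof -
  have "(\<Sum>u\<in>U. scale u (vquot l u (mzb f))) = mzb (\<Sum>u\<in>U. scale u (vquot l u f)) - S 0 f"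
    by (simp add: vquot_mzb root_nonzero sum_subtractf lin_sum[OF lin_mzb] lin_scale[OF lin_mzb] refl_sum_def
        vp.scale_right_diff_distrib scale_scale scale_one)
  then show ?thesis
    by (simp add: Db_eq dzb_rules lin_diff[OF lin_mzb] lin_scale[OF lin_mzb] vp.scale_right_diff_distrib)
qed

text \<open>Conjugation by the reflection with parameter u sends the one with parameter v to the one
  with parameter \<open>u * u / v\<close>; this is an involution of the roots of unity.\<close>

lemma root_reindex:
  assumes u: "u \<in> U"
  shows "(\<Sum>v\<in>U. h v) = (\<Sum>v\<in>U. h (u * u / v))"
proof (rule sum.reindex_bij_betw[symmetric], rule bij_betwI[where g = "\<lambda>v. u * u / v"])
  show "(\<lambda>v. u * u / v) \<in> U \<rightarrow> U" "(\<lambda>v. u * u / v) \<in> U \<rightarrow> U"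
    using u by (auto simp: unity_roots_def power_mult_distrib power_divide)
qed (use root_nonzero u in auto)

lemma vrefl_refl_sum:
  assumes u: "u \<in> U"
  shows "vrefl l u (S k f) = scale (u powi (2 * k)) (S (- k) (vrefl l u f))"
proof -
  note [simp] = root_nonzero
  have "vrefl l u (S k f) = (\<Sum>v\<in>U. scale (v powi k) (vrefl l u (vrefl l v f)))"
    by (simp add: refl_sum_def lin_sum[OF lin_vrefl] lin_scale[OF lin_vrefl])
  also have "\<dots> = (\<Sum>v\<in>U. scale (v powi k) (vrefl l (u * u / v) (vrefl l u f)))"
    by (intro sum.cong refl arg_cong[where f = "scale _"] vrefl_vrefl) (use u in \<open>auto simp: field_simps\<close>)
  also have "\<dots> = (\<Sum>v\<in>U. scale ((u * u / v) powi k) (vrefl l v (vrefl l u f)))"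
    by (subst root_reindex[OF u]) (intro sum.cong refl, use u in simp)
  also have "\<dots> = scale (u powi (2 * k)) (S (- k) (vrefl l u f))"
    unfolding refl_sum_def vp.scale_sum_right scale_scale
    by (intro sum.cong refl arg_cong2[where f = scale])
       (use u in \<open>simp add: power_int_divide_distrib power_int_mult_distrib power_int_minus
          power_int_mult power2_eq_square divide_inverse power_int_inverse\<close>)
  finally show ?thesis .
qed

text \<open>A reflection exchanges z and zbar up to the factor u, hence also the two Dunkl
  operators. The induction uses only their commutators and the conjugation rule
  \<open>vrefl_refl_sum\<close>.\<close>

lemma vrefl_Db: "u \<in> U \<Longrightarrow> vrefl l u (Db f) = scale u (D (vrefl l u f))"
proof (induction f rule: vpoly_induct)
  case (const a b)
  then show ?case by (simp add: Db_const D_const vrefl_vconst lin_zero[OF lin_vrefl] vp.scale_zero_right)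
next
  case (mz f)
  note u = mz(2) and IH = mz(1)[OF mz(2)]
  have "vrefl l u (S 1 f) = scale (u * u) (S (- 1) (vrefl l u f))"
    using vrefl_refl_sum[OF u, of 1] by (simp add: power2_eq_square)
  then show ?case
    by (simp add: Db_mz vrefl_mz D_mzb lin_diff[OF lin_vrefl] lin_scale[OF lin_vrefl] IH lin_scale[OF lin_D]
        lin_scale[OF lin_mzb] scale_scale vp.scale_right_diff_distrib mult_ac)
next
  case (mzb f)
  note u = mzb(2) and IH = mzb(1)[OF mzb(2)]
  have "vrefl l u (S 0 f) = S 0 (vrefl l u f)"
    using vrefl_refl_sum[OF u, of 0] by (simp add: scale_one)
  then show ?case using root_nonzero[OF u]
    by (simp add: Db_mzb vrefl_mzb D_mz lin_add[OF lin_vrefl] lin_scale[OF lin_vrefl] IH lin_scale[OF lin_D]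
        lin_scale[OF lin_mz] scale_scale scale_add_right scale_one)
next
  case (add f g)
  then show ?case
    by (simp add: lin_add[OF lin_vrefl] lin_add[OF lin_D] lin_add[OF lin_Db] scale_add_right)
qed

lemma D_vrefl: "u \<in> U \<Longrightarrow> D (vrefl l u f) = scale (inverse u) (vrefl l u (Db f))"
  using root_nonzero[of u] by (simp add: vrefl_Db scale_scale scale_one)

lemma Db_vrefl: "u \<in> U \<Longrightarrow> Db (vrefl l u f) = scale u (vrefl l u (D f))"
proof -
  assume u: "u \<in> U"
  have "vrefl l u (vrefl l u (Db (vrefl l u f))) = scale u (vrefl l u (D f))"
    using root_nonzero[OF u] by (simp add: vrefl_Db[OF u] vrefl_invol lin_scale[OF lin_vrefl])
  then show ?thesis using root_nonzero[OF u] by (simp add: vrefl_invol)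
qed

lemma D_refl_sum: "D (S k f) = S (k - 1) (Db f)"
  unfolding refl_sum_def lin_sum[OF lin_D] lin_scale[OF lin_D]
  by (intro sum.cong refl) (simp add: D_vrefl scale_scale root_nonzero power_int_diff divide_inverse)

lemma Db_refl_sum: "Db (S k f) = S (k + 1) (D f)"
  unfolding refl_sum_def lin_sum[OF lin_Db] lin_scale[OF lin_Db]
  by (intro sum.cong refl) (simp add: Db_vrefl scale_scale root_nonzero power_int_add)

text \<open>The reflection terms cancel: \<open>D_mz\<close> applied to \<open>Db f\<close>
  contributes \<open>S 0 (Db f)\<close>, and \<open>D (S 1 f)\<close> is the same with the opposite
  sign in front. Hence the Laplacian commutes with z as in the classical case.\<close>

lemma DDb_mz: "D (Db (mz f)) = mz (D (Db f)) + Db f"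
  by (simp add: Db_mz lin_diff[OF lin_D] D_mz lin_scale[OF lin_D] D_refl_sum)

lemma DDb_mzb: "D (Db (mzb f)) = mzb (D (Db f)) + D f"
  by (simp add: Db_mzb lin_add[OF lin_D] D_mzb lin_scale[OF lin_D] D_refl_sum)

lemma DbD_mz: "Db (D (mz f)) = mz (Db (D f)) + Db f"
  by (simp add: D_mz lin_add[OF lin_Db] Db_mz lin_scale[OF lin_Db] Db_refl_sum)

lemma DbD_mzb: "Db (D (mzb f)) = mzb (Db (D f)) + D f"
  by (simp add: D_mzb lin_diff[OF lin_Db] Db_mzb lin_scale[OF lin_Db] Db_refl_sum)

text \<open>Both products vanish on constants and have the same commutators with z and zbar.\<close>

lemma D_Db_commute: "D (Db f) = Db (D f)"
proof (induction f rule: vpoly_induct)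
  case (const a b)
  then show ?case by (simp add: D_const Db_const lin_zero[OF lin_D] lin_zero[OF lin_Db])
qed (simp_all add: DDb_mz DbD_mz DDb_mzb DbD_mzb lin_add[OF lin_D] lin_add[OF lin_Db])

section \<open>The Laplacian and its exponential\<close>

abbreviation "\<Delta> \<equiv> laplacian m l \<kappa>"

lemma lin_\<Delta>: "lin \<Delta>"
  unfolding laplacian_def[abs_def] by (intro lin_scale_fun lin_comp[OF lin_D lin_Db])

lemma \<Delta>_const: "\<Delta> (vconst a b) = 0"
  by (simp add: laplacian_def Db_const lin_zero[OF lin_D] vp.scale_zero_right)

lemma \<Delta>_mz: "\<Delta> (mz f) = mz (\<Delta> f) + scale 4 (Db f)"
  by (simp add: laplacian_def DDb_mz scale_add_right lin_scale[OF lin_mz])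

lemma \<Delta>_mzb: "\<Delta> (mzb f) = mzb (\<Delta> f) + scale 4 (D f)"
  by (simp add: laplacian_def DDb_mzb scale_add_right lin_scale[OF lin_mzb])

lemma \<Delta>_D: "\<Delta> (D f) = D (\<Delta> f)"
  by (simp add: laplacian_def D_Db_commute lin_scale[OF lin_D])

lemma \<Delta>_Db: "\<Delta> (Db f) = Db (\<Delta> f)"
  by (simp add: laplacian_def D_Db_commute lin_scale[OF lin_Db])

abbreviation "\<Delta>n n \<equiv> laplacian m l \<kappa> ^^ n"

lemmas lin_\<Delta>n = lin_funpow[OF lin_\<Delta>]

lemma \<Delta>n_D: "(\<Delta>n n) (D f) = D ((\<Delta>n n) f)"
  by (induction n) (simp_all add: \<Delta>_D)

lemma \<Delta>n_Db: "(\<Delta>n n) (Db f) = Db ((\<Delta>n n) f)"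
  by (induction n) (simp_all add: \<Delta>_Db)

text \<open>The commutator of the Laplacian with z is \<open>4 Db\<close>, which commutes with the
  Laplacian, so the commutator of a power follows the rule for the derivative of a power.\<close>

lemma \<Delta>n_mz: "(\<Delta>n (Suc n)) (mz f) = mz ((\<Delta>n (Suc n)) f) + scale (4 * of_nat (Suc n)) (Db ((\<Delta>n n) f))"
proof (induction n)
  case 0
  then show ?case by (simp add: \<Delta>_mz)
next
  case (Suc n)
  define A where "A = (\<Delta>n (Suc n)) f"
  have A: "\<Delta> A = (\<Delta>n (Suc (Suc n))) f" "A = \<Delta> ((\<Delta>n n) f)" by (simp_all add: A_def)
  have "(\<Delta>n (Suc (Suc n))) (mz f) = \<Delta> ((\<Delta>n (Suc n)) (mz f))" by simp
  also have "\<dots> = \<Delta> (mz A) + scale (4 * of_nat (Suc n)) (Db A)"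
    by (simp only: Suc lin_add[OF lin_\<Delta>] lin_scale[OF lin_\<Delta>] \<Delta>_Db A_def[symmetric] A(2)[symmetric])
  also have "\<dots> = mz (\<Delta> A) + (scale 4 (Db A) + scale (4 * of_nat (Suc n)) (Db A))"
    by (simp only: \<Delta>_mz add.assoc)
  also have "scale 4 (Db A) + scale (4 * of_nat (Suc n)) (Db A) = scale (4 * of_nat (Suc (Suc n))) (Db A)"
    unfolding scale_add_left[symmetric] by (simp add: algebra_simps)
  finally show ?case unfolding A(1) unfolding A_def .
qed

lemma \<Delta>n_mzb: "(\<Delta>n (Suc n)) (mzb f) = mzb ((\<Delta>n (Suc n)) f) + scale (4 * of_nat (Suc n)) (D ((\<Delta>n n) f))"
proof (induction n)
  case 0
  then show ?case by (simp add: \<Delta>_mzb)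
next
  case (Suc n)
  define A where "A = (\<Delta>n (Suc n)) f"
  have A: "\<Delta> A = (\<Delta>n (Suc (Suc n))) f" "A = \<Delta> ((\<Delta>n n) f)" by (simp_all add: A_def)
  have "(\<Delta>n (Suc (Suc n))) (mzb f) = \<Delta> ((\<Delta>n (Suc n)) (mzb f))" by simp
  also have "\<dots> = \<Delta> (mzb A) + scale (4 * of_nat (Suc n)) (D A)"
    by (simp only: Suc lin_add[OF lin_\<Delta>] lin_scale[OF lin_\<Delta>] \<Delta>_D A_def[symmetric] A(2)[symmetric])
  also have "\<dots> = mzb (\<Delta> A) + (scale 4 (D A) + scale (4 * of_nat (Suc n)) (D A))"
    by (simp only: \<Delta>_mzb add.assoc)
  also have "scale 4 (D A) + scale (4 * of_nat (Suc n)) (D A) = scale (4 * of_nat (Suc (Suc n))) (D A)"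
    unfolding scale_add_left[symmetric] by (simp add: algebra_simps)
  finally show ?case unfolding A(1) unfolding A_def .
qed

lemma \<Delta>n_zero_mono: "(\<Delta>n n) f = 0 \<Longrightarrow> n \<le> k \<Longrightarrow> (\<Delta>n k) f = 0"
  by (induction k) (auto simp: le_Suc_eq lin_zero[OF lin_\<Delta>])

text \<open>A further factor z or zbar raises the order of nilpotency by at most one; hence the
  exponential series is a finite sum.\<close>

lemma \<Delta>_nilpotent: "\<exists>n. (\<Delta>n n) f = 0"
proof (induction f rule: vpoly_induct)
  case (const a b)
  then show ?case by (intro exI[of _ 1]) (simp add: \<Delta>_const)
next
  case (mz f)
  then obtain n where "(\<Delta>n n) f = 0" ..
  then show ?case
    by (intro exI[of _ "Suc n"], subst \<Delta>n_mz)
       (simp add: lin_zero[OF lin_\<Delta>] lin_zero[OF lin_mz] lin_zero[OF lin_Db] vp.scale_zero_right)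
next
  case (mzb f)
  then obtain n where "(\<Delta>n n) f = 0" ..
  then show ?case
    by (intro exI[of _ "Suc n"], subst \<Delta>n_mzb)
       (simp add: lin_zero[OF lin_\<Delta>] lin_zero[OF lin_mzb] lin_zero[OF lin_D] vp.scale_zero_right)
next
  case (add f g)
  then obtain a b where "(\<Delta>n a) f = 0" "(\<Delta>n b) g = 0" by auto
  then have "(\<Delta>n (max a b)) f = 0" "(\<Delta>n (max a b)) g = 0" using \<Delta>n_zero_mono by auto
  then show ?case by (intro exI[of _ "max a b"]) (simp add: lin_add[OF lin_\<Delta>n])
qed

text \<open>The scalar is kept free so that the inverse exp (- \<Delta> / 2) is another
  instance.\<close>

definition exp\<Delta> :: "complex \<Rightarrow> vpoly \<Rightarrow> vpoly" where
  "exp\<Delta> c f = Sum_any (\<lambda>n. scale (c ^ n / fact n) ((\<Delta>n n) f))"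

lemma exp\<Delta>_eq:
  assumes "(\<Delta>n N) f = 0"
  shows "exp\<Delta> c f = (\<Sum>n<N. scale (c ^ n / fact n) ((\<Delta>n n) f))"
  unfolding exp\<Delta>_def
proof (rule Sum_any.expand_superset)
  show "{n. scale (c ^ n / fact n) ((\<Delta>n n) f) \<noteq> 0} \<subseteq> {..<N}"
  proof (rule subsetI, rule ccontr)
    fix n assume "n \<in> {n. scale (c ^ n / fact n) ((\<Delta>n n) f) \<noteq> 0}" "n \<notin> {..<N}"
    then show False using \<Delta>n_zero_mono[OF assms, of n] by (simp add: vp.scale_zero_right)
  qed
qed simp

lemma lin_exp\<Delta>: "lin (exp\<Delta> c)"
proof (rule linI)
  fix f g d
  obtain a b where ab: "(\<Delta>n a) f = 0" "(\<Delta>n b) g = 0" using \<Delta>_nilpotent by metis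
  have f: "(\<Delta>n (max a b)) f = 0" by (rule \<Delta>n_zero_mono[OF ab(1)]) simp
  have g: "(\<Delta>n (max a b)) g = 0" by (rule \<Delta>n_zero_mono[OF ab(2)]) simp
  have fg: "(\<Delta>n (max a b)) (f + g) = 0" by (simp only: lin_add[OF lin_\<Delta>n] f g add_0)
  show "exp\<Delta> c (f + g) = exp\<Delta> c f + exp\<Delta> c g"
    unfolding exp\<Delta>_eq[OF f] exp\<Delta>_eq[OF g] exp\<Delta>_eq[OF fg] lin_add[OF lin_\<Delta>n] scale_add_right sum.distrib ..
  have df: "(\<Delta>n a) (scale d f) = 0" by (simp only: lin_scale[OF lin_\<Delta>n] ab vp.scale_zero_right)
  show "exp\<Delta> c (scale d f) = scale d (exp\<Delta> c f)"
    unfolding exp\<Delta>_eq[OF ab(1)] exp\<Delta>_eq[OF df] lin_scale[OF lin_\<Delta>n] vp.scale_sum_right scale_scale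
    by (simp only: mult.commute)
qed

lemma exp\<Delta>_const: "exp\<Delta> c (vconst a b) = vconst a b"
  by (subst exp\<Delta>_eq[where N = 1]) (simp_all add: \<Delta>_const scale_one)

lemma exp\<Delta>_D: "exp\<Delta> c (D f) = D (exp\<Delta> c f)"
proof -
  obtain n where n: "(\<Delta>n n) f = 0" using \<Delta>_nilpotent by metis
  then have n': "(\<Delta>n n) (D f) = 0" by (simp only: \<Delta>n_D lin_zero[OF lin_D])
  show ?thesis unfolding exp\<Delta>_eq[OF n] exp\<Delta>_eq[OF n'] \<Delta>n_D lin_sum[OF lin_D] lin_scale[OF lin_D] ..
qed

lemma exp\<Delta>_Db: "exp\<Delta> c (Db f) = Db (exp\<Delta> c f)"
proof -
  obtain n where n: "(\<Delta>n n) f = 0" using \<Delta>_nilpotent by metis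
  then have n': "(\<Delta>n n) (Db f) = 0" by (simp only: \<Delta>n_Db lin_zero[OF lin_Db])
  show ?thesis unfolding exp\<Delta>_eq[OF n] exp\<Delta>_eq[OF n'] \<Delta>n_Db lin_sum[OF lin_Db] lin_scale[OF lin_Db] ..
qed

lemma exp_coeff_Suc: "c ^ Suc n / fact (Suc n) * (4 * of_nat (Suc n)) = 4 * c * (c ^ n / fact n :: complex)"
  by (simp add: field_simps del: of_nat_Suc)

lemma exp\<Delta>_mz: "exp\<Delta> c (mz f) = mz (exp\<Delta> c f) + scale (4 * c) (Db (exp\<Delta> c f))"
proof -
  obtain n where n: "(\<Delta>n n) f = 0" using \<Delta>_nilpotent by metis
  have n1: "(\<Delta>n (Suc n)) f = 0" by (rule \<Delta>n_zero_mono[OF n]) simp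
  have n': "(\<Delta>n (Suc n)) (mz f) = 0"
    by (simp only: \<Delta>n_mz n n1 lin_zero[OF lin_Db] lin_zero[OF lin_mz] vp.scale_zero_right add_0)
  have "exp\<Delta> c (mz f) = mz f + (\<Sum>k<n. scale (c ^ Suc k / fact (Suc k)) (mz ((\<Delta>n (Suc k)) f))
       + scale (4 * c) (scale (c ^ k / fact k) (Db ((\<Delta>n k) f))))"
    unfolding exp\<Delta>_eq[OF n'] sum.lessThan_Suc_shift \<Delta>n_mz scale_add_right scale_scale exp_coeff_Suc
    by (simp only: power_0 fact_0 div_by_1 scale_one funpow_0)
  also have "\<dots> = mz (\<Sum>k<Suc n. scale (c ^ k / fact k) ((\<Delta>n k) f))
      + scale (4 * c) (Db (\<Sum>k<n. scale (c ^ k / fact k) ((\<Delta>n k) f)))"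
    unfolding sum.lessThan_Suc_shift lin_add[OF lin_mz] lin_sum[OF lin_mz] lin_sum[OF lin_Db]
      lin_scale[OF lin_mz] lin_scale[OF lin_Db] vp.scale_sum_right sum.distrib
    by (simp only: power_0 fact_0 div_by_1 scale_one funpow_0 add.assoc)
  finally show ?thesis unfolding exp\<Delta>_eq[OF n1, symmetric] exp\<Delta>_eq[OF n, symmetric] .
qed

lemma exp\<Delta>_mzb: "exp\<Delta> c (mzb f) = mzb (exp\<Delta> c f) + scale (4 * c) (D (exp\<Delta> c f))"
proof -
  obtain n where n: "(\<Delta>n n) f = 0" using \<Delta>_nilpotent by metis
  have n1: "(\<Delta>n (Suc n)) f = 0" by (rule \<Delta>n_zero_mono[OF n]) simp
  have n': "(\<Delta>n (Suc n)) (mzb f) = 0"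
    by (simp only: \<Delta>n_mzb n n1 lin_zero[OF lin_D] lin_zero[OF lin_mzb] vp.scale_zero_right add_0)
  have "exp\<Delta> c (mzb f) = mzb f + (\<Sum>k<n. scale (c ^ Suc k / fact (Suc k)) (mzb ((\<Delta>n (Suc k)) f))
       + scale (4 * c) (scale (c ^ k / fact k) (D ((\<Delta>n k) f))))"
    unfolding exp\<Delta>_eq[OF n'] sum.lessThan_Suc_shift \<Delta>n_mzb scale_add_right scale_scale exp_coeff_Suc
    by (simp only: power_0 fact_0 div_by_1 scale_one funpow_0)
  also have "\<dots> = mzb (\<Sum>k<Suc n. scale (c ^ k / fact k) ((\<Delta>n k) f))
      + scale (4 * c) (D (\<Sum>k<n. scale (c ^ k / fact k) ((\<Delta>n k) f)))"
    unfolding sum.lessThan_Suc_shift lin_add[OF lin_mzb] lin_sum[OF lin_mzb] lin_sum[OF lin_D]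
      lin_scale[OF lin_mzb] lin_scale[OF lin_D] vp.scale_sum_right sum.distrib
    by (simp only: power_0 fact_0 div_by_1 scale_one funpow_0 add.assoc)
  finally show ?thesis unfolding exp\<Delta>_eq[OF n1, symmetric] exp\<Delta>_eq[OF n, symmetric] .
qed

text \<open>The exponential commutes with D and Db, so the corrections that c and - c add to z and
  zbar are opposite. The inverse is thus checked on generators, without multiplying two
  series.\<close>

lemma exp\<Delta>_inverse: "exp\<Delta> (- c) (exp\<Delta> c f) = f"
proof (induction f rule: vpoly_induct)
  case (const a b)
  show ?case by (simp only: exp\<Delta>_const)
next
  case (mz f)
  then show ?case
    by (simp add: exp\<Delta>_mz lin_add[OF lin_exp\<Delta>] lin_scale[OF lin_exp\<Delta>] exp\<Delta>_Db vp.scale_minus_left)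
next
  case (mzb f)
  then show ?case
    by (simp add: exp\<Delta>_mzb lin_add[OF lin_exp\<Delta>] lin_scale[OF lin_exp\<Delta>] exp\<Delta>_D vp.scale_minus_left)
next
  case (add f g)
  then show ?case by (simp only: lin_add[OF lin_exp\<Delta>])
qed

lemma exp_half_laplacian_eq: "exp_half_laplacian m l \<kappa> f = exp\<Delta> (1 / 2) f"
  unfolding exp_half_laplacian_def exp\<Delta>_def by (simp add: power_one_over)

section \<open>The form\<close>

lemma star_op_eq:
  "star_op m l \<kappa> p q = coeff_sum (\<lambda>j k a. scale (cnj a * 2 ^ (j + k)) ((D ^^ j) ((Db ^^ k) q))) p"
  by (simp add: star_op_def coeff_sum_def)

lemma Dbn_D: "(Db ^^ k) (D q) = D ((Db ^^ k) q)"
  by (induction k) (simp_all add: D_Db_commute)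

lemma star_op_add: "star_op m l \<kappa> (p + p') q = star_op m l \<kappa> p q + star_op m l \<kappa> p' q"
  unfolding star_op_eq
  by (rule coeff_sum_add) (simp_all add: vp.scale_zero_left scale_add_left distrib_right)

text \<open>The additional factor D is moved past all powers of Db so that it acts on q first; this
  is where commutativity of the Dunkl operators enters the form.\<close>

lemma star_op_Z: "star_op m l \<kappa> (Z * p) q = star_op m l \<kappa> p (scale 2 (D q))"
proof -
  have "scale (cnj a * 2 ^ (Suc j + k)) ((D ^^ Suc j) ((Db ^^ k) q))
      = scale (cnj a * 2 ^ (j + k)) ((D ^^ j) ((Db ^^ k) (scale 2 (D q))))" for a j k
    by (simp add: lin_scale[OF lin_funpow[OF lin_D]] lin_scale[OF lin_funpow[OF lin_Db]] Dbn_D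
        scale_scale funpow_swap1 mult_ac)
  then show ?thesis unfolding star_op_eq
    by (subst coeff_sum_Z) (simp add: vp.scale_zero_left, simp only:)
qed

lemma star_op_Zb: "star_op m l \<kappa> (Zb * p) q = star_op m l \<kappa> p (scale 2 (Db q))"
proof -
  have "scale (cnj a * 2 ^ (j + Suc k)) ((D ^^ j) ((Db ^^ Suc k) q))
      = scale (cnj a * 2 ^ (j + k)) ((D ^^ j) ((Db ^^ k) (scale 2 (Db q))))" for a j k
    by (simp add: lin_scale[OF lin_funpow[OF lin_D]] lin_scale[OF lin_funpow[OF lin_Db]]
        scale_scale funpow_swap1 mult_ac)
  then show ?thesis unfolding star_op_eq
    by (subst coeff_sum_Zb) (simp add: vp.scale_zero_left, simp only:)
qed

lemma eval_bipoly_add: "eval_bipoly (p + q) z = eval_bipoly p z + eval_bipoly q z"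
  by (simp add: eval_bipoly_def)

lemma eval_bipoly_mult: "eval_bipoly (p * q) z = eval_bipoly p z * eval_bipoly q z"
  by (simp add: eval_bipoly_def)

lemma eval_bipoly_cst: "eval_bipoly (cst c) z = c"
  by (simp add: eval_bipoly_def)

lemma eval_bipoly_Z: "eval_bipoly Z z = z"
  by (simp add: eval_bipoly_def)

lemma eval_bipoly_Zb: "eval_bipoly Zb z = cnj z"
  by (simp add: eval_bipoly_def)

abbreviation "frm \<equiv> form m l \<kappa>"

lemma form_mz: "frm (mz f) g = frm f (scale 2 (D g))"
  unfolding form_def mz_def fst_conv snd_conv star_op_Z ..

lemma form_mzb: "frm (mzb f) g = frm f (scale 2 (Db g))"
  unfolding form_def mzb_def fst_conv snd_conv star_op_Zb ..

lemma form_add: "frm (f + f') g = frm f g + frm f' g"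
  unfolding form_def fst_add snd_add star_op_add
  by (simp add: form0_def at_zero_def fst_add snd_add eval_bipoly_add algebra_simps)

lemma form_const:
  "frm (vconst a b) g = 2 * (cnj a * eval_bipoly (fst g) 0 + cnj b * eval_bipoly (snd g) 0)"
  unfolding form_def vconst_def fst_conv snd_conv star_op_eq coeff_sum_cst
  by (simp only: form0_def at_zero_def scale_def fst_conv snd_conv eval_bipoly_mult eval_bipoly_cst
      funpow_0 add_0_left power_0 mult_1_right) (simp add: algebra_simps)

end

section \<open>Characterisation of the Gaussian form\<close>

definition vmono :: "nat \<Rightarrow> nat \<Rightarrow> vpoly \<Rightarrow> vpoly" where
  "vmono a b f = (mz ^^ a) ((mzb ^^ b) f)"

lemma mz_funpow_mzb: "(mz ^^ a) (mzb f) = mzb ((mz ^^ a) f)"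
  by (induction a) (simp_all add: mz_mzb)

lemma vmono_simps: "vmono 0 0 f = f" "mz (vmono a b f) = vmono (Suc a) b f" "mzb (vmono a b f) = vmono a (Suc b) f"
  "vmono a b (mz f) = vmono (Suc a) b f" "vmono a b (mzb f) = vmono a (Suc b) f"
proof -
  show "vmono 0 0 f = f" by (simp add: vmono_def)
  show "mz (vmono a b f) = vmono (Suc a) b f" by (simp add: vmono_def)
  show mzb: "mzb (vmono a b f) = vmono a (Suc b) f" for f by (simp add: vmono_def mz_funpow_mzb[symmetric])
  have "(mzb ^^ b) (mz f) = mz ((mzb ^^ b) f)" by (induction b) (simp_all add: mz_mzb)
  then show "vmono a b (mz f) = vmono (Suc a) b f" by (simp add: vmono_def funpow_swap1)
  show "vmono a b (mzb f) = vmono a (Suc b) f" by (simp add: vmono_def funpow_swap1)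
qed

lemma lin_vmono: "lin (vmono a b)"
  unfolding vmono_def[abs_def] by (rule lin_comp[OF lin_funpow[OF lin_mz] lin_funpow[OF lin_mzb]])

definition unit_vec :: "bool \<Rightarrow> vpoly" where
  "unit_vec e = (if e then vconst 1 0 else vconst 0 1)"

lemma vconst_unit: "vconst a b = scale a (unit_vec True) + scale b (unit_vec False)"
  by (simp add: unit_vec_def scale_vconst vconst_add)

lemma vpoly_vmono_induct:
  assumes m: "\<And>a b x e. P (scale x (vmono a b (unit_vec e)))" and a: "\<And>f g. P f \<Longrightarrow> P g \<Longrightarrow> P (f + g)"
  shows "P f"
proof -
  have "P (vmono i j f)" for i j
  proof (induction f arbitrary: i j rule: vpoly_induct)
    case (const x y)
    show ?case unfolding vconst_unit lin_add[OF lin_vmono] lin_scale[OF lin_vmono] by (rule a) (rule m)+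
  next
    case (add f g)
    show ?case unfolding lin_add[OF lin_vmono] by (rule a) (rule add)+
  next
    case (mz f)
    show ?case unfolding vmono_simps(4) by (rule mz)
  next
    case (mzb f)
    show ?case unfolding vmono_simps(5) by (rule mzb)
  qed
  from this[of 0 0] show ?thesis unfolding vmono_simps(1) .
qed

text \<open>Homogeneity of total degree, given by closure under the generators. Two facts about it
  are used: Db lowers the degree by one, and z zbar multiplies a moment by a factor that depends
  only on the degree.\<close>

inductive hom :: "nat \<Rightarrow> vpoly \<Rightarrow> bool" where
  hom_zero: "hom n 0"
| hom_const: "hom 0 (vconst a b)"
| hom_mz: "hom n f \<Longrightarrow> hom (Suc n) (mz f)"
| hom_mzb: "hom n f \<Longrightarrow> hom (Suc n) (mzb f)"
| hom_add: "hom n f \<Longrightarrow> hom n g \<Longrightarrow> hom n (f + g)"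

lemma hom_scale: "hom n f \<Longrightarrow> hom n (scale c f)"
  by (induction rule: hom.induct)
     (simp_all add: vp.scale_zero_right scale_vconst lin_scale[OF lin_mz, symmetric]
       lin_scale[OF lin_mzb, symmetric] scale_add_right hom.intros)

lemma hom_sum: "(\<And>i. i \<in> I \<Longrightarrow> hom n (f i)) \<Longrightarrow> hom n (sum f I)"
  by (induction I rule: infinite_finite_induct) (auto intro: hom.intros)

lemma hom_vrefl: "hom n f \<Longrightarrow> hom n (vrefl l u f)"
  by (induction rule: hom.induct)
     (simp_all add: lin_zero[OF lin_vrefl] lin_add[OF lin_vrefl] vrefl_mz vrefl_mzb vrefl_vconst
       hom_scale hom.intros)

lemma hom_refl_sum: "hom n f \<Longrightarrow> hom n (refl_sum m l k f)"
  unfolding refl_sum_def by (intro hom_sum hom_scale hom_vrefl)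

lemma hom_minus: "hom n f \<Longrightarrow> hom n g \<Longrightarrow> hom n (f - g)"
  using hom_add[of n f "scale (- 1) g"] hom_scale[of n g "- 1"] by (simp add: vp.scale_minus_left scale_one)

lemma hom_mono: "hom n f \<Longrightarrow> hom (a + b + n) (vmono a b f)"
proof -
  assume f: "hom n f"
  have 1: "hom (b + n) ((mzb ^^ b) f)" by (induction b) (simp_all add: f hom_mzb)
  have "hom (a + (b + n)) ((mz ^^ a) ((mzb ^^ b) f))" by (induction a) (simp_all add: 1 hom_mz)
  then show ?thesis by (simp add: vmono_def add.assoc)
qed

text \<open>The terms of an arithmetic progression of step 2 m inside an open symmetric interval.
  The modulus 2 m records at once the parity of an exponent difference and the divisibility by m
  that comes from summing over roots of unity.\<close>

definition prog_sum :: "nat \<Rightarrow> (int \<Rightarrow> real) \<Rightarrow> int \<Rightarrow> int \<Rightarrow> real" where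
  "prog_sum m h k c = (\<Sum>x | \<bar>x\<bar> < k \<and> 2 * int m dvd x + c. h x)"

text \<open>The sign of the exponent l with which a reflection acts on t and on tbar, see
  \<open>vrefl_unit\<close>.\<close>

definition sg :: "bool \<Rightarrow> int" where "sg e = (if e then 1 else - 1)"

lemma sg_not: "sg (\<not> e) = - sg e"
  by (simp add: sg_def)

context dihedral_params begin

lemma S_mz: "S k (mz f) = mzb (S (k + 1) f)"
  unfolding refl_sum_def lin_sum[OF lin_mzb] lin_scale[OF lin_mzb]
  by (intro sum.cong refl) (simp add: vrefl_mz scale_scale power_int_add root_nonzero)

lemma S_mzb: "S k (mzb f) = mz (S (k - 1) f)"
  unfolding refl_sum_def lin_sum[OF lin_mz] lin_scale[OF lin_mz]
  by (intro sum.cong refl) (simp add: vrefl_mzb scale_scale power_int_diff root_nonzero divide_inverse)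

text \<open>The function z zbar is invariant under all reflections, so their contributions cancel
  and Db treats this factor as the ordinary derivative in zbar does.\<close>

lemma Db_mz_mzb: "Db (mz (mzb f)) = mz (mzb (Db f)) + mz f"
  by (simp add: Db_mz Db_mzb S_mzb lin_add[OF lin_mz] lin_scale[OF lin_mz])

lemma hom_Db: "hom n f \<Longrightarrow> (case n of 0 \<Rightarrow> Db f = 0 | Suc k \<Rightarrow> hom k (Db f))"
proof (induction rule: hom.induct)
  case (hom_zero n)
  then show ?case by (simp add: lin_zero[OF lin_Db] hom.hom_zero split: nat.split)
next
  case (hom_mz n f)
  show ?case
    by (cases n) (use hom_mz in \<open>simp_all add: Db_mz lin_zero[OF lin_mz] hom_minus hom_scale hom_refl_sum
      hom.hom_mz hom.hom_zero vp.scale_minus_left[symmetric] del: diff_0\<close>)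
next
  case (hom_mzb n f)
  show ?case
    by (cases n) (use hom_mzb in \<open>simp_all add: Db_mzb lin_zero[OF lin_mzb] hom.hom_add hom_scale hom_refl_sum
      hom.hom_mzb\<close>)
next
  case (hom_add n f g)
  then show ?case by (simp add: lin_add[OF lin_Db] hom.hom_add split: nat.splits)
qed (simp add: Db_const)

lemma root_power_sum: "(\<Sum>u\<in>U. u powi k) = (if int m dvd k then of_nat m else 0)"
proof -
  define w where "w = cis (2 * pi * real_of_int k / real m)"
  have "(\<Sum>u\<in>U. u powi k) = (\<Sum>j<m. w ^ j)"
    unfolding root_sum[symmetric]
    by (simp add: omega_power w_def cis_power_int Complex.DeMoivre mult_ac)
  moreover have wm: "w ^ m = 1"
    using m_pos cis_multiple_2pi[of "real_of_int k"] by (simp add: w_def Complex.DeMoivre mult_ac)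
  moreover have "w = 1 \<longleftrightarrow> int m dvd k"
  proof
    assume "w = 1"
    then have "cos (2 * pi * real_of_int k / real m) = 1"
      by (simp add: w_def complex_eq_iff)
    then obtain j :: int where "2 * pi * real_of_int k / real m = real_of_int j * (2 * pi)"
      unfolding cos_one_2pi_int by (auto simp: mult.assoc)
    then have "real_of_int k = real_of_int (j * int m)" using m_pos by (simp add: field_simps)
    then have "k = j * int m" by linarith
    then show "int m dvd k" by simp
  next
    assume "int m dvd k"
    then obtain j where "k = int m * j" by (auto elim: dvdE)
    then have "2 * pi * real_of_int k / real m = 2 * pi * real_of_int j" using m_pos by simp
    then show "w = 1" unfolding w_def by (simp only:) (simp add: cis_multiple_2pi)
  qed
  ultimately show ?thesis
    using geometric_sum[of w m] by auto
qed

lemma vrefl_unit: "u \<in> U \<Longrightarrow> vrefl l u (unit_vec e) = scale (u powi (sg e * int l)) (unit_vec (\<not> e))"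
  using root_nonzero[of u]
  by (simp add: unit_vec_def vrefl_vconst scale_vconst sg_def power_int_minus power_inverse)

lemma S_unit: "S k (unit_vec e) = (if int m dvd k + sg e * int l then scale (of_nat m) (unit_vec (\<not> e)) else 0)"
proof -
  have "S k (unit_vec e) = scale (\<Sum>u\<in>U. u powi (k + sg e * int l)) (unit_vec (\<not> e))"
    unfolding refl_sum_def vp.scale_sum_left
    by (intro sum.cong refl) (simp add: vrefl_unit scale_scale power_int_add root_nonzero)
  then show ?thesis by (simp add: root_power_sum vp.scale_zero_left)
qed

lemma S_mono_mz: "S k (vmono i 0 f) = vmono 0 i (S (k + int i) f)"
proof (induction i arbitrary: k)
  case (Suc i)
  have "S k (vmono (Suc i) 0 f) = mzb (S (k + 1) (vmono i 0 f))"
    by (simp only: vmono_simps(2)[symmetric] S_mz)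
  then show ?case by (simp add: Suc vmono_simps algebra_simps)
qed (simp add: vmono_simps)

lemma S_mono_mzb: "S k (vmono 0 i f) = vmono i 0 (S (k - int i) f)"
proof (induction i arbitrary: k)
  case (Suc i)
  have "S k (vmono 0 (Suc i) f) = mz (S (k - 1) (vmono 0 i f))"
    by (simp only: vmono_simps(3)[symmetric] S_mzb)
  then show ?case by (simp add: Suc vmono_simps algebra_simps)
qed (simp add: vmono_simps)

text \<open>Each factor z adds one sum over reflections. Orthogonality of the characters keeps only
  those i whose total exponent 1 + i \<plusminus> l is divisible by m, and then contributes the
  factor m.\<close>

lemma Db_mono_mz:
  "Db (vmono n 0 (unit_vec e)) = scale (- (k' * of_nat m))
     (\<Sum>i | i < n \<and> int m dvd 1 + int i + sg e * int l. vmono (n - Suc i) i (unit_vec (\<not> e)))"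
proof (induction n)
  case 0
  then show ?case by (simp add: vmono_simps vp.scale_zero_right unit_vec_def Db_const)
next
  case (Suc n)
  let ?P = "\<lambda>i. int m dvd 1 + int i + sg e * int l" and ?c = "scale (- (k' * of_nat m))"
  have "Db (vmono (Suc n) 0 (unit_vec e)) = mz (Db (vmono n 0 (unit_vec e))) - scale k' (S 1 (vmono n 0 (unit_vec e)))"
    by (simp only: vmono_simps(2)[symmetric] Db_mz)
  also have "mz (Db (vmono n 0 (unit_vec e))) = ?c (\<Sum>i | i < n \<and> ?P i. vmono (Suc n - Suc i) i (unit_vec (\<not> e)))"
    unfolding Suc lin_scale[OF lin_mz] lin_sum[OF lin_mz] vmono_simps(2)
    by (intro arg_cong[where f = ?c] sum.cong refl) (auto simp: Suc_diff_Suc)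
  also have "scale k' (S 1 (vmono n 0 (unit_vec e))) = - ?c (if ?P n then vmono 0 n (unit_vec (\<not> e)) else 0)"
    unfolding S_mono_mz S_unit
    by (simp add: lin_scale[OF lin_vmono] lin_zero[OF lin_vmono] scale_scale vp.scale_zero_right vp.scale_minus_left)
  also have "?c (\<Sum>i | i < n \<and> ?P i. vmono (Suc n - Suc i) i (unit_vec (\<not> e))) - - ?c (if ?P n then vmono 0 n (unit_vec (\<not> e)) else 0)
     = ?c ((\<Sum>i | i < n \<and> ?P i. vmono (Suc n - Suc i) i (unit_vec (\<not> e))) + (if ?P n then vmono 0 n (unit_vec (\<not> e)) else 0))"
    by (simp only: scale_add_right diff_minus_eq_add)
  also have "(\<Sum>i | i < n \<and> ?P i. vmono (Suc n - Suc i) i (unit_vec (\<not> e))) + (if ?P n then vmono 0 n (unit_vec (\<not> e)) else 0)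
     = (\<Sum>i | i < Suc n \<and> ?P i. vmono (Suc n - Suc i) i (unit_vec (\<not> e)))"
  proof -
    have fin: "finite {i. i < n \<and> ?P i}" by simp
    have eq: "{i. i < Suc n \<and> ?P i} = (if ?P n then insert n {i. i < n \<and> ?P i} else {i. i < n \<and> ?P i})"
      by (auto simp: less_Suc_eq)
    show ?thesis unfolding eq using fin by (simp add: add.commute)
  qed
  finally show ?case .
qed

lemma Db_mono_mzb:
  "Db (vmono 0 n (unit_vec e)) = scale (of_nat n) (vmono 0 (n - 1) (unit_vec e)) + scale (k' * of_nat m)
     (\<Sum>i | i < n \<and> int m dvd int i - sg e * int l. vmono i (n - Suc i) (unit_vec (\<not> e)))"
proof (induction n)
  case 0
  then show ?case by (simp add: vmono_simps vp.scale_zero_right vp.scale_zero_left unit_vec_def Db_const)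
next
  case (Suc n)
  let ?P = "\<lambda>i. int m dvd int i - sg e * int l" and ?c = "scale (k' * of_nat m)"
  have sgl: "int m dvd - int n + sg e * int l \<longleftrightarrow> ?P n"
    using dvd_minus_iff[of "int m" "int n - sg e * int l"] by (simp add: algebra_simps)
  have "Db (vmono 0 (Suc n) (unit_vec e))
      = mzb (Db (vmono 0 n (unit_vec e))) + vmono 0 n (unit_vec e) + scale k' (S 0 (vmono 0 n (unit_vec e)))"
    by (simp only: vmono_simps(3)[symmetric] Db_mzb)
  also have "mzb (Db (vmono 0 n (unit_vec e))) = scale (of_nat n) (vmono 0 n (unit_vec e))
      + ?c (\<Sum>i | i < n \<and> ?P i. vmono i (Suc n - Suc i) (unit_vec (\<not> e)))"
    unfolding Suc lin_add[OF lin_mzb] lin_scale[OF lin_mzb] lin_sum[OF lin_mzb] vmono_simps(3)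
    by (intro arg_cong[where f = ?c] arg_cong2[where f = "(+)"] sum.cong refl)
       (auto simp: Suc_diff_Suc vp.scale_zero_left intro: arg_cong2[where f = scale])
  also have "scale k' (S 0 (vmono 0 n (unit_vec e))) = ?c (if ?P n then vmono n 0 (unit_vec (\<not> e)) else 0)"
    unfolding S_mono_mzb S_unit diff_0 sgl
    by (simp add: lin_scale[OF lin_vmono] lin_zero[OF lin_vmono] scale_scale vp.scale_zero_right)
  also have "scale (of_nat n) (vmono 0 n (unit_vec e)) + ?c (\<Sum>i | i < n \<and> ?P i. vmono i (Suc n - Suc i) (unit_vec (\<not> e)))
      + vmono 0 n (unit_vec e) + ?c (if ?P n then vmono n 0 (unit_vec (\<not> e)) else 0)
     = (scale (of_nat n) (vmono 0 n (unit_vec e)) + scale 1 (vmono 0 n (unit_vec e)))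
       + ?c ((\<Sum>i | i < n \<and> ?P i. vmono i (Suc n - Suc i) (unit_vec (\<not> e))) + (if ?P n then vmono n 0 (unit_vec (\<not> e)) else 0))"
    by (simp only: scale_add_right scale_one add_ac)
  also have "(\<Sum>i | i < n \<and> ?P i. vmono i (Suc n - Suc i) (unit_vec (\<not> e))) + (if ?P n then vmono n 0 (unit_vec (\<not> e)) else 0)
     = (\<Sum>i | i < Suc n \<and> ?P i. vmono i (Suc n - Suc i) (unit_vec (\<not> e)))"
  proof -
    have fin: "finite {i. i < n \<and> ?P i}" by simp
    have eq: "{i. i < Suc n \<and> ?P i} = (if ?P n then insert n {i. i < n \<and> ?P i} else {i. i < n \<and> ?P i})"
      by (auto simp: less_Suc_eq)
    show ?thesis unfolding eq using fin by (simp add: add.commute)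
  qed
  finally show ?case unfolding scale_add_left[symmetric] by (simp add: add.commute)
qed

end

text \<open>\<open>M e e' x\<close> is the angular Fourier coefficient at \<open>x\<close> of the \<open>(e, e')\<close> entry of the weight in the basis \<open>t, tbar\<close>, and \<open>R\<close>
  collects its radial moments.\<close>

locale dihedral_form = dihedral_params +
  fixes B :: "vpoly \<Rightarrow> vpoly \<Rightarrow> complex" and M :: "bool \<Rightarrow> bool \<Rightarrow> int \<Rightarrow> real" and R :: "nat \<Rightarrow> real"
  assumes l: "0 < l" "l < m"
    and B_add_right: "B f (g + h) = B f g + B f h"
    and B_scale_right: "B f (scale c g) = c * B f g"
    and B_cnj: "B g f = cnj (B f g)"
    and B_mz: "B (mz f) g = B f (mzb g)"
    and B_mono: "B (unit_vec e) (vmono a b (unit_vec e')) = of_real (R (a + b) * M e e' (int a - int b))"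
    and R_0: "R 0 = 1" and R_Suc: "R (Suc (Suc n)) = (real n + 2) * R n"
    and M_neg: "M (\<not> e) (\<not> e') (- x) = M e e' x"
    and M_0: "M e e' 0 = (if e = e' then 2 else 0)"
    and M_zero: "\<not> int m dvd x + (if e = e' then 0 else - 2 * sg e * int l) \<Longrightarrow> M e e' x = 0"
    and M_rec: "0 \<le> k \<Longrightarrow> real_of_int k * M e e' k
       = - 2 * \<kappa> * real m * prog_sum m (\<lambda>x. M e (\<not> e') (- x)) k (k + 2 * sg e' * int l)"
begin

lemma B_add_left: "B (f + g) h = B f h + B g h"
  by (metis B_add_right B_cnj complex_cnj_add)

lemma B_scale_left: "B (scale c f) h = cnj c * B f h"
  by (metis B_scale_right B_cnj complex_cnj_mult)

lemma B_zero_right: "B f 0 = 0"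
  using B_scale_right[of f 0 0] by (simp add: vp.scale_zero_left)

lemma B_diff_right: "B f (g - h) = B f g - B f h"
  using B_add_right[of f "g - h" h] by simp

lemma B_diff_left: "B (f - g) h = B f h - B g h"
  using B_add_left[of "f - g" g h] by simp

lemma B_sum_right: "B f (sum g I) = (\<Sum>i\<in>I. B f (g i))"
  by (induction I rule: infinite_finite_induct) (simp_all add: B_zero_right B_add_right)

lemma B_sum_left: "B (sum g I) f = (\<Sum>i\<in>I. B (g i) f)"
  by (subst B_cnj) (simp add: B_sum_right B_cnj[symmetric])

lemma B_mzb: "B (mzb f) g = B f (mz g)"
  by (metis B_mz B_cnj)

lemma M_rec_minus: "0 \<le> k \<Longrightarrow> real_of_int k * M e e' (- k)
       = - 2 * \<kappa> * real m * prog_sum m (\<lambda>x. M e (\<not> e') x) k (k - 2 * sg e' * int l)"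
  using M_rec[of k "\<not> e" "\<not> e'"] M_neg[of e e' "- k"] M_neg[of e "\<not> e'"] by (simp add: sg_not)

text \<open>At k = 1 the recurrence sums over x = 0 alone, which the congruence modulo 2 m excludes
  by parity.\<close>

lemma M_one: "M e e' 1 = 0"
proof -
  have no: "\<not> 2 * int m dvd 1 + 2 * sg e' * int l"
  proof -
    have "odd (1 + 2 * sg e' * int l)" by simp
    then show ?thesis by (metis dvd_mult_left)
  qed
  have "\<not> (\<bar>x\<bar> < 1 \<and> 2 * int m dvd x + (1 + 2 * sg e' * int l))" for x
  proof
    assume x: "\<bar>x\<bar> < 1 \<and> 2 * int m dvd x + (1 + 2 * sg e' * int l)"
    then have "x = 0" by simp
    then show False using x no by simp
  qed
  then have "{x. \<bar>x\<bar> < 1 \<and> 2 * int m dvd x + (1 + 2 * sg e' * int l)} = {}" by blast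
  then have "prog_sum m (\<lambda>x. M e (\<not> e') (- x)) 1 (1 + 2 * sg e' * int l) = 0"
    unfolding prog_sum_def by (simp only: sum.empty)
  then show ?thesis using M_rec[of 1 e e'] by (simp only:) simp
qed

text \<open>The factor z zbar leaves the angular part unchanged and raises the radial moment from n
  to n + 2. The auxiliary claim carries a monomial prefix, since the induction peels the
  multiplications off f from outside.\<close>

lemma hom_radial:
  "hom n f \<Longrightarrow> B (unit_vec e) (mz (mzb f)) = (of_nat n + 2) * B (unit_vec e) f"
proof -
  have "hom n f \<Longrightarrow> B (unit_vec e) (mz (mzb (vmono a b f))) = (of_nat (a + b + n) + 2) * B (unit_vec e) (vmono a b f)" for a b
  proof (induction arbitrary: a b rule: hom.induct)
    case (hom_const x y)
    have "B (unit_vec e) (mz (mzb (vmono a b (unit_vec e')))) = (of_nat (a + b) + 2) * B (unit_vec e) (vmono a b (unit_vec e'))" for e'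
      by (simp add: vmono_simps B_mono R_Suc)
    then show ?case
      by (simp add: vconst_unit lin_add[OF lin_vmono] lin_scale[OF lin_vmono] lin_add[OF lin_mz] lin_scale[OF lin_mz]
        lin_add[OF lin_mzb] lin_scale[OF lin_mzb] B_add_right B_scale_right algebra_simps)
  next
    case (hom_mz n f)
    show ?case using hom_mz(2)[of "Suc a" b] by (simp only: vmono_simps(4)) simp
  next
    case (hom_mzb n f)
    show ?case using hom_mzb(2)[of a "Suc b"] by (simp only: vmono_simps(5)) simp
  next
    case (hom_add n f g)
    then show ?case
      by (simp add: lin_add[OF lin_vmono] lin_add[OF lin_mz] lin_add[OF lin_mzb] B_add_right algebra_simps)
  qed (simp add: lin_zero[OF lin_vmono] lin_zero[OF lin_mz] lin_zero[OF lin_mzb] B_zero_right)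
  from this[of 0 0] show "hom n f \<Longrightarrow> ?thesis" by (simp add: vmono_simps)
qed

lemma prog_sum_mz:
  "(\<Sum>i | i < n \<and> int m dvd 1 + int i + s * int l. h (int (n - Suc i) - int i))
    = prog_sum m (\<lambda>x. h (- x)) (int n + 1) (int n + 1 + 2 * s * int l)"
  unfolding prog_sum_def
\<comment> \<open>The new index x is minus the exponent difference n - 1 - 2 i; doubling i turns
  divisibility by m into divisibility by 2 m.\<close>
proof (rule sum.reindex_bij_witness[of _ "\<lambda>x. nat ((x + int n - 1) div 2)" "\<lambda>i. 2 * int i + 1 - int n"])
  fix i assume i: "i \<in> {i. i < n \<and> int m dvd 1 + int i + s * int l}"
  have "2 * int i + 1 - int n + (int n + 1 + 2 * s * int l) = 2 * (1 + int i + s * int l)" by simp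
  then have "2 * int m dvd 2 * int i + 1 - int n + (int n + 1 + 2 * s * int l)"
    using i by (simp only:) (intro mult_dvd_mono, simp_all)
  then show "2 * int i + 1 - int n \<in> {x. \<bar>x\<bar> < int n + 1 \<and> 2 * int m dvd x + (int n + 1 + 2 * s * int l)}"
    by (intro CollectI conjI) (use i in \<open>auto simp: abs_le_iff\<close>)
  show "nat ((2 * int i + 1 - int n + int n - 1) div 2) = i" by simp
  show "h (- (2 * int i + 1 - int n)) = h (int (n - Suc i) - int i)"
    using i by (intro arg_cong[where f = h]) auto
next
  fix x assume x: "x \<in> {x. \<bar>x\<bar> < int n + 1 \<and> 2 * int m dvd x + (int n + 1 + 2 * s * int l)}"
  then have "even (x + (int n + 1 + 2 * s * int l))" using dvd_mult_left[of 2 "int m"] by blast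
  then have "even (x + int n - 1)" by simp
  then obtain y where y: "x + int n - 1 = 2 * y" by (rule evenE)
  have y': "0 \<le> y" "y < int n" using x y by auto
  have "x + (int n + 1 + 2 * s * int l) = 2 * (1 + y + s * int l)" using y by simp
  then have "2 * int m dvd 2 * (1 + y + s * int l)" using x by (simp only: mem_Collect_eq)
  then have "int m dvd 1 + y + s * int l" unfolding dvd_mult_cancel_left by simp
  then show "nat ((x + int n - 1) div 2) \<in> {i. i < n \<and> int m dvd 1 + int i + s * int l}"
    using y' unfolding y by (simp add: nat_less_iff)
  show "2 * int (nat ((x + int n - 1) div 2)) + 1 - int n = x"
    using y y' by simp
qed

text \<open>The exponent differences fill the closed interval from - n to n, whereas the recurrence
  for \<open>M\<close> sums over the open one; the assumption disposes of the two end terms.\<close>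

lemma prog_sum_mzb:
  assumes "\<And>x. \<bar>x\<bar> = int n \<Longrightarrow> 2 * int m dvd x + (int n - 2 * s * int l) \<Longrightarrow> h x = 0"
  shows "(\<Sum>i | i < Suc n \<and> int m dvd int i - s * int l. h (int i - int (Suc n - Suc i)))
    = prog_sum m h (int n) (int n - 2 * s * int l)"
proof -
  have "(\<Sum>i | i < Suc n \<and> int m dvd int i - s * int l. h (int i - int (Suc n - Suc i)))
     = (\<Sum>x | \<bar>x\<bar> \<le> int n \<and> 2 * int m dvd x + (int n - 2 * s * int l). h x)"
  proof (rule sum.reindex_bij_witness[of _ "\<lambda>x. nat ((x + int n) div 2)" "\<lambda>i. 2 * int i - int n"])
    fix i assume i: "i \<in> {i. i < Suc n \<and> int m dvd int i - s * int l}"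
    have "2 * int i - int n + (int n - 2 * s * int l) = 2 * (int i - s * int l)" by simp
    then have "2 * int m dvd 2 * int i - int n + (int n - 2 * s * int l)"
      using i by (simp only:) (intro mult_dvd_mono, simp_all)
    then show "2 * int i - int n \<in> {x. \<bar>x\<bar> \<le> int n \<and> 2 * int m dvd x + (int n - 2 * s * int l)}"
      by (intro CollectI conjI) (use i in \<open>auto simp: abs_le_iff\<close>)
    show "nat ((2 * int i - int n + int n) div 2) = i" by simp
    show "h (2 * int i - int n) = h (int i - int (Suc n - Suc i))"
      using i by (intro arg_cong[where f = h]) auto
  next
    fix x assume x: "x \<in> {x. \<bar>x\<bar> \<le> int n \<and> 2 * int m dvd x + (int n - 2 * s * int l)}"
    then have "even (x + (int n - 2 * s * int l))" using dvd_mult_left[of 2 "int m"] by blast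
    then have "even (x + int n)" by simp
    then obtain y where y: "x + int n = 2 * y" by (rule evenE)
    have y': "0 \<le> y" "y < int (Suc n)" using x y by auto
    have "x + (int n - 2 * s * int l) = 2 * (y - s * int l)" using y by simp
    then have "2 * int m dvd 2 * (y - s * int l)" using x by (simp only: mem_Collect_eq)
    then have "int m dvd y - s * int l" unfolding dvd_mult_cancel_left by simp
    then show "nat ((x + int n) div 2) \<in> {i. i < Suc n \<and> int m dvd int i - s * int l}"
      using y' unfolding y by (simp add: nat_less_iff)
    show "2 * int (nat ((x + int n) div 2)) - int n = x" using y y' by simp
  qed
  also have "\<dots> = prog_sum m h (int n) (int n - 2 * s * int l)"
    unfolding prog_sum_def
  proof (rule sum.mono_neutral_right)
    show "finite {x. \<bar>x\<bar> \<le> int n \<and> 2 * int m dvd x + (int n - 2 * s * int l)}"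
      by (rule finite_subset[of _ "{- int n..int n}"]) auto
  qed (use assms in \<open>auto simp: order_le_less\<close>)
  finally show ?thesis .
qed

lemma not_dvd_l: "\<not> int m dvd sg e * int l"
  using l by (auto simp: sg_def zdvd_not_zless)

text \<open>This is \<open>M_rec\<close> at k = n + 1; the factor k is absorbed by R (n + 1) = (n +
  1) R (n - 1).\<close>

lemma adjoint_mz:
  "B (unit_vec e) (scale 2 (Db (vmono n 0 (unit_vec e')))) = B (unit_vec e) (mz (vmono n 0 (unit_vec e')))"
proof -
  have L: "B (unit_vec e) (scale 2 (Db (vmono n 0 (unit_vec e'))))
      = of_real (- 2 * \<kappa> * real m * (R (n - 1)
        * prog_sum m (\<lambda>x. M e (\<not> e') (- x)) (int n + 1) (int n + 1 + 2 * sg e' * int l)))"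
    unfolding prog_sum_mz[symmetric] Db_mono_mz B_scale_right B_sum_right B_mono
    by (simp add: sum_distrib_left mult_ac)
  have Rr: "B (unit_vec e) (mz (vmono n 0 (unit_vec e'))) = of_real (R (n + 1) * M e e' (int n + 1))"
    by (simp add: vmono_simps B_mono add.commute)
  show ?thesis
  \<comment> \<open>For n = 0 the index n - 1 is truncated. There the sum on the left is empty and
    the right side vanishes by \<open>M_one\<close>.\<close>
  proof (cases n)
    case 0
    then show ?thesis unfolding Rr unfolding Db_mono_mz by (simp add: M_one B_scale_right B_zero_right vp.scale_zero_right)
  next
    case (Suc k)
    let ?p = "prog_sum m (\<lambda>x. M e (\<not> e') (- x)) (int n + 1) (int n + 1 + 2 * sg e' * int l)"
    have e: "real_of_int (int n + 1) * M e e' (int n + 1) = - 2 * \<kappa> * real m * ?p"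
      by (rule M_rec) simp
    have "- 2 * \<kappa> * real m * (R (n - 1) * ?p) = R (n - 1) * (- 2 * \<kappa> * real m * ?p)" by simp
    also have "\<dots> = R (n - 1) * (real_of_int (int n + 1) * M e e' (int n + 1))" by (simp only: e)
    also have "\<dots> = R (n + 1) * M e e' (int n + 1)" using Suc by (simp add: R_Suc)
    finally show ?thesis unfolding L Rr by (simp only:)
  qed
qed

text \<open>The ordinary derivative contributes 2 (n + 1), and the recurrence at k = n turns the
  reflection terms into - n. The remaining n + 2 is the quotient of the radial moments n + 2 and
  n.\<close>

lemma adjoint_mzb:
  "B (unit_vec e) (scale 2 (Db (vmono 0 (Suc n) (unit_vec e')))) = B (unit_vec e) (mz (vmono 0 (Suc n) (unit_vec e')))"
proof -
  \<comment> \<open>At x = n the congruence and the support of \<open>M\<close> together would make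
    l divisible by m; at x = - n the congruence alone does.\<close>
  have end0: "M e (\<not> e') x = 0" if x: "\<bar>x\<bar> = int n" "2 * int m dvd x + (int n - 2 * sg e' * int l)" for x
  proof -
    consider "x = int n" | "x = - int n" using x(1) by linarith
    then show ?thesis
    proof cases
      case 1
      then have "2 * int m dvd 2 * (int n - sg e' * int l)" using x(2) by (simp add: algebra_simps)
      then have d: "int m dvd int n - sg e' * int l" unfolding dvd_mult_cancel_left by simp
      have "\<not> int m dvd int n + (if e = (\<not> e') then 0 else - 2 * sg e * int l)"
      proof
        assume "int m dvd int n + (if e = (\<not> e') then 0 else - 2 * sg e * int l)"
        from dvd_diff[OF d this] show False
          using not_dvd_l[of e] not_dvd_l[of e'] dvd_minus_iff[of "int m" "sg e' * int l"]
          by (auto split: if_splits simp: mult.commute)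
      qed
      then show ?thesis using M_zero 1 by blast
    next
      case 2
      then have "2 * int m dvd 2 * (- sg e' * int l)" using x(2) by (simp add: algebra_simps)
      then show ?thesis using not_dvd_l[of e'] unfolding dvd_mult_cancel_left by simp
    qed
  qed
  let ?p = "prog_sum m (M e (\<not> e')) (int n) (int n - 2 * sg e' * int l)"
  have ps: "(\<Sum>i | i < Suc n \<and> int m dvd int i - sg e' * int l. M e (\<not> e') (int i - int (Suc n - Suc i))) = ?p"
    by (rule prog_sum_mzb) (rule end0)
  have "B (unit_vec e) (scale 2 (Db (vmono 0 (Suc n) (unit_vec e'))))
      = of_real (2 * real (Suc n) * (R n * M e e' (- int n)) + 2 * \<kappa> * real m * (R n
        * (\<Sum>i | i < Suc n \<and> int m dvd int i - sg e' * int l. M e (\<not> e') (int i - int (Suc n - Suc i)))))"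
    unfolding Db_mono_mzb B_add_right B_scale_right B_sum_right B_mono
    by (simp add: sum_distrib_left mult_ac distrib_left distrib_right)
  also note ps
  also have "2 * \<kappa> * real m * (R n * prog_sum m (M e (\<not> e')) (int n) (int n - 2 * sg e' * int l))
      = - (R n * (real n * M e e' (- int n)))"
    using M_rec_minus[of "int n" e e'] by (simp add: mult_ac)
  also have "2 * real (Suc n) * (R n * M e e' (- int n)) + - (R n * (real n * M e e' (- int n)))
      = R (1 + Suc n) * M e e' (- int n)"
    by (simp add: R_Suc algebra_simps)
  finally show ?thesis by (simp add: vmono_simps B_mono)
qed

text \<open>A monomial that is no pure power has the form z zbar h with h of degree n = a + b. Then
  2 B(e, Db (z zbar h)) is (n + 1) 2 B(e, Db h) + 2 B(e, z h), which by induction equals (n + 3)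
  B(e, z h), the value required.\<close>

lemma adjoint_vmono:
  "B (unit_vec e) (scale 2 (Db (vmono a b (unit_vec e')))) = B (unit_vec e) (mz (vmono a b (unit_vec e')))"
proof (induction b arbitrary: a)
  case 0
  show ?case by (rule adjoint_mz)
next
  case (Suc b a')
  show ?case
  proof (cases a')
    case 0
    then show ?thesis by (simp only: adjoint_mzb)
  next
    case (Suc a)
    define h where "h = vmono a b (unit_vec e')"
    have eq: "vmono a' (Suc b) (unit_vec e') = mz (mzb h)" by (simp only: h_def vmono_simps Suc)
    have h: "hom (a + b) h"
      using hom_mono[of 0 "unit_vec e'" a b] by (simp add: h_def unit_vec_def hom_const)
    have IH: "2 * B (unit_vec e) (Db h) = B (unit_vec e) (mz h)"
      using Suc.IH[of a] by (simp add: h_def B_scale_right)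
    have 1: "B (unit_vec e) (mz (mzb (Db h))) = (of_nat (a + b) + 1) * B (unit_vec e) (Db h)"
    proof (cases "a + b")
      case 0
      then show ?thesis using hom_Db[OF h] by (simp add: lin_zero[OF lin_mz] lin_zero[OF lin_mzb] B_zero_right)
    next
      case (Suc k)
      then have "hom k (Db h)" using hom_Db[OF h] by simp
      from hom_radial[OF this, of e] show ?thesis unfolding Suc by (simp add: add.commute)
    qed
    have 2: "B (unit_vec e) (mz (mz (mzb h))) = (of_nat (a + b) + 3) * B (unit_vec e) (mz h)"
      using hom_radial[OF hom_mz[OF h], of e] by (simp add: mz_mzb add.commute)
    show ?thesis unfolding eq Db_mz_mzb B_scale_right B_add_right 1 2
      using IH by (simp add: algebra_simps)
  qed
qed

lemma adjoint_const: "2 * B (vconst x y) (Db g) = B (vconst x y) (mz g)"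
proof -
  have "2 * B (unit_vec e) (Db g) = B (unit_vec e) (mz g)" for e
  proof (induction g rule: vpoly_vmono_induct)
    case (1 a b x e')
    show ?case using adjoint_vmono[of e a b e']
      by (simp add: lin_scale[OF lin_Db] lin_scale[OF lin_mz] B_scale_right)
  next
    case (2 f g)
    then show ?case by (simp add: lin_add[OF lin_Db] lin_add[OF lin_mz] B_add_right distrib_left)
  qed
  from this[of True] this[of False] show ?thesis
    by (simp add: vconst_unit B_add_left B_scale_left algebra_simps)
qed

section \<open>Symmetry of the form under reflections\<close>

lemma root_powi_eq_1: "u \<in> U \<Longrightarrow> int m dvd k \<Longrightarrow> u powi k = 1"
  by (auto simp: unity_roots_def power_int_mult elim!: dvdE)

lemma root_cnj: "u \<in> U \<Longrightarrow> cnj u = inverse u"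
proof -
  assume u: "u \<in> U"
  then have "cmod u ^ m = 1" by (simp add: unity_roots_def norm_power[symmetric])
  then have "cmod u = 1" using m_pos power_eq_imp_eq_base[of "cmod u" m 1] by simp
  then have "u * cnj u = 1" by (simp add: complex_norm_square[symmetric])
  then show ?thesis using inverse_unique by metis
qed

lemma vrefl_vmono: "u \<in> U \<Longrightarrow> vrefl l u (vmono a b f) = scale (u powi (int a - int b)) (vmono b a (vrefl l u f))"
proof -
  assume u: "u \<in> U"
  have 1: "vrefl l u ((mzb ^^ b) f) = scale (inverse u ^ b) ((mz ^^ b) (vrefl l u f))"
    by (induction b) (simp_all add: vrefl_mzb scale_one lin_scale[OF lin_mz] scale_scale mult_ac)
  have "vrefl l u ((mz ^^ a) g) = scale (u ^ a) ((mzb ^^ a) (vrefl l u g))" for g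
    by (induction a) (simp_all add: vrefl_mz scale_one lin_scale[OF lin_mzb] scale_scale mult_ac)
  moreover have "(mzb ^^ a) ((mz ^^ b) g) = (mz ^^ b) ((mzb ^^ a) g)" for g
    by (induction a) (simp_all add: mz_funpow_mzb)
  ultimately show ?thesis
    by (simp add: vmono_def 1 lin_scale[OF lin_funpow[OF lin_mzb]] scale_scale power_int_diff root_nonzero u
        power_inverse divide_inverse mult_ac)
qed

text \<open>Both sides contain the same moment, with phases whose quotient is a power of u. By
  \<open>M_zero\<close> the moment vanishes unless that exponent is divisible by m, and then the
  phases agree.\<close>

lemma B_vrefl_unit:
  assumes u: "u \<in> U"
  shows "B (vrefl l u (unit_vec e)) (vmono a b (unit_vec e')) = B (unit_vec e) (vrefl l u (vmono a b (unit_vec e')))"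
proof -
  let ?x = "int a - int b"
  have u0: "u \<noteq> 0" using root_nonzero[OF u] .
  have L: "B (vrefl l u (unit_vec e)) (vmono a b (unit_vec e')) = u powi (- sg e * int l) * of_real (R (a + b) * M (\<not> e) e' ?x)"
    by (simp add: vrefl_unit[OF u] B_scale_left B_mono root_cnj[OF u] power_int_minus power_int_inverse)
  have R: "B (unit_vec e) (vrefl l u (vmono a b (unit_vec e'))) = u powi (?x + sg e' * int l) * of_real (R (a + b) * M (\<not> e) e' ?x)"
    using M_neg[of "\<not> e" e' ?x]
    by (simp add: vrefl_vmono[OF u] vrefl_unit[OF u] lin_scale[OF lin_vmono] scale_scale B_scale_right B_mono
        power_int_add u0 add.commute)
  show ?thesis
  proof (cases "int m dvd ?x + sg e' * int l + sg e * int l")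
    case True
    then have "u powi (sg e * int l + (?x + sg e' * int l)) = 1"
      by (intro root_powi_eq_1[OF u]) (simp add: algebra_simps)
    then have "u powi (sg e * int l) * u powi (?x + sg e' * int l) = 1"
      using power_int_add[of u "sg e * int l" "?x + sg e' * int l"] u0 by simp
    from inverse_unique[OF this] have "u powi (?x + sg e' * int l) = u powi (- sg e * int l)"
      by (simp add: power_int_minus)
    then show ?thesis unfolding L R by simp
  next
    case False
    then have "M (\<not> e) e' ?x = 0"
      by (intro M_zero) (cases e; cases e'; simp add: sg_def algebra_simps)
    then show ?thesis unfolding L R by simp
  qed
qed

lemma B_vrefl:
  assumes u: "u \<in> U"
  shows "B (vrefl l u f) g = B f (vrefl l u g)"
proof (induction f arbitrary: g rule: vpoly_induct)
  case (const x y)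
  have "B (vrefl l u (unit_vec e)) g = B (unit_vec e) (vrefl l u g)" for e
  proof (induction g rule: vpoly_vmono_induct)
    case (1 a b x e')
    show ?case by (simp add: lin_scale[OF lin_vrefl] B_scale_right B_vrefl_unit[OF u])
  next
    case (2 f g)
    then show ?case by (simp add: lin_add[OF lin_vrefl] B_add_right)
  qed
  then show ?case
    by (simp add: vconst_unit lin_add[OF lin_vrefl] lin_scale[OF lin_vrefl] B_add_left B_scale_left)
next
  case (mz f)
  have "B (vrefl l u (mz f)) g = inverse u * B f (vrefl l u (mz g))"
    by (simp add: vrefl_mz B_scale_left B_mzb mz root_cnj[OF u])
  then show ?case using root_nonzero[OF u] by (simp add: vrefl_mz B_scale_right B_mz)
next
  case (mzb f)
  have "B (vrefl l u (mzb f)) g = u * B f (vrefl l u (mzb g))"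
    using arg_cong[OF root_cnj[OF u], of inverse] by (simp add: vrefl_mzb B_scale_left B_mz mzb)
  then show ?case using root_nonzero[OF u] by (simp add: vrefl_mzb B_scale_right B_mzb)
next
  case (add f1 f2)
  then show ?case by (simp add: lin_add[OF lin_vrefl] B_add_left)
qed

lemma B_S: "B (S k f) g = B f (S (- k) g)"
  unfolding refl_sum_def B_sum_left B_sum_right B_scale_left B_scale_right
  by (intro sum.cong refl) (simp add: B_vrefl root_cnj power_int_minus power_int_inverse)

text \<open>Passing from f to z f, or to zbar f, moves the multiplication to g. The reflection sums
  in the commutators of D on the left and of Db on the right are matched by \<open>B_S\<close>, so
  the claim for z f at g is the claim for f at zbar g.\<close>

lemma adjoint_D: "2 * (B (D f) g + B f (Db g)) = B f (mz g)"
proof (induction f arbitrary: g rule: vpoly_induct)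
  case (const x y)
  show ?case using adjoint_const[of x y g] B_scale_left[of 0 0 g] by (simp add: D_const vp.scale_zero_left)
next
  case (mz f)
  have "B (D (mz f)) g + B (mz f) (Db g) = B (D f) (mzb g) + B f (Db (mzb g))"
    by (simp add: D_mz Db_mzb B_add_left B_add_right B_scale_left B_scale_right B_mz B_S)
  then show ?case using mz[of "mzb g"] by (simp add: B_mz mz_mzb)
next
  case (mzb f)
  have "B (D (mzb f)) g + B (mzb f) (Db g) = B (D f) (mz g) + B f (Db (mz g))"
    using B_add_left[of "D (mzb f)" "scale k' (S (- 1) f)" g]
    by (simp add: D_mzb Db_mz B_diff_right B_scale_left B_scale_right B_mzb B_S)
  then show ?case using mzb[of "mz g"] by (simp add: B_mzb)
next
  case (add f1 f2)
  show ?case using add(1)[of g, symmetric] add(2)[of g, symmetric]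
    by (simp add: lin_add[OF lin_D] B_add_left algebra_simps)
qed

lemma adjoint_Db: "2 * (B (Db f) g + B f (D g)) = B f (mzb g)"
proof -
  have "cnj (2 * (B (D g) f + B g (Db f))) = cnj (B g (mz f))" by (simp only: adjoint_D)
  then have "2 * (B f (D g) + B (Db f) g) = B (mz f) g"
    by (simp only: complex_cnj_mult complex_cnj_add B_cnj[symmetric] complex_cnj_numeral)
  then show ?thesis by (simp add: B_mz add.commute)
qed

abbreviation "E \<equiv> exp\<Delta> (- (1 / 2))"

text \<open>The operator \<open>E\<close> turns z into z - 2 Db, whose adjoint for \<open>B\<close>
  is 2 D by \<open>adjoint_Db\<close>; this is the rule that defines the form on z F. For constants
  on the left, both sides vanish on multiples of z and zbar and agree on constants.\<close>

lemma form_eq_B: "frm F G = B (E F) (E G)"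
proof (induction F arbitrary: G rule: vpoly_induct)
  case (const a b)
  show ?case
  proof (induction G rule: vpoly_induct)
    case (const c d)
    have "B (unit_vec e) (unit_vec e') = (if e = e' then 2 else 0)" for e e'
      using B_mono[of e 0 0 e'] by (simp add: vmono_simps R_0 M_0)
    then have "B (vconst a b) (vconst c d) = 2 * (cnj a * c + cnj b * d)"
      by (simp add: vconst_unit B_add_left B_add_right B_scale_left B_scale_right)
    then show ?case unfolding form_const exp\<Delta>_const by (simp add: vconst_def eval_bipoly_def)
  next
    case (mz G)
    have "B (vconst a b) (E (mz G)) = 0"
      using adjoint_const[of a b "E G"] by (simp add: exp\<Delta>_mz B_diff_right B_add_right B_scale_right)
    then show ?case unfolding form_const exp\<Delta>_const by (simp add: mz_def eval_bipoly_def)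
  next
    case (mzb G)
    have "B (vconst a b) (E (mzb G)) = 0"
      using adjoint_Db[of "vconst a b" "E G"] B_scale_left[of 0 0 "E G"]
      by (simp add: exp\<Delta>_mzb B_diff_right B_add_right B_scale_right Db_const vp.scale_zero_left)
    then show ?case unfolding form_const exp\<Delta>_const
      unfolding mzb_def fst_conv snd_conv eval_bipoly_mult eval_bipoly_Zb by simp
  next
    case (add f g)
    show ?case unfolding form_const exp\<Delta>_const
      by (simp add: lin_add[OF lin_exp\<Delta>] B_add_right eval_bipoly_add
          add[unfolded form_const exp\<Delta>_const, symmetric] algebra_simps)
  qed
next
  case (mz F)
  show ?case using adjoint_Db[of "E F" "E G"]
    by (simp add: form_mz mz exp\<Delta>_mz lin_scale[OF lin_exp\<Delta>] exp\<Delta>_D B_scale_right B_add_left B_diff_left B_scale_left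
        B_mz algebra_simps)
next
  case (mzb F)
  show ?case using adjoint_D[of "E F" "E G"]
    by (simp add: form_mzb mzb exp\<Delta>_mzb lin_scale[OF lin_exp\<Delta>] exp\<Delta>_Db B_scale_right B_add_left B_diff_left B_scale_left
        B_mzb algebra_simps)
next
  case (add f g)
  then show ?case by (simp add: form_add lin_add[OF lin_exp\<Delta>] B_add_left)
qed

theorem gauss_form_eq_B: "gauss_form m l \<kappa> f g = B f g"
  unfolding gauss_form_def exp_half_laplacian_eq form_eq_B exp\<Delta>_inverse ..

end

section \<open>Gauss's summation of the hypergeometric series\<close>

definition hcoef :: "real \<Rightarrow> real \<Rightarrow> nat \<Rightarrow> real" where
  "hcoef c d n = pochhammer d n * pochhammer (- d) n / (pochhammer c n * fact n)"

definition hfps :: "real \<Rightarrow> real \<Rightarrow> real fps" where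
  "hfps c d = fps_hypergeo [d, - d] [c] 1"

lemma hfps_nth: "fps_nth (hfps c d) n = hcoef c d n"
  by (simp add: hfps_def hcoef_def)

lemma hcoef_0: "hcoef c d 0 = 1"
  by (simp add: hcoef_def)

lemma hcoef_Suc:
  assumes "0 < c"
  shows "hcoef c d (Suc n) = hcoef c d n * ((real n)\<^sup>2 - d\<^sup>2) / ((c + real n) * (real n + 1))"
  using assms by (simp add: hcoef_def pochhammer_Suc field_simps power2_eq_square)

lemma hcoef_Suc':
  assumes "0 < c"
  shows "hcoef c d (Suc n) * ((c + real n) * (real n + 1)) = hcoef c d n * ((real n)\<^sup>2 - d\<^sup>2)"
  using assms by (simp add: hcoef_Suc)

text \<open>The ratio of successive coefficients has the sign of n^2 - d^2, which is negative only
  at n = 0. All coefficients after the first therefore have one sign, which makes summability and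
  monotonicity accessible by telescoping.\<close>

lemma hcoef_neg:
  assumes "0 < c" "0 < d" "d < 1"
  shows "hcoef c d (Suc n) < 0"
proof (induction n)
  case 0
  then show ?case using assms by (simp add: hcoef_Suc hcoef_0 divide_neg_pos)
next
  case (Suc n)
  have "d\<^sup>2 < 1" using assms by (simp add: abs_square_less_1)
  moreover have "1 \<le> (real (Suc n))\<^sup>2" by simp
  ultimately have "(real (Suc n))\<^sup>2 - d\<^sup>2 > 0" by linarith
  then show ?case unfolding hcoef_Suc[OF assms(1), of d "Suc n"]
    using Suc assms by (intro divide_neg_pos mult_neg_pos mult_pos_pos) auto
qed

locale hyp_series =
  fixes c d :: real
  assumes c: "0 < c" and d: "0 < d" "d < 1"
begin

abbreviation "u \<equiv> hcoef c d"

lemma abs_u: "\<bar>u (Suc n)\<bar> = - u (Suc n)"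
  using hcoef_neg[OF c d, of n] by simp

text \<open>The bound is uniform in d and so serves as a majorant when d varies.\<close>

lemma u_le_one: "\<bar>u n\<bar> \<le> 1 + 1 / c"
proof (cases n)
  case 0
  then show ?thesis using c by (simp add: hcoef_0)
next
  case (Suc k)
  have "\<bar>u (Suc k)\<bar> \<le> 1 / c" for k
  proof (induction k)
    case 0
    have "d\<^sup>2 \<le> 1" using d by (simp add: power_le_one)
    then show ?case using c by (simp add: hcoef_Suc hcoef_0 divide_right_mono)
  next
    case (Suc k)
    let ?n = "real (Suc k)"
    have "d\<^sup>2 \<le> 1" using d by (simp add: power_le_one)
    moreover have "1 \<le> ?n\<^sup>2" by simp
    ultimately have b: "0 \<le> ?n\<^sup>2 - d\<^sup>2" by linarith
    have "?n\<^sup>2 - d\<^sup>2 \<le> (c + ?n) * (?n + 1)" using c by (simp add: power2_eq_square algebra_simps)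
    then have r: "\<bar>(?n\<^sup>2 - d\<^sup>2) / ((c + ?n) * (?n + 1))\<bar> \<le> 1" using b c by (simp add: abs_divide divide_le_eq_1)
    have "\<bar>u (Suc (Suc k))\<bar> = \<bar>u (Suc k)\<bar> * \<bar>(?n\<^sup>2 - d\<^sup>2) / ((c + ?n) * (?n + 1))\<bar>"
      unfolding hcoef_Suc[OF c, of d "Suc k"] by (simp add: abs_mult abs_divide)
    also have "\<dots> \<le> \<bar>u (Suc k)\<bar> * 1" by (intro mult_left_mono r) auto
    finally show ?case using Suc by simp
  qed
  then show ?thesis using Suc by (simp add: add_increasing)
qed

text \<open>A multiple of the coefficient as an exact difference. It yields absolute summability at
  the point 1 and, after summation, the relation between the parameters c and c + 1.\<close>

lemma telescope: "c * u n * (c * real n + d\<^sup>2) / (c + real n)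
    = (- c * real (Suc n) * u (Suc n)) - (- c * real n * u n)"
  unfolding hcoef_Suc[OF c] using c by (simp add: divide_simps power2_eq_square) (simp add: algebra_simps)

text \<open>The constant is the reciprocal of c / (c + 1), a lower bound of (c n + d^2) / (c + n)
  for n \<ge> 1 that is uniform in d.\<close>

lemma u_le_difference:
  "\<bar>u (Suc n)\<bar> \<le> (c + 1) / c * (real (Suc n) * \<bar>u (Suc n)\<bar> - real (Suc (Suc n)) * \<bar>u (Suc (Suc n))\<bar>)"
proof -
  let ?n = "real (Suc n)"
  have "c / (c + 1) \<le> (c * ?n + d\<^sup>2) / (c + ?n)"
  proof -
    have "c * (c + ?n) \<le> (c * ?n + d\<^sup>2) * (c + 1)"
    proof -
      have "(c * ?n + d\<^sup>2) * (c + 1) - c * (c + ?n) = c * c * (?n - 1) + d\<^sup>2 * (c + 1)"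
        by (simp add: algebra_simps)
      moreover have "0 \<le> c * c * (?n - 1)" by simp
      moreover have "0 \<le> d\<^sup>2 * (c + 1)" using c by simp
      ultimately show ?thesis by linarith
    qed
    then show ?thesis using c by (simp add: divide_simps mult.commute)
  qed
  then have "\<bar>u (Suc n)\<bar> * (c / (c + 1)) \<le> \<bar>u (Suc n)\<bar> * ((c * ?n + d\<^sup>2) / (c + ?n))"
    by (intro mult_left_mono) auto
  also have "\<dots> = ?n * \<bar>u (Suc n)\<bar> - real (Suc (Suc n)) * \<bar>u (Suc (Suc n))\<bar>"
  proof -
    have "c * (u (Suc n) * ((c * ?n + d\<^sup>2) / (c + ?n))) = c * (?n * u (Suc n) - real (Suc (Suc n)) * u (Suc (Suc n)))"
      using telescope[of "Suc n"] by (simp add: algebra_simps)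
    then have "u (Suc n) * ((c * ?n + d\<^sup>2) / (c + ?n)) = ?n * u (Suc n) - real (Suc (Suc n)) * u (Suc (Suc n))"
      by (rule mult_left_cancel[THEN iffD1, rotated]) (use c in simp)
    then show ?thesis by (simp add: abs_u)
  qed
  finally show ?thesis using c by (simp add: field_simps)
qed

lemma summable_abs_u: "summable (\<lambda>n. \<bar>u n\<bar>)"
proof -
  have "(\<Sum>n<N. \<bar>u (Suc n)\<bar>) \<le> (c + 1) / c * (1 * \<bar>u 1\<bar> - real (Suc N) * \<bar>u (Suc N)\<bar>)" for N
  proof (induction N)
    case (Suc N)
    have "(\<Sum>n<Suc N. \<bar>u (Suc n)\<bar>) \<le> (c + 1) / c * (1 * \<bar>u 1\<bar> - real (Suc N) * \<bar>u (Suc N)\<bar>)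
        + (c + 1) / c * (real (Suc N) * \<bar>u (Suc N)\<bar> - real (Suc (Suc N)) * \<bar>u (Suc (Suc N))\<bar>)"
      using Suc u_le_difference[of N] by simp
    then show ?case by (simp only: distrib_left[symmetric]) simp
  qed simp
  moreover have "(c + 1) / c * (1 * \<bar>u 1\<bar> - real (Suc N) * \<bar>u (Suc N)\<bar>) \<le> (c + 1) / c * \<bar>u 1\<bar>" for N
    using c by (intro mult_left_mono) auto
  ultimately have "(\<Sum>n<N. \<bar>u (Suc n)\<bar>) \<le> (c + 1) / c * \<bar>u 1\<bar>" for N
    by (meson order_trans)
  then have "summable (\<lambda>n. \<bar>u (Suc n)\<bar>)"
    by (intro summableI_nonneg_bounded) auto
  then show ?thesis using summable_Suc_iff[of "\<lambda>n. \<bar>u n\<bar>"] by (rule iffD1[rotated])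
qed

lemma summable_u: "summable u"
  using summable_abs_u by (rule summable_rabs_cancel)

text \<open>By \<open>u_le_difference\<close> the sequence n |u n| decreases; a positive limit would
  make the summable series of |u n| dominate a harmonic series.\<close>

lemma nu_tendsto_0: "(\<lambda>n. real n * u n) \<longlonglongrightarrow> 0"
proof -
  define a where "a n = real (Suc n) * \<bar>u (Suc n)\<bar>" for n
  have "decseq a"
  proof (rule decseq_SucI)
    fix n
    have "0 \<le> (c + 1) / c * (a n - a (Suc n))"
      using u_le_difference[of n] abs_ge_zero[of "u (Suc n)"] unfolding a_def by linarith
    moreover have "0 < (c + 1) / c" using c by simp
    ultimately have "0 \<le> a n - a (Suc n)" using zero_le_mult_iff[of "(c + 1) / c" "a n - a (Suc n)"] by linarith
    then show "a (Suc n) \<le> a n" by simp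
  qed
  moreover have "0 \<le> a n" for n by (simp add: a_def)
  ultimately obtain L where L: "a \<longlonglongrightarrow> L" "\<And>n. L \<le> a n" "0 \<le> L"
    using decseq_convergent[of a 0] LIMSEQ_le_const[of a] by metis
  have "L = 0"
  proof (rule ccontr)
    assume "L \<noteq> 0"
    then have "0 < L" using L by simp
    have "summable (\<lambda>n. L * inverse (real (Suc n)))"
    proof (rule summable_comparison_test')
      show "summable (\<lambda>n. \<bar>u (Suc n)\<bar>)" using summable_abs_u summable_Suc_iff[of "\<lambda>n. \<bar>u n\<bar>"] by (rule iffD2[rotated])
      show "norm (L * inverse (real (Suc n))) \<le> \<bar>u (Suc n)\<bar>" if "0 \<le> n" for n
        using L(2)[of n] \<open>0 < L\<close> by (simp add: a_def divide_simps mult.commute abs_mult)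
    qed
    then have "summable (\<lambda>n. inverse (real (Suc n)))"
      using \<open>0 < L\<close> summable_mult_D[of L "\<lambda>n. inverse (real (Suc n))"] by simp
    then show False
      using not_summable_harmonic[where 'a = real] summable_Suc_iff[of "\<lambda>n. inverse (real n)"] by simp
  qed
  then have "(\<lambda>n. \<bar>real (Suc n) * u (Suc n)\<bar>) \<longlonglongrightarrow> 0"
    using L(1) \<open>L = 0\<close> by (simp add: a_def[abs_def] abs_mult add.commute)
  then have "(\<lambda>n. real (Suc n) * u (Suc n)) \<longlonglongrightarrow> 0" by (simp only: tendsto_rabs_zero_iff)
  then show ?thesis by (rule LIMSEQ_imp_Suc)
qed

lemma hcoef_shift: "hcoef (c + 1) d n = u n * c / (c + real n)"
proof -
  have "pochhammer c n * (c + real n) = c * pochhammer (c + 1) n"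
    using pochhammer_rec[of c n] pochhammer_Suc[of c n] by simp
  moreover have "pochhammer c n > 0" "pochhammer (c + 1) n > 0" using c by (auto intro!: pochhammer_pos)
  ultimately show ?thesis using c by (simp add: hcoef_def field_simps)
qed

text \<open>Summing the telescoping identity leaves only boundary terms: one is zero at n = 0, the
  other tends to 0 by \<open>nu_tendsto_0\<close>. The result is a contiguous relation at the
  argument 1.\<close>

lemma contiguous: "c\<^sup>2 * suminf u = (c\<^sup>2 - d\<^sup>2) * suminf (hcoef (c + 1) d)"
proof -
  interpret s: hyp_series "c + 1" d using c d by unfold_locales auto
  have eq: "c\<^sup>2 * u n - (c\<^sup>2 - d\<^sup>2) * hcoef (c + 1) d n
      = (- c * real (Suc n) * u (Suc n)) - (- c * real n * u n)" for n
    unfolding telescope[symmetric] hcoef_shift using c by (simp add: field_simps power2_eq_square)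
  have "(\<lambda>n. (- c) * (real n * u n)) \<longlonglongrightarrow> (- c) * 0" by (intro tendsto_mult tendsto_const nu_tendsto_0)
  then have lim: "(\<lambda>n. - c * real n * u n) \<longlonglongrightarrow> 0" by (simp add: mult.assoc)
  have "(\<lambda>n. (- c * real (Suc n) * u (Suc n)) - (- c * real n * u n)) sums (0 - (- c * real 0 * u 0))"
    by (rule telescope_sums[OF lim])
  then have "(\<lambda>n. c\<^sup>2 * u n - (c\<^sup>2 - d\<^sup>2) * hcoef (c + 1) d n) sums 0"
    unfolding eq by simp
  moreover have "(\<lambda>n. c\<^sup>2 * u n - (c\<^sup>2 - d\<^sup>2) * hcoef (c + 1) d n) sums
      (c\<^sup>2 * suminf u - (c\<^sup>2 - d\<^sup>2) * suminf (hcoef (c + 1) d))"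
    by (intro sums_diff sums_mult summable_sums summable_u s.summable_u)
  ultimately show ?thesis using sums_unique2 by fastforce
qed

end

lemma hcoef_iterate:
  assumes "0 < c" "0 < d" "d < 1" "d < c"
  shows "(pochhammer c n)\<^sup>2 * suminf (hcoef c d)
      = pochhammer (c + d) n * pochhammer (c - d) n * suminf (hcoef (c + real n) d)"
proof (induction n)
  case (Suc n)
  interpret hyp_series "c + real n" d using assms by unfold_locales auto
  have "(pochhammer c (Suc n))\<^sup>2 * suminf (hcoef c d)
      = (c + real n)\<^sup>2 * ((pochhammer c n)\<^sup>2 * suminf (hcoef c d))"
    by (simp add: pochhammer_Suc power_mult_distrib)
  also have "\<dots> = pochhammer (c + d) n * pochhammer (c - d) n * ((c + real n)\<^sup>2 * suminf (hcoef (c + real n) d))"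
    unfolding Suc by simp
  also have "\<dots> = pochhammer (c + d) (Suc n) * pochhammer (c - d) (Suc n) * suminf (hcoef (c + real (Suc n)) d)"
    unfolding contiguous by (simp add: pochhammer_Suc power2_eq_square algebra_simps)
  finally show ?case .
qed simp

text \<open>For growing lower parameter every coefficient but the first tends to 0, and all are
  dominated by those of the initial parameter.\<close>

lemma hcoef_sum_tendsto_1:
  assumes "0 < c" "0 < d" "d < 1"
  shows "(\<lambda>n. suminf (hcoef (c + real n) d)) \<longlonglongrightarrow> 1"
proof -
  interpret hyp_series c d using assms by unfold_locales auto
  have le: "\<bar>hcoef (c + real n) d k\<bar> \<le> \<bar>u k\<bar>" for n k
  proof -
    have "pochhammer c k \<le> pochhammer (c + real n) k"
      unfolding pochhammer_prod by (rule prod_mono) (use c in auto)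
    moreover have "0 < pochhammer c k" using c by (rule pochhammer_pos)
    ultimately show ?thesis unfolding hcoef_def abs_divide abs_mult
      by (intro divide_left_mono mult_right_mono mult_pos_pos) auto
  qed
  have lim: "(\<lambda>n. hcoef (c + real n) d k) \<longlonglongrightarrow> (if k = 0 then 1 else 0)" for k
  proof (cases k)
    case 0
    then show ?thesis by (simp add: hcoef_0)
  next
    case (Suc j)
    have "filterlim (\<lambda>n. pochhammer (c + real n) (Suc j)) at_top sequentially"
    proof (rule filterlim_at_top_mono)
      show "filterlim (\<lambda>n. c ^ j * real n) at_top sequentially"
        using c by (intro filterlim_tendsto_pos_mult_at_top[OF tendsto_const] filterlim_real_sequentially) auto
      show "\<forall>\<^sub>F n in sequentially. c ^ j * real n \<le> pochhammer (c + real n) (Suc j)"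
      proof (intro always_eventually allI)
        fix n
        have "c ^ j = (\<Prod>i<j. c)" by simp
        also have "\<dots> \<le> (\<Prod>i<j. c + real n + real i)" by (rule prod_mono) (use c in auto)
        finally have "c ^ j \<le> pochhammer (c + real n) j" by (simp add: pochhammer_prod lessThan_atLeast0)
        moreover have "real n \<le> c + real n + real j" using c by simp
        ultimately show "c ^ j * real n \<le> pochhammer (c + real n) (Suc j)"
          unfolding pochhammer_Suc using c by (intro mult_mono) (auto intro!: pochhammer_nonneg)
      qed
    qed
    then have "(\<lambda>n. (pochhammer d (Suc j) * pochhammer (- d) (Suc j) / fact (Suc j)) / pochhammer (c + real n) (Suc j)) \<longlonglongrightarrow> 0"
      by (intro real_tendsto_divide_at_top[OF tendsto_const])
    then show ?thesis using Suc by (simp add: hcoef_def mult.commute)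
  qed
  have "(\<lambda>n. suminf (\<lambda>k. hcoef (c + real n) d k)) \<longlonglongrightarrow> suminf (\<lambda>k::nat. if k = 0 then 1 else 0 :: real)"
  proof (rule tannerys_theorem[where M = "\<lambda>k. \<bar>u k\<bar>", THEN conjunct2, THEN conjunct2])
    show "\<forall>\<^sub>F (k, n) in at_top \<times>\<^sub>F sequentially. norm (hcoef (c + real n) d k) \<le> \<bar>u k\<bar>"
      by (rule always_eventually) (use le in auto)
    show "(\<lambda>n. hcoef (c + real n) d k) \<longlonglongrightarrow> (if k = 0 then 1 else 0)" for k by (rule lim)
    show "summable (\<lambda>k. \<bar>u k\<bar>)" by (rule summable_abs_u)
    show "sequentially \<noteq> bot" by simp
  qed
  moreover have "suminf (\<lambda>k::nat. if k = 0 then 1 else 0 :: real) = 1"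
    by (subst suminf_finite[of "{0}"]) auto
  ultimately show ?thesis by (simp only:)
qed

text \<open>Iterating the contiguous relation writes the sum as a quotient of Pochhammer symbols
  times a sum that tends to 1. The quotient is that of three \<open>Gamma_series\<close>, in which
  the factorials and the powers of n cancel because (c + d) + (c - d) = 2 c.\<close>

theorem gauss_sum:
  assumes "0 < c" "0 < d" "d < 1" "d < c"
  shows "suminf (hcoef c d) = Gamma c ^ 2 / (Gamma (c + d) * Gamma (c - d))"
proof -
  have g: "0 < Gamma (c + d)" "0 < Gamma (c - d)" using assms by (auto intro!: Gamma_real_pos)
  have p: "0 < pochhammer a n" if "0 < a" for a :: real and n using that by (rule pochhammer_pos)
  have 1: "suminf (hcoef c d) / suminf (hcoef (c + real (Suc n)) d)
      = Gamma_series c n ^ 2 / (Gamma_series (c + d) n * Gamma_series (c - d) n)"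
    if s: "suminf (hcoef (c + real (Suc n)) d) \<noteq> 0" "0 < n" for n
  proof -
    let ?e = "exp (c * ln (real n))"
    have e: "exp ((c + d) * ln (real n)) * exp ((c - d) * ln (real n)) = ?e * ?e"
      by (simp add: exp_add[symmetric] algebra_simps)
    have "Gamma_series c n ^ 2 / (Gamma_series (c + d) n * Gamma_series (c - d) n)
       = (fact n * ?e / pochhammer c (Suc n)) ^ 2 /
         ((fact n * fact n) * (exp ((c + d) * ln (real n)) * exp ((c - d) * ln (real n))) /
          (pochhammer (c + d) (Suc n) * pochhammer (c - d) (Suc n)))"
      unfolding Gamma_series_def by (simp add: mult_ac)
    also have "\<dots> = pochhammer (c + d) (Suc n) * pochhammer (c - d) (Suc n) / (pochhammer c (Suc n))\<^sup>2"
      unfolding e using p[of c "Suc n"] p[of "c + d" "Suc n"] p[of "c - d" "Suc n"] assms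
      by (simp add: divide_simps power2_eq_square del: pochhammer_Suc)
    also have "\<dots> = suminf (hcoef c d) / suminf (hcoef (c + real (Suc n)) d)"
      using hcoef_iterate[OF assms, of "Suc n"] p[of c "Suc n"] assms s
      by (simp add: divide_simps mult_ac)
    finally show ?thesis by simp
  qed
  have lim1: "(\<lambda>n. suminf (hcoef (c + real (Suc n)) d)) \<longlonglongrightarrow> 1"
    using hcoef_sum_tendsto_1[OF assms(1-3)] by (rule LIMSEQ_Suc)
  then have "\<forall>\<^sub>F n in sequentially. suminf (hcoef (c + real (Suc n)) d) \<noteq> 0"
    by (rule tendsto_imp_eventually_ne) simp
  then have ev: "\<forall>\<^sub>F n in sequentially. suminf (hcoef c d) / suminf (hcoef (c + real (Suc n)) d)
      = Gamma_series c n ^ 2 / (Gamma_series (c + d) n * Gamma_series (c - d) n)"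
    using eventually_gt_at_top[of 0] by eventually_elim (rule 1)
  have "(\<lambda>n. suminf (hcoef c d) / suminf (hcoef (c + real (Suc n)) d)) \<longlonglongrightarrow> suminf (hcoef c d) / 1"
    by (intro tendsto_divide tendsto_const lim1) simp
  then have "(\<lambda>n. Gamma_series c n ^ 2 / (Gamma_series (c + d) n * Gamma_series (c - d) n))
      \<longlonglongrightarrow> suminf (hcoef c d) / 1"
    by (rule iffD1[OF tendsto_cong[OF ev]])
  moreover have "(\<lambda>n. Gamma_series c n ^ 2 / (Gamma_series (c + d) n * Gamma_series (c - d) n))
      \<longlonglongrightarrow> Gamma c ^ 2 / (Gamma (c + d) * Gamma (c - d))"
    by (intro tendsto_divide tendsto_mult tendsto_power Gamma_series_LIMSEQ) (use g in auto)
  ultimately have "suminf (hcoef c d) / 1 = Gamma c ^ 2 / (Gamma (c + d) * Gamma (c - d))"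
    by (rule LIMSEQ_unique)
  then show ?thesis by (simp only: div_by_1)
qed

section \<open>The first-order system in the angular variable\<close>

text \<open>With \<open>x = m \<theta>\<close> and \<open>\<tau> = tan (x / 2)\<close> the entries of \<open>L\<close> are \<open>f\<^sub>1 = \<tau>\<^sup>\<kappa> F\<close> and
  \<open>f\<^sub>2 = \<tau>\<^sup>-\<^sup>\<kappa> Q\<close>, where \<open>F' = - d \<tau>\<^sup>-\<^sup>2\<^sup>\<kappa> Q\<close> and \<open>Q' = d \<tau>\<^sup>2\<^sup>\<kappa> F\<close>; unlike \<open>f\<^sub>1, f\<^sub>2\<close>,
  the functions \<open>F\<close> and \<open>Q\<close> have finite limits at both ends.\<close>

definition hF :: "real \<Rightarrow> real \<Rightarrow> real \<Rightarrow> real" where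
  "hF \<kappa> d x = eval_fps (hfps (1 / 2 + \<kappa>) d) ((sin (x / 2))\<^sup>2)"

text \<open>Written with the derivative of the series for F, so that the first equation of the
  system is the chain rule and the second is the hypergeometric equation;
  \<open>hyp2F1_shift\<close> links it with the series in \<open>wt_f2\<close>.\<close>

definition hQ :: "real \<Rightarrow> real \<Rightarrow> real \<Rightarrow> real" where
  "hQ \<kappa> d x = - (1 / d) * (tan (x / 2) powr (2 * \<kappa>)
     * (sin (x / 2) * cos (x / 2) * eval_fps (fps_deriv (hfps (1 / 2 + \<kappa>) d)) ((sin (x / 2))\<^sup>2)))"

lemma half_angle:
  assumes "0 < x" "x < pi"
  shows "0 < sin (x / 2)" "0 < cos (x / 2)" "0 < tan (x / 2)" "(sin (x / 2))\<^sup>2 < 1"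
proof -
  show s: "0 < sin (x / 2)" and c: "0 < cos (x / 2)"
    using assms by (auto intro!: sin_gt_zero cos_gt_zero)
  then show "0 < tan (x / 2)" by (simp add: tan_def)
  have "0 < (cos (x / 2))\<^sup>2" using c by simp
  then show "(sin (x / 2))\<^sup>2 < 1" using sin_cos_squared_add[of "x / 2"] by linarith
qed

context hyp_series begin

lemma radius: "norm (v::real) < 1 \<Longrightarrow> ereal (norm v) < fps_conv_radius (hfps c d)"
proof -
  assume v: "norm v < 1"
  have "ereal (norm (1::real)) \<le> conv_radius (fps_nth (hfps c d))"
    by (rule conv_radius_geI) (simp add: hfps_nth summable_u)
  then have "1 \<le> fps_conv_radius (hfps c d)" by (simp add: fps_conv_radius_def one_ereal_def)
  moreover have "ereal (norm v) < 1" using v by (simp add: one_ereal_def)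
  ultimately show ?thesis by (rule less_le_trans[rotated])
qed

lemma radius': "norm (v::real) < 1 \<Longrightarrow> ereal (norm v) < fps_conv_radius (fps_deriv (hfps c d))"
  using radius fps_conv_radius_deriv less_le_trans by blast

lemma radius'': "norm (v::real) < 1 \<Longrightarrow> ereal (norm v) < fps_conv_radius (fps_deriv (fps_deriv (hfps c d)))"
  using radius' fps_conv_radius_deriv less_le_trans by blast

text \<open>Gauss's equation for the upper parameters d and - d, whose sum vanishes, so that the
  first derivative has the coefficient c - v. Coefficientwise it is the recursion
  \<open>hcoef_Suc'\<close>.\<close>

lemma hypergeometric_ode:
  assumes v: "\<bar>v\<bar> < 1"
  shows "(c - v) * eval_fps (fps_deriv (hfps c d)) v + v * (1 - v) * eval_fps (fps_deriv (fps_deriv (hfps c d))) v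
    = - (d\<^sup>2) * eval_fps (hfps c d) v"
proof -
  let ?U = "hfps c d" and ?P = "fps_deriv (hfps c d)" and ?R = "fps_deriv (fps_deriv (hfps c d))"
  define a where "a n = u n * v ^ n" for n
  define b where "b n = fps_nth ?P n * v ^ n" for n
  define e where "e n = fps_nth ?R n * v ^ n" for n
  have v': "norm v < 1" using v by simp
  have A: "a sums eval_fps ?U v" and B: "b sums eval_fps ?P v" and E: "e sums eval_fps ?R v"
    using sums_eval_fps[OF radius[OF v']] sums_eval_fps[OF radius'[OF v']] sums_eval_fps[OF radius''[OF v']]
    by (simp_all add: a_def[abs_def] b_def[abs_def] e_def[abs_def] hfps_nth)
  \<comment> \<open>Multiplication by v shifts the coefficients by one; the case distinction
    supplies the zero term in front.\<close>
  have shift: "(\<lambda>n. case n of 0 \<Rightarrow> 0 | Suc k \<Rightarrow> v * f k) sums (v * s)" if "f sums s" for f s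
  proof -
    have "(\<lambda>n. v * f n) sums (v * s)" using that by (rule sums_mult)
    then show ?thesis
      using sums_Suc_iff[of "\<lambda>n. case n of 0 \<Rightarrow> 0 | Suc k \<Rightarrow> v * f k" "v * s"] by simp
  qed
  have coef: "c * b n + (case n of 0 \<Rightarrow> 0 | Suc k \<Rightarrow> v * e k)
      = (case n of 0 \<Rightarrow> 0 | Suc k \<Rightarrow> v * b k)
      + (case n of 0 \<Rightarrow> 0 | Suc k \<Rightarrow> v * (case k of 0 \<Rightarrow> 0 | Suc j \<Rightarrow> v * e j)) - d\<^sup>2 * a n" for n
  proof -
    have 1: "fps_nth ?P k = (real k + 1) * u (Suc k)" for k by (simp add: hfps_nth add.commute)
    have 2: "fps_nth ?R k = (real k + 1) * (real k + 2) * u (Suc (Suc k))" for k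
      by (simp add: hfps_nth algebra_simps)
    have rec: "u (Suc n) * ((c + real n) * (real n + 1)) = u n * ((real n)\<^sup>2 - d\<^sup>2)" by (rule hcoef_Suc'[OF c])
    show ?thesis
    proof (cases n)
      case 0
      then show ?thesis using rec by (simp add: a_def b_def 1 mult.commute del: fps_deriv_nth)
    next
      case (Suc k)
      have "c * b n + v * e k = v ^ n * (u (Suc n) * ((c + real n) * (real n + 1)))"
        unfolding a_def b_def e_def 1 2 using Suc by (simp add: algebra_simps)
      also have "\<dots> = v ^ n * (u n * ((real n)\<^sup>2 - d\<^sup>2))" by (simp only: rec)
      also have "\<dots> = v * b k + v * (case k of 0 \<Rightarrow> 0 | Suc j \<Rightarrow> v * e j) - d\<^sup>2 * a n"
        unfolding a_def b_def e_def 1 2 using Suc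
        by (cases k) (simp_all add: algebra_simps power2_eq_square)
      finally show ?thesis using Suc by simp
    qed
  qed
  have "(\<lambda>n. c * b n + (case n of 0 \<Rightarrow> 0 | Suc k \<Rightarrow> v * e k)) sums (c * eval_fps ?P v + v * eval_fps ?R v)"
    by (intro sums_add sums_mult B shift E)
  moreover have "(\<lambda>n. c * b n + (case n of 0 \<Rightarrow> 0 | Suc k \<Rightarrow> v * e k))
      sums (v * eval_fps ?P v + v * (v * eval_fps ?R v) - d\<^sup>2 * eval_fps ?U v)"
    unfolding coef by (intro sums_add sums_diff sums_mult A B shift E)
  ultimately have "c * eval_fps ?P v + v * eval_fps ?R v
      = v * eval_fps ?P v + v * (v * eval_fps ?R v) - d\<^sup>2 * eval_fps ?U v"
    by (rule sums_unique2)
  then show ?thesis by (simp add: algebra_simps)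
qed

text \<open>The formula for the derivative of a hypergeometric series, which multiplies by - d^2 / c
  and raises all parameters by one, solved for the raised series.\<close>

lemma hyp2F1_shift:
  assumes v: "\<bar>v\<bar> < 1"
  shows "hyp2F1 (1 + d) (1 - d) (1 + c) v = - (c / d\<^sup>2) * eval_fps (fps_deriv (hfps c d)) v"
proof -
  have coef: "fps_nth (fps_hypergeo [1 + d, 1 - d] [1 + c] 1) n = - (c / d\<^sup>2) * fps_nth (fps_deriv (hfps c d)) n" for n
  proof -
    have "pochhammer d (Suc n) = d * pochhammer (1 + d) n" "pochhammer (- d) (Suc n) = - d * pochhammer (1 - d) n"
      "pochhammer c (Suc n) = c * pochhammer (1 + c) n"
      by (simp_all add: pochhammer_rec add.commute)
    then have "hcoef c d (Suc n) = (d * pochhammer (1 + d) n) * (- d * pochhammer (1 - d) n)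
         / ((c * pochhammer (1 + c) n) * (real (Suc n) * fact n))"
      unfolding hcoef_def by (simp only: fact_Suc)
    then have "- (c / d\<^sup>2) * (real (Suc n) * hcoef c d (Suc n))
        = pochhammer (1 + d) n * pochhammer (1 - d) n / (pochhammer (1 + c) n * fact n)"
      by (simp only:) (use c d pochhammer_pos[of "1 + c" n] in
        \<open>simp add: power2_eq_square field_simps del: of_nat_Suc\<close>)
    then show ?thesis by (simp add: hfps_nth)
  qed
  have "(\<lambda>n. - (c / d\<^sup>2) * (fps_nth (fps_deriv (hfps c d)) n * v ^ n)) sums (- (c / d\<^sup>2) * eval_fps (fps_deriv (hfps c d)) v)"
    by (intro sums_mult sums_eval_fps radius') (use v in simp)
  from sums_unique[OF this] show ?thesis
    unfolding hyp2F1_def eval_fps_def coef by (simp only: mult.assoc)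
qed

text \<open>All terms after the first are negative, so the value at v lies between the sum at 1 and
  the constant term 1.\<close>

lemma eval_hfps_bounds:
  assumes v: "0 \<le> v" "v < 1"
  shows "suminf u \<le> eval_fps (hfps c d) v" "eval_fps (hfps c d) v \<le> 1"
proof -
  have s: "(\<lambda>n. u n * v ^ n) sums eval_fps (hfps c d) v"
    using sums_eval_fps[OF radius, of v] v by (simp add: hfps_nth)
  have "u n \<le> u n * v ^ n" for n
  proof (cases n)
    case (Suc k)
    have "v ^ n \<le> 1" using v by (simp add: power_le_one)
    then show ?thesis using hcoef_neg[OF c d, of k] Suc mult_left_mono_neg[of "v ^ n" 1 "u n"] by simp
  qed simp
  then show "suminf u \<le> eval_fps (hfps c d) v"
    by (rule sums_le[OF _ summable_sums[OF summable_u] s])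
  have "u n * v ^ n \<le> (if n = 0 then 1 else 0)" for n
  proof (cases n)
    case (Suc k)
    then show ?thesis using hcoef_neg[OF c d, of k] v by (simp add: mult_nonpos_nonneg)
  qed (simp add: hcoef_0)
  from sums_le[OF this s sums_single] show "eval_fps (hfps c d) v \<le> 1" .
qed

end

lemma has_deriv_zero_const:
  fixes f :: "real \<Rightarrow> real"
  assumes "\<And>x. a < x \<Longrightarrow> x < b \<Longrightarrow> (f has_real_derivative 0) (at x)" "a < x" "x < b" "a < y" "y < b"
  shows "f x = f y"
  using DERIV_isconst3[of a b x y f] assms by auto

lemma eventually_at_right_0: "0 < b \<Longrightarrow> eventually (\<lambda>x::real. 0 < x \<and> x < b) (at_right 0)"
  by (auto simp: eventually_at_right_field)

lemma eventually_at_left_pi: "a < b \<Longrightarrow> eventually (\<lambda>x::real. a < x \<and> x < b) (at_left b)"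
  by (auto simp: eventually_at_left_field)

locale hyp_angle =
  fixes \<kappa> d :: real
  assumes \<kappa>: "- 1 / 2 < \<kappa>" "\<kappa> < 1 / 2" and d: "0 < d" "d < 1"
begin

sublocale hyp_series "1 / 2 + \<kappa>" d
  using \<kappa> d by unfold_locales auto

abbreviation "\<tau> x \<equiv> tan (x / 2)"

lemma wt_f1_eq:
  assumes "0 < x" "x < pi"
  shows "wt_f1 \<kappa> d ((sin (x / 2))\<^sup>2) = \<tau> x powr \<kappa> * hF \<kappa> d x"
proof -
  note h = half_angle[OF assms]
  have 1: "1 - (sin (x / 2))\<^sup>2 = (cos (x / 2))\<^sup>2" using sin_cos_squared_add[of "x / 2"] by linarith
  have 2: "(y\<^sup>2) powr (a / 2) = y powr a" if "0 < y" for y a :: real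
    using that by (simp add: powr_powr flip: powr_numeral)
  have "\<tau> x powr \<kappa> = sin (x / 2) powr \<kappa> * cos (x / 2) powr (- \<kappa>)"
    unfolding tan_def using h by (simp add: powr_divide powr_minus_divide)
  then show ?thesis
    unfolding wt_f1_def 1 2[OF h(1)] 2[OF h(2)] hF_def hyp2F1_def hfps_def by simp
qed

lemma wt_f2_eq:
  assumes "0 < x" "x < pi"
  shows "wt_f2 \<kappa> d ((sin (x / 2))\<^sup>2) = \<tau> x powr (- \<kappa>) * hQ \<kappa> d x"
proof -
  note h = half_angle[OF assms]
  define s where "s = sin (x / 2)"
  define k where "k = cos (x / 2)"
  define P where "P = eval_fps (fps_deriv (hfps (1 / 2 + \<kappa>) d)) (s\<^sup>2)"
  have sk: "0 < s" "0 < k" using h by (simp_all add: s_def k_def)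
  have 1: "1 - s\<^sup>2 = k\<^sup>2" unfolding s_def k_def using sin_cos_squared_add[of "x / 2"] by linarith
  have 2: "(y\<^sup>2) powr (a / 2) = y powr a" if "0 < y" for y a :: real
    using that by (simp add: powr_powr flip: powr_numeral)
  have "1 + (1 / 2 + \<kappa>) = 3 / 2 + \<kappa>" by simp
  then have 3: "hyp2F1 (1 + d) (1 - d) (3 / 2 + \<kappa>) (s\<^sup>2) = - ((1 / 2 + \<kappa>) / d\<^sup>2) * P"
    using hyp2F1_shift[of "s\<^sup>2"] h(4) unfolding P_def s_def by (simp only:) simp
  have 4: "\<tau> x powr \<kappa> = s powr \<kappa> * k powr (- \<kappa>)"
    unfolding tan_def s_def[symmetric] k_def[symmetric] using sk by (simp add: powr_divide powr_minus_divide)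
  have "\<tau> x powr (- \<kappa>) * hQ \<kappa> d x = - (1 / d) * (\<tau> x powr \<kappa> * (s * k * P))"
    unfolding hQ_def s_def[symmetric] k_def[symmetric] P_def[symmetric]
    by (simp add: mult.assoc[symmetric] powr_add[symmetric] mult.commute[of "\<tau> x powr - \<kappa>"])
  also have "\<dots> = - (1 / d) * ((s powr \<kappa> * s) * (k powr (- \<kappa>) * k) * P)"
    by (simp add: 4)
  also have "s powr \<kappa> * s = s powr (\<kappa> + 1)" using sk by (simp add: powr_add)
  also have "k powr (- \<kappa>) * k = k powr (1 - \<kappa>)" using sk powr_add[of k "- \<kappa>" 1] by simp
  also have "- (1 / d) * (s powr (\<kappa> + 1) * k powr (1 - \<kappa>) * P)
     = d / (1 / 2 + \<kappa>) * s powr (\<kappa> + 1) * k powr (1 - \<kappa>) * (- ((1 / 2 + \<kappa>) / d\<^sup>2) * P)"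
    using c d by (simp add: divide_simps power2_eq_square)
  also have "\<dots> = wt_f2 \<kappa> d (s\<^sup>2)"
    unfolding wt_f2_def 1 3[symmetric] 2[OF sk(1)] 2[OF sk(2)] ..
  finally show ?thesis unfolding s_def ..
qed

lemma sin_sq_deriv: "((\<lambda>x. (sin (x / 2))\<^sup>2) has_real_derivative sin (x / 2) * cos (x / 2)) (at x within A)"
  by (auto intro!: derivative_eq_intros)

lemma \<tau>_powr_deriv:
  assumes "0 < x" "x < pi"
  shows "((\<lambda>x. \<tau> x powr a) has_real_derivative a / 2 * \<tau> x powr a / (sin (x / 2) * cos (x / 2))) (at x)"
proof -
  note h = half_angle[OF assms]
  have "((\<lambda>x. \<tau> x powr a) has_real_derivative a * \<tau> x powr (a - 1) * (inverse ((cos (x / 2))\<^sup>2) * (1 / 2))) (at x)"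
    using h by (auto intro!: derivative_eq_intros)
  also have "\<tau> x powr (a - 1) = \<tau> x powr a / \<tau> x"
    using h(3) by (simp add: powr_diff)
  also have "a * (\<tau> x powr a / \<tau> x) * (inverse ((cos (x / 2))\<^sup>2) * (1 / 2))
      = a / 2 * \<tau> x powr a / (sin (x / 2) * cos (x / 2))"
    using h unfolding tan_def by (simp add: divide_simps power2_eq_square)
  finally show ?thesis .
qed

lemma hF_deriv:
  assumes "0 < x" "x < pi"
  shows "(hF \<kappa> d has_real_derivative - d * \<tau> x powr (- (2 * \<kappa>)) * hQ \<kappa> d x) (at x)"
proof -
  note h = half_angle[OF assms]
  let ?U = "hfps (1 / 2 + \<kappa>) d"
  have "((\<lambda>x. eval_fps ?U ((sin (x / 2))\<^sup>2)) has_real_derivative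
      eval_fps (fps_deriv ?U) ((sin (x / 2))\<^sup>2) * (sin (x / 2) * cos (x / 2))) (at x)"
    by (rule DERIV_chain2[OF has_field_derivative_eval_fps sin_sq_deriv]) (rule radius, use h in simp)
  also have "eval_fps (fps_deriv ?U) ((sin (x / 2))\<^sup>2) * (sin (x / 2) * cos (x / 2))
      = - d * \<tau> x powr (- (2 * \<kappa>)) * hQ \<kappa> d x"
    unfolding hQ_def using d h(3) by (simp add: powr_minus field_simps)
  finally show ?thesis unfolding hF_def[abs_def] .
qed

text \<open>Differentiating the power of the tangent contributes \<kappa> times the derivative of
  the series. It completes 1 / 2 - v, from sin (x / 2) cos (x / 2), to the coefficient 1 / 2 +
  \<kappa> - v of the hypergeometric equation.\<close>

lemma hQ_deriv:
  assumes "0 < x" "x < pi"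
  shows "(hQ \<kappa> d has_real_derivative d * \<tau> x powr (2 * \<kappa>) * hF \<kappa> d x) (at x)"
proof -
  note h = half_angle[OF assms]
  let ?U = "hfps (1 / 2 + \<kappa>) d" and ?v = "(sin (x / 2))\<^sup>2" and ?t = "\<tau> x powr (2 * \<kappa>)"
  let ?P = "eval_fps (fps_deriv ?U) ?v" and ?R = "eval_fps (fps_deriv (fps_deriv ?U)) ?v"
  let ?s = "sin (x / 2)" and ?k = "cos (x / 2)"
  have P: "((\<lambda>x. eval_fps (fps_deriv ?U) ((sin (x / 2))\<^sup>2)) has_real_derivative ?R * (?s * ?k)) (at x)"
    by (rule DERIV_chain2[OF has_field_derivative_eval_fps sin_sq_deriv]) (rule radius', use h in simp)
  have sk: "((\<lambda>x. sin (x / 2) * cos (x / 2)) has_real_derivative (1 / 2 - ?v)) (at x)"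
  proof -
    have "((\<lambda>x. sin (x / 2) * cos (x / 2)) has_real_derivative ?s * (- ?s * (1 / 2)) + ?k * (1 / 2) * ?k) (at x)"
      by (auto intro!: derivative_eq_intros)
    also have "?s * (- ?s * (1 / 2)) + ?k * (1 / 2) * ?k = 1 / 2 - ?v"
      using sin_cos_squared_add[of "x / 2"] by (simp add: power2_eq_square)
    finally show ?thesis .
  qed
  have "(hQ \<kappa> d has_real_derivative - (1 / d) * (2 * \<kappa> / 2 * ?t / (?s * ?k) * (?s * ?k * ?P)
      + ((1 / 2 - ?v) * ?P + ?R * (?s * ?k) * (?s * ?k)) * ?t)) (at x)"
    unfolding hQ_def[abs_def]
    by (rule DERIV_cmult, rule DERIV_mult[OF \<tau>_powr_deriv[OF assms] DERIV_mult[OF sk P]])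
  also have "2 * \<kappa> / 2 * ?t / (?s * ?k) * (?s * ?k * ?P) = \<kappa> * ?P * ?t"
    using h by (simp add: field_simps)
  also have "?R * (?s * ?k) * (?s * ?k) = ?v * (1 - ?v) * ?R"
  proof -
    have "1 - ?v = ?k\<^sup>2" using sin_cos_squared_add[of "x / 2"] by linarith
    then show ?thesis by (simp add: power2_eq_square mult_ac)
  qed
  also have "- (1 / d) * (\<kappa> * ?P * ?t + ((1 / 2 - ?v) * ?P + ?v * (1 - ?v) * ?R) * ?t)
      = - (1 / d) * ?t * ((1 / 2 + \<kappa> - ?v) * ?P + ?v * (1 - ?v) * ?R)"
    by (simp add: algebra_simps)
  also have "(1 / 2 + \<kappa> - ?v) * ?P + ?v * (1 - ?v) * ?R = - (d\<^sup>2) * eval_fps ?U ?v"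
    by (rule hypergeometric_ode) (use h in simp)
  also have "- (1 / d) * ?t * (- (d\<^sup>2) * eval_fps ?U ?v) = d * ?t * hF \<kappa> d x"
    using d by (simp add: hF_def power2_eq_square)
  finally show ?thesis .
qed

lemma hF_bounds:
  assumes "0 < x" "x < pi"
  shows "suminf u \<le> hF \<kappa> d x" "hF \<kappa> d x \<le> 1"
  unfolding hF_def using eval_hfps_bounds[of "(sin (x / 2))\<^sup>2"] half_angle[OF assms] by auto

lemma hF_at_0: "(hF \<kappa> d \<longlongrightarrow> 1) (at_right 0)"
proof -
  have "isCont (eval_fps (hfps (1 / 2 + \<kappa>) d)) 0"
    by (rule DERIV_isCont[OF has_field_derivative_eval_fps]) (use radius[of 0] in simp)
  moreover have "((\<lambda>x. (sin (x / 2))\<^sup>2) \<longlongrightarrow> 0) (at_right (0::real))"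
    by (auto intro!: tendsto_eq_intros)
  ultimately have "((\<lambda>x. eval_fps (hfps (1 / 2 + \<kappa>) d) ((sin (x / 2))\<^sup>2)) \<longlongrightarrow> eval_fps (hfps (1 / 2 + \<kappa>) d) 0) (at_right 0)"
    by (rule isCont_tendsto_compose)
  then show ?thesis by (simp add: hF_def[abs_def] eval_fps_at_0 hfps_nth hcoef_0)
qed

text \<open>The coefficients are absolutely summable, so the limit v \<rightarrow> 1 passes inside
  the series.\<close>

lemma hF_at_pi: "(hF \<kappa> d \<longlongrightarrow> suminf u) (at_left pi)"
proof -
  have "((\<lambda>x. suminf (\<lambda>n. u n * ((sin (x / 2))\<^sup>2) ^ n)) \<longlongrightarrow> suminf u) (at_left pi)"
  proof (rule tannerys_theorem[where M = "\<lambda>k. \<bar>u k\<bar>", THEN conjunct2, THEN conjunct2])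
    show "((\<lambda>x. u k * ((sin (x / 2))\<^sup>2) ^ k) \<longlongrightarrow> u k) (at_left pi)" for k
      by (auto intro!: tendsto_eq_intros)
    have "norm (u k * ((sin (x / 2))\<^sup>2) ^ k) \<le> \<bar>u k\<bar>" for k x
    proof -
      have "((sin (x / 2))\<^sup>2) ^ k \<le> 1" by (rule power_le_one) (auto simp: abs_square_le_1)
      then show ?thesis by (simp add: abs_mult mult_left_le)
    qed
    then show "\<forall>\<^sub>F (k, x) in at_top \<times>\<^sub>F at_left pi. norm (u k * ((sin (x / 2))\<^sup>2) ^ k) \<le> \<bar>u k\<bar>"
      by (intro always_eventually) auto
  qed (auto simp: summable_abs_u trivial_limit_at_left_real)
  then show ?thesis by (simp add: hF_def[abs_def] eval_fps_def hfps_nth)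
qed

lemma hQ_at_0: "(hQ \<kappa> d \<longlongrightarrow> 0) (at_right 0)"
proof -
  let ?P = "eval_fps (fps_deriv (hfps (1 / 2 + \<kappa>) d))"
  have s0: "((\<lambda>x. sin (x / 2)) \<longlongrightarrow> 0) (at_right (0::real))" by (auto intro!: tendsto_eq_intros)
  have "isCont ?P 0"
    by (rule DERIV_isCont[OF has_field_derivative_eval_fps]) (use radius'[of 0] in simp)
  moreover have "((\<lambda>x. (sin (x / 2))\<^sup>2) \<longlongrightarrow> 0) (at_right (0::real))"
    by (auto intro!: tendsto_eq_intros)
  ultimately have P: "((\<lambda>x. ?P ((sin (x / 2))\<^sup>2)) \<longlongrightarrow> ?P 0) (at_right 0)"
    by (rule isCont_tendsto_compose)
  have ev: "eventually (\<lambda>x. 0 < x \<and> x < pi) (at_right 0)" by (rule eventually_at_right_0) simp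
  \<comment> \<open>Since 2 \<kappa> + 1 is positive, the factor sin (x / 2) outweighs a possible
    singularity of the power of the tangent.\<close>
  have "((\<lambda>x. sin (x / 2) powr (2 * \<kappa> + 1)) \<longlongrightarrow> 0) (at_right 0)"
  proof (rule tendsto_zero_powrI[OF s0 tendsto_const])
    show "\<forall>\<^sub>F x in at_right 0. 0 \<le> sin (x / 2 :: real)"
      using ev by eventually_elim (use half_angle in force)
  qed (use \<kappa> in simp)
  moreover have "((\<lambda>x. cos (x / 2) powr (1 - 2 * \<kappa>)) \<longlongrightarrow> 1 powr (1 - 2 * \<kappa>)) (at_right 0)"
    by (rule tendsto_powr) (auto intro!: tendsto_eq_intros)
  ultimately have "((\<lambda>x. - (1 / d) * (sin (x / 2) powr (2 * \<kappa> + 1) * cos (x / 2) powr (1 - 2 * \<kappa>) * ?P ((sin (x / 2))\<^sup>2)))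
      \<longlongrightarrow> - (1 / d) * (0 * 1 powr (1 - 2 * \<kappa>) * ?P 0)) (at_right 0)"
    by (intro tendsto_mult tendsto_const P)
  moreover have "eventually (\<lambda>x. - (1 / d) * (sin (x / 2) powr (2 * \<kappa> + 1) * cos (x / 2) powr (1 - 2 * \<kappa>) * ?P ((sin (x / 2))\<^sup>2))
     = hQ \<kappa> d x) (at_right 0)"
    using ev
  proof eventually_elim
    case (elim x)
    then have h: "0 < sin (x / 2)" "0 < cos (x / 2)" using half_angle[of x] by auto
    have "\<tau> x powr (2 * \<kappa>) * (sin (x / 2) * cos (x / 2)) = sin (x / 2) powr (2 * \<kappa> + 1) * cos (x / 2) powr (1 - 2 * \<kappa>)"
      unfolding tan_def using h by (simp add: powr_divide powr_add powr_diff)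
    then have "\<tau> x powr (2 * \<kappa>) * (sin (x / 2) * cos (x / 2) * ?P ((sin (x / 2))\<^sup>2))
        = sin (x / 2) powr (2 * \<kappa> + 1) * cos (x / 2) powr (1 - 2 * \<kappa>) * ?P ((sin (x / 2))\<^sup>2)"
      by (simp only: mult.assoc[symmetric])
    then show ?case unfolding hQ_def by (simp only:)
  qed
  ultimately show ?thesis by (simp add: tendsto_cong)
qed

end

section \<open>The symmetry x \<mapsto> \<pi> - x, Gamma reflection, and boundary values at
  \<pi>\<close>

lemma borel_measurable_tan_half [measurable]: "(\<lambda>x::real. tan (x / 2)) \<in> borel_measurable borel"
  unfolding tan_def by measurable

lemma tan_half_reflect:
  assumes "0 < x" "x < pi"
  shows "tan ((pi - x) / 2) = inverse (tan (x / 2))"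
  using tan_cot[of "x / 2"] by (simp add: diff_divide_distrib)

lemma tan_half_reflect_powr:
  assumes "0 < x" "x < pi"
  shows "tan ((pi - x) / 2) powr a = tan (x / 2) powr (- a)"
  using half_angle[OF assms] tan_half_reflect[OF assms] by (simp add: powr_minus inverse_eq_divide powr_divide)

lemma tendsto_reflect:
  fixes f :: "real \<Rightarrow> real"
  assumes "(f \<longlongrightarrow> a) (at_right 0)"
  shows "((\<lambda>x. f (pi - x)) \<longlongrightarrow> a) (at_left pi)"
proof (rule filterlim_compose[OF assms])
  show "filterlim (\<lambda>x. pi - x) (at_right 0) (at_left pi)"
    unfolding filterlim_at
    by (auto intro!: tendsto_eq_intros eventually_mono[OF eventually_at_left_pi[of 0 pi]])
qed

lemma Gamma_half_prod:
  fixes y :: real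
  shows "Gamma (1 / 2 + y) * Gamma (1 / 2 - y) = pi / cos (pi * y)"
proof -
  have "Gamma (complex_of_real (1 / 2 + y)) * Gamma (1 - complex_of_real (1 / 2 + y))
      = of_real pi / sin (of_real pi * complex_of_real (1 / 2 + y))"
    by (rule Gamma_reflection_complex)
  moreover have "1 - complex_of_real (1 / 2 + y) = complex_of_real (1 / 2 - y)" by simp
  moreover have "sin (of_real pi * complex_of_real (1 / 2 + y)) = complex_of_real (sin (pi * (1 / 2 + y)))"
    by (simp only: sin_of_real[symmetric] of_real_mult)
  ultimately have "complex_of_real (Gamma (1 / 2 + y) * Gamma (1 / 2 - y)) = complex_of_real (pi / sin (pi * (1 / 2 + y)))"
    by (simp only: Gamma_complex_of_real of_real_mult of_real_divide)
  then have "Gamma (1 / 2 + y) * Gamma (1 / 2 - y) = pi / sin (pi * (1 / 2 + y))"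
    by (simp only: of_real_eq_iff)
  also have "sin (pi * (1 / 2 + y)) = cos (pi * y)"
    by (simp add: distrib_left sin_add)
  finally show ?thesis .
qed

lemma cos_pi_pos: "\<bar>y\<bar> < 1 / 2 \<Longrightarrow> 0 < cos (pi * y)"
proof -
  assume y: "\<bar>y\<bar> < 1 / 2"
  have "y < 1 / 2" "- (1 / 2) < y" using y by linarith+
  then have "pi * y < pi * (1 / 2)" "pi * (- (1 / 2)) < pi * y"
    by (simp_all only: mult_less_cancel_left_pos pi_gt_zero)
  then show ?thesis by (intro cos_gt_zero_pi) auto
qed

text \<open>The six Gamma values pair up under the reflection formula, and cos (a + b) cos (a - b) =
  cos^2 a - sin^2 b finishes.\<close>

lemma wt_H_mult:
  assumes "0 < d" "d < 1 / 2 - \<bar>\<kappa>\<bar>"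
  shows "wt_H \<kappa> d * wt_H (- \<kappa>) d = 1 - (sin (pi * d) / cos (pi * \<kappa>))\<^sup>2"
proof -
  define a where "a = cos (pi * \<kappa>)"
  define p where "p = cos (pi * (\<kappa> + d))"
  define q where "q = cos (pi * (\<kappa> - d))"
  have pos: "0 < a" "0 < p" "0 < q" unfolding a_def p_def q_def by (rule cos_pi_pos, use assms in linarith)+
  have "wt_H \<kappa> d * wt_H (- \<kappa>) d = (Gamma (1 / 2 + \<kappa>) * Gamma (1 / 2 - \<kappa>))\<^sup>2
      / ((Gamma (1 / 2 + (\<kappa> + d)) * Gamma (1 / 2 - (\<kappa> + d))) * (Gamma (1 / 2 + (\<kappa> - d)) * Gamma (1 / 2 - (\<kappa> - d))))"
    unfolding wt_H_def by (simp add: power_mult_distrib algebra_simps)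
  also have "\<dots> = (pi / a)\<^sup>2 / ((pi / p) * (pi / q))"
    unfolding Gamma_half_prod a_def p_def q_def ..
  also have "\<dots> = p * q / a\<^sup>2" using pos by (simp add: power2_eq_square divide_simps)
  also have "p * q = a\<^sup>2 - (sin (pi * d))\<^sup>2"
  proof -
    have "p * q = (cos (pi * \<kappa>))\<^sup>2 * (cos (pi * d))\<^sup>2 - (sin (pi * \<kappa>))\<^sup>2 * (sin (pi * d))\<^sup>2"
      unfolding p_def q_def by (simp add: distrib_left right_diff_distrib cos_add cos_diff power2_eq_square algebra_simps)
    also have "\<dots> = a\<^sup>2 - (sin (pi * d))\<^sup>2"
      unfolding a_def cos_squared_eq[of "pi * d"] sin_squared_eq[of "pi * \<kappa>"] by (simp add: algebra_simps)
    finally show ?thesis .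
  qed
  finally show ?thesis using pos by (simp add: a_def[symmetric] power_divide diff_divide_distrib)
qed

lemma wt_H_pos:
  assumes "0 < d" "d < 1 / 2 - \<bar>\<kappa>\<bar>"
  shows "0 < wt_H \<kappa> d"
proof -
  have "0 < Gamma (1 / 2 + \<kappa>)" "0 < Gamma (1 / 2 + \<kappa> + d)" "0 < Gamma (1 / 2 + \<kappa> - d)"
    using assms by (auto intro!: Gamma_real_pos)
  then show ?thesis by (simp add: wt_H_def)
qed

text \<open>The limit of \<open>hQ\<close> at \<pi>, by \<open>Q_at_pi\<close>. It is even in
  \<kappa>, so that both signs of \<kappa> share the same limit.\<close>

definition hS :: "real \<Rightarrow> real \<Rightarrow> real" where "hS \<kappa> d = sin (pi * d) / cos (pi * \<kappa>)"

locale hyp_pair =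
  fixes \<kappa> d :: real
  assumes d0: "0 < d" and d\<kappa>: "d < 1 / 2 - \<bar>\<kappa>\<bar>"
begin

sublocale p: hyp_angle \<kappa> d using d0 d\<kappa> by unfold_locales auto
sublocale m: hyp_angle "- \<kappa>" d using d0 d\<kappa> by unfold_locales auto

abbreviation "\<tau> x \<equiv> tan (x / 2)"
abbreviation "F \<equiv> hF \<kappa> d"
abbreviation "Q \<equiv> hQ \<kappa> d"
abbreviation "G \<equiv> hF (- \<kappa>) d"
abbreviation "P \<equiv> hQ (- \<kappa>) d"
abbreviation "Hp \<equiv> wt_H \<kappa> d"
abbreviation "Hm \<equiv> wt_H (- \<kappa>) d"
abbreviation "S \<equiv> hS \<kappa> d"

lemma hyp_pair_minus: "hyp_pair (- \<kappa>) d"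
  using d0 d\<kappa> by unfold_locales auto

lemma hS_minus: "hS (- \<kappa>) d = S"
  by (simp add: hS_def)

lemma sum_eq_H: "suminf p.u = Hp" "suminf m.u = Hm"
  unfolding wt_H_def by (rule gauss_sum; use d0 d\<kappa> in auto)+

lemma H_pos: "0 < Hp" "0 < Hm"
  using wt_H_pos d0 d\<kappa> by auto

lemma F_bounds: "0 < x \<Longrightarrow> x < pi \<Longrightarrow> Hp \<le> F x" "0 < x \<Longrightarrow> x < pi \<Longrightarrow> F x \<le> 1"
  using p.hF_bounds sum_eq_H by auto

lemma F_at_pi: "(F \<longlongrightarrow> Hp) (at_left pi)"
  using p.hF_at_pi sum_eq_H by simp

lemma G_at_pi: "(G \<longlongrightarrow> Hm) (at_left pi)"
  using m.hF_at_pi sum_eq_H by simp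

lemma powr_cancel: "0 < x \<Longrightarrow> x < pi \<Longrightarrow> \<tau> x powr a * \<tau> x powr (- a) = 1"
  using half_angle[of x] by (simp add: powr_minus)

lemma Q_mono: "0 < x \<Longrightarrow> x \<le> y \<Longrightarrow> y < pi \<Longrightarrow> Q x \<le> Q y"
proof (rule DERIV_nonneg_imp_nondecreasing[of x y Q])
  fix z assume "0 < x" "y < pi" "x \<le> z" "z \<le> y"
  then have z: "0 < z" "z < pi" by auto
  show "\<exists>D. (Q has_real_derivative D) (at z) \<and> 0 \<le> D"
    using p.hQ_deriv[OF z] F_bounds(1)[OF z] H_pos d0 by (intro exI conjI) auto
qed

lemma Q_nonneg: assumes x: "0 < x" "x < pi" shows "0 \<le> Q x"
proof (rule tendsto_upperbound[OF p.hQ_at_0])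
  show "\<forall>\<^sub>F y in at_right 0. Q y \<le> Q x"
    using eventually_at_right_0[OF x(1)] by eventually_elim (use x Q_mono in auto)
qed simp

text \<open>Reflecting x in \<pi> / 2 inverts the tangent and thus exchanges \<kappa> and -
  \<kappa>, so (G(\<pi> - x), - P(\<pi> - x)) solves the same system as (F, Q). Up to sign this is
  the Wronskian of the two solutions.\<close>

definition "crossing x = F x * P (pi - x) + Q x * G (pi - x)"

lemma crossing_const:
  assumes "0 < x" "x < pi" "0 < y" "y < pi"
  shows "crossing x = crossing y"
proof (rule has_deriv_zero_const[of 0 pi crossing, OF _ assms])
  fix x assume x: "0 < x" "x < pi"
  then have y: "0 < pi - x" "pi - x < pi" by auto
  let ?a = "\<tau> x powr (2 * \<kappa>)" and ?b = "\<tau> x powr (- (2 * \<kappa>))"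
  have t: "\<tau> (pi - x) powr (2 * \<kappa>) = ?b" "\<tau> (pi - x) powr (- (2 * \<kappa>)) = ?a"
    using tan_half_reflect_powr[OF x] by simp_all
  have refl': "((\<lambda>x. pi - x) has_real_derivative - 1) (at x)"
    by (auto intro!: derivative_eq_intros)
  have dP: "((\<lambda>x. P (pi - x)) has_real_derivative d * ?a * G (pi - x) * (- 1)) (at x)"
    using DERIV_chain2[OF m.hQ_deriv[OF y] refl'] t by simp
  have dG: "((\<lambda>x. G (pi - x)) has_real_derivative - d * ?b * P (pi - x) * (- 1)) (at x)"
    using DERIV_chain2[OF m.hF_deriv[OF y] refl'] t by simp
  have "(crossing has_real_derivative
      (- d * ?b * Q x) * P (pi - x) + (d * ?a * G (pi - x) * (- 1)) * F x
      + ((d * ?a * F x) * G (pi - x) + (- d * ?b * P (pi - x) * (- 1)) * Q x)) (at x)"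
    unfolding crossing_def[abs_def]
    by (intro DERIV_add DERIV_mult p.hF_deriv p.hQ_deriv dP dG x)
  then show "(crossing has_real_derivative 0) (at x)" by (simp add: algebra_simps)
qed

definition "S0 = crossing (pi / 2)"

lemma crossing_eq: "0 < x \<Longrightarrow> x < pi \<Longrightarrow> crossing x = S0"
  unfolding S0_def by (rule crossing_const) auto

text \<open>At \<pi> the reflected functions take their values at 0, namely P = 0 and G = 1, so the
  constant \<open>crossing\<close> is itself the limit of Q. This avoids the behaviour of the
  differentiated series at v = 1.\<close>

lemma Q_at_pi0: "(Q \<longlongrightarrow> S0) (at_left pi)"
proof -
  have ev: "eventually (\<lambda>x. 0 < x \<and> x < pi) (at_left pi)" by (rule eventually_at_left_pi) simp
  have lim: "((\<lambda>x. (S0 - F x * P (pi - x)) / G (pi - x)) \<longlongrightarrow> (S0 - Hp * 0) / 1) (at_left pi)"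
    by (intro tendsto_divide tendsto_diff tendsto_const tendsto_mult F_at_pi tendsto_reflect m.hQ_at_0 m.hF_at_0) simp
  have "eventually (\<lambda>x. (S0 - F x * P (pi - x)) / G (pi - x) = Q x) (at_left pi)"
    using ev
  proof eventually_elim
    case (elim x)
    have "0 < G (pi - x)" using m.hF_bounds(1)[of "pi - x"] sum_eq_H(2) H_pos(2) elim by auto
    then show ?case using crossing_eq[of x] elim by (simp add: crossing_def divide_simps)
  qed
  with lim show ?thesis by (simp add: tendsto_cong)
qed

lemma P_at_pi0: "(P \<longlongrightarrow> S0) (at_left pi)"
proof -
  have ev: "eventually (\<lambda>x. 0 < x \<and> x < pi) (at_left pi)" by (rule eventually_at_left_pi) simp
  have lim: "((\<lambda>x. (S0 - Q (pi - x) * G x) / F (pi - x)) \<longlongrightarrow> (S0 - 0 * Hm) / 1) (at_left pi)"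
    by (intro tendsto_divide tendsto_diff tendsto_const tendsto_mult G_at_pi tendsto_reflect p.hQ_at_0 p.hF_at_0) simp
  have "eventually (\<lambda>x. (S0 - Q (pi - x) * G x) / F (pi - x) = P x) (at_left pi)"
    using ev
  proof eventually_elim
    case (elim x)
    have "0 < F (pi - x)" using F_bounds(1)[of "pi - x"] H_pos elim by auto
    then show ?case using crossing_eq[of "pi - x"] elim
      by (simp add: crossing_def divide_simps mult.commute[of "P x"])
  qed
  with lim show ?thesis by (simp add: tendsto_cong)
qed

text \<open>The pair (- P, G) solves the same system as (F, Q). The Wronskian is constant and its
  limit at 0 is 1.\<close>

lemma wronskian:
  assumes x: "0 < x" "x < pi"
  shows "F x * G x + Q x * P x = 1"
proof -
  let ?w = "\<lambda>x. F x * G x + Q x * P x"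
  have d: "(?w has_real_derivative 0) (at x)" if x: "0 < x" "x < pi" for x
  proof -
    let ?a = "\<tau> x powr (2 * \<kappa>)" and ?b = "\<tau> x powr (- (2 * \<kappa>))"
    have "(?w has_real_derivative
      (- d * ?b * Q x) * G x + (- d * \<tau> x powr (- (2 * - \<kappa>)) * P x) * F x
      + ((d * ?a * F x) * P x + (d * \<tau> x powr (2 * - \<kappa>) * G x) * Q x)) (at x)"
      by (intro DERIV_add DERIV_mult p.hF_deriv p.hQ_deriv m.hF_deriv m.hQ_deriv x)
    then show ?thesis by (simp add: algebra_simps)
  qed
  have "(?w \<longlongrightarrow> 1 * 1 + 0 * 0) (at_right 0)"
    by (intro tendsto_add tendsto_mult p.hF_at_0 m.hF_at_0 p.hQ_at_0 m.hQ_at_0)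
  moreover have "eventually (\<lambda>y. ?w y = ?w x) (at_right 0)"
    using eventually_at_right_0[OF pi_gt_zero] by eventually_elim (rule has_deriv_zero_const[OF d]; use x in auto)
  then have "(?w \<longlongrightarrow> ?w x) (at_right 0)" by (rule tendsto_eventually)
  ultimately show ?thesis using tendsto_unique[of "at_right (0::real)" ?w] by fastforce
qed

text \<open>The Wronskian identity at \<pi> together with \<open>wt_H_mult\<close> determines the
  square of \<open>S0\<close>; its sign follows from Q \<ge> 0.\<close>

lemma S0_eq: "S0 = S"
proof -
  have "((\<lambda>x. F x * G x + Q x * P x) \<longlongrightarrow> Hp * Hm + S0 * S0) (at_left pi)"
    by (intro tendsto_add tendsto_mult F_at_pi G_at_pi Q_at_pi0 P_at_pi0)
  moreover have "eventually (\<lambda>y. F y * G y + Q y * P y = 1) (at_left pi)"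
    using eventually_at_left_pi[OF pi_gt_zero] by eventually_elim (simp add: wronskian)
  then have "((\<lambda>x. F x * G x + Q x * P x) \<longlongrightarrow> 1) (at_left pi)" by (rule tendsto_eventually)
  ultimately have "Hp * Hm + S0 * S0 = 1"
    using tendsto_unique[of "at_left pi"] by fastforce
  then have "S0\<^sup>2 = S\<^sup>2" using wt_H_mult[OF d0 d\<kappa>] by (simp add: hS_def power2_eq_square)
  moreover have "0 \<le> S0"
  proof (rule tendsto_lowerbound[OF Q_at_pi0])
    show "\<forall>\<^sub>F x in at_left pi. 0 \<le> Q x"
      using eventually_at_left_pi[OF pi_gt_zero] by eventually_elim (simp add: Q_nonneg)
  qed simp
  moreover have "0 \<le> S"
  proof -
    have "0 < cos (pi * \<kappa>)" by (rule cos_pi_pos) (use d0 d\<kappa> in linarith)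
    moreover have "0 \<le> sin (pi * d)" by (rule sin_ge_zero) (use d0 d\<kappa> in auto)
    ultimately show ?thesis by (simp add: hS_def)
  qed
  ultimately show ?thesis by (simp add: power2_eq_iff_nonneg)
qed

lemmas Q_at_pi = Q_at_pi0[unfolded S0_eq] and P_at_pi = P_at_pi0[unfolded S0_eq]

lemma HH: "Hp * Hm = 1 - S\<^sup>2"
  using wt_H_mult[OF d0 d\<kappa>] by (simp add: hS_def)

lemma Q_le_S: assumes x: "0 < x" "x < pi" shows "Q x \<le> S"
proof (rule tendsto_lowerbound[OF Q_at_pi])
  show "\<forall>\<^sub>F y in at_left pi. Q x \<le> Q y"
    using eventually_at_left_pi[OF x(2)] by eventually_elim (use x Q_mono in auto)
qed simp

lemma cont:
  assumes "0 < x" "x < pi"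
  shows "isCont F x" "isCont Q x" "isCont G x" "isCont P x" "isCont (\<lambda>x. \<tau> x powr a) x"
  using assms p.hF_deriv p.hQ_deriv m.hF_deriv m.hQ_deriv p.\<tau>_powr_deriv by (blast intro: DERIV_isCont)+

text \<open>Up to the factor d F, which is bounded below by d times \<open>Hp\<close>, the power of
  the tangent is the derivative of Q, and Q has finite limits at both ends.\<close>

lemma tau_powr_integrable:
  "set_integrable lborel {0<..<pi} (\<lambda>x. \<tau> x powr (2 * \<kappa>))"
proof -
  have "set_integrable lborel (einterval (ereal 0) (ereal pi)) (\<lambda>x. d * \<tau> x powr (2 * \<kappa>) * F x)"
  proof (rule interval_integral_FTC_nonneg(1)[where F = Q and A = 0 and B = S])
    show "((Q \<circ> real_of_ereal) \<longlongrightarrow> 0) (at_right (ereal 0))" using p.hQ_at_0 by (simp add: ereal_tendsto_simps)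
    show "((Q \<circ> real_of_ereal) \<longlongrightarrow> S) (at_left (ereal pi))" using Q_at_pi by (simp add: ereal_tendsto_simps)
    show "AE x in lborel. ereal 0 < ereal x \<longrightarrow> ereal x < ereal pi \<longrightarrow> 0 \<le> d * \<tau> x powr (2 * \<kappa>) * F x"
    proof (intro always_eventually allI impI)
      fix x assume "ereal 0 < ereal x" "ereal x < ereal pi"
      then have "Hp \<le> F x" using F_bounds(1) by simp
      then show "0 \<le> d * \<tau> x powr (2 * \<kappa>) * F x" using H_pos(1) d0 by simp
    qed
  qed (use p.hQ_deriv cont in \<open>auto intro!: continuous_intros\<close>)
  then have i: "set_integrable lborel {0<..<pi} (\<lambda>x. d * \<tau> x powr (2 * \<kappa>) * F x)" by simp
  have "set_integrable lborel {0<..<pi} (\<lambda>x. (1 / (d * Hp)) * (d * \<tau> x powr (2 * \<kappa>) * F x))"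
    using i by (rule set_integrable_mult_right)
  then show ?thesis
  proof (rule set_integrable_bound)
    show "set_borel_measurable lborel {0<..<pi} (\<lambda>x. \<tau> x powr (2 * \<kappa>))"
      unfolding set_borel_measurable_def by measurable
    show "AE x in lborel. x \<in> {0<..<pi} \<longrightarrow> norm (\<tau> x powr (2 * \<kappa>)) \<le> norm ((1 / (d * Hp)) * (d * \<tau> x powr (2 * \<kappa>) * F x))"
    proof (intro always_eventually allI impI)
      fix x assume "x \<in> {0<..<pi}"
      then have "Hp \<le> F x" using F_bounds(1) by simp
      then have "\<tau> x powr (2 * \<kappa>) * Hp \<le> \<tau> x powr (2 * \<kappa>) * F x" by (intro mult_left_mono) auto
      moreover have "0 \<le> F x" using \<open>Hp \<le> F x\<close> H_pos(1) by simp
      ultimately show "norm (\<tau> x powr (2 * \<kappa>)) \<le> norm ((1 / (d * Hp)) * (d * \<tau> x powr (2 * \<kappa>) * F x))"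
        using H_pos(1) d0 by (simp add: abs_mult divide_simps mult_ac)
    qed
  qed
qed

end

section \<open>Continuity of the solutions in the parameter d\<close>

lemma (in hyp_series) hcoef_le: "\<bar>hcoef c d n\<bar> \<le> 1 + 1 / c"
  by (rule u_le_one)

lemma tendsto_pochhammer:
  fixes f :: "'a \<Rightarrow> real"
  assumes "(f \<longlongrightarrow> a) A" shows "((\<lambda>x. pochhammer (f x) n) \<longlongrightarrow> pochhammer a n) A"
  unfolding pochhammer_prod by (intro tendsto_prod tendsto_add assms tendsto_const)

lemma tendsto_hcoef:
  assumes "e \<longlonglongrightarrow> d" "0 < c"
  shows "(\<lambda>n. hcoef c (e n) k) \<longlonglongrightarrow> hcoef c d k"
  unfolding hcoef_def
  by (intro tendsto_divide tendsto_mult tendsto_pochhammer tendsto_minus assms tendsto_const)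
     (use pochhammer_pos[OF assms(2), of k] in simp)

lemma tendsto_hF:
  assumes e: "e \<longlonglongrightarrow> d" "\<And>n. 0 < e n" "\<And>n. e n < 1" and \<kappa>: "- 1 / 2 < \<kappa>" and x: "0 < x" "x < pi"
  shows "(\<lambda>n. hF \<kappa> (e n) x) \<longlonglongrightarrow> hF \<kappa> d x"
proof -
  let ?v = "(sin (x / 2))\<^sup>2" and ?c = "1 / 2 + \<kappa>"
  have c: "0 < ?c" using \<kappa> by simp
  have v: "norm ?v < 1" using half_angle[OF x] by simp
  have "(\<lambda>n. suminf (\<lambda>k. hcoef ?c (e n) k * ?v ^ k)) \<longlonglongrightarrow> suminf (\<lambda>k. hcoef ?c d k * ?v ^ k)"
  proof (rule tannerys_theorem[where M = "\<lambda>k. (1 + 1 / ?c) * ?v ^ k", THEN conjunct2, THEN conjunct2])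
    show "(\<lambda>n. hcoef ?c (e n) k * ?v ^ k) \<longlonglongrightarrow> hcoef ?c d k * ?v ^ k" for k
      by (intro tendsto_mult tendsto_const tendsto_hcoef e c)
    have "\<bar>hcoef ?c (e n) k\<bar> \<le> 1 + 1 / ?c" for n k
    proof -
      interpret hyp_series ?c "e n" using c e by unfold_locales auto
      show ?thesis by (rule hcoef_le)
    qed
    then have "norm (hcoef ?c (e n) k * ?v ^ k) \<le> (1 + 1 / ?c) * ?v ^ k" for n k
      by (simp add: abs_mult mult_right_mono)
    then show "\<forall>\<^sub>F (k, n) in at_top \<times>\<^sub>F sequentially. norm (hcoef ?c (e n) k * ?v ^ k) \<le> (1 + 1 / ?c) * ?v ^ k"
      by (intro always_eventually) auto
    show "summable (\<lambda>k. (1 + 1 / ?c) * ?v ^ k)" by (intro summable_mult summable_geometric v)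
  qed simp
  then show ?thesis by (simp add: hF_def eval_fps_def hfps_nth)
qed

lemma tendsto_hQ:
  assumes e: "e \<longlonglongrightarrow> d" "\<And>n. 0 < e n" "\<And>n. e n < 1" "0 < d" and \<kappa>: "- 1 / 2 < \<kappa>" and x: "0 < x" "x < pi"
  shows "(\<lambda>n. hQ \<kappa> (e n) x) \<longlonglongrightarrow> hQ \<kappa> d x"
proof -
  let ?v = "(sin (x / 2))\<^sup>2" and ?c = "1 / 2 + \<kappa>"
  have c: "0 < ?c" using \<kappa> by simp
  have v: "norm ?v < 1" using half_angle[OF x] by simp
  have "(\<lambda>n. suminf (\<lambda>k. of_nat (Suc k) * hcoef ?c (e n) (Suc k) * ?v ^ k)) \<longlonglongrightarrow> suminf (\<lambda>k. of_nat (Suc k) * hcoef ?c d (Suc k) * ?v ^ k)"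
  proof (rule tannerys_theorem[where M = "\<lambda>k. (1 + 1 / ?c) * (of_nat (Suc k) * ?v ^ k)", THEN conjunct2, THEN conjunct2])
    show "(\<lambda>n. of_nat (Suc k) * hcoef ?c (e n) (Suc k) * ?v ^ k) \<longlonglongrightarrow> of_nat (Suc k) * hcoef ?c d (Suc k) * ?v ^ k" for k
      by (intro tendsto_mult tendsto_const tendsto_hcoef e c)
    have le: "\<bar>hcoef ?c (e n) k\<bar> \<le> 1 + 1 / ?c" for n k
    proof -
      interpret hyp_series ?c "e n" using c e by unfold_locales auto
      show ?thesis by (rule hcoef_le)
    qed
    have "norm (of_nat (Suc k) * hcoef ?c (e n) (Suc k) * ?v ^ k) \<le> (1 + 1 / ?c) * (of_nat (Suc k) * ?v ^ k)" for n k
    proof -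
      have "norm (of_nat (Suc k) * hcoef ?c (e n) (Suc k) * ?v ^ k) = \<bar>hcoef ?c (e n) (Suc k)\<bar> * (of_nat (Suc k) * ?v ^ k)"
        by (simp add: abs_mult mult_ac)
      also have "\<dots> \<le> (1 + 1 / ?c) * (of_nat (Suc k) * ?v ^ k)" by (intro mult_right_mono le) simp
      finally show ?thesis .
    qed
    then show "\<forall>\<^sub>F (k, n) in at_top \<times>\<^sub>F sequentially. norm (of_nat (Suc k) * hcoef ?c (e n) (Suc k) * ?v ^ k) \<le> (1 + 1 / ?c) * (of_nat (Suc k) * ?v ^ k)"
      by (intro always_eventually) auto
    show "summable (\<lambda>k. (1 + 1 / ?c) * (of_nat (Suc k) * ?v ^ k))"
      using geometric_deriv_sums[OF v] by (intro summable_mult) (rule sums_summable)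
  qed simp
  then have "(\<lambda>n. eval_fps (fps_deriv (hfps ?c (e n))) ?v) \<longlonglongrightarrow> eval_fps (fps_deriv (hfps ?c d)) ?v"
    by (simp add: eval_fps_def hfps_nth)
  then show ?thesis unfolding hQ_def using e(4)
    by (intro tendsto_mult tendsto_minus tendsto_divide tendsto_const e(1)) auto
qed

section \<open>The Lagrange identity between the systems for two parameters\<close>

context hyp_pair begin

text \<open>Two nonnegative numbers with product 1. The sum of the two powers therefore also
  majorises bounded functions, and one majorant serves for all integrability claims.\<close>

lemma tau_sum_ge_1: "0 < x \<Longrightarrow> x < pi \<Longrightarrow> 1 \<le> \<tau> x powr (2 * \<kappa>) + \<tau> x powr (- (2 * \<kappa>))"
proof -
  assume x: "0 < x" "x < pi"
  let ?a = "\<tau> x powr (2 * \<kappa>)" and ?b = "\<tau> x powr (- (2 * \<kappa>))"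
  have ab: "?a * ?b = 1" using powr_cancel[OF x] .
  have nn: "0 \<le> ?a" "0 \<le> ?b" by simp_all
  show ?thesis
  proof (rule ccontr)
    assume "\<not> 1 \<le> ?a + ?b"
    then have "?a < 1" "?b \<le> 1" using nn by linarith+
    then have "?a * ?b < 1" using mult_left_mono[of ?b 1 ?a] nn by simp
    then show False using ab by simp
  qed
qed

lemma dominated_integrable:
  assumes c: "\<And>x. 0 < x \<Longrightarrow> x < pi \<Longrightarrow> isCont g x"
    and b: "\<And>x. 0 < x \<Longrightarrow> x < pi \<Longrightarrow> \<bar>g x\<bar> \<le> C * (\<tau> x powr (2 * \<kappa>) + \<tau> x powr (- (2 * \<kappa>)))"
  shows "set_integrable lborel {0<..<pi} (g :: real \<Rightarrow> real)"
proof -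
  interpret n: hyp_pair "- \<kappa>" d by (rule hyp_pair_minus)
  have "set_integrable lborel {0<..<pi} (\<lambda>x. C * (\<tau> x powr (2 * \<kappa>) + \<tau> x powr (2 * - \<kappa>)))"
    by (intro set_integrable_mult_right set_integral_add tau_powr_integrable n.tau_powr_integrable)
  then show ?thesis
  proof (rule set_integrable_bound)
    have "continuous_on {0<..<pi} g" using c by (intro continuous_at_imp_continuous_on) auto
    then show "set_borel_measurable lborel {0<..<pi} g"
      unfolding set_borel_measurable_def using borel_measurable_continuous_on_indicator[of "{0<..<pi}" g] by simp
    show "AE x in lborel. x \<in> {0<..<pi} \<longrightarrow> norm (g x) \<le> norm (C * (\<tau> x powr (2 * \<kappa>) + \<tau> x powr (2 * - \<kappa>)))"
      using b by (intro always_eventually) force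
  qed
qed

abbreviation "I0 g \<equiv> set_lebesgue_integral lborel {0<..<pi} (g :: real \<Rightarrow> real)"

lemma FTC:
  assumes f: "\<And>x. 0 < x \<Longrightarrow> x < pi \<Longrightarrow> (f has_real_derivative g x) (at x)"
    and c: "\<And>x. 0 < x \<Longrightarrow> x < pi \<Longrightarrow> isCont g x"
    and i: "set_integrable lborel {0<..<pi} g"
    and a: "(f \<longlongrightarrow> a) (at_right 0)" and b: "(f \<longlongrightarrow> b) (at_left pi)"
  shows "I0 g = b - a"
proof -
  have "(LBINT x=ereal 0..ereal pi. g x) = b - a"
  proof (rule interval_integral_FTC_integrable[where F = f])
    show "(f has_vector_derivative g x) (at x)" if "ereal 0 < ereal x" "ereal x < ereal pi" for x
      using f[of x] that by (simp add: has_real_derivative_iff_has_vector_derivative)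
    show "set_integrable lborel (einterval (ereal 0) (ereal pi)) g" using i by simp
    show "((f \<circ> real_of_ereal) \<longlongrightarrow> a) (at_right (ereal 0))" "((f \<circ> real_of_ereal) \<longlongrightarrow> b) (at_left (ereal pi))"
      using a b by (simp_all add: ereal_tendsto_simps)
  qed (use c in auto)
  then show ?thesis by (simp add: interval_lebesgue_integral_def)
qed

text \<open>Up to the factor e - d, the derivative of the Wronskian of the solutions for d and
  e.\<close>

definition "pairing e x = \<tau> x powr (2 * \<kappa>) * F x * hF \<kappa> e x + \<tau> x powr (- (2 * \<kappa>)) * Q x * hQ \<kappa> e x"

lemma S_bound: "0 \<le> hS \<kappa> e \<and> hS \<kappa> e \<le> 1 / cos (pi * \<kappa>)" if "hyp_pair \<kappa> e"
proof -
  interpret e: hyp_pair \<kappa> e by fact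
  have "0 < cos (pi * \<kappa>)" by (rule cos_pi_pos) (use d0 d\<kappa> in linarith)
  moreover have "0 \<le> sin (pi * e)" by (rule sin_ge_zero) (use e.d0 e.d\<kappa> in auto)
  ultimately show ?thesis by (simp add: hS_def divide_right_mono)
qed

lemma pairing_bound:
  assumes e: "hyp_pair \<kappa> e" and x: "0 < x" "x < pi"
  shows "\<bar>pairing e x\<bar> \<le> (1 + (1 / cos (pi * \<kappa>))\<^sup>2) * (\<tau> x powr (2 * \<kappa>) + \<tau> x powr (- (2 * \<kappa>)))"
proof -
  interpret e: hyp_pair \<kappa> e by fact
  let ?a = "\<tau> x powr (2 * \<kappa>)" and ?b = "\<tau> x powr (- (2 * \<kappa>))" and ?B = "1 / cos (pi * \<kappa>)"
  have F: "0 \<le> F x" "F x \<le> 1" "0 \<le> e.F x" "e.F x \<le> 1"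
    using F_bounds[OF x] e.F_bounds[OF x] H_pos e.H_pos by auto
  have Q: "0 \<le> Q x" "Q x \<le> ?B" "0 \<le> e.Q x" "e.Q x \<le> ?B"
    using Q_nonneg[OF x] e.Q_nonneg[OF x] Q_le_S[OF x] e.Q_le_S[OF x] S_bound[OF e] S_bound[OF hyp_pair_axioms] by auto
  have B: "0 \<le> ?B" using Q by linarith
  have "?a * F x * e.F x \<le> ?a * 1 * 1" using F by (intro mult_mono) auto
  moreover have "?b * Q x * e.Q x \<le> ?b * ?B * ?B"
    using Q B by (intro mult_mono mult_nonneg_nonneg) (auto simp del: zero_le_divide_1_iff)
  moreover have "0 \<le> ?a * F x * e.F x" "0 \<le> ?b * Q x * e.Q x" using F Q by simp_all
  ultimately have "\<bar>pairing e x\<bar> \<le> ?a + ?b * ?B * ?B" unfolding pairing_def by simp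
  also have "\<dots> \<le> (1 + ?B\<^sup>2) * (?a + ?b)"
  proof -
    have "(1 + ?B\<^sup>2) * (?a + ?b) - (?a + ?b * ?B * ?B) = ?b + ?B\<^sup>2 * ?a"
      by (simp add: algebra_simps power2_eq_square)
    moreover have "0 \<le> ?b + ?B\<^sup>2 * ?a" by simp
    ultimately show ?thesis by linarith
  qed
  finally show ?thesis .
qed

lemma pairing_integrable: "hyp_pair \<kappa> e \<Longrightarrow> set_integrable lborel {0<..<pi} (pairing e)"
proof (rule dominated_integrable[OF _ pairing_bound])
  assume "hyp_pair \<kappa> e"
  then interpret e: hyp_pair \<kappa> e .
  show "isCont (pairing e) x" if "0 < x" "x < pi" for x
    unfolding pairing_def[abs_def] by (intro continuous_intros cont e.cont that)
qed auto

text \<open>At e = d both sides vanish, so the value at d itself is only reached as a limit of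
  difference quotients.\<close>

lemma pairing_integral:
  assumes "hyp_pair \<kappa> e" shows "(e - d) * I0 (pairing e) = Hp * hS \<kappa> e - S * wt_H \<kappa> e"
proof -
  interpret e: hyp_pair \<kappa> e by fact
  have "I0 (\<lambda>x. (e - d) * pairing e x) = (Hp * hS \<kappa> e - S * wt_H \<kappa> e) - (1 * 0 - 0 * 1)"
  proof (rule FTC[where f = "\<lambda>x. F x * e.Q x - Q x * e.F x"])
    fix x assume x: "0 < x" "x < pi"
    let ?a = "\<tau> x powr (2 * \<kappa>)" and ?b = "\<tau> x powr (- (2 * \<kappa>))"
    have "((\<lambda>x. F x * e.Q x - Q x * e.F x) has_real_derivative
       ((- d * ?b * Q x) * e.Q x + (e * ?a * e.F x) * F x) - ((d * ?a * F x) * e.F x + (- e * ?b * e.Q x) * Q x)) (at x)"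
      by (intro DERIV_diff DERIV_mult p.hF_deriv p.hQ_deriv e.p.hF_deriv e.p.hQ_deriv x)
    then show "((\<lambda>x. F x * e.Q x - Q x * e.F x) has_real_derivative (e - d) * pairing e x) (at x)"
      by (simp add: pairing_def algebra_simps)
    show "isCont (\<lambda>x. (e - d) * pairing e x) x"
      unfolding pairing_def[abs_def] by (intro continuous_intros cont e.cont x)
  next
    show "set_integrable lborel {0<..<pi} (\<lambda>x. (e - d) * pairing e x)"
      by (intro set_integrable_mult_right pairing_integrable assms)
    show "((\<lambda>x. F x * e.Q x - Q x * e.F x) \<longlongrightarrow> 1 * 0 - 0 * 1) (at_right 0)"
      by (intro tendsto_diff tendsto_mult p.hF_at_0 p.hQ_at_0 e.p.hF_at_0 e.p.hQ_at_0)
    show "((\<lambda>x. F x * e.Q x - Q x * e.F x) \<longlongrightarrow> Hp * hS \<kappa> e - S * wt_H \<kappa> e) (at_left pi)"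
      by (intro tendsto_diff tendsto_mult F_at_pi Q_at_pi e.F_at_pi e.Q_at_pi)
  qed
  then show ?thesis by simp
qed

text \<open>A sequence tending to d but never equal to it; the denominator starts at 2 to stay
  strictly below the upper bound 1 / 2 - |\<kappa>|.\<close>

definition "perturb n = d + (1 / 2 - \<bar>\<kappa>\<bar> - d) / (real n + 2)"

lemma perturb: "hyp_pair \<kappa> (perturb n)" "perturb n \<noteq> d" "perturb \<longlonglongrightarrow> d"
proof -
  have r: "0 < 1 / 2 - \<bar>\<kappa>\<bar> - d" using d\<kappa> by simp
  have "0 < (1 / 2 - \<bar>\<kappa>\<bar> - d) / (real n + 2)" using r by (intro divide_pos_pos) auto
  moreover have "(1 / 2 - \<bar>\<kappa>\<bar> - d) / (real n + 2) < (1 / 2 - \<bar>\<kappa>\<bar> - d) / 1"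
    using r by (intro divide_strict_left_mono) auto
  ultimately show "hyp_pair \<kappa> (perturb n)" "perturb n \<noteq> d"
    using d0 by (auto simp: perturb_def intro!: hyp_pair.intro)
  have "filterlim (\<lambda>n. real n + 2) at_top sequentially"
    by (intro filterlim_tendsto_add_at_top filterlim_real_sequentially filterlim_at_top_add_at_top
        filterlim_tendsto_add_at_top[OF tendsto_const, of _ _ 2, simplified add.commute])
  then have "(\<lambda>n. d + (1 / 2 - \<bar>\<kappa>\<bar> - d) / (real n + 2)) \<longlonglongrightarrow> d + 0"
    by (intro tendsto_add tendsto_const real_tendsto_divide_at_top[OF tendsto_const])
  then show "perturb \<longlonglongrightarrow> d" by (simp add: perturb_def[abs_def])
qed

lemma pairing_limit: "(\<lambda>n. I0 (pairing (perturb n))) \<longlonglongrightarrow> I0 (pairing d)"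
proof -
  interpret n: hyp_pair "- \<kappa>" d by (rule hyp_pair_minus)
  let ?w = "\<lambda>x. (1 + (1 / cos (pi * \<kappa>))\<^sup>2) * (\<tau> x powr (2 * \<kappa>) + \<tau> x powr (- (2 * \<kappa>)))"
  have w: "set_integrable lborel {0<..<pi} ?w"
    using n.tau_powr_integrable by (intro set_integrable_mult_right set_integral_add tau_powr_integrable) simp
  have meas: "hyp_pair \<kappa> e \<Longrightarrow> (\<lambda>x. indicator {0<..<pi} x *\<^sub>R pairing e x) \<in> borel_measurable lborel" for e
    using pairing_integrable[of e] unfolding set_integrable_def by (rule borel_measurable_integrable)
  show ?thesis
    unfolding set_lebesgue_integral_def
  proof (rule integral_dominated_convergence[where w = "\<lambda>x. indicator {0<..<pi} x *\<^sub>R ?w x"])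
    show "(\<lambda>x. indicator {0<..<pi} x *\<^sub>R pairing d x) \<in> borel_measurable lborel"
      by (rule meas) (rule hyp_pair_axioms)
    show "(\<lambda>x. indicator {0<..<pi} x *\<^sub>R pairing (perturb n) x) \<in> borel_measurable lborel" for n
      by (rule meas) (rule perturb)
    show "integrable lborel (\<lambda>x. indicator {0<..<pi} x *\<^sub>R ?w x)" using w by (simp add: set_integrable_def)
    show "AE x in lborel. norm (indicator {0<..<pi} x *\<^sub>R pairing (perturb n) x) \<le> indicator {0<..<pi} x *\<^sub>R ?w x" for n
      using pairing_bound[OF perturb(1)] by (intro always_eventually) (auto simp: indicator_def)
    have pd: "0 < perturb n" "perturb n < 1" for n
      using hyp_pair.d0[OF perturb(1)] hyp_pair.d\<kappa>[OF perturb(1), of n] by auto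
    have "(\<lambda>n. pairing (perturb n) x) \<longlonglongrightarrow> pairing d x" if x: "0 < x" "x < pi" for x
      unfolding pairing_def using p.\<kappa> d0
      by (intro tendsto_add tendsto_mult tendsto_const tendsto_hF tendsto_hQ perturb pd x) auto
    then show "AE x in lborel. (\<lambda>n. indicator {0<..<pi} x *\<^sub>R pairing (perturb n) x) \<longlonglongrightarrow> indicator {0<..<pi} x *\<^sub>R pairing d x"
      by (intro always_eventually allI) (auto simp: indicator_def)
  qed
qed

definition "S' = pi * cos (pi * d) / cos (pi * \<kappa>)"

lemma S_deriv: "(hS \<kappa> has_real_derivative S') (at d)"
  unfolding hS_def[abs_def] S'_def
  by (rule DERIV_cdivide) (auto intro!: derivative_eq_intros)

lemma pairing_value:
  assumes h: "(wt_H \<kappa> has_real_derivative h) (at d)"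
  shows "I0 (pairing d) = Hp * S' - S * h"
proof -
  have q: "(\<lambda>n. (f (perturb n) - f d) / (perturb n - d)) \<longlonglongrightarrow> f'" if "(f has_real_derivative f') (at d)" for f f'
  proof -
    have "((\<lambda>y. (f y - f d) / (y - d)) \<longlongrightarrow> f') (at d)" using that by (simp add: has_field_derivative_iff)
    moreover have "filterlim perturb (at d) sequentially"
      unfolding filterlim_at using perturb by auto
    ultimately show ?thesis by (rule filterlim_compose)
  qed
  have "(\<lambda>n. Hp * ((hS \<kappa> (perturb n) - hS \<kappa> d) / (perturb n - d)) - S * ((wt_H \<kappa> (perturb n) - wt_H \<kappa> d) / (perturb n - d)))
      \<longlonglongrightarrow> Hp * S' - S * h"
    by (intro tendsto_diff tendsto_mult tendsto_const q S_deriv h)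
  \<comment> \<open>The boundary expression vanishes at e = d; division by e - d turns it into
    difference quotients of S and H.\<close>
  moreover have "Hp * ((hS \<kappa> (perturb n) - hS \<kappa> d) / (perturb n - d)) - S * ((wt_H \<kappa> (perturb n) - wt_H \<kappa> d) / (perturb n - d))
     = I0 (pairing (perturb n))" for n
    using pairing_integral[OF perturb(1)[of n]] perturb(2)[of n] by (simp add: divide_simps) (simp add: algebra_simps)
  ultimately show ?thesis using pairing_limit LIMSEQ_unique by (simp only:)
qed

end

lemma wt_H_differentiable:
  assumes "0 < d" "d < 1 / 2 - \<bar>\<kappa>\<bar>"
  shows "\<exists>h. (wt_H \<kappa> has_real_derivative h) (at d)"
proof -
  have pos: "0 < 1 / 2 + \<kappa> + d" "0 < 1 / 2 + \<kappa> - d" using assms by auto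
  have n: "1 / 2 + \<kappa> + d \<notin> \<int>\<^sub>\<le>\<^sub>0" "1 / 2 + \<kappa> - d \<notin> \<int>\<^sub>\<le>\<^sub>0"
    using pos by (auto elim!: nonpos_Ints_cases)
  have a: "((\<lambda>e. 1 / 2 + \<kappa> + e) has_real_derivative 1) (at d)" "((\<lambda>e. 1 / 2 + \<kappa> - e) has_real_derivative - 1) (at d)"
    by (auto intro!: derivative_eq_intros)
  have b: "Gamma (1 / 2 + \<kappa> + d) * Gamma (1 / 2 + \<kappa> - d) \<noteq> 0"
    using Gamma_real_pos[OF pos(1)] Gamma_real_pos[OF pos(2)] by simp
  show ?thesis
    unfolding wt_H_def[abs_def]
    by (rule exI, rule DERIV_divide[OF DERIV_const DERIV_mult[OF DERIV_chain2[OF has_field_derivative_Gamma[OF n(1)] a(1)]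
       DERIV_chain2[OF has_field_derivative_Gamma[OF n(2)] a(2)]] b])
qed

section \<open>Trace and trace-free part of the weight, and the total mass\<close>

context hyp_pair begin

definition "c0 = cos (pi * \<kappa>) / (2 * pi * cos (pi * d))"

lemma cos_pos: "0 < cos (pi * \<kappa>)" "0 < cos (pi * d)"
  by (rule cos_pi_pos, use d0 d\<kappa> in linarith)+

lemma c0_pos: "0 < c0"
  using cos_pos by (simp add: c0_def)

text \<open>A, C and N are the two diagonal entries and the off-diagonal entry of K before the
  rotation by \<delta> m \<theta>, stripped of the powers of the tangent. They have finite limits at
  both walls; the whole singularity of K sits in these powers.\<close>

definition "A x = c0 * (Hm * (F x)\<^sup>2 + Hp * (P x)\<^sup>2)"
definition "C x = c0 * (Hm * (Q x)\<^sup>2 + Hp * (G x)\<^sup>2)"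
definition "N x = c0 * (Hm * F x * Q x - Hp * G x * P x)"
definition "T x = \<tau> x powr (2 * \<kappa>) * A x + \<tau> x powr (- (2 * \<kappa>)) * C x"
definition "V x = \<tau> x powr (2 * \<kappa>) * A x - \<tau> x powr (- (2 * \<kappa>)) * C x"
definition "W x = 2 * N x"

lemma T_integral: "I0 T = 1"
proof -
  interpret n: hyp_pair "- \<kappa>" d by (rule hyp_pair_minus)
  obtain h where h: "(wt_H \<kappa> has_real_derivative h) (at d)" using wt_H_differentiable[OF d0 d\<kappa>] ..
  obtain k where k: "(wt_H (- \<kappa>) has_real_derivative k) (at d)" using wt_H_differentiable[OF n.d0 n.d\<kappa>] ..
  have "((\<lambda>e. wt_H \<kappa> e * wt_H (- \<kappa>) e) has_real_derivative h * Hm + k * Hp) (at d)"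
    by (rule DERIV_mult[OF h k])
  \<comment> \<open>Near d the product of the two constants is 1 - S^2, so the unknown derivatives h
    and k are needed only in a combination known from S.\<close>
  moreover have "((\<lambda>e. wt_H \<kappa> e * wt_H (- \<kappa>) e) has_real_derivative - (2 * S * S')) (at d)"
  proof (rule has_field_derivative_transform_within_open[where S = "{0<..<1 / 2 - \<bar>\<kappa>\<bar>}"])
    have "((\<lambda>e. 1 - hS \<kappa> e * hS \<kappa> e) has_real_derivative 0 - (S' * S + S' * S)) (at d)"
      by (intro DERIV_diff DERIV_const DERIV_mult S_deriv)
    then show "((\<lambda>e. 1 - hS \<kappa> e * hS \<kappa> e) has_real_derivative - (2 * S * S')) (at d)" by (simp add: mult_ac)
    show "1 - hS \<kappa> e * hS \<kappa> e = wt_H \<kappa> e * wt_H (- \<kappa>) e" if "e \<in> {0<..<1 / 2 - \<bar>\<kappa>\<bar>}" for e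
      using wt_H_mult[of e \<kappa>] that by (simp add: hS_def power2_eq_square)
  qed (use d0 d\<kappa> in auto)
  ultimately have hk: "h * Hm + k * Hp = - (2 * S * S')" by (rule DERIV_unique)
  have eq: "T x = c0 * Hm * pairing d x + c0 * Hp * n.pairing d x" for x
    by (simp add: T_def A_def C_def pairing_def n.pairing_def algebra_simps power2_eq_square)
  have "I0 T = c0 * Hm * I0 (pairing d) + c0 * Hp * I0 (n.pairing d)"
    unfolding eq[abs_def] using pairing_integrable[OF hyp_pair_axioms] n.pairing_integrable[OF n.hyp_pair_axioms]
    by (subst set_integral_add) (auto intro!: set_integrable_mult_right)
  also have "\<dots> = c0 * (Hm * (Hp * S' - S * h) + Hp * (Hm * S' - S * k))"
    using n.pairing_value[OF k] unfolding pairing_value[OF h]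
    by (simp add: n.S'_def S'_def hS_minus distrib_left)
  also have "Hm * (Hp * S' - S * h) + Hp * (Hm * S' - S * k) = 2 * (Hp * Hm) * S' - S * (h * Hm + k * Hp)"
    by (simp add: algebra_simps)
  \<comment> \<open>The terms are 2 (1 - S^2) S' and 2 S^2 S'. The prefactor \<open>c0\<close> of
    the weight is exactly 1 / (2 S').\<close>
  also have "\<dots> = 2 * S'" unfolding hk HH by (simp add: algebra_simps power2_eq_square)
  also have "c0 * (2 * S') = 1" using cos_pos by (simp add: c0_def S'_def)
  finally show ?thesis .
qed

end

text \<open>The quotient sin (n x) / sin x as a trigonometric polynomial, in effect a Chebyshev
  polynomial of the second kind in cos x.\<close>

definition cos_sum :: "nat \<Rightarrow> real \<Rightarrow> real" where
  "cos_sum n x = (\<Sum>j<n. cos (real_of_int (int n - 1 - 2 * int j) * x))"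

lemma sin_cos_sum: "sin x * cos_sum n x = sin (real n * x)"
proof -
  have "2 * (sin x * cos_sum n x) = (\<Sum>j<n. sin (real_of_int (int n - 2 * int j) * x) - sin (real_of_int (int n - 2 * int (Suc j)) * x))"
    unfolding cos_sum_def sum_distrib_left
  proof (intro sum.cong refl)
    fix j
    have "sin (real_of_int (int n - 2 * int j) * x) = sin (real_of_int (int n - 1 - 2 * int j) * x + x)"
      "sin (real_of_int (int n - 2 * int (Suc j)) * x) = sin (real_of_int (int n - 1 - 2 * int j) * x - x)"
      by (simp_all add: algebra_simps)
    then show "2 * (sin x * cos (real_of_int (int n - 1 - 2 * int j) * x))
        = sin (real_of_int (int n - 2 * int j) * x) - sin (real_of_int (int n - 2 * int (Suc j)) * x)"
      by (simp only:) (simp add: sin_add sin_diff)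
  qed
  also have "\<dots> = sin (real n * x) - sin (- (real n * x))"
    by (subst sum_lessThan_telescope') (simp add: algebra_simps)
  finally show ?thesis by simp
qed

lemma cos_sum_bound: "\<bar>cos_sum n x\<bar> \<le> real n"
proof -
  have "\<bar>cos_sum n x\<bar> \<le> (\<Sum>j<n. \<bar>cos (real_of_int (int n - 1 - 2 * int j) * x)\<bar>)"
    unfolding cos_sum_def by (rule sum_abs)
  also have "\<dots> \<le> (\<Sum>j<n. 1)" by (rule sum_mono) simp
  finally show ?thesis by simp
qed

lemma cos_sum_deriv: "((\<lambda>x. sin (real n * x)) has_real_derivative real n * cos (real n * x)) (at x)"
  by (auto intro!: derivative_eq_intros)

lemma sum_reflect_odd:
  fixes f :: "int \<Rightarrow> real"
  assumes "\<And>k. f (- k) = - f k"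
  shows "(\<Sum>j<n. f (int n - 1 - 2 * int j)) = 0"
proof -
  have "(\<Sum>j<n. f (int n - 1 - 2 * int j)) = (\<Sum>j<n. f (int n - 1 - 2 * int (n - Suc j)))"
    by (rule sum.nat_diff_reindex[symmetric])
  also have "\<dots> = (\<Sum>j<n. - f (int n - 1 - 2 * int j))"
    by (intro sum.cong refl) (simp add: assms[symmetric] of_nat_diff algebra_simps)
  finally show ?thesis by (simp add: sum_negf)
qed

section \<open>The differential system, its boundary terms and its Fourier moments\<close>

context hyp_pair begin

text \<open>Near 0 the function is of order x powr (1 + a). With a = \<plusminus>2 \<kappa> this
  makes the boundary terms of the integrations by parts vanish.\<close>

lemma sin_tau_at_0: "\<bar>a\<bar> < 1 \<Longrightarrow> ((\<lambda>x::real. sin x * \<tau> x powr a) \<longlongrightarrow> 0) (at_right 0)"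
proof -
  assume a: "\<bar>a\<bar> < 1"
  have ev: "eventually (\<lambda>x. 0 < x \<and> x < pi) (at_right 0)" by (rule eventually_at_right_0) simp
  have "((\<lambda>x::real. sin (x / 2) powr (1 + a)) \<longlongrightarrow> 0) (at_right 0)"
  proof (rule tendsto_zero_powrI[OF _ tendsto_const])
    show "((\<lambda>x. sin (x / 2)) \<longlongrightarrow> 0) (at_right (0::real))" by (auto intro!: tendsto_eq_intros)
    show "\<forall>\<^sub>F x in at_right 0. 0 \<le> sin (x / 2 :: real)"
      using ev by eventually_elim (use half_angle in force)
  qed (use a in simp)
  moreover have "((\<lambda>x::real. cos (x / 2) powr (1 - a)) \<longlongrightarrow> 1 powr (1 - a)) (at_right 0)"
    by (rule tendsto_powr) (auto intro!: tendsto_eq_intros)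
  ultimately have "((\<lambda>x. 2 * (sin (x / 2) powr (1 + a) * cos (x / 2) powr (1 - a))) \<longlongrightarrow> 2 * (0 * 1 powr (1 - a))) (at_right 0)"
    by (intro tendsto_mult tendsto_const)
  moreover have "eventually (\<lambda>x::real. 2 * (sin (x / 2) powr (1 + a) * cos (x / 2) powr (1 - a)) = sin x * \<tau> x powr a) (at_right 0)"
    using ev
  proof eventually_elim
    case (elim x)
    then have h: "0 < sin (x / 2)" "0 < cos (x / 2)" using half_angle[of x] by auto
    have "sin x = 2 * sin (x / 2) * cos (x / 2)" using sin_double[of "x / 2"] by simp
    then show ?case unfolding tan_def using h by (simp add: powr_divide powr_add powr_diff)
  qed
  ultimately show ?thesis by (simp add: tendsto_cong)
qed

lemma sin_tau_at_pi: "\<bar>a\<bar> < 1 \<Longrightarrow> ((\<lambda>x::real. sin x * \<tau> x powr a) \<longlongrightarrow> 0) (at_left pi)"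
proof -
  assume "\<bar>a\<bar> < 1"
  then have "((\<lambda>x. sin x * \<tau> x powr (- a)) \<longlongrightarrow> 0) (at_right 0)" by (intro sin_tau_at_0) simp
  from tendsto_reflect[OF this] have "((\<lambda>x. sin (pi - x) * \<tau> (pi - x) powr (- a)) \<longlongrightarrow> 0) (at_left pi)" .
  moreover have "eventually (\<lambda>x. sin (pi - x) * \<tau> (pi - x) powr (- a) = sin x * \<tau> x powr a) (at_left pi)"
    using eventually_at_left_pi[OF pi_gt_zero] by eventually_elim (use tan_half_reflect_powr in simp)
  ultimately show ?thesis by (rule Lim_transform_eventually)
qed

lemma ACN_deriv:
  assumes x: "0 < x" "x < pi"
  shows "(A has_real_derivative - 2 * d * \<tau> x powr (- (2 * \<kappa>)) * N x) (at x)"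
    and "(C has_real_derivative 2 * d * \<tau> x powr (2 * \<kappa>) * N x) (at x)"
    and "(N has_real_derivative d * V x) (at x)"
proof -
  let ?a = "\<tau> x powr (2 * \<kappa>)" and ?b = "\<tau> x powr (- (2 * \<kappa>))"
  have dG: "(G has_real_derivative - d * ?a * P x) (at x)" and dP: "(P has_real_derivative d * ?b * G x) (at x)"
    using m.hF_deriv[OF x] m.hQ_deriv[OF x] by simp_all
  note D = p.hF_deriv[OF x] p.hQ_deriv[OF x] dG dP
  note ders = DERIV_add DERIV_diff DERIV_mult DERIV_cmult D
  have "(A has_real_derivative c0 * (Hm * ((- d * ?b * Q x) * F x + (- d * ?b * Q x) * F x)
      + Hp * ((d * ?b * G x) * P x + (d * ?b * G x) * P x))) (at x)"
    unfolding A_def[abs_def] power2_eq_square by (intro ders)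
  then show "(A has_real_derivative - 2 * d * ?b * N x) (at x)"
    by (rule DERIV_cong) (simp add: N_def algebra_simps)
  have "(C has_real_derivative c0 * (Hm * ((d * ?a * F x) * Q x + (d * ?a * F x) * Q x)
      + Hp * ((- d * ?a * P x) * G x + (- d * ?a * P x) * G x))) (at x)"
    unfolding C_def[abs_def] power2_eq_square by (intro ders)
  then show "(C has_real_derivative 2 * d * ?a * N x) (at x)"
    by (rule DERIV_cong) (simp add: N_def algebra_simps)
  have "(N has_real_derivative c0 * (Hm * ((- d * ?b * Q x) * Q x + (d * ?a * F x) * F x)
      - Hp * ((- d * ?a * P x) * P x + (d * ?b * G x) * G x))) (at x)"
    unfolding N_def[abs_def] mult.assoc[of Hm] mult.assoc[of Hp] by (intro ders)
  then show "(N has_real_derivative d * V x) (at x)"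
    by (rule DERIV_cong) (simp add: V_def A_def C_def power2_eq_square algebra_simps)
qed

text \<open>The derivatives of A and C carry the power of the tangent inverse to their own factor.
  The resulting terms in N are opposite; they cancel in the sum T and add up in the difference
  V.\<close>

lemma TVW_deriv:
  assumes x: "0 < x" "x < pi"
  shows "(T has_real_derivative 2 * \<kappa> / sin x * V x) (at x)"
    and "(V has_real_derivative 2 * \<kappa> / sin x * T x - 2 * d * W x) (at x)"
    and "(W has_real_derivative 2 * d * V x) (at x)"
proof -
  let ?a = "\<tau> x powr (2 * \<kappa>)" and ?b = "\<tau> x powr (- (2 * \<kappa>))"
  have sx: "sin x = 2 * (sin (x / 2) * cos (x / 2))" using sin_double[of "x / 2"] by simp
  have ab: "?a * ?b = 1" by (rule powr_cancel[OF x])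
  have a: "((\<lambda>x. \<tau> x powr (2 * \<kappa>)) has_real_derivative 2 * \<kappa> / sin x * ?a) (at x)"
    using p.\<tau>_powr_deriv[OF x, of "2 * \<kappa>"] unfolding sx by (rule DERIV_cong) (simp add: field_simps)
  have b: "((\<lambda>x. \<tau> x powr (- (2 * \<kappa>))) has_real_derivative - (2 * \<kappa> / sin x * ?b)) (at x)"
    using p.\<tau>_powr_deriv[OF x, of "- (2 * \<kappa>)"] unfolding sx by (rule DERIV_cong) (simp add: field_simps)
  note m = DERIV_mult[OF a ACN_deriv(1)[OF x]] DERIV_mult[OF b ACN_deriv(2)[OF x]]
  have e1: "- 2 * d * ?b * N x * ?a = - 2 * d * N x" and e2: "2 * d * ?a * N x * ?b = 2 * d * N x"
    using ab by (metis mult.assoc mult.commute mult.right_neutral)+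
  show "(T has_real_derivative 2 * \<kappa> / sin x * V x) (at x)"
    unfolding T_def[abs_def]
    by (rule DERIV_cong[OF DERIV_add[OF m]]) (simp only: e1 e2 V_def, simp add: algebra_simps)
  show "(V has_real_derivative 2 * \<kappa> / sin x * T x - 2 * d * W x) (at x)"
    unfolding V_def[abs_def]
    by (rule DERIV_cong[OF DERIV_diff[OF m]]) (simp only: e1 e2 T_def W_def, simp add: algebra_simps)
  show "(W has_real_derivative 2 * d * V x) (at x)"
    unfolding W_def[abs_def] by (rule DERIV_cong[OF DERIV_cmult[OF ACN_deriv(3)[OF x]]]) simp
qed

lemma limits_0: "(A \<longlongrightarrow> c0 * (Hm * 1\<^sup>2 + Hp * 0\<^sup>2)) (at_right 0)"
  "(C \<longlongrightarrow> c0 * (Hm * 0\<^sup>2 + Hp * 1\<^sup>2)) (at_right 0)" "(N \<longlongrightarrow> c0 * (Hm * 1 * 0 - Hp * 1 * 0)) (at_right 0)"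
  unfolding A_def[abs_def] C_def[abs_def] N_def[abs_def]
  by (intro tendsto_mult tendsto_add tendsto_diff tendsto_power tendsto_const p.hF_at_0 p.hQ_at_0 m.hF_at_0 m.hQ_at_0)+

lemma limits_pi: "(A \<longlongrightarrow> c0 * (Hm * Hp\<^sup>2 + Hp * S\<^sup>2)) (at_left pi)"
  "(C \<longlongrightarrow> c0 * (Hm * S\<^sup>2 + Hp * Hm\<^sup>2)) (at_left pi)" "(N \<longlongrightarrow> c0 * (Hm * Hp * S - Hp * Hm * S)) (at_left pi)"
  unfolding A_def[abs_def] C_def[abs_def] N_def[abs_def]
  by (intro tendsto_mult tendsto_add tendsto_diff tendsto_power tendsto_const F_at_pi G_at_pi Q_at_pi P_at_pi)+

text \<open>The weight \<open>Hm\<close> multiplies F and Q, with limits \<open>Hp\<close> and S,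
  and \<open>Hp\<close> multiplies G and P, with limits \<open>Hm\<close> and S. The two products in
  N thus have equal limits at \<pi>.\<close>

lemma W_limits: "(W \<longlongrightarrow> 0) (at_right 0)" "(W \<longlongrightarrow> 0) (at_left pi)"
  using tendsto_mult[OF tendsto_const limits_0(3), of 2] tendsto_mult[OF tendsto_const limits_pi(3), of 2]
  by (simp_all add: W_def[abs_def])

lemma sin_T_limits:
  "((\<lambda>x. sin (real n * x) * T x) \<longlongrightarrow> 0) (at_right 0)" "((\<lambda>x. sin (real n * x) * T x) \<longlongrightarrow> 0) (at_left pi)"
  "((\<lambda>x. sin (real n * x) * V x) \<longlongrightarrow> 0) (at_right 0)" "((\<lambda>x. sin (real n * x) * V x) \<longlongrightarrow> 0) (at_left pi)"
proof -
  have k: "\<bar>2 * \<kappa>\<bar> < 1" "\<bar>- (2 * \<kappa>)\<bar> < 1" using d0 d\<kappa> by auto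
  have c: "(cos_sum n \<longlongrightarrow> cos_sum n z) (at z within X)" for z X
    unfolding cos_sum_def[abs_def] by (intro tendsto_intros)
  have eq: "sin (real n * x) * T x = cos_sum n x * ((sin x * \<tau> x powr (2 * \<kappa>)) * A x + (sin x * \<tau> x powr (- (2 * \<kappa>))) * C x)"
    "sin (real n * x) * V x = cos_sum n x * ((sin x * \<tau> x powr (2 * \<kappa>)) * A x - (sin x * \<tau> x powr (- (2 * \<kappa>))) * C x)" for x
    unfolding sin_cos_sum[symmetric] T_def V_def by (simp_all add: algebra_simps)
  note t0 = tendsto_mult[OF sin_tau_at_0[OF k(1)] limits_0(1)] tendsto_mult[OF sin_tau_at_0[OF k(2)] limits_0(2)]
  note tp = tendsto_mult[OF sin_tau_at_pi[OF k(1)] limits_pi(1)] tendsto_mult[OF sin_tau_at_pi[OF k(2)] limits_pi(2)]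
  show "((\<lambda>x. sin (real n * x) * T x) \<longlongrightarrow> 0) (at_right 0)" unfolding eq
    using tendsto_mult[OF c tendsto_add[OF t0]] by simp
  show "((\<lambda>x. sin (real n * x) * T x) \<longlongrightarrow> 0) (at_left pi)" unfolding eq
    using tendsto_mult[OF c tendsto_add[OF tp]] by simp
  show "((\<lambda>x. sin (real n * x) * V x) \<longlongrightarrow> 0) (at_right 0)" unfolding eq
    using tendsto_mult[OF c tendsto_diff[OF t0]] by simp
  show "((\<lambda>x. sin (real n * x) * V x) \<longlongrightarrow> 0) (at_left pi)" unfolding eq
    using tendsto_mult[OF c tendsto_diff[OF tp]] by simp
qed

definition "BB = c0 * (Hm + Hp) * (1 + S\<^sup>2)"

lemma TVW_bound:
  assumes x: "0 < x" "x < pi"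
  shows "\<bar>T x\<bar> \<le> BB * (\<tau> x powr (2 * \<kappa>) + \<tau> x powr (- (2 * \<kappa>)))"
    and "\<bar>V x\<bar> \<le> BB * (\<tau> x powr (2 * \<kappa>) + \<tau> x powr (- (2 * \<kappa>)))"
    and "\<bar>W x\<bar> \<le> 2 * BB * (\<tau> x powr (2 * \<kappa>) + \<tau> x powr (- (2 * \<kappa>)))"
proof -
  interpret n: hyp_pair "- \<kappa>" d by (rule hyp_pair_minus)
  let ?a = "\<tau> x powr (2 * \<kappa>)" and ?b = "\<tau> x powr (- (2 * \<kappa>))"
  have F: "0 \<le> F x" "F x \<le> 1" "0 \<le> G x" "G x \<le> 1"
    using F_bounds[OF x] n.F_bounds[OF x] H_pos by auto
  have Q: "0 \<le> Q x" "Q x \<le> S" "0 \<le> P x" "P x \<le> S"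
    using Q_nonneg[OF x] n.Q_nonneg[OF x] Q_le_S[OF x] n.Q_le_S[OF x] hS_minus by auto
  have s: "(F x)\<^sup>2 \<le> 1 + S\<^sup>2" "(G x)\<^sup>2 \<le> 1 + S\<^sup>2" "(Q x)\<^sup>2 \<le> 1 + S\<^sup>2" "(P x)\<^sup>2 \<le> 1 + S\<^sup>2"
    using F Q power_mono[of "F x" 1 2] power_mono[of "G x" 1 2] power_mono[of "Q x" S 2] power_mono[of "P x" S 2]
    by (auto intro: add_increasing2 add_increasing)
  have BB: "BB = c0 * (Hm * (1 + S\<^sup>2) + Hp * (1 + S\<^sup>2))" by (simp add: BB_def algebra_simps)
  have A: "0 \<le> A x" "A x \<le> BB"
    using c0_pos H_pos s unfolding BB A_def by (auto intro!: mult_left_mono add_mono)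
  have C: "0 \<le> C x" "C x \<le> BB"
    using c0_pos H_pos s unfolding BB C_def by (auto intro!: mult_left_mono add_mono)
  have "2 * \<bar>F x * Q x\<bar> \<le> (F x)\<^sup>2 + (Q x)\<^sup>2" "2 * \<bar>G x * P x\<bar> \<le> (G x)\<^sup>2 + (P x)\<^sup>2"
    using sum_squares_bound[of "\<bar>F x\<bar>" "\<bar>Q x\<bar>"] sum_squares_bound[of "\<bar>G x\<bar>" "\<bar>P x\<bar>"] by (simp_all add: abs_mult)
  then have fq: "\<bar>F x * Q x\<bar> \<le> 1 + S\<^sup>2" "\<bar>G x * P x\<bar> \<le> 1 + S\<^sup>2" using s by linarith+
  have "\<bar>Hm * F x * Q x - Hp * G x * P x\<bar> \<le> Hm * \<bar>F x * Q x\<bar> + Hp * \<bar>G x * P x\<bar>"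
    using abs_triangle_ineq4[of "Hm * F x * Q x" "Hp * G x * P x"] H_pos by (simp add: abs_mult mult.assoc)
  also have "\<dots> \<le> Hm * (1 + S\<^sup>2) + Hp * (1 + S\<^sup>2)" using fq H_pos by (intro add_mono mult_left_mono) auto
  finally have N: "\<bar>N x\<bar> \<le> BB" unfolding N_def BB abs_mult using c0_pos by (simp add: mult_left_mono)
  have "?a * A x \<le> ?a * BB" "?b * C x \<le> ?b * BB" using A C by (auto intro: mult_left_mono)
  moreover have "0 \<le> ?a * A x" "0 \<le> ?b * C x" using A C by auto
  ultimately show "\<bar>T x\<bar> \<le> BB * (?a + ?b)" "\<bar>V x\<bar> \<le> BB * (?a + ?b)"
    unfolding T_def V_def by (auto simp: distrib_left mult.commute[of BB])
  have "0 \<le> BB" using A by linarith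
  then have "2 * BB * 1 \<le> 2 * BB * (?a + ?b)" using tau_sum_ge_1[OF x] by (intro mult_left_mono) auto
  then show "\<bar>W x\<bar> \<le> 2 * BB * (?a + ?b)" using N unfolding W_def abs_mult by simp
qed

lemma TVW_cont: "0 < x \<Longrightarrow> x < pi \<Longrightarrow> isCont T x" "0 < x \<Longrightarrow> x < pi \<Longrightarrow> isCont V x" "0 < x \<Longrightarrow> x < pi \<Longrightarrow> isCont W x"
  using TVW_deriv by (blast intro: DERIV_isCont)+

lemma TVW_integrable:
  assumes b: "\<And>x. \<bar>b x\<bar> \<le> B" and c: "\<And>x. isCont b x"
  shows "set_integrable lborel {0<..<pi} (\<lambda>x. b x * T x)" "set_integrable lborel {0<..<pi} (\<lambda>x. b x * V x)"
    "set_integrable lborel {0<..<pi} (\<lambda>x. b x * W x)"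
proof -
  have B: "0 \<le> B" using b[of 0] by linarith
  have *: "\<bar>b x * g\<bar> \<le> B * D * r" if "\<bar>g\<bar> \<le> D * r" for x g D r :: real
    using mult_mono[OF b that B] by (simp add: abs_mult mult.assoc)
  show "set_integrable lborel {0<..<pi} (\<lambda>x. b x * T x)"
    by (rule dominated_integrable[where C = "B * BB"]) (auto intro!: continuous_intros c TVW_cont * TVW_bound)
  show "set_integrable lborel {0<..<pi} (\<lambda>x. b x * V x)"
    by (rule dominated_integrable[where C = "B * BB"]) (auto intro!: continuous_intros c TVW_cont * TVW_bound)
  show "set_integrable lborel {0<..<pi} (\<lambda>x. b x * W x)"
    by (rule dominated_integrable[where C = "B * (2 * BB)"]) (auto intro!: continuous_intros c TVW_cont * TVW_bound)
qed

lemma trig_integrable: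
  "set_integrable lborel {0<..<pi} (\<lambda>x. cos (r * x) * T x)" "set_integrable lborel {0<..<pi} (\<lambda>x. cos (r * x) * V x)"
  "set_integrable lborel {0<..<pi} (\<lambda>x. cos (r * x) * W x)"
  "set_integrable lborel {0<..<pi} (\<lambda>x. sin (r * x) * T x)" "set_integrable lborel {0<..<pi} (\<lambda>x. sin (r * x) * V x)"
  "set_integrable lborel {0<..<pi} (\<lambda>x. sin (r * x) * W x)"
  by (rule TVW_integrable[where B = 1]; auto intro!: continuous_intros)+

definition "Tm n = I0 (\<lambda>x. cos (real_of_int n * x) * T x)"
definition "Vm n = I0 (\<lambda>x. cos (real_of_int n * x) * V x)"
definition "Wm n = I0 (\<lambda>x. sin (real_of_int n * x) * W x)"
text \<open>The real part of the Fourier coefficient of V + \<i> W with frequency n.\<close>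

definition "Um n = Vm n - Wm n"

lemma cos_sum_cont: "isCont (cos_sum n) x"
  unfolding cos_sum_def[abs_def] by (intro continuous_intros)

lemma cos_sum_integral:
  "I0 (\<lambda>x. cos_sum n x * T x) = (\<Sum>j<n. Tm (int n - 1 - 2 * int j))"
  "I0 (\<lambda>x. cos_sum n x * V x) = (\<Sum>j<n. Vm (int n - 1 - 2 * int j))"
  unfolding cos_sum_def sum_distrib_right Tm_def Vm_def set_lebesgue_integral_def scaleR_sum_right
  by (rule Bochner_Integration.integral_sum, rule trig_integrable[unfolded set_integrable_def])+

text \<open>Integration of the derivative of sin (n x) T: the factor sin (n x) cancels the
  denominator sin x and produces \<open>cos_sum\<close>.\<close>

lemma moment_T: "real n * Tm (int n) = - 2 * \<kappa> * (\<Sum>j<n. Vm (int n - 1 - 2 * int j))"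
proof -
  note cs = TVW_integrable[OF cos_sum_bound cos_sum_cont]
  have i: "set_integrable lborel {0<..<pi} (\<lambda>x. real n * (cos (real n * x) * T x))"
    "set_integrable lborel {0<..<pi} (\<lambda>x. 2 * \<kappa> * (cos_sum n x * V x))"
    by (intro set_integrable_mult_right trig_integrable cs)+
  have "I0 (\<lambda>x. real n * (cos (real n * x) * T x) + 2 * \<kappa> * (cos_sum n x * V x)) = 0 - 0"
  proof (rule FTC[where f = "\<lambda>x. sin (real n * x) * T x", OF _ _ _ sin_T_limits(1,2)])
    fix x assume x: "0 < x" "x < pi"
    have "sin x \<noteq> 0" using sin_gt_zero[OF x] by simp
    then have "2 * \<kappa> / sin x * V x * sin (real n * x) = 2 * \<kappa> * (cos_sum n x * V x)"
      unfolding sin_cos_sum[symmetric] by simp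
    then show "((\<lambda>x. sin (real n * x) * T x) has_real_derivative real n * (cos (real n * x) * T x) + 2 * \<kappa> * (cos_sum n x * V x)) (at x)"
      using DERIV_mult[OF cos_sum_deriv[of n x] TVW_deriv(1)[OF x]] by (simp add: mult.assoc)
    show "isCont (\<lambda>x. real n * (cos (real n * x) * T x) + 2 * \<kappa> * (cos_sum n x * V x)) x"
      by (intro continuous_intros TVW_cont cos_sum_cont x)
  next
    show "set_integrable lborel {0<..<pi} (\<lambda>x. real n * (cos (real n * x) * T x) + 2 * \<kappa> * (cos_sum n x * V x))"
      by (rule set_integral_add(1)[OF i])
  qed
  then show ?thesis
    unfolding set_integral_add(2)[OF i] by (simp add: cos_sum_integral Tm_def)
qed

lemma moment_V: "real n * Vm (int n) - 2 * d * Wm (int n) = - 2 * \<kappa> * (\<Sum>j<n. Tm (int n - 1 - 2 * int j))"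
proof -
  note cs = TVW_integrable[OF cos_sum_bound cos_sum_cont]
  have i: "set_integrable lborel {0<..<pi} (\<lambda>x. real n * (cos (real n * x) * V x))"
    "set_integrable lborel {0<..<pi} (\<lambda>x. 2 * \<kappa> * (cos_sum n x * T x))"
    "set_integrable lborel {0<..<pi} (\<lambda>x. 2 * d * (sin (real n * x) * W x))"
    by (intro set_integrable_mult_right trig_integrable cs)+
  note j = set_integral_add[OF i(1,2)]
  have "I0 (\<lambda>x. real n * (cos (real n * x) * V x) + 2 * \<kappa> * (cos_sum n x * T x) - 2 * d * (sin (real n * x) * W x)) = 0 - 0"
  proof (rule FTC[where f = "\<lambda>x. sin (real n * x) * V x", OF _ _ _ sin_T_limits(3,4)])
    fix x assume x: "0 < x" "x < pi"
    have "sin x \<noteq> 0" using sin_gt_zero[OF x] by simp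
    then have "(2 * \<kappa> / sin x * T x - 2 * d * W x) * sin (real n * x) = 2 * \<kappa> * (cos_sum n x * T x) - 2 * d * (sin (real n * x) * W x)"
      unfolding sin_cos_sum[symmetric] by (simp add: left_diff_distrib)
    then show "((\<lambda>x. sin (real n * x) * V x) has_real_derivative real n * (cos (real n * x) * V x) + 2 * \<kappa> * (cos_sum n x * T x)
        - 2 * d * (sin (real n * x) * W x)) (at x)"
      using DERIV_mult[OF cos_sum_deriv[of n x] TVW_deriv(2)[OF x]] by (simp add: mult.assoc add_diff_eq)
    show "isCont (\<lambda>x. real n * (cos (real n * x) * V x) + 2 * \<kappa> * (cos_sum n x * T x) - 2 * d * (sin (real n * x) * W x)) x"
      by (intro continuous_intros TVW_cont cos_sum_cont x)
  next
    show "set_integrable lborel {0<..<pi} (\<lambda>x. real n * (cos (real n * x) * V x) + 2 * \<kappa> * (cos_sum n x * T x) - 2 * d * (sin (real n * x) * W x))"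
      by (rule set_integral_diff(1)[OF j(1) i(3)])
  qed
  then show ?thesis
    unfolding set_integral_diff(2)[OF j(1) i(3)] j(2) by (simp add: cos_sum_integral Vm_def Wm_def)
qed

text \<open>Here the test function is cos (n x), which does not vanish at the ends; the boundary
  terms disappear because W itself does.\<close>

lemma moment_W: "real n * Wm (int n) = 2 * d * Vm (int n)"
proof -
  have i: "set_integrable lborel {0<..<pi} (\<lambda>x. 2 * d * (cos (real n * x) * V x))"
    "set_integrable lborel {0<..<pi} (\<lambda>x. real n * (sin (real n * x) * W x))"
    by (intro set_integrable_mult_right trig_integrable)+
  have c: "((\<lambda>x. cos (real n * x)) has_real_derivative - real n * sin (real n * x)) (at x)" for x
    by (auto intro!: derivative_eq_intros)
  have l: "((\<lambda>x. cos (real n * x)) \<longlongrightarrow> cos (real n * z)) (at z within X)" for z X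
    by (intro tendsto_intros)
  have "I0 (\<lambda>x. 2 * d * (cos (real n * x) * V x) - real n * (sin (real n * x) * W x)) = cos (real n * pi) * 0 - cos (real n * 0) * 0"
  proof (rule FTC[where f = "\<lambda>x. cos (real n * x) * W x"])
    fix x assume x: "0 < x" "x < pi"
    show "((\<lambda>x. cos (real n * x) * W x) has_real_derivative 2 * d * (cos (real n * x) * V x) - real n * (sin (real n * x) * W x)) (at x)"
      by (rule DERIV_cong[OF DERIV_mult[OF c TVW_deriv(3)[OF x]]]) simp
    show "isCont (\<lambda>x. 2 * d * (cos (real n * x) * V x) - real n * (sin (real n * x) * W x)) x"
      by (intro continuous_intros TVW_cont x)
  next
    show "set_integrable lborel {0<..<pi} (\<lambda>x. 2 * d * (cos (real n * x) * V x) - real n * (sin (real n * x) * W x))"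
      by (rule set_integral_diff(1)[OF i])
  qed (intro tendsto_mult W_limits l)+
  then show ?thesis
    unfolding set_integral_diff(2)[OF i] by (simp add: Vm_def Wm_def)
qed

lemma moment_parity: "Tm (- n) = Tm n" "Vm (- n) = Vm n" "Wm (- n) = - Wm n"
  by (simp_all add: Tm_def Vm_def Wm_def set_lebesgue_integral_def)

lemma Tm_0: "Tm 0 = 1"
  using T_integral by (simp add: Tm_def)

text \<open>The moments of W are odd in the frequency and drop out of the symmetric sum in the first
  equation. The other two arise from \<open>moment_V\<close> by replacing n Wm with 2 d Vm, for
  either sign of the frequency.\<close>

theorem moments:
  "real n * Tm (int n) = - 2 * \<kappa> * (\<Sum>j<n. Um (int n - 1 - 2 * int j))"
  "(real n + 2 * d) * Um (int n) = - 2 * \<kappa> * (\<Sum>j<n. Tm (int n - 1 - 2 * int j))"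
  "(real n - 2 * d) * Um (- int n) = - 2 * \<kappa> * (\<Sum>j<n. Tm (int n - 1 - 2 * int j))"
proof -
  have "(\<Sum>j<n. Wm (int n - 1 - 2 * int j)) = 0"
    by (rule sum_reflect_odd) (rule moment_parity)
  then show "real n * Tm (int n) = - 2 * \<kappa> * (\<Sum>j<n. Um (int n - 1 - 2 * int j))"
    unfolding moment_T by (simp add: Um_def sum_subtractf)
  show "(real n + 2 * d) * Um (int n) = - 2 * \<kappa> * (\<Sum>j<n. Tm (int n - 1 - 2 * int j))"
    unfolding moment_V[symmetric] Um_def using moment_W[of n] by (simp add: algebra_simps)
  show "(real n - 2 * d) * Um (- int n) = - 2 * \<kappa> * (\<Sum>j<n. Tm (int n - 1 - 2 * int j))"
    unfolding moment_V[symmetric] Um_def moment_parity using moment_W[of n] by (simp add: algebra_simps)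
qed

end

section \<open>Polar coordinates\<close>

lemma borel_measurable_tan [measurable]: "(tan :: real \<Rightarrow> real) \<in> borel_measurable borel"
  unfolding tan_def[abs_def] by measurable

text \<open>The substitution y = x tan p for fixed x, as an identity of measures. It suffices to
  compare boxes, where the fundamental theorem applies to x tan p.\<close>

lemma lborel_eq_distr_tan:
  assumes x: "0 < (x :: real)"
  shows "lborel = distr (density lborel (\<lambda>p. ennreal (x / (cos p)\<^sup>2) * indicator {- pi / 2<..<pi / 2} p)) borel (\<lambda>p. x * tan p)"
    (is "_ = ?M")
proof (rule lborel_eqI)
  fix l u :: real assume "\<And>b. b \<in> Basis \<Longrightarrow> l \<bullet> b \<le> u \<bullet> b"
  then have lu: "l \<le> u" by simp
  define a where "a = arctan (l / x)"
  define b where "b = arctan (u / x)"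
  have ab: "a \<le> b" "- pi / 2 < a" "b < pi / 2"
    using lu x arctan_lbound[of "l / x"] arctan_ubound[of "u / x"]
    by (simp_all add: a_def b_def arctan_le_iff divide_right_mono)
  have mem: "p \<in> {- pi / 2<..<pi / 2} \<and> x * tan p \<in> {l<..<u} \<longleftrightarrow> a < p \<and> p < b" for p
  proof (cases "p \<in> {- pi / 2<..<pi / 2}")
    case True
    then have p: "arctan (tan p) = p" by (intro arctan_tan) auto
    have "l < x * tan p \<longleftrightarrow> l / x < tan p" using x by (simp add: divide_less_eq mult.commute)
    also have "\<dots> \<longleftrightarrow> arctan (l / x) < arctan (tan p)" by (simp only: arctan_less_iff)
    also have "\<dots> \<longleftrightarrow> a < p" by (simp only: p a_def)
    finally have 1: "l < x * tan p \<longleftrightarrow> a < p" .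
    have "x * tan p < u \<longleftrightarrow> tan p < u / x" using x by (simp add: less_divide_eq mult.commute)
    also have "\<dots> \<longleftrightarrow> arctan (tan p) < arctan (u / x)" by (simp only: arctan_less_iff)
    also have "\<dots> \<longleftrightarrow> p < b" by (simp only: p b_def)
    finally show ?thesis using 1 True by simp
  qed (use ab in auto)
  have v: "(\<lambda>p. x * tan p) -` box l u \<in> sets borel"
    using measurable_sets[of "\<lambda>p. x * tan p" borel borel "box l u"] by simp
  have "emeasure ?M (box l u) = (\<integral>\<^sup>+p. ennreal (x / (cos p)\<^sup>2) * indicator {- pi / 2<..<pi / 2} p
      * indicator ((\<lambda>p. x * tan p) -` box l u \<inter> space lborel) p \<partial>lborel)"
    by (subst emeasure_distr, simp, simp, subst emeasure_density) (use v in auto)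
  also have "\<dots> = (\<integral>\<^sup>+p. ennreal (x / (cos p)\<^sup>2) * indicator {a..b} p \<partial>lborel)"
  proof (rule nn_integral_cong_AE)
    have "AE p in lborel. p \<noteq> a" "AE p in lborel. p \<noteq> b" by (rule AE_lborel_singleton)+
    then show "AE p in lborel. ennreal (x / (cos p)\<^sup>2) * indicator {- pi / 2<..<pi / 2} p
      * indicator ((\<lambda>p. x * tan p) -` box l u \<inter> space lborel) p = ennreal (x / (cos p)\<^sup>2) * indicator {a..b} p"
    proof eventually_elim
      case (elim p)
      then show ?case using mem[of p] by (auto simp: indicator_def box_real)
    qed
  qed
  also have "\<dots> = ennreal (x * tan b - x * tan a)"
  proof (rule nn_integral_FTC_Icc[where F = "\<lambda>p. x * tan p"])
    show "(\<lambda>p. x / (cos p)\<^sup>2) \<in> borel_measurable borel" by measurable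
    show "((\<lambda>p. x * tan p) has_real_derivative x / (cos p)\<^sup>2) (at p)" if "p \<in> {a..b}" for p
    proof -
      have "0 < cos p" using that ab by (intro cos_gt_zero_pi) auto
      then show ?thesis by (auto intro!: derivative_eq_intros simp: divide_inverse)
    qed
    show "0 \<le> x / (cos p)\<^sup>2" for p using x by simp
  qed (rule ab)
  also have "x * tan b - x * tan a = u - l"
    using x by (simp add: a_def b_def tan_arctan)
  finally show "emeasure ?M (box l u) = ennreal (\<Prod>b\<in>Basis. (u - l) \<bullet> b)" by simp
qed simp

lemma nn_integral_tan:
  assumes x: "0 < (x :: real)" and g[measurable]: "g \<in> borel_measurable borel"
  shows "(\<integral>\<^sup>+y. g y \<partial>lborel) = (\<integral>\<^sup>+p. ennreal (x / (cos p)\<^sup>2) * indicator {- pi / 2<..<pi / 2} p * g (x * tan p) \<partial>lborel)"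
  by (subst lborel_eq_distr_tan[OF x], subst nn_integral_distr, simp, simp, subst nn_integral_density) simp_all

text \<open>Polar coordinates as two one-dimensional substitutions: y = x tan p for fixed x and,
  after exchanging the integrals, x = r cos p for fixed p.\<close>

lemma nn_integral_half_plane:
  fixes f :: "real \<Rightarrow> real \<Rightarrow> ennreal"
  assumes f[measurable]: "(\<lambda>(x, y). f x y) \<in> borel_measurable borel"
  shows "(\<integral>\<^sup>+x. \<integral>\<^sup>+y. indicator {0<..} x * f x y \<partial>lborel \<partial>lborel)
    = (\<integral>\<^sup>+p. \<integral>\<^sup>+r. indicator {- pi / 2<..<pi / 2} p * (indicator {0<..} r * ennreal r) * f (r * cos p) (r * sin p) \<partial>lborel \<partial>lborel)"
proof -
  have m[measurable]: "(\<lambda>(x, y). f x y) \<in> borel_measurable (borel \<Otimes>\<^sub>M borel)"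
    using f by (simp add: borel_prod)
  have "(\<integral>\<^sup>+x. \<integral>\<^sup>+y. indicator {0<..} x * f x y \<partial>lborel \<partial>lborel)
     = (\<integral>\<^sup>+x. \<integral>\<^sup>+p. indicator {0<..} x * (ennreal (x / (cos p)\<^sup>2) * indicator {- pi / 2<..<pi / 2} p) * f x (x * tan p) \<partial>lborel \<partial>lborel)"
  proof (rule nn_integral_cong)
    fix x :: real
    show "(\<integral>\<^sup>+y. indicator {0<..} x * f x y \<partial>lborel)
      = (\<integral>\<^sup>+p. indicator {0<..} x * (ennreal (x / (cos p)\<^sup>2) * indicator {- pi / 2<..<pi / 2} p) * f x (x * tan p) \<partial>lborel)"
    proof (cases "0 < x")
      case True
      then show ?thesis by (subst nn_integral_tan[OF True]) (simp_all add: mult_ac)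
    qed simp
  qed
  also have "\<dots> = (\<integral>\<^sup>+p. \<integral>\<^sup>+x. indicator {0<..} x * (ennreal (x / (cos p)\<^sup>2) * indicator {- pi / 2<..<pi / 2} p) * f x (x * tan p) \<partial>lborel \<partial>lborel)"
    by (rule lborel_pair.Fubini') measurable
  also have "\<dots> = (\<integral>\<^sup>+p. \<integral>\<^sup>+r. indicator {- pi / 2<..<pi / 2} p * (indicator {0<..} r * ennreal r) * f (r * cos p) (r * sin p) \<partial>lborel \<partial>lborel)"
  proof (rule nn_integral_cong)
    fix p :: real
    show "(\<integral>\<^sup>+x. indicator {0<..} x * (ennreal (x / (cos p)\<^sup>2) * indicator {- pi / 2<..<pi / 2} p) * f x (x * tan p) \<partial>lborel)
      = (\<integral>\<^sup>+r. indicator {- pi / 2<..<pi / 2} p * (indicator {0<..} r * ennreal r) * f (r * cos p) (r * sin p) \<partial>lborel)"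
    proof (cases "p \<in> {- pi / 2<..<pi / 2}")
      case True
      then have c: "0 < cos p" by (intro cos_gt_zero_pi) auto
      have "(\<integral>\<^sup>+x. indicator {0<..} x * (ennreal (x / (cos p)\<^sup>2) * indicator {- pi / 2<..<pi / 2} p) * f x (x * tan p) \<partial>lborel)
        = ennreal \<bar>cos p\<bar> * (\<integral>\<^sup>+r. indicator {0<..} (0 + cos p * r) * (ennreal ((0 + cos p * r) / (cos p)\<^sup>2) * indicator {- pi / 2<..<pi / 2} p)
            * f (0 + cos p * r) ((0 + cos p * r) * tan p) \<partial>lborel)"
        by (rule nn_integral_real_affine) (use c in auto)
      also have "\<dots> = (\<integral>\<^sup>+r. ennreal (cos p) * (indicator {0<..} (0 + cos p * r) * (ennreal ((0 + cos p * r) / (cos p)\<^sup>2) * indicator {- pi / 2<..<pi / 2} p)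
            * f (0 + cos p * r) ((0 + cos p * r) * tan p)) \<partial>lborel)"
        using c by (subst nn_integral_cmult) auto
      also have "\<dots> = (\<integral>\<^sup>+r. indicator {- pi / 2<..<pi / 2} p * (indicator {0<..} r * ennreal r) * f (r * cos p) (r * sin p) \<partial>lborel)"
      proof (rule nn_integral_cong)
        fix r :: real
        have 1: "cos p * r * tan p = r * sin p" using c by (simp add: tan_def)
        \<comment> \<open>The factor cos p from x = r cos p and the density x / (cos p)^2 of the
          tangent multiply to the Jacobian r.\<close>
        have 2: "ennreal (cos p) * ennreal (cos p * r / (cos p)\<^sup>2) = ennreal r"
        proof -
          have "ennreal (cos p) * ennreal (cos p * r / (cos p)\<^sup>2) = ennreal (cos p * (cos p * r / (cos p)\<^sup>2))"
            by (rule ennreal_mult'[symmetric]) (use c in simp)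
          also have "cos p * (cos p * r / (cos p)\<^sup>2) = r" using c by (simp add: power2_eq_square)
          finally show ?thesis .
        qed
        show "ennreal (cos p) * (indicator {0<..} (0 + cos p * r) * (ennreal ((0 + cos p * r) / (cos p)\<^sup>2) * indicator {- pi / 2<..<pi / 2} p)
            * f (0 + cos p * r) ((0 + cos p * r) * tan p)) = indicator {- pi / 2<..<pi / 2} p * (indicator {0<..} r * ennreal r) * f (r * cos p) (r * sin p)"
        proof (cases "0 < r")
          case True
          have "ennreal (cos p) * (ennreal (cos p * r / (cos p)\<^sup>2) * f (cos p * r) (r * sin p)) = ennreal r * f (r * cos p) (r * sin p)"
            by (simp only: mult.assoc[symmetric] 2 mult.commute[of r "cos p"])
          then show ?thesis unfolding add_0 1 using True c \<open>p \<in> _\<close> by simp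
        next
          case False
          then show ?thesis using c by (simp add: zero_less_mult_iff)
        qed
      qed
      finally show ?thesis .
    qed simp
  qed
  finally show ?thesis .
qed

lemma borel_measurable_Complex [measurable]:
  "f \<in> borel_measurable M \<Longrightarrow> g \<in> borel_measurable M \<Longrightarrow> (\<lambda>x. Complex (f x) (g x)) \<in> borel_measurable M"
  by (simp add: borel_measurable_complex_iff)

lemma lborel_complex_eq_distr:
  "(lborel :: complex measure) = distr (lborel \<Otimes>\<^sub>M lborel) borel (\<lambda>(x, y). Complex x y)"
proof (rule lborel_eqI)
  have m[measurable]: "(\<lambda>(x, y). Complex x y) \<in> borel_measurable (lborel \<Otimes>\<^sub>M lborel)"
    unfolding case_prod_beta' by measurable
  fix l u :: complex assume lu: "\<And>b. b \<in> Basis \<Longrightarrow> l \<bullet> b \<le> u \<bullet> b"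
  then have r: "Re l \<le> Re u" "Im l \<le> Im u" using lu[of 1] lu[of \<i>] by (simp_all add: Basis_complex_def)
  have "(\<lambda>(x, y). Complex x y) -` box l u \<inter> space (lborel \<Otimes>\<^sub>M lborel) = {Re l<..<Re u} \<times> {Im l<..<Im u}"
    by (auto simp: box_def Basis_complex_def space_pair_measure)
  then have "emeasure (distr (lborel \<Otimes>\<^sub>M lborel) borel (\<lambda>(x, y). Complex x y)) (box l u)
      = emeasure (lborel \<Otimes>\<^sub>M lborel) ({Re l<..<Re u} \<times> {Im l<..<Im u})"
    by (subst emeasure_distr) auto
  also have "\<dots> = ennreal (Re u - Re l) * ennreal (Im u - Im l)"
    using r by (subst lborel.emeasure_pair_measure_Times) auto
  also have "\<dots> = ennreal (\<Prod>b\<in>Basis. (u - l) \<bullet> b)"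
    using r by (simp add: Basis_complex_def ennreal_mult'')
  finally show "emeasure (distr (lborel \<Otimes>\<^sub>M lborel) borel (\<lambda>(x, y). Complex x y)) (box l u) = ennreal (\<Prod>b\<in>Basis. (u - l) \<bullet> b)" .
qed simp

text \<open>The upper and lower half-planes are treated separately: exchanging the coordinates, with
  a point reflection for the lower one, leads to the right half-plane. The real axis is a null
  set.\<close>

lemma nn_integral_polar:
  assumes f[measurable]: "f \<in> borel_measurable borel"
  shows "(\<integral>\<^sup>+z. f z \<partial>lborel)
    = (\<integral>\<^sup>+t. \<integral>\<^sup>+r. indicator {0<..<2 * pi} t * (indicator {0<..} r * ennreal r) * f (Complex (r * cos t) (r * sin t)) \<partial>lborel \<partial>lborel)"
proof -
  define H where "H t = (\<integral>\<^sup>+r. (indicator {0<..} r * ennreal r) * f (Complex (r * cos t) (r * sin t)) \<partial>lborel)" for t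
  have H[measurable]: "H \<in> borel_measurable borel" unfolding H_def[abs_def] by measurable
  have pull: "(\<integral>\<^sup>+r. indicator X t * (indicator {0<..} r * ennreal r) * h r \<partial>lborel) = indicator X t * (\<integral>\<^sup>+r. (indicator {0<..} r * ennreal r) * h r \<partial>lborel)"
    if "h \<in> borel_measurable borel" for h t and X :: "real set"
    using that unfolding mult.assoc by (subst nn_integral_cmult) auto
  have up: "(\<integral>\<^sup>+y. \<integral>\<^sup>+x. indicator {0<..} y * f (Complex x y) \<partial>lborel \<partial>lborel) = (\<integral>\<^sup>+t. indicator {0<..<pi} t * H t \<partial>lborel)"
  proof -
    have "(\<integral>\<^sup>+y. \<integral>\<^sup>+x. indicator {0<..} y * f (Complex x y) \<partial>lborel \<partial>lborel)
      = (\<integral>\<^sup>+p. \<integral>\<^sup>+r. indicator {- pi / 2<..<pi / 2} p * (indicator {0<..} r * ennreal r) * f (Complex (r * sin p) (r * cos p)) \<partial>lborel \<partial>lborel)"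
      by (rule nn_integral_half_plane) (simp add: borel_prod[symmetric])
    also have "\<dots> = (\<integral>\<^sup>+p. indicator {- pi / 2<..<pi / 2} p * (\<integral>\<^sup>+r. (indicator {0<..} r * ennreal r) * f (Complex (r * sin p) (r * cos p)) \<partial>lborel) \<partial>lborel)"
      by (subst pull) auto
    also have "\<dots> = (\<integral>\<^sup>+t. indicator {- pi / 2<..<pi / 2} (pi / 2 + (- 1) * t) * (\<integral>\<^sup>+r. (indicator {0<..} r * ennreal r)
        * f (Complex (r * sin (pi / 2 + (- 1) * t)) (r * cos (pi / 2 + (- 1) * t))) \<partial>lborel) \<partial>lborel)"
      by (subst nn_integral_real_affine[where c = "- 1" and t = "pi / 2"]) auto
    also have "\<dots> = (\<integral>\<^sup>+t. indicator {0<..<pi} t * H t \<partial>lborel)"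
      by (rule nn_integral_cong) (auto simp: H_def sin_diff cos_diff indicator_def)
    finally show ?thesis .
  qed
  have down: "(\<integral>\<^sup>+y. \<integral>\<^sup>+x. indicator {..<0} y * f (Complex x y) \<partial>lborel \<partial>lborel) = (\<integral>\<^sup>+t. indicator {pi<..<2 * pi} t * H t \<partial>lborel)"
  proof -
    have "(\<integral>\<^sup>+y. \<integral>\<^sup>+x. indicator {..<0} y * f (Complex x y) \<partial>lborel \<partial>lborel)
      = (\<integral>\<^sup>+y. \<integral>\<^sup>+x. indicator {..<0} (0 + (- 1) * y) * f (Complex x (0 + (- 1) * y)) \<partial>lborel \<partial>lborel)"
      by (subst nn_integral_real_affine[where c = "- 1" and t = 0]) auto
    also have "\<dots> = (\<integral>\<^sup>+y. \<integral>\<^sup>+x. indicator {0<..} y * f (Complex (- x) (- y)) \<partial>lborel \<partial>lborel)"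
    proof (rule nn_integral_cong)
      fix y :: real
      have "(\<integral>\<^sup>+x. indicator {..<0} (0 + (- 1) * y) * f (Complex x (0 + (- 1) * y)) \<partial>lborel)
        = ennreal \<bar>- 1\<bar> * (\<integral>\<^sup>+x. indicator {..<0} (0 + (- 1) * y) * f (Complex (0 + (- 1) * x) (0 + (- 1) * y)) \<partial>lborel)"
        by (rule nn_integral_real_affine) auto
      then show "(\<integral>\<^sup>+x. indicator {..<0} (0 + (- 1) * y) * f (Complex x (0 + (- 1) * y)) \<partial>lborel)
        = (\<integral>\<^sup>+x. indicator {0<..} y * f (Complex (- x) (- y)) \<partial>lborel)"
        by (simp add: indicator_def)
    qed
    also have "\<dots> = (\<integral>\<^sup>+p. \<integral>\<^sup>+r. indicator {- pi / 2<..<pi / 2} p * (indicator {0<..} r * ennreal r) * f (Complex (- (r * sin p)) (- (r * cos p))) \<partial>lborel \<partial>lborel)"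
      by (rule nn_integral_half_plane) (simp add: borel_prod[symmetric])
    also have "\<dots> = (\<integral>\<^sup>+p. indicator {- pi / 2<..<pi / 2} p * (\<integral>\<^sup>+r. (indicator {0<..} r * ennreal r) * f (Complex (- (r * sin p)) (- (r * cos p))) \<partial>lborel) \<partial>lborel)"
      by (subst pull) auto
    also have "\<dots> = (\<integral>\<^sup>+t. indicator {- pi / 2<..<pi / 2} (3 * pi / 2 + (- 1) * t) * (\<integral>\<^sup>+r. (indicator {0<..} r * ennreal r)
        * f (Complex (- (r * sin (3 * pi / 2 + (- 1) * t))) (- (r * cos (3 * pi / 2 + (- 1) * t)))) \<partial>lborel) \<partial>lborel)"
      by (subst nn_integral_real_affine[where c = "- 1" and t = "3 * pi / 2"]) auto
    also have "\<dots> = (\<integral>\<^sup>+t. indicator {pi<..<2 * pi} t * H t \<partial>lborel)"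
    proof (rule nn_integral_cong)
      fix t
      have "sin (3 * pi / 2 + (- 1) * t) = - cos t" "cos (3 * pi / 2 + (- 1) * t) = - sin t"
        using sin_3over2_pi cos_3over2_pi by (simp_all add: sin_diff cos_diff)
      then show "indicator {- pi / 2<..<pi / 2} (3 * pi / 2 + (- 1) * t) * (\<integral>\<^sup>+r. (indicator {0<..} r * ennreal r)
        * f (Complex (- (r * sin (3 * pi / 2 + (- 1) * t))) (- (r * cos (3 * pi / 2 + (- 1) * t)))) \<partial>lborel) = indicator {pi<..<2 * pi} t * H t"
        by (auto simp: H_def indicator_def)
    qed
    finally show ?thesis .
  qed
  have "(\<integral>\<^sup>+z. f z \<partial>lborel) = (\<integral>\<^sup>+x. \<integral>\<^sup>+y. f (Complex x y) \<partial>lborel \<partial>lborel)"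
    by (subst lborel_complex_eq_distr, subst nn_integral_distr) (auto simp: lborel.nn_integral_fst[symmetric])
  also have "\<dots> = (\<integral>\<^sup>+y. \<integral>\<^sup>+x. f (Complex x y) \<partial>lborel \<partial>lborel)"
    by (rule lborel_pair.Fubini') measurable
  also have "\<dots> = (\<integral>\<^sup>+y. (\<integral>\<^sup>+x. indicator {0<..} y * f (Complex x y) \<partial>lborel) + (\<integral>\<^sup>+x. indicator {..<0} y * f (Complex x y) \<partial>lborel) \<partial>lborel)"
  proof (rule nn_integral_cong_AE)
    have "AE y in lborel. y \<noteq> (0::real)" by (rule AE_lborel_singleton)
    then show "AE y in lborel. (\<integral>\<^sup>+x. f (Complex x y) \<partial>lborel)
      = (\<integral>\<^sup>+x. indicator {0<..} y * f (Complex x y) \<partial>lborel) + (\<integral>\<^sup>+x. indicator {..<0} y * f (Complex x y) \<partial>lborel)"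
      by eventually_elim (auto simp: indicator_def not_less)
  qed
  also have "\<dots> = (\<integral>\<^sup>+t. indicator {0<..<pi} t * H t \<partial>lborel) + (\<integral>\<^sup>+t. indicator {pi<..<2 * pi} t * H t \<partial>lborel)"
    unfolding up[symmetric] down[symmetric] by (rule nn_integral_add) measurable
  also have "\<dots> = (\<integral>\<^sup>+t. indicator {0<..<pi} t * H t + indicator {pi<..<2 * pi} t * H t \<partial>lborel)"
    by (rule nn_integral_add[symmetric]) measurable
  also have "\<dots> = (\<integral>\<^sup>+t. indicator {0<..<2 * pi} t * H t \<partial>lborel)"
  proof (rule nn_integral_cong_AE)
    have "AE t in lborel. t \<noteq> pi" by (rule AE_lborel_singleton)
    then show "AE t in lborel. indicator {0<..<pi} t * H t + indicator {pi<..<2 * pi} t * H t = indicator {0<..<2 * pi} t * H t"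
      by eventually_elim (auto simp: indicator_def)
  qed
  also have "\<dots> = (\<integral>\<^sup>+t. \<integral>\<^sup>+r. indicator {0<..<2 * pi} t * (indicator {0<..} r * ennreal r) * f (Complex (r * cos t) (r * sin t)) \<partial>lborel \<partial>lborel)"
    unfolding H_def by (subst pull) auto
  finally show ?thesis .
qed

lemma lborel_eq_polar:
  "(lborel :: complex measure) = distr (density (lborel \<Otimes>\<^sub>M lborel)
     (\<lambda>(t, r). ennreal (indicator {0<..<2 * pi} t * (indicator {0<..} r * r)))) borel (\<lambda>(t, r). Complex (r * cos t) (r * sin t))"
  (is "_ = distr (density _ ?d) _ ?p")
proof (rule measure_eqI)
  have p[measurable]: "?p \<in> borel_measurable (lborel \<Otimes>\<^sub>M lborel)" unfolding case_prod_beta' by measurable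
  have d[measurable]: "?d \<in> borel_measurable (lborel \<Otimes>\<^sub>M lborel)" unfolding case_prod_beta' by measurable
  fix A :: "complex set" assume "A \<in> sets lborel"
  then have A[measurable]: "A \<in> sets borel" by simp
  have v: "?p -` A \<inter> space (lborel \<Otimes>\<^sub>M lborel) \<in> sets (lborel \<Otimes>\<^sub>M lborel)"
    by (rule measurable_sets[OF p A])
  have "emeasure lborel A = (\<integral>\<^sup>+z. indicator A z \<partial>lborel)" by simp
  also have "\<dots> = (\<integral>\<^sup>+t. \<integral>\<^sup>+r. indicator {0<..<2 * pi} t * (indicator {0<..} r * ennreal r) * indicator A (Complex (r * cos t) (r * sin t)) \<partial>lborel \<partial>lborel)"
    by (rule nn_integral_polar) measurable
  also have "\<dots> = (\<integral>\<^sup>+t. \<integral>\<^sup>+r. (\<lambda>q. ?d q * indicator (?p -` A \<inter> space (lborel \<Otimes>\<^sub>M lborel)) q) (t, r) \<partial>lborel \<partial>lborel)"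
    by (intro nn_integral_cong) (auto simp: indicator_def space_pair_measure)
  also have "\<dots> = (\<integral>\<^sup>+q. ?d q * indicator (?p -` A \<inter> space (lborel \<Otimes>\<^sub>M lborel)) q \<partial>(lborel \<Otimes>\<^sub>M lborel))"
    using v by (subst lborel.nn_integral_fst) auto
  also have "\<dots> = emeasure (distr (density (lborel \<Otimes>\<^sub>M lborel) ?d) borel ?p) A"
    using v by (subst emeasure_distr, simp, simp, subst emeasure_density) auto
  finally show "emeasure lborel A = emeasure (distr (density (lborel \<Otimes>\<^sub>M lborel) ?d) borel ?p) A" .
qed simp

lemma has_bochner_integral_product:
  fixes f :: "real \<Rightarrow> complex" and g :: "real \<Rightarrow> real"
  assumes f: "has_bochner_integral lborel f a" and g: "has_bochner_integral lborel g b"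
  shows "has_bochner_integral (lborel \<Otimes>\<^sub>M lborel) (\<lambda>(x, y). g y *\<^sub>R f x) (b *\<^sub>R a)"
proof -
  have fi: "integrable lborel f" "integral\<^sup>L lborel f = a" and gi: "integrable lborel g" "integral\<^sup>L lborel g = b"
    using f g by (auto simp: has_bochner_integral_iff)
  have [measurable]: "f \<in> borel_measurable borel" "g \<in> borel_measurable borel"
    using borel_measurable_integrable[OF fi(1)] borel_measurable_integrable[OF gi(1)] by simp_all
  have i: "integrable (lborel \<Otimes>\<^sub>M lborel) (\<lambda>(x, y). g y *\<^sub>R f x)"
  proof (rule lborel_pair.Fubini_integrable)
    show "(\<lambda>(x, y). g y *\<^sub>R f x) \<in> borel_measurable (lborel \<Otimes>\<^sub>M lborel)" by measurable
    have "(\<lambda>x. \<integral>y. norm (case (x, y) of (x, y) \<Rightarrow> g y *\<^sub>R f x) \<partial>lborel) = (\<lambda>x. (\<integral>y. norm (g y) \<partial>lborel) * norm (f x))"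
      by simp
    then show "integrable lborel (\<lambda>x. \<integral>y. norm (case (x, y) of (x, y) \<Rightarrow> g y *\<^sub>R f x) \<partial>lborel)"
      using fi by (simp only:) (intro integrable_mult_right integrable_norm)
    show "AE x in lborel. integrable lborel (\<lambda>y. case (x, y) of (x, y) \<Rightarrow> g y *\<^sub>R f x)"
      using gi by (intro always_eventually) simp
  qed
  have "integral\<^sup>L (lborel \<Otimes>\<^sub>M lborel) (\<lambda>(x, y). g y *\<^sub>R f x) = (\<integral>x. \<integral>y. g y *\<^sub>R f x \<partial>lborel \<partial>lborel)"
    using lborel_pair.integral_fst'[OF i] by simp
  also have "\<dots> = b *\<^sub>R a" using fi gi by simp
  finally show ?thesis using i by (simp add: has_bochner_integral_iff)
qed

text \<open>Set to 0 on the closed positive real axis, the only place where \<open>Arg2pi\<close>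
  may be discontinuous; this makes measurability immediate.\<close>

definition argument :: "complex \<Rightarrow> real" where
  "argument z = indicator (- \<real>\<^sub>\<ge>\<^sub>0) z * Arg2pi z"

lemma borel_measurable_argument [measurable]: "argument \<in> borel_measurable borel"
proof -
  have "continuous_on (- \<real>\<^sub>\<ge>\<^sub>0) Arg2pi"
    by (intro continuous_at_imp_continuous_on ballI continuous_at_Arg2pi) auto
  then have "(\<lambda>z. indicator (- \<real>\<^sub>\<ge>\<^sub>0) z *\<^sub>R Arg2pi z) \<in> borel_measurable borel"
    by (rule borel_measurable_continuous_on_indicator[rotated]) (intro borel_open open_Compl closed_nonneg_Reals_complex)
  then show ?thesis by (simp add: argument_def[abs_def])
qed

lemma argument_polar:
  assumes "0 < r" "0 < t" "t < 2 * pi"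
  shows "argument (Complex (r * cos t) (r * sin t)) = t"
proof -
  have eq: "Complex (r * cos t) (r * sin t) = of_real r * exp (\<i> * of_real t)"
    by (simp add: complex_eq_iff Re_exp Im_exp)
  have A: "Arg2pi (Complex (r * cos t) (r * sin t)) = t"
    by (rule Arg2pi_unique) (use assms eq in auto)
  have "Complex (r * cos t) (r * sin t) \<notin> \<real>\<^sub>\<ge>\<^sub>0"
  proof
    assume *: "Complex (r * cos t) (r * sin t) \<in> \<real>\<^sub>\<ge>\<^sub>0"
    then have "sin t = 0" "0 \<le> cos t" using assms by (auto simp: complex_nonneg_Reals_iff zero_le_mult_iff)
    then have "t = pi" using sin_zero_pi_iff[of "t - pi"] assms by (simp add: sin_diff)
    then show False using \<open>0 \<le> cos t\<close> by simp
  qed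
  then show ?thesis using A by (simp add: argument_def)
qed

lemma has_bochner_integral_polar:
  fixes h :: "real \<Rightarrow> complex" and g :: "real \<Rightarrow> real"
  assumes h: "has_bochner_integral lborel (\<lambda>t. indicator {0<..<2 * pi} t *\<^sub>R h t) a"
    and g: "has_bochner_integral lborel (\<lambda>r. indicator {0<..} r * r * g r) b"
    and [measurable]: "h \<in> borel_measurable borel" "g \<in> borel_measurable borel"
  shows "has_bochner_integral lborel (\<lambda>z. g (cmod z) *\<^sub>R h (argument z)) (b *\<^sub>R a)"
proof -
  let ?d = "\<lambda>(t, r). indicator {0<..<2 * pi} t * (indicator {0<..} r * r) :: real"
  let ?p = "\<lambda>(t, r). Complex (r * cos t) (r * sin t)"
  let ?f = "\<lambda>z. g (cmod z) *\<^sub>R h (argument z)"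
  have p[measurable]: "?p \<in> borel_measurable (lborel \<Otimes>\<^sub>M lborel)" unfolding case_prod_beta' by measurable
  have d[measurable]: "?d \<in> borel_measurable (lborel \<Otimes>\<^sub>M lborel)" unfolding case_prod_beta' by measurable
  have dn: "AE q in lborel \<Otimes>\<^sub>M lborel. 0 \<le> ?d q" by (intro always_eventually) (auto simp: indicator_def)
  have f[measurable]: "?f \<in> borel_measurable borel" by measurable
  have eq: "?d q *\<^sub>R ?f (?p q) = (case q of (t, r) \<Rightarrow> (indicator {0<..} r * r * g r) *\<^sub>R (indicator {0<..<2 * pi} t *\<^sub>R h t))" for q
  proof (cases q)
    case (Pair t r)
    show ?thesis
    proof (cases "0 < t \<and> t < 2 * pi \<and> 0 < r")
      case True
      have "cmod (Complex (r * cos t) (r * sin t)) = r"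
        using True by (simp add: cmod_def power_mult_distrib flip: distrib_left)
      then show ?thesis using True argument_polar[of r t] by (simp add: Pair)
    qed (auto simp: Pair indicator_def)
  qed
  have L: "(lborel :: complex measure) = distr (density (lborel \<Otimes>\<^sub>M lborel) (\<lambda>q. ennreal (?d q))) borel ?p"
    using lborel_eq_polar by (simp add: case_prod_beta')
  have "has_bochner_integral (lborel \<Otimes>\<^sub>M lborel) (\<lambda>q. ?d q *\<^sub>R ?f (?p q)) (b *\<^sub>R a)"
    unfolding eq by (rule has_bochner_integral_product[OF h g])
  then have i: "integrable (lborel \<Otimes>\<^sub>M lborel) (\<lambda>q. ?d q *\<^sub>R ?f (?p q))"
    "integral\<^sup>L (lborel \<Otimes>\<^sub>M lborel) (\<lambda>q. ?d q *\<^sub>R ?f (?p q)) = b *\<^sub>R a"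
    by (auto simp: has_bochner_integral_iff)
  have p': "?p \<in> borel_measurable (density (lborel \<Otimes>\<^sub>M lborel) (\<lambda>q. ennreal (?d q)))" using p by simp
  have fp: "(\<lambda>q. ?f (?p q)) \<in> borel_measurable (lborel \<Otimes>\<^sub>M lborel)" by (rule measurable_compose[OF p f])
  have "integrable (distr (density (lborel \<Otimes>\<^sub>M lborel) (\<lambda>q. ennreal (?d q))) borel ?p) ?f"
    unfolding integrable_distr_eq[OF p' f] integrable_density[OF fp d dn] by (rule i(1))
  moreover have "integral\<^sup>L (distr (density (lborel \<Otimes>\<^sub>M lborel) (\<lambda>q. ennreal (?d q))) borel ?p) ?f = b *\<^sub>R a"
    unfolding integral_distr[OF p' f] integral_density[OF fp d dn] by (rule i(2))
  ultimately show ?thesis unfolding has_bochner_integral_iff L[symmetric] by simp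
qed

text \<open>The integral of r^(n + 1) exp (- r^2 / 2) over r > 0, in the closed form that matches
  the known moments of exp (- x^2).\<close>

definition radial :: "nat \<Rightarrow> real" where
  "radial n = (if even n then 2 ^ (n div 2) * fact (n div 2)
     else sqrt 2 * sqrt pi * fact (n + 1) / (2 ^ ((n + 1) div 2) * 2 * fact ((n + 1) div 2)))"

lemma radial_0: "radial 0 = 1"
  by (simp add: radial_def)

lemma radial_Suc: "radial (Suc (Suc n)) = (real n + 2) * radial n"
proof (cases "even n")
  case True
  then obtain k where "n = 2 * k" by (auto elim: evenE)
  then show ?thesis by (simp add: radial_def algebra_simps)
next
  case False
  then obtain k where n: "n = 2 * k + 1" by (auto elim: oddE)
  define a b p :: real where "a = fact (n + 1)" and "b = fact (k + 1)" and "p = 2 ^ (k + 1)"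
  have pos: "b \<noteq> 0" "p \<noteq> 0" by (simp_all add: b_def p_def)
  have f1: "fact (Suc (Suc n) + 1) = (2 * (real k + 2)) * ((real n + 2) * a)"
    unfolding a_def using fact_Suc[of "Suc (n + 1)", where 'a = real] fact_Suc[of "n + 1", where 'a = real]
    by (simp add: n del: fact_Suc)
  have f2: "fact ((Suc (Suc n) + 1) div 2) = (real k + 2) * b" "(2 :: real) ^ ((Suc (Suc n) + 1) div 2) = 2 * p"
    by (simp_all add: n b_def p_def)
  have f3: "fact ((n + 1) div 2) = b" "(2 :: real) ^ ((n + 1) div 2) = p"
    by (simp_all add: n b_def p_def)
  have "radial (Suc (Suc n)) = sqrt 2 * sqrt pi * ((2 * (real k + 2)) * ((real n + 2) * a)) / (2 * p * 2 * ((real k + 2) * b))"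
    unfolding radial_def f1 f2 using False by simp
  also have "\<dots> = (real n + 2) * (sqrt 2 * sqrt pi * a / (p * 2 * b))"
    using pos by (simp add: divide_simps)
  also have "sqrt 2 * sqrt pi * a / (p * 2 * b) = radial n"
    unfolding radial_def f3 a_def using False by simp
  finally show ?thesis .
qed

lemma radial_integral:
  "has_bochner_integral lborel (\<lambda>r. indicator {0<..} r * r * (r ^ n * exp (- r\<^sup>2 / 2))) (radial n)"
proof -
  define I where "I = (if odd n then (sqrt pi / 2) * (fact (2 * ((n + 1) div 2)) / (2 ^ (2 * ((n + 1) div 2)) * fact ((n + 1) div 2)))
     else fact (n div 2) / 2)"
  have I: "has_bochner_integral lborel (\<lambda>x::real. indicator {0..} x *\<^sub>R (exp (- x\<^sup>2) * x ^ (n + 1))) I"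
  proof (cases "even n")
    case True
    then have "2 * (n div 2) + 1 = n + 1" by simp
    then show ?thesis using gaussian_moment_odd_pos[of "n div 2"] True unfolding I_def by (simp only: if_False not_True_eq_False)
  next
    case False
    then have "2 * ((n + 1) div 2) = n + 1" by simp
    then show ?thesis using gaussian_moment_even_pos[of "(n + 1) div 2"] False unfolding I_def by (simp only: if_True not_False_eq_True)
  qed
  \<comment> \<open>The rescaling r = sqrt 2 x turns exp (- x^2) into exp (- r^2 / 2).\<close>
  have s: "inverse (sqrt 2) \<noteq> (0 :: real)" by simp
  define J where "J r = indicator {0..} (0 + inverse (sqrt 2) * r) *\<^sub>R
      (exp (- (0 + inverse (sqrt 2) * r)\<^sup>2) * (0 + inverse (sqrt 2) * r) ^ (n + 1))" for r :: real
  have J: "has_bochner_integral lborel J (I /\<^sub>R \<bar>inverse (sqrt 2)\<bar>)"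
    unfolding J_def[abs_def] by (rule iffD1[OF lborel_has_bochner_integral_real_affine_iff[OF s, of _ _ 0] I])
  have "has_bochner_integral lborel (\<lambda>r. sqrt 2 ^ (n + 1) * J r) (sqrt 2 ^ (n + 1) * (I /\<^sub>R \<bar>inverse (sqrt 2)\<bar>))"
    by (rule has_bochner_integral_mult_right) (rule J)
  also have "(\<lambda>r. sqrt 2 ^ (n + 1) * J r) = (\<lambda>r. indicator {0<..} r * r * (r ^ n * exp (- r\<^sup>2 / 2)))"
  proof
    fix r :: real
    have 1: "(inverse (sqrt 2) * r)\<^sup>2 = r\<^sup>2 / 2"
    proof -
      have "inverse (sqrt 2) * r = r / sqrt 2" by (simp only: divide_inverse mult.commute)
      then show ?thesis by (simp only: power_divide) simp
    qed
    have 2: "sqrt 2 ^ (n + 1) * (inverse (sqrt 2) * r) ^ (n + 1) = r ^ (n + 1)"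
      by (simp only: power_mult_distrib[symmetric] mult.assoc[symmetric]) simp
    have 3: "indicator {0..} (inverse (sqrt 2) * r) = (indicator {0..} r :: real)"
      by (simp add: indicator_def zero_le_mult_iff)
    have "sqrt 2 ^ (n + 1) * J r
      = indicator {0..} r * (exp (- (r\<^sup>2 / 2)) * (sqrt 2 ^ (n + 1) * (inverse (sqrt 2) * r) ^ (n + 1)))"
      unfolding J_def add_0 1 3 by (simp only: real_scaleR_def mult_ac)
    also have "\<dots> = indicator {0<..} r * r * (r ^ n * exp (- r\<^sup>2 / 2))"
      unfolding 2 by (cases "r = 0") (auto simp: indicator_def)
    finally show "sqrt 2 ^ (n + 1) * J r = indicator {0<..} r * r * (r ^ n * exp (- r\<^sup>2 / 2))" .
  qed
  also have "sqrt 2 ^ (n + 1) * (I /\<^sub>R \<bar>inverse (sqrt 2)\<bar>) = radial n"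
  proof (cases "even n")
    case True
    then obtain k where n: "n = 2 * k" by (auto elim: evenE)
    have "sqrt 2 ^ (2 * k) = (2::real) ^ k" by (simp add: power_mult)
    then show ?thesis by (simp add: n I_def radial_def)
  next
    case False
    then obtain k where n: "n = 2 * k + 1" by (auto elim: oddE)
    define a b p :: real where "a = fact (2 * (k + 1))" and "b = fact (k + 1)" and "p = 2 ^ (k + 1)"
    have pos: "b \<noteq> 0" "p \<noteq> 0" by (simp_all add: b_def p_def)
    have p1: "sqrt 2 ^ (n + 1) = p" using power_mult[of "sqrt 2" 2 "k + 1"] by (simp add: n p_def)
    have p2: "(2::real) ^ (2 * (k + 1)) = p * p" by (simp only: p_def power_add[symmetric] mult_2)
    have k: "(n + 1) div 2 = k + 1" "n + 1 = 2 * (k + 1)" "odd n" by (simp_all add: n)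
    have I': "I = (sqrt pi / 2) * (a / (p * p * b))"
      unfolding I_def k(1) p2 a_def b_def using k(3) by (simp only: if_True not_False_eq_True)
    have r': "radial n = sqrt 2 * sqrt pi * a / (p * 2 * b)"
      unfolding radial_def k(1) using k(3) unfolding k(2) a_def b_def p_def by (simp only: if_False)
    show ?thesis unfolding p1 I' r' using pos by (simp add: divide_simps)
  qed
  finally show ?thesis .
qed

section \<open>The weight as a function of the angle\<close>

lemma mat2_eqI:
  fixes A B :: "real^2^2"
  assumes "A $ 1 $ 1 = B $ 1 $ 1" "A $ 1 $ 2 = B $ 1 $ 2" "A $ 2 $ 1 = B $ 2 $ 1" "A $ 2 $ 2 = B $ 2 $ 2"
  shows "A = B"
  using assms by (simp add: vec_eq_iff forall_2)

lemma mat2_mult: "mat2 a b c d ** mat2 e f g h = mat2 (a * e + b * g) (a * f + b * h) (c * e + d * g) (c * f + d * h)"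
  by (rule mat2_eqI) (simp_all add: matrix_matrix_mult_def sum_2)

lemma mat2_transpose: "transpose (mat2 a b c d) = mat2 a c b d"
  by (rule mat2_eqI) (simp_all add: transpose_def)

lemma mat2_scaleR: "r *\<^sub>R mat2 a b c d = mat2 (r * a) (r * b) (r * c) (r * d)"
  by (rule mat2_eqI) simp_all

lemma mat2_one: "mat 1 = mat2 1 0 0 1"
  by (rule mat2_eqI) (simp_all add: mat_def)

lemma matrix_inv_eqI:
  fixes A B :: "real^'n^'n"
  assumes "A ** B = mat 1" "B ** A = mat 1"
  shows "matrix_inv A = B"
proof -
  have "A ** matrix_inv A = mat 1 \<and> matrix_inv A ** A = mat 1"
    unfolding matrix_inv_def by (rule someI[of _ B]) (use assms in simp)
  then have "matrix_inv A = (B ** A) ** matrix_inv A" using assms by simp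
  also have "\<dots> = B" using \<open>A ** matrix_inv A = mat 1 \<and> _\<close> by (simp add: matrix_mul_assoc[symmetric])
  finally show ?thesis .
qed

text \<open>The real symmetric matrix with trace \<open>t\<close> and \<open>u = k\<^sub>1\<^sub>1 - k\<^sub>2\<^sub>2 + 2 \<i> k\<^sub>1\<^sub>2\<close>.\<close>

definition sym_mat :: "real \<Rightarrow> complex \<Rightarrow> real^2^2" where
  "sym_mat t u = mat2 ((t + Re u) / 2) (Im u / 2) (Im u / 2) ((t - Re u) / 2)"

text \<open>Conjugation by a rotation fixes the trace and turns the trace-free part by twice the
  angle, here expressed by the algebraic double-angle formulas; a reflection conjugates it in
  addition.\<close>

lemma sym_mat_rotation:
  assumes "c\<^sup>2 + s\<^sup>2 = 1"
  shows "mat2 c (- s) s c ** sym_mat t u ** mat2 c s (- s) c = sym_mat t (u * Complex (c\<^sup>2 - s\<^sup>2) (2 * c * s))"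
  unfolding sym_mat_def mat2_mult
  by (rule mat2_eqI) (simp_all, (use assms in algebra)+)

lemma sym_mat_reflection:
  assumes "c\<^sup>2 + s\<^sup>2 = 1"
  shows "mat2 c s s (- c) ** sym_mat t u ** mat2 c s s (- c) = sym_mat t (cnj u * Complex (c\<^sup>2 - s\<^sup>2) (2 * c * s))"
  unfolding sym_mat_def mat2_mult
  by (rule mat2_eqI) (simp_all, (use assms in algebra)+)

lemma tau_conj:
  fixes m l j :: nat
  defines "a \<equiv> 2 * pi * real l * real j / real m"
  shows "matrix_inv (tau m l (Rotn j)) ** sym_mat t u ** tau m l (Rotn j) = sym_mat t (u * cis (2 * a))"
    and "matrix_inv (tau m l (Refl j)) ** sym_mat t u ** tau m l (Refl j) = sym_mat t (cnj u * cis (2 * a))"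
proof -
  let ?c = "cos a" and ?s = "sin a"
  have cs: "?c\<^sup>2 + ?s\<^sup>2 = 1" by simp
  have c2: "Complex (?c\<^sup>2 - ?s\<^sup>2) (2 * ?c * ?s) = cis (2 * a)"
    by (simp add: complex_eq_iff cos_double sin_double)
  have r: "tau m l (Rotn j) = mat2 ?c ?s (- ?s) ?c" "tau m l (Refl j) = mat2 ?c ?s ?s (- ?c)"
    by (simp_all add: Let_def a_def)
  have i1: "matrix_inv (mat2 ?c ?s (- ?s) ?c) = mat2 ?c (- ?s) ?s ?c"
    by (rule matrix_inv_eqI) (simp_all only: mat2_mult mat2_one, simp_all add: mult.commute flip: power2_eq_square)
  have i2: "matrix_inv (mat2 ?c ?s ?s (- ?c)) = mat2 ?c ?s ?s (- ?c)"
    by (rule matrix_inv_eqI) (simp_all only: mat2_mult mat2_one, simp_all add: mult.commute flip: power2_eq_square)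
  show "matrix_inv (tau m l (Rotn j)) ** sym_mat t u ** tau m l (Rotn j) = sym_mat t (u * cis (2 * a))"
    unfolding r i1 sym_mat_rotation[OF cs] c2 ..
  show "matrix_inv (tau m l (Refl j)) ** sym_mat t u ** tau m l (Refl j) = sym_mat t (cnj u * cis (2 * a))"
    unfolding r i2 sym_mat_reflection[OF cs] c2 ..
qed

text \<open>The eigenvalues are (t \<plusminus> |u|) / 2. With the vector read as a complex number
  w, twice the quadratic form is t |w|^2 + Re (cnj u w^2).\<close>

lemma pos_def_sym_mat:
  assumes "cmod u < t"
  shows "pos_def (sym_mat t u)"
  unfolding pos_def_def
proof (intro conjI allI impI)
  show "transpose (sym_mat t u) = sym_mat t u" by (simp add: sym_mat_def mat2_transpose)
  fix x :: "real^2" assume x: "x \<noteq> 0"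
  define w where "w = Complex (x $ 1) (x $ 2)"
  have cw: "(cmod w)\<^sup>2 = (x $ 1)\<^sup>2 + (x $ 2)\<^sup>2" by (simp add: w_def cmod_power2)
  have w: "0 < (cmod w)\<^sup>2" using x by (simp add: w_def vec_eq_iff forall_2 complex_eq_iff)
  have "- (cmod u * (cmod w)\<^sup>2) \<le> Re (cnj u * w\<^sup>2)"
    using abs_Re_le_cmod[of "cnj u * w\<^sup>2"] by (simp add: norm_mult norm_power)
  moreover have "Re (cnj u * w\<^sup>2) = Re u * ((x $ 1)\<^sup>2 - (x $ 2)\<^sup>2) + 2 * Im u * x $ 1 * x $ 2"
    by (simp add: w_def power2_eq_square)
  moreover have "2 * (x \<bullet> (sym_mat t u *v x)) = t * (cmod w)\<^sup>2 + (Re u * ((x $ 1)\<^sup>2 - (x $ 2)\<^sup>2) + 2 * Im u * x $ 1 * x $ 2)"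
    unfolding cw by (simp add: sym_mat_def inner_vec_def matrix_vector_mult_def sum_2 power2_eq_square field_simps)
  moreover have "cmod u * (cmod w)\<^sup>2 < t * (cmod w)\<^sup>2" using assms w by simp
  ultimately show "0 < x \<bullet> (sym_mat t u *v x)" by linarith
qed

context hyp_pair begin

text \<open>The trace-free part of K itself: rotating by \<delta> m \<theta> turns V + \<i> W by
  twice that angle.\<close>

definition "UU x = cis (- (2 * d * x)) * Complex (V x) (W x)"

text \<open>The difference of the squares is four times the determinant of K, and that determinant
  is \<open>c0\<^sup>2 * (Hm * Hp)\<close> times the square of the Wronskian.\<close>

lemma cmod_UU_less_T:
  assumes x: "0 < x" "x < pi"
  shows "cmod (UU x) < T x"
proof -
  let ?a = "\<tau> x powr (2 * \<kappa>)" and ?b = "\<tau> x powr (- (2 * \<kappa>))"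
  have ab: "?a * ?b = 1" by (rule powr_cancel[OF x])
  have pos: "0 < ?a" "0 \<le> ?b" using half_angle[OF x] by simp_all
  have "0 < F x" using F_bounds(1)[OF x] H_pos by linarith
  then have A: "0 < A x" unfolding A_def using c0_pos H_pos by (intro mult_pos_pos add_pos_nonneg) auto
  have C: "0 \<le> C x" unfolding C_def using c0_pos H_pos by (intro mult_nonneg_nonneg add_nonneg_nonneg) auto
  have T: "0 < T x" unfolding T_def using A C pos by (intro add_pos_nonneg mult_pos_pos mult_nonneg_nonneg) auto
  have "A x * C x - (N x)\<^sup>2 = c0\<^sup>2 * (Hm * Hp) * (F x * G x + Q x * P x)\<^sup>2"
    unfolding A_def C_def N_def by (simp add: power2_eq_square algebra_simps)
  then have det: "0 < A x * C x - (N x)\<^sup>2" using c0_pos H_pos by (simp add: wronskian[OF x])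
  have "(T x)\<^sup>2 - (V x)\<^sup>2 = 4 * (?a * ?b) * (A x * C x)"
    unfolding T_def V_def by (simp add: power2_eq_square algebra_simps)
  then have "(T x)\<^sup>2 - ((V x)\<^sup>2 + (W x)\<^sup>2) = 4 * (A x * C x - (N x)\<^sup>2)"
    unfolding ab W_def by (simp add: power2_eq_square)
  moreover have "(cmod (UU x))\<^sup>2 = (V x)\<^sup>2 + (W x)\<^sup>2"
    by (simp add: UU_def norm_mult cmod_power2)
  ultimately have "(T x)\<^sup>2 - (cmod (UU x))\<^sup>2 = 4 * (A x * C x - (N x)\<^sup>2)" by simp
  moreover have "0 < 4 * (A x * C x - (N x)\<^sup>2)" using det by simp
  ultimately have "(cmod (UU x))\<^sup>2 < (T x)\<^sup>2" by simp
  then show ?thesis using T by (simp add: power2_less_imp_less)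
qed

lemma wt_K_eq:
  assumes m: "0 < m" and t: "0 < t" "t < pi / real m"
  shows "wt_K m \<kappa> d t = sym_mat (T (real m * t)) (UU (real m * t))"
proof -
  define x where "x = real m * t"
  have x: "0 < x" "x < pi" using m t by (simp_all add: x_def field_simps)
  define a where "a = \<tau> x powr \<kappa>"
  define b where "b = \<tau> x powr (- \<kappa>)"
  define c where "c = cos (d * x)"
  define s where "s = sin (d * x)"
  have ab: "a * b = 1" unfolding a_def b_def by (rule powr_cancel[OF x])
  have aa: "\<tau> x powr (2 * \<kappa>) = a\<^sup>2" "\<tau> x powr (- (2 * \<kappa>)) = b\<^sup>2"
    unfolding a_def b_def power2_eq_square by (simp_all add: powr_add[symmetric])
  have cs: "c\<^sup>2 + s\<^sup>2 = 1" by (simp add: c_def s_def)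
  have v: "sin (real m * t / 2) = sin (x / 2)" by (simp add: x_def)
  have f: "wt_f1 \<kappa> d ((sin (x / 2))\<^sup>2) = a * F x" "wt_f2 \<kappa> d ((sin (x / 2))\<^sup>2) = b * Q x"
    "wt_f1 (- \<kappa>) d ((sin (x / 2))\<^sup>2) = b * G x" "wt_f2 (- \<kappa>) d ((sin (x / 2))\<^sup>2) = a * P x"
    using p.wt_f1_eq[OF x] p.wt_f2_eq[OF x] m.wt_f1_eq[OF x] m.wt_f2_eq[OF x] by (simp_all add: a_def b_def)
  have rot: "cos (d * real m * t) = c" "sin (d * real m * t) = s" by (simp_all add: c_def s_def x_def mult.assoc)
  define n1 where "n1 = a\<^sup>2 * A x"
  define n2 where "n2 = b\<^sup>2 * C x"
  have n1: "n1 = c0 * (Hm * (a * F x)\<^sup>2 + Hp * (a * P x)\<^sup>2)" by (simp add: n1_def A_def power2_eq_square algebra_simps)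
  have n2: "n2 = c0 * (Hm * (b * Q x)\<^sup>2 + Hp * (b * G x)\<^sup>2)" by (simp add: n2_def C_def power2_eq_square algebra_simps)
  have n12: "N x = c0 * (Hm * (a * F x) * (b * Q x) - Hp * (b * G x) * (a * P x))"
  proof -
    have "c0 * (Hm * (a * F x) * (b * Q x) - Hp * (b * G x) * (a * P x)) = (a * b) * N x"
      by (simp add: N_def algebra_simps)
    then show ?thesis by (simp add: ab)
  qed
  have u: "Re (UU x) = (c\<^sup>2 - s\<^sup>2) * (n1 - n2) + 2 * s * c * (2 * N x)"
    "Im (UU x) = (c\<^sup>2 - s\<^sup>2) * (2 * N x) - 2 * s * c * (n1 - n2)"
    using cos_double[of "d * x"] sin_double[of "d * x"]
    by (simp_all add: UU_def V_def W_def aa n1_def n2_def c_def s_def mult.assoc)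
  have T: "T x = n1 + n2" by (simp add: T_def aa n1_def n2_def)
  have e11: "c\<^sup>2 * n1 + s\<^sup>2 * n2 + 2 * s * c * N x = (T x + Re (UU x)) / 2"
    and e22: "s\<^sup>2 * n1 + c\<^sup>2 * n2 - 2 * s * c * N x = (T x - Re (UU x)) / 2"
  proof -
    have "T x = (c\<^sup>2 + s\<^sup>2) * (n1 + n2)" using T cs by simp
    then show "c\<^sup>2 * n1 + s\<^sup>2 * n2 + 2 * s * c * N x = (T x + Re (UU x)) / 2"
      "s\<^sup>2 * n1 + c\<^sup>2 * n2 - 2 * s * c * N x = (T x - Re (UU x)) / 2"
      unfolding u by (simp_all add: algebra_simps)
  qed
  have e12: "(c\<^sup>2 - s\<^sup>2) * N x - s * c * (n1 - n2) = Im (UU x) / 2"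
    unfolding u by (simp add: algebra_simps)
  have L: "wt_L m \<kappa> d t = mat2 (a * F x * c + b * Q x * s) (a * F x * - s + b * Q x * c)
      (- (a * P x) * c + b * G x * s) (- (a * P x) * - s + b * G x * c)"
    unfolding wt_L_def Let_def v f rot mat2_mult ..
  have "wt_K m \<kappa> d t = c0 *\<^sub>R (transpose (wt_L m \<kappa> d t) ** mat2 Hm 0 0 Hp ** wt_L m \<kappa> d t)"
    by (simp add: wt_K_def c0_def)
  also have "\<dots> = mat2 (c\<^sup>2 * n1 + s\<^sup>2 * n2 + 2 * s * c * N x) ((c\<^sup>2 - s\<^sup>2) * N x - s * c * (n1 - n2))
      ((c\<^sup>2 - s\<^sup>2) * N x - s * c * (n1 - n2)) (s\<^sup>2 * n1 + c\<^sup>2 * n2 - 2 * s * c * N x)"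
    unfolding L mat2_transpose mat2_mult mat2_scaleR n1 n2 n12
    by (rule mat2_eqI) (simp_all add: power2_eq_square algebra_simps)
  also have "\<dots> = sym_mat (T x) (UU x)"
    unfolding sym_mat_def e11 e22 e12 ..
  finally show ?thesis unfolding x_def .
qed

end

section \<open>Extension of the weight to all chambers\<close>

locale dihedral_weight =
  fixes m l :: nat and \<kappa> \<delta> :: real and K :: "complex \<Rightarrow> real^2^2"
  assumes m3: "3 \<le> m" and l1: "1 \<le> l" and lm: "l \<le> (m - 1) div 2"
    and \<kappa>1: "- (real l / real m) < \<kappa>" and \<kappa>2: "\<kappa> < real l / real m"
    and \<delta>: "\<delta> = 1 / 2 - real l / real m"
    and K1: "\<And>r \<theta>. 0 < r \<Longrightarrow> 0 < \<theta> \<Longrightarrow> \<theta> < pi / real m \<Longrightarrow>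
           K (of_real r * exp (\<i> * of_real \<theta>)) = wt_K m \<kappa> \<delta> \<theta>"
    and K2: "\<And>z w. z \<in> chamber m 1 \<Longrightarrow> w \<in> I2 m \<Longrightarrow>
           K (act m z w) = matrix_inv (tau m l w) ** K z ** tau m l w"
begin

lemma l_bounds: "0 < l" "2 * l < m" "0 < m"
  using m3 l1 lm by auto

sublocale h: hyp_pair \<kappa> \<delta>
proof
  have "real l / real m < 1 / 2" using l_bounds by (simp add: field_simps)
  then show "0 < \<delta>" by (simp add: \<delta>)
  show "\<delta> < 1 / 2 - \<bar>\<kappa>\<bar>" using \<kappa>1 \<kappa>2 by (simp add: \<delta>)
qed

sublocale g: dihedral_params m l \<kappa>
  using l_bounds by unfold_locales

lemma two_\<delta>: "2 * \<delta> * (real m * x) = (real m - 2 * real l) * x"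
  using l_bounds by (simp add: \<delta> field_simps)

definition fold :: "real \<Rightarrow> real" where "fold x = arccos (cos x)"
definition "T_ang t = h.T (fold (real m * t))"
text \<open>The phase is taken in the unfolded angle. Under t \<mapsto> t + 2 \<pi> / m it acquires
  the factor cis (4 \<pi> l / m), which is the action of \<tau> on the trace-free part. A reflection
  reverses t and conjugates, whence the sign before W.\<close>

definition "U_ang t = cis (- ((real m - 2 * real l) * t))
   * Complex (h.V (fold (real m * t))) (sgn (sin (real m * t)) * h.W (fold (real m * t)))"

lemma fold_bounds: "sin x \<noteq> 0 \<Longrightarrow> 0 < fold x \<and> fold x < pi"
proof -
  assume s: "sin x \<noteq> 0"
  then have "(cos x)\<^sup>2 < 1" using sin_cos_squared_add[of x] zero_less_power2[of "sin x"] by linarith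
  then have "\<bar>cos x\<bar> < 1" by (simp add: abs_square_less_1)
  then show ?thesis unfolding fold_def using arccos_lt_bounded[of "cos x"] by auto
qed

text \<open>The integer that moves an angle back to the fundamental chamber is reduced modulo m to
  an admissible index; both phases survive since they change by full turns.\<close>

lemma omega_power_int:
  fixes n :: int
  defines "j \<equiv> nat (n mod int m)"
  shows "j < m" "omega m ^ j = cis (2 * pi * real_of_int n / real m)"
    and "cis (2 * (2 * pi * real l * real j / real m)) = cis (4 * pi * real l * real_of_int n / real m)"
proof -
  have m: "0 < real m" using l_bounds by simp
  have j: "int j = n mod int m" using l_bounds by (simp add: j_def)
  show "j < m" using l_bounds by (simp add: j_def nat_less_iff)
  define q where "q = n div int m"
  have n: "real_of_int n = real m * real_of_int q + real j"
  proof -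
    have "n = int m * q + int j" by (simp add: j q_def)
    then show ?thesis by (metis of_int_add of_int_mult of_int_of_nat_eq)
  qed
  have e1: "2 * pi * real_of_int n / real m = 2 * pi * real_of_int q + 2 * pi * real j / real m"
    unfolding n using m by (simp add: field_simps)
  show "omega m ^ j = cis (2 * pi * real_of_int n / real m)"
    unfolding e1 omega_power cis_mult[symmetric] using cis_multiple_2pi[of "real_of_int q"] by simp
  have e2: "4 * pi * real l * real_of_int n / real m = 2 * pi * real_of_int (2 * int l * q) + 2 * (2 * pi * real l * real j / real m)"
    unfolding n using m by (simp add: field_simps)
  show "cis (2 * (2 * pi * real l * real j / real m)) = cis (4 * pi * real l * real_of_int n / real m)"
    unfolding e2 cis_mult[symmetric] using cis_multiple_2pi[of "real_of_int (2 * int l * q)"] by simp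
qed

lemma K_eq:
  assumes r: "0 < r" and s: "sin (real m * t) \<noteq> 0"
  shows "K (of_real r * cis t) = sym_mat (T_ang t) (U_ang t)"
proof -
  define x where "x = real m * t"
  define y where "y = fold x"
  define t0 where "t0 = y / real m"
  define z0 where "z0 = of_real r * cis t0"
  have m: "0 < real m" using l_bounds by simp
  have y: "0 < y" "y < pi" using fold_bounds s by (auto simp: y_def x_def)
  have t0: "0 < t0" "t0 < pi / real m" "real m * t0 = y" using y m by (simp_all add: t0_def divide_strict_right_mono)
  have K0: "K z0 = sym_mat (h.T y) (h.UU y)"
    using K1[OF r t0(1,2)] h.wt_K_eq[OF _ t0(1,2)] l_bounds t0(3) by (simp add: z0_def cis_conv_exp)
  have z0: "z0 \<in> chamber m 1"
    unfolding chamber_def z0_def cis_conv_exp using r t0 by auto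
  have "cos x = cos y" unfolding y_def fold_def by (simp add: cos_arccos)
  \<comment> \<open>Equal cosines leave two cases: the sign plus means that t arises from the
    fundamental angle by a rotation, the sign minus by a reflection.\<close>
  then obtain nn where nn: "nn \<in> \<int>" "x = y + 2 * nn * pi \<or> x = - y + 2 * nn * pi"
    unfolding cos_eq by blast
  then obtain n :: int where n: "nn = real_of_int n" by (auto elim: Ints_cases)
  define j where "j = nat (n mod int m)"
  note w = omega_power_int[of n, folded j_def]
  have jI: "Rotn j \<in> I2 m" "Refl j \<in> I2 m" using w(1) by (auto simp: I2_def)
  have tx: "t = x / real m" using m by (simp add: x_def)
  have Uy: "h.UU y = cis (- ((real m - 2 * real l) * t0)) * Complex (h.V y) (h.W y)"
    unfolding h.UU_def using two_\<delta>[of t0] by (simp add: t0(3))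
  from nn(2) show ?thesis
  proof
    assume x: "x = y + 2 * nn * pi"
    have t: "t = t0 + 2 * pi * real_of_int n / real m" unfolding tx x n t0_def using m by (simp add: field_simps)
    have "of_real r * cis t = act m z0 (Rotn j)" by (simp add: z0_def w(2) t cis_mult mult.assoc)
    then have "K (of_real r * cis t) = sym_mat (h.T y) (h.UU y * cis (4 * pi * real l * real_of_int n / real m))"
      using K2[OF z0 jI(1)] unfolding K0 tau_conj(1) w(3) by simp
    moreover have "h.UU y * cis (4 * pi * real l * real_of_int n / real m) = U_ang t"
    proof -
      have "sin x = sin y" using sin_cos_eq_iff[of x y] x n by (simp add: sin_add mult.commute mult.left_commute)
      moreover have "0 < sin y" using y by (rule sin_gt_zero)
      ultimately have sg: "sgn (sin x) = 1" by simp
      have "- ((real m - 2 * real l) * t) = - ((real m - 2 * real l) * t0) + (4 * pi * real l * real_of_int n / real m + 2 * pi * real_of_int (- n))"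
        unfolding t using m by (simp add: field_simps)
      then have "cis (- ((real m - 2 * real l) * t)) = cis (- ((real m - 2 * real l) * t0)) * cis (4 * pi * real l * real_of_int n / real m)"
        using cis_multiple_2pi[of "real_of_int (- n)"] by (simp only: cis_mult[symmetric]) simp
      then show ?thesis unfolding U_ang_def Uy x_def[symmetric] y_def[symmetric] sg by (simp add: mult_ac)
    qed
    ultimately show ?thesis by (simp add: T_ang_def x_def[symmetric] y_def[symmetric])
  next
    assume x: "x = - y + 2 * nn * pi"
    have t: "t = - t0 + 2 * pi * real_of_int n / real m" unfolding tx x n t0_def using m by (simp add: field_simps)
    have "of_real r * cis t = act m z0 (Refl j)" by (simp add: z0_def w(2) t cis_mult mult.assoc cis_cnj)
    then have "K (of_real r * cis t) = sym_mat (h.T y) (cnj (h.UU y) * cis (4 * pi * real l * real_of_int n / real m))"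
      using K2[OF z0 jI(2)] unfolding K0 tau_conj(2) w(3) by simp
    moreover have "cnj (h.UU y) * cis (4 * pi * real l * real_of_int n / real m) = U_ang t"
    proof -
      have "x = 2 * pi * real_of_int n - y" using x n by simp
      then have "sin x = - sin y" by (simp add: sin_diff)
      moreover have "0 < sin y" using y by (rule sin_gt_zero)
      ultimately have sg: "sgn (sin x) = - 1" by simp
      have "- ((real m - 2 * real l) * t) = (real m - 2 * real l) * t0 + (4 * pi * real l * real_of_int n / real m + 2 * pi * real_of_int (- n))"
        unfolding t using m by (simp add: field_simps)
      then have "cis (- ((real m - 2 * real l) * t)) = cis ((real m - 2 * real l) * t0) * cis (4 * pi * real l * real_of_int n / real m)"
        using cis_multiple_2pi[of "real_of_int (- n)"] by (simp only: cis_mult[symmetric]) simp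
      moreover have "cnj (Complex (h.V y) (h.W y)) = Complex (h.V y) (- h.W y)" by (simp add: complex_eq_iff)
      ultimately show ?thesis unfolding U_ang_def Uy x_def[symmetric] y_def[symmetric] sg by (simp add: mult_ac cis_cnj)
    qed
    ultimately show ?thesis by (simp add: T_ang_def x_def[symmetric] y_def[symmetric])
  qed
qed

lemma K_pos_def:
  assumes "z \<in> chamber m j"
  shows "pos_def (K z)"
proof -
  obtain r t where z: "z = of_real r * cis t" and r: "0 < r"
    and t: "(real j - 1) * pi / real m < t" "t < real j * pi / real m"
    using assms by (auto simp: chamber_def cis_conv_exp)
  have m: "0 < real m" using l_bounds by simp
  have "sin (real m * t) \<noteq> 0"
  proof
    assume "sin (real m * t) = 0"
    then obtain i :: int where i: "real m * t = real_of_int i * pi" by (auto simp: sin_zero_iff_int2)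
    then have "(real j - 1) * pi < real_of_int i * pi" "real_of_int i * pi < real j * pi"
      using t m by (simp_all add: field_simps)
    then have "real j - 1 < real_of_int i" "real_of_int i < real j"
      by (simp_all add: mult_less_cancel_right)
    then have "int j - 1 < i" "i < int j" by linarith+
    then show False by linarith
  qed
  then have "K z = sym_mat (T_ang t) (U_ang t)" and b: "0 < fold (real m * t)" "fold (real m * t) < pi"
    using K_eq[OF r] fold_bounds z by auto
  moreover have "cmod (U_ang t) < T_ang t"
  proof -
    have "cmod (U_ang t) = cmod (h.UU (fold (real m * t)))"
      using \<open>sin (real m * t) \<noteq> 0\<close> unfolding U_ang_def h.UU_def norm_mult norm_cis
      by (auto simp: cmod_def sgn_if)
    then show ?thesis using h.cmod_UU_less_T[OF b] by (simp add: T_ang_def)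
  qed
  ultimately show ?thesis by (simp add: pos_def_sym_mat)
qed

end

section \<open>Angular integrals\<close>

text \<open>The circle is cut into m arcs, each stretched by m to a full period; the countably many
  division points are null.\<close>

lemma has_bochner_integral_rescale_period:
  fixes g :: "real \<Rightarrow> complex"
  assumes m: "0 < m" and g: "g \<in> borel_measurable borel"
    and v: "\<And>j. j < m \<Longrightarrow> has_bochner_integral lborel
      (\<lambda>x. indicator {0<..<2 * pi} x *\<^sub>R g ((x + 2 * pi * real j) / real m)) (v j)"
  shows "has_bochner_integral lborel (\<lambda>t. indicator {0<..<2 * pi} t *\<^sub>R g t) ((\<Sum>j<m. v j) / of_nat m)"
proof -
  note [measurable] = g
  define f where "f j t = indicator {0<..<2 * pi} (real m * t - 2 * pi * real j) *\<^sub>R g t" for j t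
  have "has_bochner_integral lborel (f j) (v j / of_nat m)" if "j < m" for j
  proof -
    have c: "inverse (real m) \<noteq> 0" using m by simp
    have "f j (2 * pi * real j / real m + inverse (real m) * x) = indicator {0<..<2 * pi} x *\<^sub>R g ((x + 2 * pi * real j) / real m)" for x
    proof -
      have "2 * pi * real j / real m + inverse (real m) * x = (x + 2 * pi * real j) / real m"
        using m by (simp add: field_simps)
      then show ?thesis unfolding f_def using m by simp
    qed
    moreover have "(v j / of_nat m) /\<^sub>R \<bar>inverse (real m)\<bar> = v j" using m by (simp add: scaleR_conv_of_real)
    ultimately show ?thesis
      using lborel_has_bochner_integral_real_affine_iff[OF c, of "f j" "v j / of_nat m" "2 * pi * real j / real m"] v[OF that] by simp
  qed
  then have "has_bochner_integral lborel (\<lambda>t. \<Sum>j<m. f j t) (\<Sum>j<m. v j / of_nat m)"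
    by (intro has_bochner_integral_sum) auto
  then have s: "has_bochner_integral lborel (\<lambda>t. \<Sum>j<m. f j t) ((\<Sum>j<m. v j) / of_nat m)"
    by (simp only: sum_divide_distrib)
  have "AE t in lborel. t \<notin> range (\<lambda>i :: int. 2 * pi * real_of_int i / real m)"
    by (intro AE_not_in countable_imp_null_set_lborel) auto
  then have "AE t in lborel. (\<Sum>j<m. f j t) = indicator {0<..<2 * pi} t *\<^sub>R g t"
  proof eventually_elim
    case (elim t)
    \<comment> \<open>The arc containing t has the index floor x, unless x is an integer.\<close>
    define x where "x = real m * t / (2 * pi)"
    have t: "t = 2 * pi * x / real m" using m by (simp add: x_def)
    have nx: "x \<noteq> real_of_int i" for i using elim t by auto
    have cond: "indicator {0<..<2 * pi} (real m * t - 2 * pi * real j) = (if nat \<lfloor>x\<rfloor> = j \<and> 0 < x then 1 else 0 :: real)" for j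
    proof -
      have "real m * t - 2 * pi * real j = 2 * pi * (x - real j)" using m by (simp add: t algebra_simps)
      then have "real m * t - 2 * pi * real j \<in> {0<..<2 * pi} \<longleftrightarrow> real j < x \<and> x < real j + 1"
        using mult_less_cancel_left_pos[of "2 * pi" "x - real j" 1] by (auto simp: zero_less_mult_iff)
      also have "\<dots> \<longleftrightarrow> nat \<lfloor>x\<rfloor> = j \<and> 0 < x"
      proof
        assume "real j < x \<and> x < real j + 1"
        moreover from this have "\<lfloor>x\<rfloor> = int j" by (intro floor_unique) auto
        ultimately show "nat \<lfloor>x\<rfloor> = j \<and> 0 < x" by auto
      next
        assume *: "nat \<lfloor>x\<rfloor> = j \<and> 0 < x"
        then have "\<lfloor>x\<rfloor> = int j" by auto
        then show "real j < x \<and> x < real j + 1"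
          using nx[of "int j"] of_int_floor_le[of x] real_of_int_floor_add_one_gt[of x] by auto
      qed
      finally show ?thesis by (auto simp: indicator_def)
    qed
    have "(\<Sum>j<m. f j t) = (\<Sum>j<m. if nat \<lfloor>x\<rfloor> = j then (if 0 < x then g t else 0) else 0)"
      unfolding f_def cond by (intro sum.cong) auto
    also have "\<dots> = (if nat \<lfloor>x\<rfloor> < m \<and> 0 < x then g t else 0)" by auto
    also have "nat \<lfloor>x\<rfloor> < m \<and> 0 < x \<longleftrightarrow> 0 < t \<and> t < 2 * pi"
    proof -
      have "nat \<lfloor>x\<rfloor> < m \<longleftrightarrow> \<lfloor>x\<rfloor> < int m" using m by linarith
      then have "nat \<lfloor>x\<rfloor> < m \<longleftrightarrow> x < real m" by (simp add: floor_less_iff)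
      moreover have "x < real m \<longleftrightarrow> t < 2 * pi" "0 < x \<longleftrightarrow> 0 < t"
        using m by (simp_all add: x_def field_simps zero_less_mult_iff)
      ultimately show ?thesis by blast
    qed
    finally show ?case by (auto simp: indicator_def)
  qed
  then show ?thesis
    using s by (subst (asm) has_bochner_integral_cong_AE) (auto simp: f_def[abs_def])
qed

text \<open>The cut to the open interval gives a measurable function although P is only known, and
  only continuous, between the walls.\<close>

definition fold_cut :: "(real \<Rightarrow> real) \<Rightarrow> real \<Rightarrow> real" where
  "fold_cut P x = indicator {0<..<pi} (arccos (cos x)) * P (arccos (cos x))"

text \<open>The real part is extended evenly and the imaginary part oddly across the walls, with
  period 2 \<pi>.\<close>

definition osc :: "(real \<Rightarrow> real) \<Rightarrow> (real \<Rightarrow> real) \<Rightarrow> real \<Rightarrow> complex" where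
  "osc P Q x = Complex (fold_cut P x) (sgn (sin x) * fold_cut Q x)"

lemma borel_measurable_fold_cut:
  assumes "\<And>x. 0 < x \<Longrightarrow> x < pi \<Longrightarrow> isCont P x"
  shows "fold_cut P \<in> borel_measurable borel"
proof -
  have "continuous_on {0<..<pi} P" using assms by (intro continuous_at_imp_continuous_on) auto
  then have "(\<lambda>x. indicator {0<..<pi} x *\<^sub>R P x) \<in> borel_measurable borel"
    by (rule borel_measurable_continuous_on_indicator[rotated]) simp
  moreover have "(\<lambda>x. arccos (cos x)) \<in> borel_measurable borel"
    by (intro borel_measurable_continuous_onI continuous_intros) auto
  ultimately have "(\<lambda>x. indicator {0<..<pi} (arccos (cos x)) *\<^sub>R P (arccos (cos x))) \<in> borel_measurable borel"
    by (rule measurable_compose[rotated])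
  then show ?thesis by (simp add: fold_cut_def[abs_def])
qed

lemma borel_measurable_osc:
  assumes "\<And>x. 0 < x \<Longrightarrow> x < pi \<Longrightarrow> isCont P x" "\<And>x. 0 < x \<Longrightarrow> x < pi \<Longrightarrow> isCont Q x"
  shows "osc P Q \<in> borel_measurable borel"
proof -
  have [measurable]: "fold_cut P \<in> borel_measurable borel" "fold_cut Q \<in> borel_measurable borel"
    using assms by (auto intro: borel_measurable_fold_cut)
  show ?thesis unfolding osc_def[abs_def] by measurable
qed

lemma osc_periodic: "osc P Q (x + 2 * pi * real j) = osc P Q x"
proof -
  have "sin (x + 2 * pi * real j) = sin x" "cos (x + 2 * pi * real j) = cos x"
    using sin.plus_of_nat[of x j] cos.plus_of_nat[of x j] by (simp_all add: mult_ac)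
  then show ?thesis by (simp only: osc_def fold_cut_def)
qed

text \<open>On the second half of the period, x \<mapsto> 2 \<pi> - x conjugates both the amplitude
  and, up to a constant phase, the exponential.\<close>

lemma osc_split:
  fixes \<rho> :: real and P Q :: "real \<Rightarrow> real"
  defines "k \<equiv> \<lambda>x. indicator {0<..<pi} x *\<^sub>R (cis (\<rho> * x) * Complex (P x) (Q x))"
  shows "indicator {0<..<2 * pi} x *\<^sub>R (cis (\<rho> * x) * osc P Q x) = k x + cis (2 * pi * \<rho>) * cnj (k (2 * pi + (- 1) * x))"
proof -
  consider "x \<le> 0 \<or> 2 * pi \<le> x" | "0 < x" "x < pi" | "x = pi" | "pi < x" "x < 2 * pi" by linarith
  then show ?thesis
  proof cases
    case 1
    then show ?thesis using pi_gt_zero by (auto simp: k_def indicator_def)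
  next
    case 2
    then have "0 < sin x" by (intro sin_gt_zero)
    with 2 show ?thesis by (auto simp: k_def indicator_def osc_def fold_cut_def arccos_cos)
  next
    case 3
    then show ?thesis by (auto simp: k_def indicator_def osc_def fold_cut_def complex_eq_iff)
  next
    case 4
    define y where "y = 2 * pi - x"
    have y: "0 < y" "y < pi" "x = 2 * pi - y" using 4 by (simp_all add: y_def)
    have "0 < sin y" using y by (intro sin_gt_zero)
    then have "sgn (sin x) = -1" by (simp add: y(3))
    moreover have "arccos (cos x) = y" using y(1,2) by (simp add: y(3) arccos_cos)
    moreover have "cis (\<rho> * x) = cis (2 * pi * \<rho>) * cnj (cis (\<rho> * y))"
      by (simp add: y(3) cis_cnj cis_mult algebra_simps)
    moreover have "2 * pi + (- 1) * x = y" by (simp add: y_def)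
    moreover have "cnj (Complex (P y) (Q y)) = Complex (P y) (- Q y)" by (simp add: complex_eq_iff)
    ultimately show ?thesis using y 4
      by (simp add: k_def osc_def fold_cut_def)
  qed
qed

text \<open>Only the real part of a is recorded: for integer \<rho> the integral is a + cnj
  a.\<close>

lemma has_bochner_integral_osc:
  fixes P Q :: "real \<Rightarrow> real" and \<rho> :: real
  assumes i: "\<And>r. set_integrable lborel {0<..<pi} (\<lambda>x. cos (r * x) * P x)" "\<And>r. set_integrable lborel {0<..<pi} (\<lambda>x. sin (r * x) * P x)"
    "\<And>r. set_integrable lborel {0<..<pi} (\<lambda>x. cos (r * x) * Q x)" "\<And>r. set_integrable lborel {0<..<pi} (\<lambda>x. sin (r * x) * Q x)"
  obtains a where "has_bochner_integral lborel (\<lambda>x. indicator {0<..<2 * pi} x *\<^sub>R (cis (\<rho> * x) * osc P Q x)) (a + cis (2 * pi * \<rho>) * cnj a)"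
    "Re a = set_lebesgue_integral lborel {0<..<pi} (\<lambda>x. cos (\<rho> * x) * P x) - set_lebesgue_integral lborel {0<..<pi} (\<lambda>x. sin (\<rho> * x) * Q x)"
proof -
  define k where "k = (\<lambda>x. indicator {0<..<pi} x *\<^sub>R (cis (\<rho> * x) * Complex (P x) (Q x)))"
  define a where "a = of_real (set_lebesgue_integral lborel {0<..<pi} (\<lambda>x. cos (\<rho> * x) * P x) - set_lebesgue_integral lborel {0<..<pi} (\<lambda>x. sin (\<rho> * x) * Q x))
     + \<i> * of_real (set_lebesgue_integral lborel {0<..<pi} (\<lambda>x. cos (\<rho> * x) * Q x) + set_lebesgue_integral lborel {0<..<pi} (\<lambda>x. sin (\<rho> * x) * P x))"
  have h: "has_bochner_integral lborel (\<lambda>x. indicator {0<..<pi} x *\<^sub>R f x) (set_lebesgue_integral lborel {0<..<pi} f)" if "set_integrable lborel {0<..<pi} f" for f :: "real \<Rightarrow> real"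
    using that unfolding set_integrable_def set_lebesgue_integral_def by (rule has_bochner_integral_integrable)
  have "has_bochner_integral lborel (\<lambda>x. of_real (indicator {0<..<pi} x *\<^sub>R (cos (\<rho> * x) * P x) - indicator {0<..<pi} x *\<^sub>R (sin (\<rho> * x) * Q x))
     + \<i> * of_real (indicator {0<..<pi} x *\<^sub>R (cos (\<rho> * x) * Q x) + indicator {0<..<pi} x *\<^sub>R (sin (\<rho> * x) * P x))) a"
    unfolding a_def
    by (intro has_bochner_integral_add has_bochner_integral_diff has_bochner_integral_mult_right has_bochner_integral_of_real h i)
  moreover have "of_real (indicator {0<..<pi} x *\<^sub>R (cos (\<rho> * x) * P x) - indicator {0<..<pi} x *\<^sub>R (sin (\<rho> * x) * Q x))
     + \<i> * of_real (indicator {0<..<pi} x *\<^sub>R (cos (\<rho> * x) * Q x) + indicator {0<..<pi} x *\<^sub>R (sin (\<rho> * x) * P x)) = k x" for x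
    by (simp add: k_def complex_eq_iff algebra_simps)
  ultimately have k: "has_bochner_integral lborel k a" by simp
  then have "has_bochner_integral lborel (\<lambda>x. k (2 * pi + (- 1) * x)) (a /\<^sub>R \<bar>- 1\<bar>)"
    by (subst lborel_has_bochner_integral_real_affine_iff[symmetric]) auto
  then have "has_bochner_integral lborel (\<lambda>x. k x + cis (2 * pi * \<rho>) * cnj (k (2 * pi + (- 1) * x))) (a + cis (2 * pi * \<rho>) * cnj a)"
    by (intro has_bochner_integral_add k has_bochner_integral_mult_right has_bochner_integral_cnj) simp
  then have "has_bochner_integral lborel (\<lambda>x. indicator {0<..<2 * pi} x *\<^sub>R (cis (\<rho> * x) * osc P Q x)) (a + cis (2 * pi * \<rho>) * cnj a)"
    unfolding osc_split k_def .
  then show ?thesis by (rule that) (simp add: a_def)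
qed

text \<open>The arcs contribute the same integral with phases that are s-th powers of the m-th roots
  of unity. Their sum vanishes unless m divides s, and then \<rho> = s / m is an integer.\<close>

lemma angular_integral:
  fixes P Q :: "real \<Rightarrow> real" and s :: int
  assumes m: "0 < m"
    and c: "\<And>x. 0 < x \<Longrightarrow> x < pi \<Longrightarrow> isCont P x" "\<And>x. 0 < x \<Longrightarrow> x < pi \<Longrightarrow> isCont Q x"
    and i: "\<And>r. set_integrable lborel {0<..<pi} (\<lambda>x. cos (r * x) * P x)" "\<And>r. set_integrable lborel {0<..<pi} (\<lambda>x. sin (r * x) * P x)"
    "\<And>r. set_integrable lborel {0<..<pi} (\<lambda>x. cos (r * x) * Q x)" "\<And>r. set_integrable lborel {0<..<pi} (\<lambda>x. sin (r * x) * Q x)"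
  shows "has_bochner_integral lborel (\<lambda>t. indicator {0<..<2 * pi} t *\<^sub>R (cis (real_of_int s * t) * osc P Q (real m * t)))
    (of_real (if int m dvd s then 2 * (set_lebesgue_integral lborel {0<..<pi} (\<lambda>x. cos (real_of_int (s div int m) * x) * P x) - set_lebesgue_integral lborel {0<..<pi} (\<lambda>x. sin (real_of_int (s div int m) * x) * Q x)) else 0))"
proof -
  \<comment> \<open>Instantiated with dummy parameters, for the sum of powers of the roots of
    unity.\<close>
  interpret g: dihedral_params m 0 0 using m by unfold_locales
  define \<rho> where "\<rho> = real_of_int s / real m"
  obtain a where a: "has_bochner_integral lborel (\<lambda>x. indicator {0<..<2 * pi} x *\<^sub>R (cis (\<rho> * x) * osc P Q x)) (a + cis (2 * pi * \<rho>) * cnj a)"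
    "Re a = set_lebesgue_integral lborel {0<..<pi} (\<lambda>x. cos (\<rho> * x) * P x) - set_lebesgue_integral lborel {0<..<pi} (\<lambda>x. sin (\<rho> * x) * Q x)"
    by (rule has_bochner_integral_osc[OF i])
  define b where "b = a + cis (2 * pi * \<rho>) * cnj a"
  define g where "g t = cis (real_of_int s * t) * osc P Q (real m * t)" for t
  have "osc P Q \<in> borel_measurable borel" by (rule borel_measurable_osc[OF c])
  then have "(\<lambda>t. osc P Q (real m * t)) \<in> borel_measurable borel" by (rule measurable_compose[rotated]) simp
  moreover have "cis \<in> borel_measurable borel" by (intro borel_measurable_continuous_onI continuous_intros)
  then have "(\<lambda>t. cis (real_of_int s * t)) \<in> borel_measurable borel" by (rule measurable_compose[rotated]) simp
  ultimately have gm: "g \<in> borel_measurable borel" unfolding g_def[abs_def] by (rule borel_measurable_times[rotated])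
  have cj: "cis (2 * pi * real j * \<rho>) = (omega m ^ j) powi s" for j
    by (simp add: omega_power cis_power_int \<rho>_def mult_ac)
  have gj: "g ((x + 2 * pi * real j) / real m) = cis (2 * pi * real j * \<rho>) * (cis (\<rho> * x) * osc P Q x)" for x j
  proof -
    have 1: "real m * ((x + 2 * pi * real j) / real m) = x + 2 * pi * real j" using m by simp
    have 2: "real_of_int s * ((x + 2 * pi * real j) / real m) = 2 * pi * real j * \<rho> + \<rho> * x"
      using m by (simp add: \<rho>_def field_simps)
    show ?thesis unfolding g_def 1 2 osc_periodic cis_mult[symmetric] by (simp only: mult.assoc)
  qed
  have "has_bochner_integral lborel (\<lambda>t. indicator {0<..<2 * pi} t *\<^sub>R g t) ((\<Sum>j<m. cis (2 * pi * real j * \<rho>) * b) / of_nat m)"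
  proof (rule has_bochner_integral_rescale_period[OF m gm])
    fix j
    show "has_bochner_integral lborel (\<lambda>x. indicator {0<..<2 * pi} x *\<^sub>R g ((x + 2 * pi * real j) / real m)) (cis (2 * pi * real j * \<rho>) * b)"
      using has_bochner_integral_mult_right[OF a(1), of "cis (2 * pi * real j * \<rho>)"] unfolding gj b_def
      by (simp add: mult_scaleR_right)
  qed
  also have "(\<Sum>j<m. cis (2 * pi * real j * \<rho>) * b) / of_nat m = (if int m dvd s then b else 0)"
    unfolding cj sum_distrib_right[symmetric] g.root_sum[of "\<lambda>u. u powi s"] g.root_power_sum using m by simp
  also have "\<dots> = of_real (if int m dvd s then 2 * (set_lebesgue_integral lborel {0<..<pi} (\<lambda>x. cos (real_of_int (s div int m) * x) * P x) - set_lebesgue_integral lborel {0<..<pi} (\<lambda>x. sin (real_of_int (s div int m) * x) * Q x)) else 0)"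
  proof (cases "int m dvd s")
    case True
    then have "\<rho> = real_of_int (s div int m)" using m by (auto simp: \<rho>_def)
    moreover from this have "b = of_real (2 * Re a)"
      using cis_multiple_2pi[of "real_of_int (s div int m)"] by (simp add: b_def complex_eq_iff)
    ultimately show ?thesis using True a(2) by simp
  qed simp
  finally show ?thesis unfolding g_def .
qed

section \<open>The trigonometric moments of the weight\<close>

text \<open>Here \<open>x0\<close> is the largest element of the progression below k and p the
  number of elements: the assumptions say that the last one listed is still above - k and the next
  one is not.\<close>

lemma prog_sum_reindex:
  fixes x0 k c :: int
  assumes m: "0 < m" and d: "2 * int m dvd x0 + c" and k: "x0 < k" "k \<le> x0 + 2 * int m"
    and p: "x0 - 2 * int m * (int p - 1) > - k" "x0 - 2 * int m * int p \<le> - k"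
  shows "prog_sum m h k c = (\<Sum>j<p. h (x0 - 2 * int m * int j))"
proof -
  let ?g = "\<lambda>j. x0 - 2 * int m * int j"
  have "{x. \<bar>x\<bar> < k \<and> 2 * int m dvd x + c} = ?g ` {..<p}"
  proof (intro set_eqI iffI)
    fix x assume "x \<in> {x. \<bar>x\<bar> < k \<and> 2 * int m dvd x + c}"
    then have x: "- k < x" "x < k" "2 * int m dvd x + c" by auto
    from d x(3) have "2 * int m dvd (x0 + c) - (x + c)" by (rule dvd_diff)
    then obtain i where i: "x0 - x = 2 * int m * i" by (auto elim: dvdE)
    have m2: "0 < 2 * int m" using m by simp
    have "2 * int m * (- 1) < 2 * int m * i" using i k x by linarith
    then have i0: "0 \<le> i" using mult_less_cancel_left_pos[OF m2, of "-1" i] by linarith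
    have "2 * int m * i < 2 * int m * int p" using i p x by linarith
    then have "i < int p" using mult_less_cancel_left_pos[OF m2] by blast
    with i0 i have "x = ?g (nat i)" "nat i < p" by auto
    then show "x \<in> ?g ` {..<p}" by blast
  next
    fix x assume "x \<in> ?g ` {..<p}"
    then obtain j where j: "x = ?g j" "j < p" by auto
    have "2 * int m * int j \<le> 2 * int m * (int p - 1)" using j m by (intro mult_left_mono) auto
    then have "- k < x" using p j by linarith
    moreover have "0 \<le> 2 * int m * int j" by simp
    then have "x < k" using j k by linarith
    moreover have "x + c = (x0 + c) - 2 * int m * int j" by (simp add: j)
    then have "2 * int m dvd x + c" using d by (simp only:) (intro dvd_diff dvd_triv_left)
    ultimately show "x \<in> {x. \<bar>x\<bar> < k \<and> 2 * int m dvd x + c}" by auto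
  qed
  moreover have "inj_on ?g {..<p}" using m by (auto intro!: inj_onI)
  ultimately show ?thesis unfolding prog_sum_def by (simp add: sum.reindex)
qed

lemma prog_sum_zero:
  assumes "\<And>x. 2 * int m dvd x + c \<Longrightarrow> h x = 0"
  shows "prog_sum m h k c = 0"
  unfolding prog_sum_def using assms by (intro sum.neutral) auto

lemma prog_sum_uminus: "prog_sum m (\<lambda>x. h (- x)) k c = prog_sum m h k (- c)"
proof -
  have "{x :: int. \<bar>x\<bar> < k \<and> 2 * int m dvd x + - c} = uminus ` {x. \<bar>x\<bar> < k \<and> 2 * int m dvd x + c}"
  proof (intro set_eqI iffI)
    fix x assume "x \<in> {x :: int. \<bar>x\<bar> < k \<and> 2 * int m dvd x + - c}"
    then have "- x \<in> {x. \<bar>x\<bar> < k \<and> 2 * int m dvd x + c}"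
      using dvd_minus_iff[of "2 * int m" "x - c"] by (simp add: algebra_simps)
    then show "x \<in> uminus ` {x. \<bar>x\<bar> < k \<and> 2 * int m dvd x + c}" by (metis add.inverse_inverse imageI)
  next
    fix x assume "x \<in> uminus ` {x :: int. \<bar>x\<bar> < k \<and> 2 * int m dvd x + c}"
    then obtain y where "x = - y" "\<bar>y\<bar> < k" "2 * int m dvd y + c" by auto
    then have "\<bar>- x\<bar> < k \<and> 2 * int m dvd - x + c" by simp
    then show "x \<in> {x :: int. \<bar>x\<bar> < k \<and> 2 * int m dvd x + - c}"
      using dvd_minus_iff[of "2 * int m" "x - c"] by (simp add: algebra_simps)
  qed
  then show ?thesis unfolding prog_sum_def by (simp add: sum.reindex)
qed

context dihedral_weight begin

definition T_mom :: "int \<Rightarrow> real" where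
  "T_mom k = (if int m dvd k then 2 * h.Tm (k div int m) else 0)"

text \<open>The phase cis (- (m - 2 l) t) shifts the frequency k to k + 2 l - m; division by m gives
  the shift by 1 in the index.\<close>

definition U_mom :: "int \<Rightarrow> real" where
  "U_mom k = (if int m dvd k + 2 * int l then 2 * h.Um ((k + 2 * int l) div int m - 1) else 0)"

lemma T_mom_mult: "T_mom (int m * n) = 2 * h.Tm n"
  using l_bounds by (simp add: T_mom_def)

lemma U_mom_mult: "U_mom (int m * n - 2 * int l) = 2 * h.Um (n - 1)"
  using l_bounds by (simp add: U_mom_def)

lemma T_mom_uminus: "T_mom (- k) = T_mom k"
proof (cases "int m dvd k")
  case True
  then obtain n where n: "k = int m * n" by (auto elim: dvdE)
  have "- k = int m * (- n)" by (simp add: n)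
  then show ?thesis using h.moment_parity(1)[of n] by (simp only: n T_mom_mult)
qed (simp add: T_mom_def)

lemma dvd_of_two_dvd: "2 * int m dvd x \<Longrightarrow> int m dvd x"
  by (rule dvd_mult_right)

lemma T_mom_rec:
  assumes k: "0 \<le> k"
  shows "real_of_int k * T_mom k = - 2 * \<kappa> * real m * prog_sum m U_mom k (2 * int l - k)"
proof (cases "int m dvd k")
  case False
  have "prog_sum m U_mom k (2 * int l - k) = 0"
  proof (rule prog_sum_zero)
    fix x assume "2 * int m dvd x + (2 * int l - k)"
    then have *: "int m dvd (x + 2 * int l) - k" by (auto dest: dvd_of_two_dvd simp: algebra_simps)
    have "\<not> int m dvd x + 2 * int l"
    proof
      assume "int m dvd x + 2 * int l"
      then have "int m dvd (x + 2 * int l) - ((x + 2 * int l) - k)" using * by (rule dvd_diff)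
      then show False using False by simp
    qed
    then show "U_mom x = 0" by (simp add: U_mom_def)
  qed
  then show ?thesis using False by (simp add: T_mom_def)
next
  case True
  then obtain n where n: "k = int m * n" by (auto elim: dvdE)
  have "0 \<le> n" using k l_bounds by (simp add: n zero_le_mult_iff)
  then obtain p where p: "n = int p" by (metis nonneg_int_cases)
  have "prog_sum m U_mom k (2 * int l - k) = (\<Sum>j<p. U_mom (int m * int p - 2 * int l - 2 * int m * int j))"
    using l_bounds unfolding n p by (intro prog_sum_reindex) (auto simp: algebra_simps)
  also have "\<dots> = (\<Sum>j<p. 2 * h.Um (int p - 1 - 2 * int j))"
  proof (rule sum.cong[OF refl])
    fix j
    have "int m * int p - 2 * int l - 2 * int m * int j = int m * (int p - 2 * int j) - 2 * int l"
      by (simp add: algebra_simps)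
    then show "U_mom (int m * int p - 2 * int l - 2 * int m * int j) = 2 * h.Um (int p - 1 - 2 * int j)"
      by (simp only: U_mom_mult) (simp add: algebra_simps)
  qed
  finally have "- 2 * \<kappa> * real m * prog_sum m U_mom k (2 * int l - k) = 2 * real m * (- 2 * \<kappa> * (\<Sum>j<p. h.Um (int p - 1 - 2 * int j)))"
    by (simp add: sum_distrib_left[symmetric])
  also have "\<dots> = real_of_int k * T_mom k"
    unfolding h.moments(1)[symmetric] n p T_mom_mult by simp
  finally show ?thesis by simp
qed

lemma prog_sum_T_mom:
  assumes m: "2 * int m dvd int m * (int n - 1) + c" and k: "int m * (int n - 1) < k" "k \<le> int m * (int n + 1)"
  shows "prog_sum m T_mom k c = 2 * (\<Sum>j<n. h.Tm (int n - 1 - 2 * int j))"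
proof -
  have "prog_sum m T_mom k c = (\<Sum>j<n. T_mom (int m * (int n - 1) - 2 * int m * int j))"
    by (intro prog_sum_reindex m) (use k l_bounds in \<open>auto simp: algebra_simps\<close>)
  also have "\<dots> = (\<Sum>j<n. 2 * h.Tm (int n - 1 - 2 * int j))"
  proof (rule sum.cong[OF refl])
    fix j
    have "int m * (int n - 1) - 2 * int m * int j = int m * (int n - 1 - 2 * int j)"
      by (simp add: algebra_simps)
    then show "T_mom (int m * (int n - 1) - 2 * int m * int j) = 2 * h.Tm (int n - 1 - 2 * int j)"
      by (simp only: T_mom_mult)
  qed
  finally show ?thesis by (simp add: sum_distrib_left)
qed

lemma m_\<delta>: "2 * real m * \<delta> = real m - 2 * real l"
  using l_bounds by (simp add: \<delta> field_simps)

lemma U_mom_rec: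
  assumes k: "0 \<le> k"
  shows "real_of_int k * U_mom k = - 2 * \<kappa> * real m * prog_sum m T_mom k (k + 2 * int l)"
proof (cases "int m dvd k + 2 * int l")
  case False
  have "prog_sum m T_mom k (k + 2 * int l) = 0"
  proof (rule prog_sum_zero)
    fix x assume "2 * int m dvd x + (k + 2 * int l)"
    then have "int m dvd x + (k + 2 * int l)" by (rule dvd_of_two_dvd)
    then have "\<not> int m dvd x" using False dvd_add_right_iff by blast
    then show "T_mom x = 0" by (simp add: T_mom_def)
  qed
  then show ?thesis using False by (simp add: U_mom_def)
next
  case True
  then obtain y where y: "k + 2 * int l = int m * y" by (auto elim: dvdE)
  have "0 < y" using k l_bounds y zero_less_mult_pos[of "int m" y] by simp
  then obtain n where n: "y = int n + 1" using zero_less_imp_eq_int[of y] by (metis Suc_pred of_nat_0_less_iff of_nat_Suc add.commute)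
  have kk: "k = int m * (int n + 1) - 2 * int l" using y by (simp add: n)
  have e: "int m * (int n - 1) + (k + 2 * int l) = 2 * int m * int n" by (simp add: kk algebra_simps)
  have "prog_sum m T_mom k (k + 2 * int l) = 2 * (\<Sum>j<n. h.Tm (int n - 1 - 2 * int j))"
    by (rule prog_sum_T_mom) (simp_all only: e dvd_triv_left, use l_bounds in \<open>auto simp: kk algebra_simps\<close>)
  then have "- 2 * \<kappa> * real m * prog_sum m T_mom k (k + 2 * int l) = 2 * real m * (- 2 * \<kappa> * (\<Sum>j<n. h.Tm (int n - 1 - 2 * int j)))"
    by simp
  also have "\<dots> = real_of_int k * (2 * h.Um (int n))"
  proof -
    \<comment> \<open>Since 2 m \<delta> = m - 2 l, the frequency is k = m (n + 2 \<delta>), with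
      the factor of the second moment equation.\<close>
    have "real_of_int k = real m * real n + (real m - 2 * real l)" by (simp add: kk algebra_simps)
    then show ?thesis unfolding h.moments(2)[symmetric] m_\<delta>[symmetric] by (simp add: algebra_simps)
  qed
  also have "2 * h.Um (int n) = U_mom k" unfolding kk U_mom_mult by simp
  finally show ?thesis by simp
qed

lemma U_mom_rec_uminus:
  assumes k: "0 \<le> k"
  shows "real_of_int k * U_mom (- k) = - 2 * \<kappa> * real m * prog_sum m T_mom k (k - 2 * int l)"
proof (cases "int m dvd - k + 2 * int l")
  case False
  have "prog_sum m T_mom k (k - 2 * int l) = 0"
  proof (rule prog_sum_zero)
    fix x assume "2 * int m dvd x + (k - 2 * int l)"
    then have "int m dvd x - (- k + 2 * int l)" by (auto dest: dvd_of_two_dvd simp: algebra_simps)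
    then have "\<not> int m dvd x" using False dvd_diff_right_iff by blast
    then show "T_mom x = 0" by (simp add: T_mom_def)
  qed
  then show ?thesis using False by (simp add: U_mom_def)
next
  case True
  then obtain y where y: "- k + 2 * int l = int m * y" by (auto elim: dvdE)
  have "int m * y < int m * 1" using k l_bounds y by linarith
  moreover have "0 < int m" using l_bounds by simp
  ultimately have "y < 1" using mult_less_cancel_left_pos by blast
  then obtain p where "1 - y = int p" using zero_le_imp_eq_int[of "1 - y"] by auto
  then have p: "y = 1 - int p" by simp
  have kk: "k = int m * (int p - 1) + 2 * int l" using y by (simp add: p algebra_simps)
  have mk: "- k = int m * (1 - int p) - 2 * int l" by (simp add: kk algebra_simps)
  have e: "int m * (int p - 1) + (k - 2 * int l) = 2 * int m * (int p - 1)" by (simp add: kk algebra_simps)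
  have "prog_sum m T_mom k (k - 2 * int l) = 2 * (\<Sum>j<p. h.Tm (int p - 1 - 2 * int j))"
    by (rule prog_sum_T_mom) (simp_all only: e dvd_triv_left, use l_bounds in \<open>auto simp: kk algebra_simps\<close>)
  then have "- 2 * \<kappa> * real m * prog_sum m T_mom k (k - 2 * int l) = 2 * real m * (- 2 * \<kappa> * (\<Sum>j<p. h.Tm (int p - 1 - 2 * int j)))"
    by simp
  also have "\<dots> = real_of_int k * (2 * h.Um (- int p))"
  proof -
    \<comment> \<open>Now k = m (p - 2 \<delta>), with the factor of the third moment
      equation.\<close>
    have "real_of_int k = real m * real p - (real m - 2 * real l)" by (simp add: kk algebra_simps)
    then have "real_of_int k = real m * (real p - 2 * \<delta>)" unfolding m_\<delta>[symmetric] by (simp add: algebra_simps)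
    then show ?thesis unfolding h.moments(3)[symmetric] by simp
  qed
  also have "2 * h.Um (- int p) = U_mom (- k)" unfolding mk U_mom_mult by simp
  finally show ?thesis by simp
qed

text \<open>The two off-diagonal entries of the weight are conjugate, which reverses the
  frequency.\<close>

definition moment :: "bool \<Rightarrow> bool \<Rightarrow> int \<Rightarrow> real" where
  "moment e e' x = (if e = e' then T_mom x else U_mom (if e then - x else x))"

lemma moment_props:
  "moment (\<not> e) (\<not> e') (- x) = moment e e' x"
  "moment e e' 0 = (if e = e' then 2 else 0)"
  "\<not> int m dvd x + (if e = e' then 0 else - 2 * sg e * int l) \<Longrightarrow> moment e e' x = 0"
  "0 \<le> k \<Longrightarrow> real_of_int k * moment e e' k
     = - 2 * \<kappa> * real m * prog_sum m (\<lambda>x. moment e (\<not> e') (- x)) k (k + 2 * sg e' * int l)"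
proof -
  show "moment (\<not> e) (\<not> e') (- x) = moment e e' x" by (simp add: moment_def T_mom_uminus)
  \<comment> \<open>From 0 < 2 l < m: this makes t and tbar orthogonal.\<close>
  have "\<not> int m dvd 2 * int l"
  proof
    assume "int m dvd 2 * int l"
    then have "int m \<le> 2 * int l" using l_bounds by (intro zdvd_imp_le) auto
    then show False using l_bounds by simp
  qed
  then show "moment e e' 0 = (if e = e' then 2 else 0)"
    using T_mom_mult[of 0] by (simp add: moment_def U_mom_def h.Tm_0)
  show "moment e e' x = 0" if *: "\<not> int m dvd x + (if e = e' then 0 else - 2 * sg e * int l)"
  proof (cases "e = e'")
    case True then show ?thesis using * by (simp add: moment_def T_mom_def)
  next
    case False
    have "int m dvd - x + 2 * int l \<longleftrightarrow> int m dvd x - 2 * int l"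
      using dvd_minus_iff[of "int m" "x - 2 * int l"] by (simp add: algebra_simps)
    then show ?thesis using * False by (auto simp: moment_def U_mom_def sg_def)
  qed
  assume k: "0 \<le> k"
  \<comment> \<open>The two residues differ by 2 k, a multiple of 2 m when m divides k; otherwise
    both sides of the recurrence vanish.\<close>
  have T: "prog_sum m U_mom k (k + 2 * int l) = prog_sum m U_mom k (2 * int l - k)" if "int m dvd k"
  proof -
    have d: "2 * int m dvd 2 * k" using that by simp
    have e: "x + (k + 2 * int l) = (x + (2 * int l - k)) + 2 * k" for x by simp
    show ?thesis unfolding prog_sum_def e dvd_add_left_iff[OF d] ..
  qed
  have T': "prog_sum m U_mom k (k + 2 * int l) = 0" if "\<not> int m dvd k"
  proof (rule prog_sum_zero)
    fix x assume "2 * int m dvd x + (k + 2 * int l)"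
    then have "int m dvd (x + 2 * int l) + k" by (auto dest: dvd_of_two_dvd simp: algebra_simps)
    then have "\<not> int m dvd x + 2 * int l" using that dvd_add_right_iff by blast
    then show "U_mom x = 0" by (simp add: U_mom_def)
  qed
  have T1: "real_of_int k * T_mom k = - 2 * \<kappa> * real m * prog_sum m U_mom k (k + 2 * int l)"
  proof (cases "int m dvd k")
    case True then show ?thesis unfolding T[OF True] by (intro T_mom_rec k)
  next
    case False then show ?thesis unfolding T'[OF False] by (simp add: T_mom_def)
  qed
  have T2: "prog_sum m (\<lambda>x. U_mom (- x)) k (k - 2 * int l) = prog_sum m U_mom k (2 * int l - k)"
    using prog_sum_uminus[of m U_mom k "k - 2 * int l"] by simp
  show "real_of_int k * moment e e' k
     = - 2 * \<kappa> * real m * prog_sum m (\<lambda>x. moment e (\<not> e') (- x)) k (k + 2 * sg e' * int l)"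
  proof (cases e; cases e')
    assume e: "e" "e'"
    show ?thesis using T1 by (simp add: moment_def sg_def e)
  next
    assume e: "e" "\<not> e'"
    show ?thesis using U_mom_rec_uminus[OF k] by (simp add: moment_def sg_def e T_mom_uminus)
  next
    assume e: "\<not> e" "e'"
    show ?thesis using U_mom_rec[OF k] by (simp add: moment_def sg_def e T_mom_uminus)
  next
    assume e: "\<not> e" "\<not> e'"
    have "moment e e' k = T_mom k" "(\<lambda>x. moment e (\<not> e') (- x)) = (\<lambda>x. U_mom (- x))" "k + 2 * sg e' * int l = k - 2 * int l"
      using e by (simp_all add: moment_def sg_def)
    then show ?thesis using T2 T_mom_rec[OF k] by (simp only:)
  qed
qed

end

section \<open>The integral representation\<close>

text \<open>The values of K on the walls are arbitrary, so the integrand is a Borel function only up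
  to a null set; completeness of Lebesgue measure restores measurability.\<close>

lemma has_bochner_integral_lebesgue_AE:
  fixes f g :: "'a::euclidean_space \<Rightarrow> 'b::{banach, second_countable_topology}"
  assumes g: "has_bochner_integral lborel g x" and ae: "AE z in lborel. f z = g z"
  shows "has_bochner_integral lebesgue f x"
proof -
  have gb: "g \<in> borel_measurable lborel" using g by (rule borel_measurable_has_bochner_integral)
  have gl: "g \<in> borel_measurable lebesgue" by (rule measurable_completion[OF gb])
  have ael: "AE z in lebesgue. f z = g z" by (rule AE_completion[OF ae])
  have "has_bochner_integral lebesgue g x"
    using g integrable_completion[OF gb] integral_completion[OF gb] by (simp add: has_bochner_integral_iff)
  moreover have fl: "f \<in> borel_measurable lebesgue"
  proof (rule measurableI)
    fix A :: "'b set" assume "A \<in> sets borel"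
    then have S: "g -` A \<inter> space lebesgue \<in> sets lebesgue" by (rule measurable_sets[OF gl])
    have E: "AE z in lebesgue. z \<in> g -` A \<inter> space lebesgue \<longleftrightarrow> z \<in> f -` A \<inter> space lebesgue"
      using ael by eventually_elim simp
    show "f -` A \<inter> space lebesgue \<in> sets lebesgue"
      by (rule completion.in_sets_AE[OF E S]) simp
  qed simp
  ultimately show ?thesis
    using has_bochner_integral_cong_AE[OF fl gl ael] by simp
qed

lemma argument_polar_form: "z = of_real (cmod z) * cis (argument z)"
proof (cases "z \<in> \<real>\<^sub>\<ge>\<^sub>0")
  case True
  then obtain x where "z = of_real x" "0 \<le> x" by (auto elim: nonneg_Reals_cases)
  then show ?thesis by (simp add: argument_def)
next
  case False
  then show ?thesis using Arg2pi_eq[of z] by (simp add: argument_def cis_conv_exp)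
qed

lemma power_polar_form:
  "z ^ a * cnj z ^ b = of_real (cmod z ^ (a + b)) * cis (real_of_int (int a - int b) * argument z)"
proof -
  have "z ^ a = of_real (cmod z ^ a) * cis (real a * argument z)"
    by (subst argument_polar_form[of z]) (simp only: power_mult_distrib Complex.DeMoivre of_real_power)
  moreover have "cnj z = of_real (cmod z) * cis (- argument z)"
    by (subst argument_polar_form[of z]) (simp add: cis_cnj)
  then have "cnj z ^ b = of_real (cmod z ^ b) * cis (- (real b * argument z))"
    by (simp only: power_mult_distrib Complex.DeMoivre of_real_power) simp
  moreover have "cis (real_of_int (int a - int b) * argument z) = cis (real a * argument z) * cis (- (real b * argument z))"
    by (simp add: cis_mult left_diff_distrib)
  ultimately show ?thesis by (simp add: power_add)
qed

text \<open>The change from the real coordinates to t, tbar: in the new basis the weight has the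
  trace on the diagonal and u with its conjugate off it.\<close>

lemma sym_mat_form:
  "(\<Sum>a\<in>UNIV. \<Sum>b\<in>UNIV. (vector [g1 + g2, \<i> * (g1 - g2)] :: complex^2) $ a * of_real (sym_mat t u $ a $ b)
      * cnj ((vector [f1 + f2, \<i> * (f1 - f2)] :: complex^2) $ b))
   = of_real t * (g1 * cnj f1 + g2 * cnj f2) + u * (g1 * cnj f2) + cnj u * (g2 * cnj f1)"
proof -
  obtain x y where u: "u = Complex x y" by (cases u)
  have u': "u = of_real x + \<i> * of_real y" "cnj u = of_real x - \<i> * of_real y" by (simp_all add: u complex_eq_iff)
  show ?thesis
    unfolding u' by (simp add: sum_2 sym_mat_def u field_simps)
qed

lemma sym_mat_decompose:
  "sym_mat t u = t *\<^sub>R mat2 (1/2) 0 0 (1/2) + Re u *\<^sub>R mat2 (1/2) 0 0 (- 1/2) + Im u *\<^sub>R mat2 0 (1/2) (1/2) 0"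
  by (rule mat2_eqI) (simp_all add: sym_mat_def field_simps)

definition component :: "bool \<Rightarrow> vpoly \<Rightarrow> complex \<Rightarrow> complex" where
  "component e f z = eval_bipoly (if e then fst f else snd f) z"

context dihedral_weight begin

lemma component_simps:
  "component e (f + g) z = component e f z + component e g z"
  "component e (scale c f) z = c * component e f z"
  "component e (mz f) z = z * component e f z"
  "component e (mzb f) z = cnj z * component e f z"
  "component e (unit_vec e') z = of_bool (e = e')"
proof -
  show "component e (f + g) z = component e f z + component e g z"
    unfolding component_def by (cases e) (simp_all only: fst_add snd_add g.eval_bipoly_add if_True if_False)
  show "component e (scale c f) z = c * component e f z"
    unfolding component_def scale_def
    by (cases e) (simp_all only: fst_conv snd_conv g.eval_bipoly_mult g.eval_bipoly_cst if_True if_False)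
  show "component e (mz f) z = z * component e f z"
    unfolding component_def mz_def
    by (cases e) (simp_all only: fst_conv snd_conv g.eval_bipoly_mult g.eval_bipoly_Z if_True if_False)
  show "component e (mzb f) z = cnj z * component e f z"
    unfolding component_def mzb_def
    by (cases e) (simp_all only: fst_conv snd_conv g.eval_bipoly_mult g.eval_bipoly_Zb if_True if_False)
  show "component e (unit_vec e') z = of_bool (e = e')"
    unfolding component_def unit_vec_def vconst_def
    by (cases e; cases e') (simp_all only: fst_conv snd_conv g.eval_bipoly_cst if_True if_False, simp_all)
qed

lemma component_vmono: "component e (vmono a b f) z = z ^ a * cnj z ^ b * component e f z"
proof (induction a)
  case 0
  show ?case
  proof (induction b)
    case (Suc b)
    then show ?case unfolding vmono_simps(3)[symmetric] component_simps by simp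
  qed (simp add: vmono_simps)
next
  case (Suc a)
  then show ?case unfolding vmono_simps(2)[symmetric] component_simps by simp
qed

text \<open>The entries of the weight in the basis t, tbar as functions of the angle alone.\<close>

definition phase :: "bool \<Rightarrow> bool \<Rightarrow> real \<Rightarrow> complex" where
  "phase e e' t = (if e = e' then osc h.T (\<lambda>_. 0) (real m * t)
     else if e then cnj (cis (- ((real m - 2 * real l) * t)) * osc h.V h.W (real m * t))
     else cis (- ((real m - 2 * real l) * t)) * osc h.V h.W (real m * t))"

lemma phase_cnj: "cnj (phase e e' t) = phase e' e t"
proof -
  have "cnj (osc h.T (\<lambda>_. 0) x) = osc h.T (\<lambda>_. 0) x" for x
    by (simp add: osc_def fold_cut_def complex_eq_iff)
  then show ?thesis by (simp add: phase_def)
qed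

lemma zero_trig_integrable:
  "set_integrable lborel {0<..<pi} (\<lambda>x. cos (r * x) * (\<lambda>_. 0 :: real) x)" "set_integrable lborel {0<..<pi} (\<lambda>x. sin (r * x) * (\<lambda>_. 0 :: real) x)"
  by (simp_all add: set_integrable_def)

lemma phase_moment:
  "has_bochner_integral lborel (\<lambda>t. indicator {0<..<2 * pi} t *\<^sub>R (cis (real_of_int k * t) * phase e e' t)) (of_real (moment e e' k))"
proof -
  have m: "0 < m" using l_bounds by simp
  have U: "has_bochner_integral lborel (\<lambda>t. indicator {0<..<2 * pi} t *\<^sub>R (cis (real_of_int k * t) * phase False True t)) (of_real (U_mom k))" for k
  proof -
    define s where "s = k - (int m - 2 * int l)"
    have s: "k + 2 * int l = s + int m" by (simp add: s_def)
    have "int m dvd k + 2 * int l \<longleftrightarrow> int m dvd s" unfolding s by simp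
    moreover have "(k + 2 * int l) div int m - 1 = s div int m" unfolding s using m by simp
    moreover have "cis (real_of_int k * t) * phase False True t = cis (real_of_int s * t) * osc h.V h.W (real m * t)" for t
    proof -
      have "real_of_int s * t = real_of_int k * t + - ((real m - 2 * real l) * t)" by (simp add: s_def algebra_simps)
      then show ?thesis by (simp only: phase_def cis_mult[symmetric] mult.assoc) simp
    qed
    ultimately show ?thesis
      using angular_integral[OF m h.TVW_cont(2,3) h.trig_integrable(2,5,3,6), of s]
      by (simp only: U_mom_def h.Um_def h.Vm_def h.Wm_def)
  qed
  consider "e = e'" | "\<not> e" "e'" | "e" "\<not> e'" by blast
  then show ?thesis
  proof cases
    case 1
    have z: "(LBINT x:{0<..<pi}. sin (r * x) * 0) = (0 :: real)" for r
      by (simp add: set_lebesgue_integral_def)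
    have "has_bochner_integral lborel (\<lambda>t. indicator {0<..<2 * pi} t *\<^sub>R (cis (real_of_int k * t) * osc h.T (\<lambda>_. 0) (real m * t))) (of_real (T_mom k))"
      using angular_integral[OF m h.TVW_cont(1) continuous_const h.trig_integrable(1,4) zero_trig_integrable, of k]
      by (simp only: z T_mom_def h.Tm_def diff_zero)
    then show ?thesis by (simp only: 1 phase_def moment_def refl if_True)
  next
    case 2
    then show ?thesis using U[of k] by (simp add: moment_def)
  next
    case 3
    have c: "cnj (indicator {0<..<2 * pi} t *\<^sub>R (cis (real_of_int (- k) * t) * phase False True t))
      = indicator {0<..<2 * pi} t *\<^sub>R (cis (real_of_int k * t) * phase True False t)" for t
      by (simp add: phase_cnj cis_cnj)
    show ?thesis using has_bochner_integral_cnj[OF U[of "- k"]] 3 unfolding c by (simp add: moment_def)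
  qed
qed

lemma borel_measurable_phase: "phase e e' \<in> borel_measurable borel"
proof -
  have [measurable]: "cis \<in> borel_measurable borel" "cnj \<in> borel_measurable borel"
    by (intro borel_measurable_continuous_onI continuous_intros)+
  have [measurable]: "osc h.T (\<lambda>_. 0) \<in> borel_measurable borel" "osc h.V h.W \<in> borel_measurable borel"
    using h.TVW_cont by (auto intro!: borel_measurable_osc)
  show ?thesis unfolding phase_def[abs_def] by (cases "e = e'"; cases e) (simp_all, measurable)
qed

definition integrand :: "vpoly \<Rightarrow> vpoly \<Rightarrow> complex \<Rightarrow> complex" where
  "integrand f g z = (\<Sum>e\<in>UNIV. \<Sum>e'\<in>UNIV. phase e e' (argument z) * cnj (component e f z) * component e' g z)
     * of_real (exp (- (cmod z)\<^sup>2 / 2))"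

lemma integrand_right: "integrand f (g + h) z = integrand f g z + integrand f h z" "integrand f (scale c g) z = c * integrand f g z"
  by (simp_all add: integrand_def UNIV_bool component_simps algebra_simps)

lemma integrand_cnj: "integrand g f z = cnj (integrand f g z)"
  by (simp add: integrand_def UNIV_bool phase_cnj algebra_simps)

lemma integrand_left: "integrand (f + g) h z = integrand f h z + integrand g h z" "integrand (scale c f) h z = cnj c * integrand f h z"
  by (simp_all add: integrand_def UNIV_bool component_simps algebra_simps)

lemma integrand_mz: "integrand (mz f) g z = integrand f (mzb g) z" "integrand (mzb f) g z = integrand f (mz g) z"
  by (simp_all add: integrand_def UNIV_bool component_simps algebra_simps)

lemma integrand_unit: "integrand (unit_vec e) (vmono a b (unit_vec e')) z
    = z ^ a * cnj z ^ b * phase e e' (argument z) * of_real (exp (- (cmod z)\<^sup>2 / 2))"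
  by (cases e; cases e') (simp_all add: integrand_def UNIV_bool component_vmono component_simps)

lemma integrand_monomial:
  "has_bochner_integral lborel (integrand (unit_vec e) (vmono a b (unit_vec e'))) (of_real (radial (a + b) * moment e e' (int a - int b)))"
proof -
  let ?k = "int a - int b"
  have [measurable]: "cis \<in> borel_measurable borel" by (intro borel_measurable_continuous_onI continuous_intros)
  note [measurable] = borel_measurable_phase
  have "has_bochner_integral lborel (\<lambda>z. (cmod z ^ (a + b) * exp (- (cmod z)\<^sup>2 / 2)) *\<^sub>R (cis (real_of_int ?k * argument z) * phase e e' (argument z)))
     (radial (a + b) *\<^sub>R of_real (moment e e' ?k))"
    by (rule has_bochner_integral_polar[OF phase_moment radial_integral]) measurable
  moreover have "(cmod z ^ (a + b) * exp (- (cmod z)\<^sup>2 / 2)) *\<^sub>R (cis (real_of_int ?k * argument z) * phase e e' (argument z))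
      = integrand (unit_vec e) (vmono a b (unit_vec e')) z" for z
    unfolding integrand_unit power_polar_form by (simp add: scaleR_conv_of_real)
  ultimately show ?thesis by (simp add: scaleR_conv_of_real)
qed

text \<open>Multiplications are moved from f to g until f is constant; then g splits into monomials,
  whose integrals are known.\<close>

lemma integrand_integrable: "integrable lborel (integrand f g)"
proof (induction f arbitrary: g rule: vpoly_induct)
  case (const x y)
  have u: "integrable lborel (integrand (unit_vec e) g)" for e
  proof (induction g rule: vpoly_vmono_induct)
    case (1 a b x e')
    show ?case unfolding integrand_right(2)[abs_def]
      using integrand_monomial by (intro integrable_mult_right) (auto simp: has_bochner_integral_iff)
  next
    case (2 g h)
    then show ?case unfolding integrand_right(1)[abs_def] by (rule Bochner_Integration.integrable_add)
  qed
  show ?case unfolding vconst_unit integrand_left(1)[abs_def] integrand_left(2)[abs_def]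
    by (intro Bochner_Integration.integrable_add integrable_mult_right u)
next
  case (add f1 f2)
  show ?case unfolding integrand_left(1)[abs_def] by (intro Bochner_Integration.integrable_add add)
next
  case (mz f)
  show ?case unfolding integrand_mz(1)[abs_def] by (rule mz)
next
  case (mzb f)
  show ?case unfolding integrand_mz(2)[abs_def] by (rule mzb)
qed

definition B :: "vpoly \<Rightarrow> vpoly \<Rightarrow> complex" where "B f g = integral\<^sup>L lborel (integrand f g)"

sublocale d: dihedral_form m l \<kappa> B moment radial
proof unfold_locales
  show "0 < l" "l < m" using l_bounds by simp_all
  fix f g h :: vpoly and c
  show "B f (g + h) = B f g + B f h"
    unfolding B_def integrand_right(1)[abs_def] by (rule Bochner_Integration.integral_add[OF integrand_integrable integrand_integrable])
  show "B f (scale c g) = c * B f g"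
    unfolding B_def integrand_right(2)[abs_def] by simp
  show "B g f = cnj (B f g)"
    unfolding B_def integrand_cnj[of g f, abs_def] by (rule integral_bounded_linear[OF bounded_linear_cnj integrand_integrable])
  show "B (mz f) g = B f (mzb g)"
    unfolding B_def integrand_mz(1)[abs_def] ..
  show "B (unit_vec e) (vmono a b (unit_vec e')) = of_real (radial (a + b) * moment e e' (int a - int b))" for e a b e'
    unfolding B_def using integrand_monomial by (rule has_bochner_integral_integral_eq)
  show "radial 0 = 1" "\<And>n. radial (Suc (Suc n)) = (real n + 2) * radial n" by (rule radial_0 radial_Suc)+
qed (fact moment_props)+

text \<open>The walls form a null set because their indicator, weighted with the Gaussian,
  integrates to 0 by the polar formula: its angular factor is supported on a countable set.\<close>

lemma AE_sin_argument: "AE z in lborel. sin (real m * argument z) \<noteq> 0"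
proof -
  have m: "0 < real m" using l_bounds by simp
  define h where "h t = (if sin (real m * t) = 0 then 1 else 0 :: complex)" for t
  have "{t. sin (real m * t) = 0} \<subseteq> range (\<lambda>i :: int. real_of_int i * pi / real m)"
  proof
    fix t assume "t \<in> {t. sin (real m * t) = 0}"
    then obtain i :: int where "real m * t = real_of_int i * pi" by (auto simp: sin_zero_iff_int2)
    then have "t = real_of_int i * pi / real m" using m by (simp add: field_simps)
    then show "t \<in> range (\<lambda>i :: int. real_of_int i * pi / real m)" by blast
  qed
  then have "countable {t. sin (real m * t) = 0}" by (rule countable_subset) simp
  then have ae: "AE t in lborel. t \<notin> {t. sin (real m * t) = 0}"
    by (intro AE_not_in countable_imp_null_set_lborel)
  have hm [measurable]: "h \<in> borel_measurable borel" unfolding h_def[abs_def] by measurable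
  have "has_bochner_integral lborel (\<lambda>t. indicator {0<..<2 * pi} t *\<^sub>R h t) 0"
    by (subst has_bochner_integral_cong_AE[where g = "\<lambda>_. 0"])
      (use ae in \<open>auto simp: h_def elim!: eventually_mono intro: has_bochner_integral_zero\<close>)
  from has_bochner_integral_polar[OF this radial_integral[of 0] hm]
  have "has_bochner_integral lborel (\<lambda>z. exp (- (cmod z)\<^sup>2 / 2) *\<^sub>R h (argument z)) 0" by simp
  from has_bochner_integral_Re[OF this]
  have i: "has_bochner_integral lborel (\<lambda>z. exp (- (cmod z)\<^sup>2 / 2) * Re (h (argument z))) 0" by simp
  have "AE z in lborel. exp (- (cmod z)\<^sup>2 / 2) * Re (h (argument z)) = 0"
    using i integral_nonneg_eq_0_iff_AE[of lborel "\<lambda>z. exp (- (cmod z)\<^sup>2 / 2) * Re (h (argument z))"]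
    by (auto simp: has_bochner_integral_iff h_def)
  then show ?thesis by eventually_elim (auto simp: h_def split: if_splits)
qed

lemma K_phase:
  assumes s: "sin (real m * argument z) \<noteq> 0"
  shows "K z = sym_mat (Re (phase True True (argument z))) (phase False True (argument z))"
proof -
  have "z \<noteq> 0" using s by (auto simp: argument_def)
  then have "0 < cmod z" by simp
  from K_eq[OF this s] have "K z = sym_mat (T_ang (argument z)) (U_ang (argument z))"
    by (simp add: argument_polar_form[symmetric])
  then show ?thesis using fold_bounds[OF s]
    by (simp add: T_ang_def U_ang_def phase_def osc_def fold_cut_def fold_def)
qed

lemma K_integrable: "integrable lebesgue (\<lambda>z. exp (- (cmod z)\<^sup>2 / 2) *\<^sub>R K z)"
proof -
  let ?t = "integrand (unit_vec True) (unit_vec True)" and ?u = "integrand (unit_vec False) (unit_vec True)"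
  define L where "L z = Re (?t z) *\<^sub>R mat2 (1/2) 0 0 (1/2) + Re (?u z) *\<^sub>R mat2 (1/2) 0 0 (- 1/2) + Im (?u z) *\<^sub>R mat2 0 (1/2) (1/2) 0" for z
  have d: "integrand (unit_vec e) (unit_vec e') z = phase e e' (argument z) * of_real (exp (- (cmod z)\<^sup>2 / 2))" for e e' z
    using integrand_unit[of e 0 0 e' z] by (simp add: vmono_simps)
  have "integrable lborel L" unfolding L_def
    by (intro Bochner_Integration.integrable_add integrable_scaleR_left integrable_Re integrable_Im integrand_integrable)
  then have "has_bochner_integral lborel L (integral\<^sup>L lborel L)" by (rule has_bochner_integral_integrable)
  moreover have "AE z in lborel. exp (- (cmod z)\<^sup>2 / 2) *\<^sub>R K z = L z"
    using AE_sin_argument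
  proof eventually_elim
    case (elim z)
    show ?case unfolding K_phase[OF elim] sym_mat_decompose L_def d by (simp add: scaleR_add_right mult.commute)
  qed
  ultimately have "has_bochner_integral lebesgue (\<lambda>z. exp (- (cmod z)\<^sup>2 / 2) *\<^sub>R K z) (integral\<^sup>L lborel L)"
    by (rule has_bochner_integral_lebesgue_AE)
  then show ?thesis by (simp add: has_bochner_integral_iff)
qed

theorem gauss_form_integral:
  "has_bochner_integral lebesgue
     (\<lambda>z. (\<Sum>a\<in>UNIV. \<Sum>b\<in>UNIV. real_coords g z $ a * of_real (K z $ a $ b) * cnj (real_coords f z $ b))
        * of_real (exp (- (cmod z)\<^sup>2 / 2)))
     (gauss_form m l \<kappa> f g)"
proof (rule has_bochner_integral_lebesgue_AE)
  show "has_bochner_integral lborel (integrand f g) (gauss_form m l \<kappa> f g)"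
    unfolding d.gauss_form_eq_B B_def by (rule has_bochner_integral_integrable) (rule integrand_integrable)
  show "AE z in lborel. (\<Sum>a\<in>UNIV. \<Sum>b\<in>UNIV. real_coords g z $ a * of_real (K z $ a $ b) * cnj (real_coords f z $ b))
        * of_real (exp (- (cmod z)\<^sup>2 / 2)) = integrand f g z"
    using AE_sin_argument
  proof eventually_elim
    case (elim z)
    define p where "p = Re (phase True True (argument z))"
    define q where "q = phase False True (argument z)"
    have ph: "phase True True (argument z) = of_real p" "phase False False (argument z) = of_real p"
      "phase True False (argument z) = cnj q" "phase False True (argument z) = q"
      by (simp_all add: p_def q_def phase_cnj) (simp_all add: phase_def osc_def complex_eq_iff fold_cut_def)
    show ?case
      unfolding K_phase[OF elim, folded p_def q_def] real_coords_def sym_mat_form integrand_def UNIV_bool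
      by (simp add: ph component_def algebra_simps)
  qed
qed

end

theorem mainTheorem1:
  fixes m l :: nat and \<kappa> \<delta> :: real and K :: "complex \<Rightarrow> real^2^2"
  assumes "3 \<le> m" and "1 \<le> l" and "l \<le> (m - 1) div 2"
    and "- (real l / real m) < \<kappa>" and "\<kappa> < real l / real m"
    and "\<delta> = 1 / 2 - real l / real m"
    and "\<And>r \<theta>. 0 < r \<Longrightarrow> 0 < \<theta> \<Longrightarrow> \<theta> < pi / real m \<Longrightarrow>
           K (of_real r * exp (\<i> * of_real \<theta>)) = wt_K m \<kappa> \<delta> \<theta>"
    and "\<And>z w. z \<in> chamber m 1 \<Longrightarrow> w \<in> I2 m \<Longrightarrow>
           K (act m z w) = matrix_inv (tau m l w) ** K z ** tau m l w"
  shows "(\<forall>j\<in>{1..2 * m}. \<forall>z\<in>chamber m j. pos_def (K z))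
    \<and> integrable lebesgue (\<lambda>z. exp (- (cmod z)\<^sup>2 / 2) *\<^sub>R K z)
    \<and> (\<forall>f g :: vpoly.
         has_bochner_integral lebesgue
           (\<lambda>z. (\<Sum>a\<in>UNIV. \<Sum>b\<in>UNIV.
                  real_coords g z $ a * of_real (K z $ a $ b) * cnj (real_coords f z $ b))
                * of_real (exp (- (cmod z)\<^sup>2 / 2)))
           (gauss_form m l \<kappa> f g))"
proof -
  interpret dihedral_weight m l \<kappa> \<delta> K
    using assms by unfold_locales
  show ?thesis using K_pos_def K_integrable gauss_form_integral by blast
qed

end
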